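(* Let $\psi$ be a mother wavelet of regularity $r$ and let $\hat f_n$ be the corresponding global Bayesian maximum a posteriori wavelet estimator (defined in the context) of $f$ in the Gaussian white noise model $dY_n(t)=f(t)dt+\frac{\sigma}{\sqrt n}dW(t)$, $t\in[0,1]$, where $f\in B^s_{p,q}(M)$, $0<p,q\le\infty$, $1/p<s<r$ and $M>0$. Assume that there exist positive constants $\gamma_-$ and $\gamma_+$ such that $\gamma_-\le\gamma_j\le\gamma_+$ for all $j=j_0,\ldots,J-1$. Let the prior $\pi_n$ satisfy, for some constant $c_2>0$, $\pi_n(\kappa)\ge(\kappa/n)^{c_2\kappa}$ for all $\kappa=1,2,\ldots,\exp(-9/2)n$ or, for a shorter range $\kappa=1,2,\ldots,\exp\{-c(\gamma_-)\}n$ if $\gamma_-$ is known, where $c(\gamma)=8(\gamma+3/4)^2$. Then, as $n\to\infty$, $$\sup_{f\in B^s_{p,q}(M)}E(\|\hat f_n-f\|_2^2)=O\left\{\Big(\frac{\log n}{n}\Big)^{\frac{2s}{2s+1}}\right\}.$$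
   Context: Model: one observes $Y_n$ with $dY_n(t)=f(t)dt+\frac{\sigma}{\sqrt n}dW(t)$, $t\in[0,1]$, where $\sigma>0$ is known, $W$ is a standard Wiener process and $f\in L^2[0,1]$ is unknown. $B^s_{p,q}(M)$ is the ball of radius $M$ in the Besov space $B^s_{p,q}[0,1]$. Wavelets: given a compactly supported scaling function $\phi$ of regularity $r$ and the corresponding mother wavelet $\psi$, consider the associated boundary-corrected orthonormal wavelet basis of $L^2[0,1]$ (Cohen–Daubechies–Vial type), consisting of a finite number $C_{j_0}$ of scaling functions $\phi_{j_0k}$ at a fixed primary resolution level $j_0$, denoted $\psi_{j_0-1,k}$, $k=0,\ldots,C_{j_0}-1$, and wavelets $\psi_{jk}$, $j\ge j_0$, $k=0,\ldots,2^j-1$ (the same notation is used for interior and edge wavelets). Put $\theta_{jk}=\int_0^1f\psi_{jk}$ and $Y_{jk}=\int_0^1\psi_{jk}(t)dY_n(t)=\theta_{jk}+\epsilon_{jk}$, with $\epsilon_{jk}$ independent $N(0,\sigma^2/n)$. Let $J=\log_2n$ (with $n$ a power of 2). Global estimator: $\hat\theta_{j_0-1,k}=Y_{j_0-1,k}$; $\hat\theta_{jk}=0$ for $j\ge J$; and the coefficients at all levels $j_0\le j<J$ are estimated jointly as follows. Let $\tilde n=2^J-2^{j_0}$ be their number. Let $\pi_n$ be a probability distribution on $\{0,\ldots,\tilde n\}$, with $\pi_n(\kappa)>0$ for all $\kappa$ (prior on the number of non-zero coefficients), let $\tau_j^2/n>0$ be the prior variance of non-zero coefficients at level $j$, and $\gamma_j=\tau_j^2/\sigma^2$.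 In the prior model, given the number $\kappa$ of non-zero coefficients all $\binom{\tilde n}\kappa$ configurations are equally likely, and the non-zero coefficients at level $j$ are independent $N(0,\tau_j^2/n)$. The posterior probability of an indicator vector $x=(x_{jk})\in\{0,1\}^{\tilde n}$ of non-zero coefficients, with $\kappa=\sum x_{jk}$, is then proportional to $$\binom{\tilde n}{\kappa}^{-1}\pi_n(\kappa)\prod_{j,k}(B_{jk}^{-1})^{x_{jk}},\qquad B_{jk}=\sqrt{1+\gamma_j}\,\exp\Big\{-\frac{nY_{jk}^2}{2\sigma^2(1+1/\gamma_j)}\Big\}.$$ Let $\hat x$ be a maximizer of this posterior probability (maximum a posteriori rule) and set $\hat\theta_{jk}=Y_{jk}$ if $\hat x_{jk}=1$ and $\hat\theta_{jk}=0$ otherwise. Finally $$\hat f_n(t)=\sum_{k=0}^{C_{j_0}-1}Y_{j_0-1,k}\psi_{j_0-1,k}(t)+\sum_{j=j_0}^{J-1}\sum_{k=0}^{2^j-1}\hat\theta_{jk}\psi_{jk}(t).$$ The constants $\gamma_\pm,c_2$ do not depend on $n$. *)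

theory Defs
  imports "HOL-Probability.Probability"
begin

section \<open>Besov balls on the unit interval\<close>

text \<open>Functions on $[0,1]$ are represented by functions on the reals; only their values on
  $[0,1]$ (up to null sets) are ever used.\<close>

definition meas01 :: "(real \<Rightarrow> real) set" where
  "meas01 = {f. set_borel_measurable lborel {0..1} f}"

definition L2_01 :: "(real \<Rightarrow> real) set" where
  "L2_01 = {f \<in> meas01. set_integrable lborel {0..1} (\<lambda>x. (f x)\<^sup>2)}"

definition inner01 :: "(real \<Rightarrow> real) \<Rightarrow> (real \<Rightarrow> real) \<Rightarrow> real" where
  "inner01 f g = (LBINT x:{0..1}. f x * g x)"

text \<open>Real powers on the extended half-line, for exponents \<open>a > 0\<close>.\<close>

definition epowr :: "ennreal \<Rightarrow> real \<Rightarrow> ennreal" where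
  "epowr x a = (if x = \<infinity> then \<infinity> else ennreal (enn2real x powr a))"

definition Lp_norm :: "ennreal \<Rightarrow> real set \<Rightarrow> (real \<Rightarrow> real) \<Rightarrow> ennreal" where
  "Lp_norm p A g =
     (if p = \<infinity> then esssup (restrict_space lborel A) (\<lambda>x. ennreal \<bar>g x\<bar>)
      else epowr (\<integral>\<^sup>+x\<in>A. ennreal (\<bar>g x\<bar> powr enn2real p) \<partial>lborel) (1 / enn2real p))"

definition fin_diff :: "nat \<Rightarrow> real \<Rightarrow> (real \<Rightarrow> real) \<Rightarrow> real \<Rightarrow> real" where
  "fin_diff m h f x = (\<Sum>i\<le>m. (-1) ^ (m - i) * real (m choose i) * f (x + real i * h))"

text \<open>The \<open>m\<close>-th modulus of smoothness on $[0,1]$: the difference is taken only at those \<open>x\<close> for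
  which all nodes \<open>x, x + h, \<dots>, x + m h\<close> lie in $[0,1]$.\<close>

definition mod_smooth :: "nat \<Rightarrow> ennreal \<Rightarrow> (real \<Rightarrow> real) \<Rightarrow> real \<Rightarrow> ennreal" where
  "mod_smooth m p f t = (SUP h\<in>{0<..t}. Lp_norm p {0..1 - real m * h} (fin_diff m h f))"

text \<open>The seminorm uses differences of the smallest integer order exceeding \<open>s\<close>.\<close>

definition besov_seminorm :: "real \<Rightarrow> ennreal \<Rightarrow> ennreal \<Rightarrow> (real \<Rightarrow> real) \<Rightarrow> ennreal" where
  "besov_seminorm s p q f =
     (let \<omega> = mod_smooth (nat \<lfloor>s\<rfloor> + 1) p f in
      if q = \<infinity> then (SUP t\<in>{0<..1}. ennreal (t powr (- s)) * \<omega> t)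
      else epowr (\<integral>\<^sup>+t\<in>{0<..1}. epowr (ennreal (t powr (- s)) * \<omega> t) (enn2real q)
                     * ennreal (1 / t) \<partial>lborel) (1 / enn2real q))"

definition besov_ball :: "real \<Rightarrow> ennreal \<Rightarrow> ennreal \<Rightarrow> real \<Rightarrow> (real \<Rightarrow> real) set" where
  "besov_ball s p q M =
     {f \<in> meas01. Lp_norm p {0..1} f + besov_seminorm s p q f \<le> ennreal M}"


section \<open>Boundary-corrected wavelet bases\<close>

text \<open>A compactly supported orthonormal scaling function of class $C^r$ with refinement filter \<open>h\<close>;
  \<open>\<integral>\<phi> = 1\<close> makes the generated multiresolution of $L^2$ of the line dense.\<close>

definition scaling_function :: "nat \<Rightarrow> (int \<Rightarrow> real) \<Rightarrow> (real \<Rightarrow> real) \<Rightarrow> bool" where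
  "scaling_function r h \<phi> \<longleftrightarrow>
     (\<forall>i<r. \<forall>x. (deriv ^^ i) \<phi> field_differentiable at x) \<and>
     continuous_on UNIV ((deriv ^^ r) \<phi>) \<and>
     (\<exists>A. \<forall>x. \<bar>x\<bar> > A \<longrightarrow> \<phi> x = 0) \<and>
     (LBINT x. \<phi> x) = 1 \<and>
     (\<forall>m::int. (LBINT x. \<phi> x * \<phi> (x - of_int m)) = (if m = 0 then 1 else 0)) \<and>
     finite {m. h m \<noteq> 0} \<and>
     (\<forall>x. \<phi> x = sqrt 2 * (\<Sum>m | h m \<noteq> 0. h m * \<phi> (2 * x - of_int m)))"

definition mother_wavelet :: "(int \<Rightarrow> real) \<Rightarrow> (real \<Rightarrow> real) \<Rightarrow> real \<Rightarrow> real" where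
  "mother_wavelet h \<phi> x =
     sqrt 2 * (\<Sum>m | h (1 - m) \<noteq> 0. ((-1) powi m) * h (1 - m) * \<phi> (2 * x - of_int m))"

text \<open>\<open>g\<close> is, on the half-line \<open>H\<close>, a finite combination of the functions \<open>\<phi>(a x - m)\<close>.\<close>

definition edge_function ::
    "real \<Rightarrow> (real \<Rightarrow> real) \<Rightarrow> real set \<Rightarrow> (real \<Rightarrow> real) \<Rightarrow> bool" where
  "edge_function a \<phi> H g \<longleftrightarrow>
     (\<exists>(F::int set) c. finite F \<and> (\<forall>x\<in>H. g x = (\<Sum>m\<in>F. c m * \<phi> (a * x - of_int m))))"

text \<open>The \<open>N\<close> level-\<open>j\<close> functions \<open>G 0, \<dots>, G (N - 1)\<close> on $[0,1]$: \<open>el\<close> dilates of left-edge functions,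
  dilated translates of \<open>g\<close> supported inside $[0,1]$, and \<open>er\<close> dilates of right-edge functions
  anchored at the point 1. The offset \<open>d\<close> accounts for the position of the support of \<open>g\<close>.\<close>

definition edge_adapted_level ::
    "nat \<Rightarrow> nat \<Rightarrow> nat \<Rightarrow> nat \<Rightarrow> int \<Rightarrow> (nat \<Rightarrow> real \<Rightarrow> real) \<Rightarrow> (real \<Rightarrow> real) \<Rightarrow>
     (nat \<Rightarrow> real \<Rightarrow> real) \<Rightarrow> (nat \<Rightarrow> real \<Rightarrow> real) \<Rightarrow> bool" where
  "edge_adapted_level j N el er d L g R G \<longleftrightarrow>
     el + er \<le> N \<and>
     (\<forall>k\<in>{el..<N - er}. \<forall>x. g (2 ^ j * x - of_int (int k + d)) \<noteq> 0 \<longrightarrow> x \<in> {0..1}) \<and>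
     (\<forall>k<N. \<forall>x\<in>{0..1}. G k x = sqrt (2 ^ j) *
        (if k < el then L k (2 ^ j * x)
         else if k < N - er then g (2 ^ j * x - of_int (int k + d))
         else R (N - 1 - k) (2 ^ j * (x - 1))))"

text \<open>Basis of Cohen--Daubechies--Vial type: \<open>\<Phi> k\<close> (\<open>k < C\<close>) are the scaling functions at the primary
  level \<open>j0\<close>, \<open>\<Psi> j k\<close> (\<open>j \<ge> j0\<close>, \<open>k < 2 ^ j\<close>) the wavelets. The edge functions are built from
  restrictions of translates of \<open>\<phi>\<close> (for wavelets: of \<open>\<phi>(2\<cdot>)\<close>), the same ones at every level, and
  the scaling functions reproduce on $[0,1]$ all polynomials of degree less than \<open>r\<close>. Together with
  orthonormality this encodes the \<open>r\<close> vanishing moments of all wavelets, edge ones included.\<close>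

definition boundary_wavelet_basis ::
    "nat \<Rightarrow> (real \<Rightarrow> real) \<Rightarrow> (real \<Rightarrow> real) \<Rightarrow> nat \<Rightarrow> nat \<Rightarrow>
     (nat \<Rightarrow> real \<Rightarrow> real) \<Rightarrow> (nat \<Rightarrow> nat \<Rightarrow> real \<Rightarrow> real) \<Rightarrow> bool" where
  "boundary_wavelet_basis r \<phi> \<psi> j0 C \<Phi> \<Psi> \<longleftrightarrow>
     (\<exists>h. scaling_function r h \<phi> \<and> \<psi> = mother_wavelet h \<phi>) \<and>
     (\<exists>el er d L R. (\<forall>k<el. edge_function 1 \<phi> {0..} (L k)) \<and>
        (\<forall>k<er. edge_function 1 \<phi> {..0} (R k)) \<and>
        edge_adapted_level j0 C el er d L \<phi> R \<Phi>) \<and>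
     (\<exists>el er d L R. (\<forall>k<el. edge_function 2 \<phi> {0..} (L k)) \<and>
        (\<forall>k<er. edge_function 2 \<phi> {..0} (R k)) \<and>
        (\<forall>j\<ge>j0. edge_adapted_level j (2 ^ j) el er d L \<psi> R (\<Psi> j))) \<and>
     (\<forall>i<r. \<exists>c. \<forall>x\<in>{0..1}. x ^ i = (\<Sum>k<C. c k * \<Phi> k x)) \<and>
     (\<forall>k<C. \<forall>k'<C. inner01 (\<Phi> k) (\<Phi> k') = (if k = k' then 1 else 0)) \<and>
     (\<forall>k<C. \<forall>j\<ge>j0. \<forall>k'<2 ^ j. inner01 (\<Phi> k) (\<Psi> j k') = 0) \<and>
     (\<forall>j\<ge>j0. \<forall>k<2 ^ j. \<forall>j'\<ge>j0. \<forall>k'<2 ^ j'.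
        inner01 (\<Psi> j k) (\<Psi> j' k') = (if (j, k) = (j', k') then 1 else 0)) \<and>
     (\<forall>g\<in>L2_01. (\<forall>k<C. inner01 g (\<Phi> k) = 0) \<and> (\<forall>j\<ge>j0. \<forall>k<2 ^ j. inner01 g (\<Psi> j k) = 0)
        \<longrightarrow> (AE x in lborel. x \<in> {0..1} \<longrightarrow> g x = 0))"


section \<open>The Gaussian white noise model\<close>

definition wiener_process :: "'w measure \<Rightarrow> (real \<Rightarrow> 'w \<Rightarrow> real) \<Rightarrow> bool" where
  "wiener_process P W \<longleftrightarrow>
     prob_space P \<and>
     (\<forall>t\<in>{0..1}. W t \<in> borel_measurable P) \<and>
     (AE w in P. W 0 w = 0) \<and>
     (\<forall>a b. 0 \<le> a \<and> a < b \<and> b \<le> 1 \<longrightarrow>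
        distributed P lborel (\<lambda>w. W b w - W a w) (normal_density 0 (sqrt (b - a)))) \<and>
     (\<forall>N (t::nat \<Rightarrow> real). (\<forall>i\<le>N. t i \<in> {0..1}) \<and> (\<forall>i<N. t i < t (Suc i)) \<longrightarrow>
        prob_space.indep_vars P (\<lambda>_. borel) (\<lambda>i w. W (t (Suc i)) w - W (t i) w) {..<N}) \<and>
     (AE w in P. continuous_on {0..1} (\<lambda>t. W t w))"

definition white_noise_obs ::
    "real \<Rightarrow> nat \<Rightarrow> (real \<Rightarrow> real) \<Rightarrow> (real \<Rightarrow> 'w \<Rightarrow> real) \<Rightarrow> real \<Rightarrow> 'w \<Rightarrow> real" where
  "white_noise_obs \<sigma> n f W t w = (LBINT u:{0..t}. f u) + \<sigma> / sqrt (real n) * W t w"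

text \<open>\<open>I\<close> is a version of the stochastic integral over $[0,1]$ of the deterministic integrand \<open>g\<close>
  against the process \<open>X\<close>: the mean-square limit of the elementary integrals of step functions
  \<open>\<Sum>i<N. c i * indicator {t i<..t (i + 1)}\<close> converging to \<open>g\<close> in $L^2[0,1]$.
  For \<open>X\<close> a Wiener process plus a drift with square-integrable density this determines \<open>I\<close> up to
  null sets, independently of the approximating sequence.\<close>

definition stoch_integral ::
    "'w measure \<Rightarrow> (real \<Rightarrow> 'w \<Rightarrow> real) \<Rightarrow> (real \<Rightarrow> real) \<Rightarrow> ('w \<Rightarrow> real) \<Rightarrow> bool" where
  "stoch_integral P X g I \<longleftrightarrow>
     I \<in> borel_measurable P \<and>
     (\<exists>(N :: nat \<Rightarrow> nat) (t :: nat \<Rightarrow> nat \<Rightarrow> real) (c :: nat \<Rightarrow> nat \<Rightarrow> real).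
        (\<forall>l. (\<forall>i\<le>N l. t l i \<in> {0..1}) \<and> (\<forall>i<N l. t l i \<le> t l (Suc i))) \<and>
        ((\<lambda>l. \<integral>\<^sup>+x\<in>{0..1}. ennreal
           (((\<Sum>i<N l. c l i * indicator {t l i<..t l (Suc i)} x) - g x)\<^sup>2) \<partial>lborel)
           \<longlonglongrightarrow> 0) \<and>
        ((\<lambda>l. \<integral>\<^sup>+w. ennreal
           (((\<Sum>i<N l. c l i * (X (t l (Suc i)) w - X (t l i) w)) - I w)\<^sup>2) \<partial>P)
           \<longlonglongrightarrow> 0))"


section \<open>The global maximum a posteriori estimator\<close>

definition coeff_index :: "nat \<Rightarrow> nat \<Rightarrow> (nat \<times> nat) set" where
  "coeff_index j0 J = (SIGMA j:{j0..<J}. {..<2 ^ j})"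

definition bayes_factor :: "real \<Rightarrow> nat \<Rightarrow> real \<Rightarrow> real \<Rightarrow> real" where
  "bayes_factor \<sigma> n \<gamma> y =
     sqrt (1 + \<gamma>) * exp (- (real n * y\<^sup>2 / (2 * \<sigma>\<^sup>2 * (1 + 1 / \<gamma>))))"

text \<open>Here \<open>n = 2 ^ J\<close>, \<open>\<gamma> j\<close> is the variance ratio at level \<open>j\<close>, \<open>\<pi>\<close> the prior on the number of non-zero
  coefficients, and \<open>y j k\<close> the empirical coefficients.\<close>

definition posterior_weight ::
    "real \<Rightarrow> nat \<Rightarrow> nat \<Rightarrow> (nat \<Rightarrow> real) \<Rightarrow> nat pmf \<Rightarrow> (nat \<Rightarrow> nat \<Rightarrow> real) \<Rightarrow>
     (nat \<times> nat \<Rightarrow> nat) \<Rightarrow> real" where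
  "posterior_weight \<sigma> j0 J \<gamma> \<pi> y x =
     (let \<kappa> = (\<Sum>i\<in>coeff_index j0 J. x i) in
      inverse (real ((2 ^ J - 2 ^ j0) choose \<kappa>)) * pmf \<pi> \<kappa> *
      (\<Prod>(j, k)\<in>coeff_index j0 J. inverse (bayes_factor \<sigma> (2 ^ J) (\<gamma> j) (y j k)) ^ x (j, k)))"

definition indicator_vectors :: "nat \<Rightarrow> nat \<Rightarrow> (nat \<times> nat \<Rightarrow> nat) set" where
  "indicator_vectors j0 J = (coeff_index j0 J \<rightarrow>\<^sub>E {0, 1})"

definition posterior_prob ::
    "real \<Rightarrow> nat \<Rightarrow> nat \<Rightarrow> (nat \<Rightarrow> real) \<Rightarrow> nat pmf \<Rightarrow> (nat \<Rightarrow> nat \<Rightarrow> real) \<Rightarrow>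
     (nat \<times> nat \<Rightarrow> nat) \<Rightarrow> real" where
  "posterior_prob \<sigma> j0 J \<gamma> \<pi> y x =
     posterior_weight \<sigma> j0 J \<gamma> \<pi> y x /
     (\<Sum>x'\<in>indicator_vectors j0 J. posterior_weight \<sigma> j0 J \<gamma> \<pi> y x')"

definition is_MAP ::
    "real \<Rightarrow> nat \<Rightarrow> nat \<Rightarrow> (nat \<Rightarrow> real) \<Rightarrow> nat pmf \<Rightarrow> (nat \<Rightarrow> nat \<Rightarrow> real) \<Rightarrow>
     (nat \<times> nat \<Rightarrow> nat) \<Rightarrow> bool" where
  "is_MAP \<sigma> j0 J \<gamma> \<pi> y x \<longleftrightarrow>
     x \<in> indicator_vectors j0 J \<and>
     (\<forall>x'\<in>indicator_vectors j0 J.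
        posterior_prob \<sigma> j0 J \<gamma> \<pi> y x' \<le> posterior_prob \<sigma> j0 J \<gamma> \<pi> y x)"

definition wavelet_estimate ::
    "nat \<Rightarrow> nat \<Rightarrow> nat \<Rightarrow> (nat \<Rightarrow> real \<Rightarrow> real) \<Rightarrow> (nat \<Rightarrow> nat \<Rightarrow> real \<Rightarrow> real) \<Rightarrow>
     (nat \<Rightarrow> real) \<Rightarrow> (nat \<Rightarrow> nat \<Rightarrow> real) \<Rightarrow> (nat \<times> nat \<Rightarrow> nat) \<Rightarrow> real \<Rightarrow> real" where
  "wavelet_estimate j0 C J \<Phi> \<Psi> y0 y x t =
     (\<Sum>k<C. y0 k * \<Phi> k t) +
     (\<Sum>j = j0..<J. \<Sum>k<2 ^ j. (if x (j, k) = 1 then y j k else 0) * \<Psi> j k t)"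

definition L2_loss :: "(real \<Rightarrow> real) \<Rightarrow> (real \<Rightarrow> real) \<Rightarrow> ennreal" where
  "L2_loss g f = (\<integral>\<^sup>+t\<in>{0..1}. ennreal ((g t - f t)\<^sup>2) \<partial>lborel)"

end

theory Submission
  imports Defs "HOL-Computational_Algebra.Polynomial" "HOL-Real_Asymp.Real_Asymp"
begin

text \<open>Divided by \<open>\<sigma> / sqrt n\<close>, the empirical coefficients become \<open>\<mu> i + z i\<close>, where \<open>\<mu>\<close> is the signal and the noise
\<open>z\<close> has the moment generating function of independent standard normal variables (as an upper bound). With
\<open>w i = \<gamma> i / (1 + \<gamma> i)\<close>, the logarithm of the posterior probability of a set \<open>S\<close> of non-zero coefficients is,
up to a constant, \<open>\<Sum>i\<in>S. w i / 2 * (\<mu> i + z i)\<^sup>2 - ln (1 + \<gamma> i) / 2\<close> minus the penalty \<open>ln (N choose |S|) - ln \<pi> |S|\<close>,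
where \<open>N\<close> is the number of coefficients. The estimator therefore maximizes a penalized quadratic criterion
(\<open>MAP_maximizes_penalized_gain\<close>).

Comparing the maximizer \<open>S\<close> with a fixed competitor \<open>A\<close> bounds the loss by the bias of \<open>A\<close>, the penalty
of \<open>A\<close> and the excess \<open>\<Sum>i\<in>S. w' i / 2 * (z i)\<^sup>2 - ln (1 + \<gamma> i) / 2\<close> of the noise, with \<open>w' i\<close> slightly
above \<open>w i\<close>, over the part \<open>ln (N choose |S|)\<close> of the penalty. This excess has to be controlled for all \<open>S\<close>
simultaneously. For \<open>w' = w\<close> summing over all \<open>S\<close> would suffice, because \<open>exp (w / 2 * z\<^sup>2 - ln (1 + \<gamma>) / 2)\<close> has
expectation 1 for a standard normal \<open>z\<close>. The margin \<open>w' > w\<close>, which is what leaves part of the noise energy on the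
side to be bounded, makes these expectations grow exponentially with \<open>|S|\<close>. Therefore \<open>1 / (N choose k)\<close> is bounded by
\<open>(N + 1) * p ^ k * (1 - p) ^ (N - k)\<close> with \<open>p = k / N\<close>, so that the exponential of the excess is at most a
product over all coordinates of two-point mixtures, each of expectation at most 1; the small gain in the
exponent is absorbed by \<open>p * t \<le> (1 - p) + p * (const * t powr (1 + \<epsilon>))\<close> (\<open>selection_noise_bound\<close>). The
risk is thus at most a constant times the bias of \<open>A\<close> plus \<open>|A| * ln n\<close> (\<open>penalized_selection_risk\<close>).

On the analytic side, \<open>besov_coefficient_bound\<close> gives \<open>\<Sum>k. |\<theta> j k| powr \<rho> \<le> C * 2 powr (- j * \<rho> * (s + 1/2 - 1/\<rho>))\<close>
uniformly over the Besov ball, with \<open>\<rho> \<le> 2\<close>. For \<open>p < 1\<close> the triangle inequality in \<open>L\<^sup>p\<close> fails,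
so \<open>f\<close> is compared pointwise with its local polynomial interpolants on nested dyadic grids. Passing
from one grid to the next costs finite differences at grid points, the wavelet annihilates the polynomial at its own
scale, and an average over a random offset of the grids turns sums over grid points into the
integrals that define the modulus of smoothness.

Finally \<open>A\<close> consists of all coefficients below the level \<open>2 ^ j = (n / ln n) powr (1 / (2 * s + 1))\<close> and of those
above it that exceed \<open>sqrt (ln n / n)\<close>. Both \<open>|A| * ln n / n\<close> and the squared coefficients outside \<open>A\<close> are then of the
order of the claimed rate (\<open>competitor_set_exists\<close>), and so are the coefficients beyond the finest level (\<open>tail_rate\<close>).\<close>

section \<open>Quadratic forms of sub-Gaussian noise\<close>
text \<open>The joint form of the inequality, over all linear combinations, is what a vector of independent standard normal
variables satisfies with equality; it survives limits by Fatou's lemma.\<close>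

definition std_subgaussian :: "'w measure \<Rightarrow> 'i set \<Rightarrow> ('i \<Rightarrow> 'w \<Rightarrow> real) \<Rightarrow> bool" where
  "std_subgaussian P U z \<longleftrightarrow> (\<forall>i\<in>U. z i \<in> borel_measurable P) \<and>
     (\<forall>a. (\<integral>\<^sup>+w. ennreal (exp (\<Sum>i\<in>U. a i * z i w)) \<partial>P) \<le> ennreal (exp ((\<Sum>i\<in>U. (a i)\<^sup>2) / 2)))"

lemma nn_integral_normal_density:
  assumes "0 < \<sigma>" shows "(\<integral>\<^sup>+x. ennreal (normal_density \<mu> \<sigma> x) \<partial>lborel) = 1"
proof -
  interpret prob_space "density lborel (normal_density \<mu> \<sigma>)"
    using assms by (rule prob_space_normal_density)
  show ?thesis using emeasure_space_1 by (simp add: emeasure_density)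
qed

lemma normal_mgf:
  assumes "0 < \<sigma>"
  shows "(\<integral>\<^sup>+x. ennreal (normal_density 0 \<sigma> x) * ennreal (exp (c * x)) \<partial>lborel) = ennreal (exp (c\<^sup>2 * \<sigma>\<^sup>2 / 2))"
proof -
  have "normal_density 0 \<sigma> x * exp (c * x) = exp (c\<^sup>2 * \<sigma>\<^sup>2 / 2) * normal_density (c * \<sigma>\<^sup>2) \<sigma> x" for x
  proof -
    have "- (x\<^sup>2) / (2 * \<sigma>\<^sup>2) + c * x = c\<^sup>2 * \<sigma>\<^sup>2 / 2 + (- ((x - c * \<sigma>\<^sup>2)\<^sup>2) / (2 * \<sigma>\<^sup>2))"
      using assms by (simp add: field_simps power2_eq_square)
    then show ?thesis
      unfolding normal_density_def by (simp add: exp_add[symmetric] mult_ac)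
  qed
  then have "(\<integral>\<^sup>+x. ennreal (normal_density 0 \<sigma> x) * ennreal (exp (c * x)) \<partial>lborel)
     = (\<integral>\<^sup>+x. ennreal (exp (c\<^sup>2 * \<sigma>\<^sup>2 / 2)) * ennreal (normal_density (c * \<sigma>\<^sup>2) \<sigma> x) \<partial>lborel)"
    by (simp add: ennreal_mult[symmetric])
  also have "\<dots> = ennreal (exp (c\<^sup>2 * \<sigma>\<^sup>2 / 2))"
    using assms by (simp add: nn_integral_cmult nn_integral_normal_density)
  finally show ?thesis .
qed

lemma normal_square_mgf:
  assumes "0 \<le> a" "a < (1::real)"
  shows "(\<integral>\<^sup>+x. ennreal (normal_density 0 1 x) * ennreal (exp (a / 2 * x\<^sup>2)) \<partial>lborel) = ennreal (1 / sqrt (1 - a))"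
proof -
  define s where "s = 1 / sqrt (1 - a)"
  have s: "s > 0" "s\<^sup>2 = 1 / (1 - a)" using assms by (auto simp: s_def power_divide)
  have "normal_density 0 1 x * exp (a / 2 * x\<^sup>2) = s * normal_density 0 s x" for x
  proof -
    have "- (x\<^sup>2) / 2 + a / 2 * x\<^sup>2 = - (x\<^sup>2) / (2 * s\<^sup>2)"
      using assms by (simp add: s field_simps)
    moreover have "sqrt (2 * pi * s\<^sup>2) = sqrt (2 * pi) * s"
      using s(1) by (subst real_sqrt_mult) simp
    ultimately show ?thesis
      using s unfolding normal_density_def by (simp add: exp_add[symmetric] mult_ac field_simps)
  qed
  then have "(\<integral>\<^sup>+x. ennreal (normal_density 0 1 x) * ennreal (exp (a / 2 * x\<^sup>2)) \<partial>lborel)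
     = (\<integral>\<^sup>+x. ennreal s * ennreal (normal_density 0 s x) \<partial>lborel)"
    using s by (simp add: ennreal_mult[symmetric])
  also have "\<dots> = ennreal s"
    using s by (simp add: nn_integral_cmult nn_integral_normal_density)
  finally show ?thesis by (simp add: s_def)
qed

text \<open>The square in the exponent is linearized by an independent Gaussian variable \<open>g\<close>, since
\<open>exp (a * z\<^sup>2 / 2)\<close> is the expectation of \<open>exp (sqrt a * z * g)\<close>. After exchanging the integrals the inner one is
covered by the assumption on linear forms, and the outer one is the explicit Gaussian integral.\<close>

lemma subgaussian_quadratic_mgf:
  fixes z :: "'i \<Rightarrow> 'w \<Rightarrow> real"
  assumes "prob_space P" "finite U" "std_subgaussian P U z" "D \<subseteq> U"
    and a: "\<And>i. i \<in> D \<Longrightarrow> 0 \<le> a i \<and> a i < 1"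
  shows "(\<integral>\<^sup>+w. ennreal (exp (\<Sum>i\<in>D. a i / 2 * (z i w)\<^sup>2)) \<partial>P) \<le> ennreal (\<Prod>i\<in>D. 1 / sqrt (1 - a i))"
proof -
  interpret P: prob_space P by fact
  define N where "N = density lborel (\<lambda>x. ennreal (normal_density 0 1 x))"
  interpret N: prob_space N unfolding N_def by (rule prob_space_normal_density) simp
  have finD: "finite D" using assms finite_subset by blast
  interpret pr: product_sigma_finite "\<lambda>_::'i. N" ..
  have Nint: "(\<integral>\<^sup>+x. h x \<partial>N) = (\<integral>\<^sup>+x. ennreal (normal_density 0 1 x) * h x \<partial>lborel)"
    if "h \<in> borel_measurable borel" for h
    using that unfolding N_def by (subst nn_integral_density) auto
  have setsN[measurable_cong]: "sets N = sets borel" by (simp add: N_def)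
  have lin: "(\<integral>\<^sup>+x. ennreal (exp (c * x)) \<partial>N) = ennreal (exp (c\<^sup>2 / 2))" for c
    by (subst Nint) (use normal_mgf[of 1 c] in auto)
  have quad: "(\<integral>\<^sup>+x. ennreal (exp (b / 2 * x\<^sup>2)) \<partial>N) = ennreal (1 / sqrt (1 - b))" if "0 \<le> b" "b < 1" for b
    by (subst Nint) (use normal_square_mgf[OF that] in auto)
  have zm[measurable]: "z i \<in> borel_measurable P" if "i \<in> D" for i
    using assms that by (auto simp: std_subgaussian_def)
  let ?Q = "Pi\<^sub>M D (\<lambda>_. N)"
  interpret Q: sigma_finite_measure ?Q by (rule pr.sigma_finite[OF finD])
  interpret PQ: pair_sigma_finite ?Q P ..
  have "(\<integral>\<^sup>+w. ennreal (exp (\<Sum>i\<in>D. a i / 2 * (z i w)\<^sup>2)) \<partial>P)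
      = (\<integral>\<^sup>+w. (\<Prod>i\<in>D. \<integral>\<^sup>+x. ennreal (exp (sqrt (a i) * z i w * x)) \<partial>N) \<partial>P)"
    using finD a by (auto intro!: nn_integral_cong prod.cong simp: lin exp_sum prod_ennreal power_mult_distrib)
  also have "\<dots> = (\<integral>\<^sup>+w. (\<integral>\<^sup>+g. (\<Prod>i\<in>D. ennreal (exp (sqrt (a i) * z i w * g i))) \<partial>?Q) \<partial>P)"
    by (intro nn_integral_cong pr.product_nn_integral_prod[symmetric] finD) auto
  also have "\<dots> = (\<integral>\<^sup>+g. (\<integral>\<^sup>+w. (\<Prod>i\<in>D. ennreal (exp (sqrt (a i) * z i w * g i))) \<partial>P) \<partial>?Q)"
    by (rule PQ.Fubini') measurable
  also have "\<dots> \<le> (\<integral>\<^sup>+g. ennreal (exp ((\<Sum>i\<in>D. a i * (g i)\<^sup>2) / 2)) \<partial>?Q)"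
  proof (rule nn_integral_mono)
    fix g
    define b where "b i = (if i \<in> D then sqrt (a i) * g i else 0)" for i
    have "(\<Prod>i\<in>D. ennreal (exp (sqrt (a i) * z i w * g i))) = ennreal (exp (\<Sum>i\<in>U. b i * z i w))" for w
    proof -
      have "(\<Sum>i\<in>U. b i * z i w) = (\<Sum>i\<in>D. sqrt (a i) * z i w * g i)"
        using assms(2,4) by (intro sum.mono_neutral_cong_right) (auto simp: b_def)
      then show ?thesis using finD by (simp add: prod_ennreal exp_sum)
    qed
    then have "(\<integral>\<^sup>+w. (\<Prod>i\<in>D. ennreal (exp (sqrt (a i) * z i w * g i))) \<partial>P)
       \<le> ennreal (exp ((\<Sum>i\<in>U. (b i)\<^sup>2) / 2))"
      using assms(3) by (simp add: std_subgaussian_def)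
    also have "(\<Sum>i\<in>U. (b i)\<^sup>2) = (\<Sum>i\<in>D. a i * (g i)\<^sup>2)"
      using assms(2,4) a by (intro sum.mono_neutral_cong_right) (auto simp: b_def power_mult_distrib)
    finally show "(\<integral>\<^sup>+w. (\<Prod>i\<in>D. ennreal (exp (sqrt (a i) * z i w * g i))) \<partial>P)
       \<le> ennreal (exp ((\<Sum>i\<in>D. a i * (g i)\<^sup>2) / 2))" .
  qed
  also have "\<dots> = (\<integral>\<^sup>+g. (\<Prod>i\<in>D. ennreal (exp (a i / 2 * (g i)\<^sup>2))) \<partial>?Q)"
    using finD by (auto intro!: nn_integral_cong simp: prod_ennreal exp_sum[symmetric] sum_divide_distrib)
  also have "\<dots> = (\<Prod>i\<in>D. \<integral>\<^sup>+x. ennreal (exp (a i / 2 * x\<^sup>2)) \<partial>N)"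
    by (intro pr.product_nn_integral_prod finD) auto
  also have "\<dots> = ennreal (\<Prod>i\<in>D. 1 / sqrt (1 - a i))"
    using a quad by (subst prod_ennreal[symmetric]) (auto intro!: prod.cong simp: less_imp_le)
  finally show ?thesis .
qed

section \<open>Two elementary inequalities for binomial mixtures\<close>
text \<open>The constant 1 in front of the additive term is essential: in \<open>mixture_le_power\<close> it becomes exactly the mass
\<open>1 - p\<close> of a mixture.\<close>

lemma young_epsilon:
  fixes y \<epsilon> :: real
  assumes "0 \<le> y" "0 < \<epsilon>"
  shows "y \<le> 1 + (\<epsilon> * y) powr \<epsilon> * y"
proof (cases "y \<le> 1")
  case True then show ?thesis using assms by (simp add: add_increasing2)
next
  case False
  define s where "s = \<epsilon> * y"
  have s: "s > 0" using False assms by (simp add: s_def)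
  have "- ln s \<le> 1 / s - 1"
    using ln_le_minus_one[of "1/s"] s by (simp add: ln_div)
  then have "\<epsilon> * ln s \<ge> \<epsilon> * (1 - 1 / s)" using assms by (intro mult_left_mono) auto
  moreover have "\<epsilon> * (1 - 1 / s) \<ge> - 1 / y"
    using False assms by (simp add: s_def field_simps)
  ultimately have "1 - 1 / y \<le> 1 + \<epsilon> * ln s" by simp
  also have "\<dots> \<le> s powr \<epsilon>" using s by (simp add: powr_def add.commute)
  finally have "(1 - 1 / y) * y \<le> s powr \<epsilon> * y" using False by (intro mult_right_mono) auto
  moreover have "(1 - 1 / y) * y = y - 1" using False by (simp add: field_simps)
  ultimately show ?thesis by (simp add: s_def)
qed

text \<open>Trading \<open>t\<close> for \<open>t powr (1 + \<epsilon>)\<close>. The weights \<open>1 - p\<close> and \<open>p\<close> on the right sum to one, so products over many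
coordinates still have expectation at most 1 when the coefficient of \<open>p\<close> does.\<close>

lemma mixture_le_power:
  fixes p R t \<epsilon> :: real
  assumes "0 \<le> p" "p < 1" "p \<le> R * (1 - p)" "0 \<le> t" "0 < \<epsilon>"
  shows "p * t \<le> (1 - p) + p * ((\<epsilon> * R) powr \<epsilon> * t powr (1 + \<epsilon>))"
proof -
  define y where "y = p * t / (1 - p)"
  have R: "R \<ge> 0"
    using order_trans[OF assms(1,3)] assms(2) by (simp add: zero_le_mult_iff)
  have "p * t \<le> R * (1 - p) * t" using assms by (intro mult_right_mono) auto
  then have y: "0 \<le> y" "y \<le> R * t" using assms 
    by (simp_all add: y_def divide_le_eq mult_ac)
  have "p * t = (1 - p) * y" using assms by (simp add: y_def)
  also have "\<dots> \<le> (1 - p) * (1 + (\<epsilon> * y) powr \<epsilon> * y)"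
    using young_epsilon[OF y(1) assms(5)] assms by (intro mult_left_mono) auto
  also have "\<dots> \<le> (1 - p) * (1 + (\<epsilon> * (R * t)) powr \<epsilon> * y)"
    using assms y by (intro mult_left_mono add_left_mono mult_right_mono powr_mono2) auto
  also have "\<dots> = (1 - p) + p * ((\<epsilon> * R) powr \<epsilon> * t powr (1 + \<epsilon>))"
    using assms R by (simp add: y_def field_simps powr_mult powr_add)
  finally show ?thesis .
qed

text \<open>The binomial distribution with success probability \<open>k / n\<close> has its mode at \<open>k\<close>, and the largest of its \<open>n + 1\<close>
probabilities is at least their mean.\<close>

lemma binomial_mode_bound:
  assumes "k \<le> n" "0 < n"
  defines "p \<equiv> real k / real n"
  shows "1 \<le> (real n + 1) * (real (n choose k) * p ^ k * (1 - p) ^ (n - k))"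
proof -
  define a where "a j = real (n choose j) * p ^ j * (1 - p) ^ (n - j)" for j
  have p: "0 \<le> p" "p \<le> 1" using assms by (auto simp: p_def)
  have np: "real n * p = real k" using assms by (simp add: p_def)
  have a0: "a j \<ge> 0" for j using p by (simp add: a_def)
  (* ratio of consecutive binomial probabilities: they increase up to k and decrease afterwards *)
  have rat: "a (Suc j) * (real (Suc j) * (1 - p)) = a j * (real (n - j) * p)" if "j < n" for j
  proof -
    have e: "n - j = Suc (n - Suc j)" using that by simp
    have "real (n choose Suc j) * real (Suc j) = real (n choose j) * real (n - j)"
    proof -
      have "(n choose Suc j) * Suc j = (n choose j) * (n - j)"
        using that binomial_absorb_comp[of n j] Suc_times_binomial[of j "n - 1"] by (simp add: mult.commute)
      then show ?thesis by (metis of_nat_mult)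
    qed
    moreover have "a (Suc j) * (real (Suc j) * (1 - p))
       = (real (n choose Suc j) * real (Suc j)) * (p ^ j * p * (1 - p) ^ (n - j))"
      unfolding a_def e by simp
    moreover have "a j * (real (n - j) * p) = (real (n choose j) * real (n - j)) * (p ^ j * p * (1 - p) ^ (n - j))"
      unfolding a_def by simp
    ultimately show ?thesis by (simp only:)
  qed
  have up: "a j \<le> a (Suc j)" if "Suc j \<le> k" for j
  proof (cases "p = 1")
    case True
    then have "k = n" using np by simp
    then have "a j = 0" using True that by (simp add: a_def)
    then show ?thesis using a0 by simp
  next
    case False
    have "real (Suc j) * (1 - p) \<le> real (n - j) * p"
    proof -
      have "real (Suc j) \<le> real k" using that by simp
      moreover have "real (n - j) = real n - real j" using that assms by simp
      ultimately show ?thesis using np p by (simp add: algebra_simps)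
    qed
    then have "a j * (real (Suc j) * (1 - p)) \<le> a (Suc j) * (real (Suc j) * (1 - p))"
      unfolding rat[OF less_le_trans[OF Suc_le_lessD[OF that] assms(1)]] by (intro mult_left_mono a0)
    moreover have "0 < real (Suc j) * (1 - p)" using False p by simp
    ultimately show ?thesis by (rule mult_right_le_imp_le)
  qed
  have down: "a (Suc j) \<le> a j" if "k \<le> j" "j < n" for j
  proof -
    have p1: "p < 1" using that assms by (simp add: p_def)
    have "real (n - j) * p \<le> real (Suc j) * (1 - p)"
    proof -
      have "real k \<le> real j" using that by simp
      moreover have "real (n - j) = real n - real j" using that assms by simp
      ultimately show ?thesis using np p by (simp add: algebra_simps)
    qed
    then have "a (Suc j) * (real (Suc j) * (1 - p)) \<le> a j * (real (Suc j) * (1 - p))"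
      unfolding rat[OF that(2)] by (intro mult_left_mono a0)
    moreover have "0 < real (Suc j) * (1 - p)" using p1 by simp
    ultimately show ?thesis by (rule mult_right_le_imp_le)
  qed
  have le1: "a j \<le> a k" if "j \<le> k" for j
    using that
  proof (induction rule: inc_induct)
    case (step m)
    then show ?case using up[of m] by simp
  qed simp
  have le2: "j \<le> n \<longrightarrow> a j \<le> a k" if "k \<le> j" for j
    using that
  proof (induction rule: dec_induct)
    case (step m)
    then show ?case using down[of m] by auto
  qed simp
  have "1 = (p + (1 - p)) ^ n" by simp
  also have "\<dots> = (\<Sum>j\<le>n. a j)" unfolding binomial_ring a_def by simp
  also have "\<dots> \<le> (\<Sum>j\<le>n. a k)" by (intro sum_mono) (use le1 le2 nat_le_linear in auto)
  also have "\<dots> = (real n + 1) * a k" by (simp add: algebra_simps)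
  finally show ?thesis by (simp add: a_def)
qed

lemma inverse_sqrt_one_minus_le_exp:
  assumes "0 \<le> x" "x \<le> (1/2::real)"
  shows "1 / sqrt (1 - x) \<le> exp x"
proof -
  have "exp (- (2 * x)) \<le> 1 - x"
  proof -
    have "1 + 2 * x + (2*x)\<^sup>2 / 2 \<le> exp (2 * x)" using exp_lower_Taylor_quadratic[of "2*x"] assms by simp
    moreover have "1 \<le> (1 + 2 * x + (2*x)\<^sup>2 / 2) * (1 - x)"
    proof -
      have "(1 + 2 * x + (2*x)\<^sup>2 / 2) * (1 - x) = 1 + x * (1 - 2 * x\<^sup>2)" by (simp add: algebra_simps power2_eq_square)
      moreover have "x\<^sup>2 \<le> (1/2)\<^sup>2" using assms by (intro power_mono) auto
      ultimately show ?thesis using assms by (simp add: power2_eq_square)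
    qed
    ultimately have "1 \<le> exp (2*x) * (1 - x)"
      using mult_right_mono[of "1 + 2 * x + (2*x)\<^sup>2 / 2" "exp (2 * x)" "1 - x"] assms by linarith
    then show ?thesis by (simp add: exp_minus field_simps)
  qed
  then have "exp (-x) \<le> sqrt (1 - x)"
    by (intro real_le_rsqrt) (simp add: exp_double[symmetric])
  then show ?thesis using assms by (simp add: exp_minus field_simps)
qed

section \<open>Exponential moments of the posterior odds\<close>
text \<open>The posterior mean of a coefficient that is known to be non-zero is this multiple of the observation.\<close>

definition shrinkage :: "real \<Rightarrow> real" where "shrinkage g = g / (1 + g)"

lemma shrinkage_bounds: "0 < g \<Longrightarrow> 0 < shrinkage g" "0 < g \<Longrightarrow> shrinkage g < 1"
  "0 < g \<Longrightarrow> 1 - shrinkage g = 1 / (1 + g)"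
  by (auto simp: shrinkage_def field_simps)

lemma shrinkage_mono: "0 < g \<Longrightarrow> g \<le> g' \<Longrightarrow> shrinkage g \<le> shrinkage g'"
  by (auto simp: shrinkage_def field_simps)

text \<open>Expanding the product over all subsets reduces the claim to quadratic forms; after taking
expectations the sum over subsets folds back into a product whose factors are at most \<open>p + (1 - p)\<close>.\<close>

lemma mixture_expectation_le_1:
  fixes z :: "'i \<Rightarrow> 'w \<Rightarrow> real"
  assumes P: "prob_space P" and U: "finite U" and z: "std_subgaussian P U z"
    and p: "0 \<le> p" "p \<le> 1"
    and a: "\<And>i. i \<in> U \<Longrightarrow> 0 \<le> a i \<and> a i < 1"
    and \<beta>: "\<And>i. i \<in> U \<Longrightarrow> 0 \<le> \<beta> i \<and> \<beta> i * (1 / sqrt (1 - a i)) \<le> 1"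
  shows "(\<integral>\<^sup>+w. ennreal (\<Prod>i\<in>U. p * (\<beta> i * exp (a i / 2 * (z i w)\<^sup>2)) + (1 - p)) \<partial>P) \<le> 1"
proof -
  have zm[measurable]: "z i \<in> borel_measurable P" if "i \<in> U" for i
    using z that by (auto simp: std_subgaussian_def)
  have D: "ennreal (\<Prod>i\<in>U. p * (\<beta> i * exp (a i / 2 * (z i w)\<^sup>2)) + (1 - p))
     = (\<Sum>D\<in>Pow U. ennreal ((\<Prod>i\<in>D. p * \<beta> i) * (1 - p) ^ card (U - D)) * ennreal (exp (\<Sum>i\<in>D. a i / 2 * (z i w)\<^sup>2)))" for w
  proof -
    have "(\<Prod>i\<in>U. p * (\<beta> i * exp (a i / 2 * (z i w)\<^sup>2)) + (1 - p))
      = (\<Sum>D\<in>Pow U. ((\<Prod>i\<in>D. p * \<beta> i) * (1 - p) ^ card (U - D)) * exp (\<Sum>i\<in>D. a i / 2 * (z i w)\<^sup>2))"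
      unfolding prod_add[OF U]
      by (intro sum.cong refl) (use U in \<open>auto simp: exp_sum[OF finite_subset[OF _ U]] prod.distrib mult_ac\<close>)
    also have "ennreal \<dots> = (\<Sum>D\<in>Pow U. ennreal (((\<Prod>i\<in>D. p * \<beta> i) * (1 - p) ^ card (U - D)) * exp (\<Sum>i\<in>D. a i / 2 * (z i w)\<^sup>2)))"
      using p \<beta> by (intro sum_ennreal[symmetric] mult_nonneg_nonneg prod_nonneg zero_le_power) auto
    finally show ?thesis
      using p \<beta> by (auto intro!: sum.cong ennreal_mult mult_nonneg_nonneg prod_nonneg zero_le_power)
  qed
  have "(\<integral>\<^sup>+w. ennreal (\<Prod>i\<in>U. p * (\<beta> i * exp (a i / 2 * (z i w)\<^sup>2)) + (1 - p)) \<partial>P)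
     = (\<Sum>D\<in>Pow U. ennreal ((\<Prod>i\<in>D. p * \<beta> i) * (1 - p) ^ card (U - D)) * (\<integral>\<^sup>+w. ennreal (exp (\<Sum>i\<in>D. a i / 2 * (z i w)\<^sup>2)) \<partial>P))"
    unfolding D
  proof (subst nn_integral_sum)
    fix D assume "D \<in> Pow U"
    then have [measurable]: "z i \<in> borel_measurable P" if "i \<in> D" for i using that zm by auto
    show "(\<lambda>w. ennreal ((\<Prod>i\<in>D. p * \<beta> i) * (1 - p) ^ card (U - D)) * ennreal (exp (\<Sum>i\<in>D. a i / 2 * (z i w)\<^sup>2))) \<in> borel_measurable P"
      by measurable
  next
    show "(\<Sum>D\<in>Pow U. \<integral>\<^sup>+ x. ennreal ((\<Prod>i\<in>D. p * \<beta> i) * (1 - p) ^ card (U - D)) * ennreal (exp (\<Sum>i\<in>D. a i / 2 * (z i x)\<^sup>2)) \<partial>P) =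
    (\<Sum>D\<in>Pow U. ennreal ((\<Prod>i\<in>D. p * \<beta> i) * (1 - p) ^ card (U - D)) * (\<integral>\<^sup>+w. ennreal (exp (\<Sum>i\<in>D. a i / 2 * (z i w)\<^sup>2)) \<partial>P))"
    proof (intro sum.cong refl nn_integral_cmult)
      fix D assume "D \<in> Pow U"
      then have [measurable]: "z i \<in> borel_measurable P" if "i \<in> D" for i using that zm by auto
      show "(\<lambda>w. ennreal (exp (\<Sum>i\<in>D. a i / 2 * (z i w)\<^sup>2))) \<in> borel_measurable P" by measurable
    qed
  qed
  also have "\<dots> \<le> (\<Sum>D\<in>Pow U. ennreal ((\<Prod>i\<in>D. p * \<beta> i) * (1 - p) ^ card (U - D)) * ennreal (\<Prod>i\<in>D. 1 / sqrt (1 - a i)))"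
    by (intro sum_mono mult_left_mono subgaussian_quadratic_mgf[OF P U z]) (use a in auto)
  also have "\<dots> = ennreal (\<Sum>D\<in>Pow U. ((\<Prod>i\<in>D. p * \<beta> i) * (1 - p) ^ card (U - D)) * (\<Prod>i\<in>D. 1 / sqrt (1 - a i)))"
  proof -
    have n: "0 \<le> (\<Prod>i\<in>D. p * \<beta> i) * (1 - p) ^ card (U - D)" "0 \<le> (\<Prod>i\<in>D. 1 / sqrt (1 - a i))" if "D \<in> Pow U" for D
      using p \<beta> a that by (force intro!: mult_nonneg_nonneg prod_nonneg zero_le_power simp: less_imp_le)+
    show ?thesis
      using n by (subst sum_ennreal[symmetric]) (auto simp only: mult_nonneg_nonneg intro!: sum.cong ennreal_mult[symmetric])
  qed
  also have "(\<Sum>D\<in>Pow U. ((\<Prod>i\<in>D. p * \<beta> i) * (1 - p) ^ card (U - D)) * (\<Prod>i\<in>D. 1 / sqrt (1 - a i)))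
     = (\<Prod>i\<in>U. p * (\<beta> i * (1 / sqrt (1 - a i))) + (1 - p))"
    unfolding prod_add[OF U]
    by (intro sum.cong refl) (use U in \<open>auto simp: prod.distrib prod_dividef mult_ac\<close>)
  also have "ennreal \<dots> \<le> ennreal (\<Prod>i\<in>U. 1)"
  proof (intro ennreal_leI prod_mono)
    fix i assume i: "i \<in> U"
    have "0 \<le> p * (\<beta> i * (1 / sqrt (1 - a i)))"
      using p \<beta>[OF i] a[OF i] by (intro mult_nonneg_nonneg) auto
    moreover have "p * (\<beta> i * (1 / sqrt (1 - a i))) \<le> p * 1" using p \<beta>[OF i] by (intro mult_left_mono) auto
    ultimately show "0 \<le> p * (\<beta> i * (1 / sqrt (1 - a i))) + (1 - p) \<and> p * (\<beta> i * (1 / sqrt (1 - a i))) + (1 - p) \<le> 1"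
      using p by simp
  qed
  finally show ?thesis by simp
qed

text \<open>For a standard normal \<open>z\<close>, \<open>exp (shrinkage g / 2 * z\<^sup>2 - ln (1 + g) / 2)\<close> has expectation 1. Raising it to a power
slightly above 1 and inflating the shrinkage inside makes the expectation exceed 1 by a factor \<open>exp (2 * g * \<epsilon>)\<close>
at most, which the prefactor \<open>(\<epsilon> * R) powr \<epsilon>\<close> compensates once \<open>\<epsilon> * R\<close> is small.\<close>

lemma tilted_moment_le_1:
  assumes g: "0 < g" "g \<le> gp" and e: "0 < \<epsilon>" "0 < R" "\<epsilon> * R \<le> exp (- 2 * gp)" "4 * gp * \<epsilon> \<le> 1"
  shows "shrinkage g * (1 + 2 * \<epsilon>) < 1"
    and "(\<epsilon> * R) powr \<epsilon> * exp (- (1 + \<epsilon>) * (ln (1 + g) / 2)) * (1 / sqrt (1 - shrinkage g * (1 + 2 * \<epsilon>))) \<le> 1"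
proof -
  have ge: "2 * g * \<epsilon> \<le> 1 / 2" 
  proof -
    have "g * \<epsilon> \<le> gp * \<epsilon>" using g e by (intro mult_right_mono) auto
    then show ?thesis using e(4) by (simp add: mult.assoc)
  qed
  have eq: "1 - shrinkage g * (1 + 2 * \<epsilon>) = (1 - 2 * g * \<epsilon>) / (1 + g)"
    using g by (simp add: shrinkage_def field_simps)
  have "(1 - 2 * g * \<epsilon>) / (1 + g) > 0" using ge g by (intro divide_pos_pos) auto
  then show "shrinkage g * (1 + 2 * \<epsilon>) < 1" using eq by linarith
  have "1 / sqrt (1 - shrinkage g * (1 + 2 * \<epsilon>)) = sqrt (1 + g) * (1 / sqrt (1 - 2 * g * \<epsilon>))"
    by (simp add: eq real_sqrt_divide)
  also have "\<dots> \<le> sqrt (1 + g) * exp (2 * g * \<epsilon>)"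
    using g e ge by (intro mult_left_mono inverse_sqrt_one_minus_le_exp) auto
  also have "sqrt (1 + g) = exp (ln (1 + g) / 2)"
    using g by (simp add: ln_sqrt[symmetric])
  finally have 1: "1 / sqrt (1 - shrinkage g * (1 + 2 * \<epsilon>)) \<le> exp (ln (1 + g) / 2 + 2 * g * \<epsilon>)"
    by (simp add: exp_add)
  have "(\<epsilon> * R) powr \<epsilon> \<le> exp (- 2 * gp) powr \<epsilon>"
    using e by (intro powr_mono2) auto
  also have "\<dots> = exp (- 2 * gp * \<epsilon>)" by (simp add: powr_def mult_ac)
  finally have 2: "(\<epsilon> * R) powr \<epsilon> \<le> exp (- 2 * gp * \<epsilon>)" .
  define l where "l = ln (1 + g) / 2"
  have l: "0 \<le> l" using g by (simp add: l_def)
  have "(\<epsilon> * R) powr \<epsilon> * exp (- (1 + \<epsilon>) * l) * (1 / sqrt (1 - shrinkage g * (1 + 2 * \<epsilon>)))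
      \<le> exp (- 2 * gp * \<epsilon>) * exp (- (1 + \<epsilon>) * l) * exp (l + 2 * g * \<epsilon>)"
    unfolding l_def by (intro mult_mono 1 2) (use eq ge g in auto)
  also have "\<dots> = exp (- 2 * gp * \<epsilon> + - (1 + \<epsilon>) * l + (l + 2 * g * \<epsilon>))"
    by (simp only: exp_add)
  also have "- 2 * gp * \<epsilon> + - (1 + \<epsilon>) * l + (l + 2 * g * \<epsilon>) = - (2 * ((gp - g) * \<epsilon>) + \<epsilon> * l)"
    by (simp add: algebra_simps)
  also have "exp \<dots> \<le> 1"
  proof -
    have "0 \<le> 2 * ((gp - g) * \<epsilon>) + \<epsilon> * l" using g e l by (intro add_nonneg_nonneg mult_nonneg_nonneg) auto
    then show ?thesis unfolding exp_le_one_iff by linarith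
  qed
  finally show "(\<epsilon> * R) powr \<epsilon> * exp (- (1 + \<epsilon>) * (ln (1 + g) / 2)) * (1 / sqrt (1 - shrinkage g * (1 + 2 * \<epsilon>))) \<le> 1"
    unfolding l_def .
qed

text \<open>At half the exponent there is strict slack, by the Cauchy-Schwarz inequality: in terms of \<open>w = shrinkage g\<close> it is
\<open>(1 - w / 2)\<^sup>2 - (1 - w) = w\<^sup>2 / 4\<close>. The slack pays both for the inflation of the exponent and for a factor
\<open>exp (\<eta> * gp / 4)\<close> per coordinate.\<close>

lemma half_tilted_moment_le_1:
  assumes g: "0 < gm" "gm \<le> g" "g \<le> gp" and e: "0 < \<epsilon>" "8 * \<epsilon> \<le> shrinkage gm"
    and \<eta>: "0 < \<eta>" "exp (\<eta> * gp) \<le> 1 + (shrinkage gm)\<^sup>2 / 8"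
  defines "w' \<equiv> shrinkage g * ((1 + 2 * \<epsilon>) / (1 + \<epsilon>))"
  shows "0 \<le> w' / 2" "w' / 2 < 1" "exp (\<eta> * (gp / 4) - ln (1 + g) / 4) * (1 / sqrt (1 - w' / 2)) \<le> 1"
proof -
  define w where "w = shrinkage g"
  have w: "0 < w" "w < 1" "shrinkage gm \<le> w" "0 < shrinkage gm"
    using g shrinkage_bounds[of g] shrinkage_bounds[of gm] shrinkage_mono[of gm g] by (auto simp: w_def)
  have "(1 + 2 * \<epsilon>) / (1 + \<epsilon>) \<le> 1 + \<epsilon>" using e by (simp add: field_simps)
  then have w'le: "w' \<le> w * (1 + \<epsilon>)" unfolding w'_def w_def[symmetric] using w by (intro mult_left_mono) auto
  have ew: "8 * \<epsilon> \<le> w" using e w by simp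
  have "w * (1 + \<epsilon>) < 2"
    using mult_strict_mono[of w 1 "1 + \<epsilon>" 2] w ew e by auto
  then show lt: "w' / 2 < 1" using w'le by linarith
  show "0 \<le> w' / 2" unfolding w'_def w_def[symmetric] using w e by simp
  (* half of the slack w^2 / 4 absorbs the inflation, because 8 * eps <= w *)
  have A: "(1 - w' / 2)\<^sup>2 \<ge> (1 - w) + w\<^sup>2 / 8"
  proof -
    have "1 - w / 2 - w * \<epsilon> / 2 \<le> 1 - w' / 2" using w'le by (simp add: algebra_simps)
    moreover have "0 \<le> 1 - w / 2 - w * \<epsilon> / 2" using \<open>w * (1 + \<epsilon>) < 2\<close> by (simp add: algebra_simps)
    ultimately have "(1 - w / 2 - w * \<epsilon> / 2)\<^sup>2 \<le> (1 - w' / 2)\<^sup>2" by (rule power_mono)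
    moreover have "(1 - w / 2 - w * \<epsilon> / 2)\<^sup>2 = (1 - w) + w\<^sup>2 / 4 - w * \<epsilon> + (w * w * \<epsilon> / 2 + (w * \<epsilon> / 2)\<^sup>2)"
      by (simp add: power2_eq_square field_simps)
    moreover have "w * \<epsilon> \<le> w\<^sup>2 / 8" using mult_left_mono[OF ew, of w] w by (simp add: power2_eq_square)
    moreover have "0 \<le> w * w * \<epsilon> / 2 + (w * \<epsilon> / 2)\<^sup>2" using w e by simp
    ultimately show ?thesis by linarith
  qed
  have "exp (\<eta> * gp) * (1 - w) \<le> (1 + (shrinkage gm)\<^sup>2 / 8) * (1 - w)"
    using \<eta> w by (intro mult_right_mono) auto
  also have "\<dots> \<le> (1 + w\<^sup>2 / 8) * (1 - w)"
    using w power_mono[of "shrinkage gm" w 2] by (intro mult_right_mono) auto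
  also have "\<dots> \<le> (1 - w) + w\<^sup>2 / 8" using w by (simp add: algebra_simps)
  also have "\<dots> \<le> (1 - w' / 2)\<^sup>2" by (rule A)
  finally have B: "exp (\<eta> * gp) * (1 - w) \<le> (1 - w' / 2)\<^sup>2" .
  have w1: "1 - w = exp (- ln (1 + g))"
    using g shrinkage_bounds(3)[of g] by (simp add: w_def exp_minus field_simps)
  define X where "X = exp (\<eta> * (gp / 4) - ln (1 + g) / 4)"
  have "X ^ 4 = exp (\<eta> * gp) * (1 - w)"
    unfolding X_def w1 by (simp add: exp_of_nat_mult[symmetric] exp_add[symmetric] algebra_simps)
  also have "\<dots> \<le> sqrt (1 - w' / 2) ^ 4"
  proof -
    have "sqrt (1 - w' / 2) ^ 4 = (sqrt (1 - w' / 2) ^ 2) ^ 2" by (simp add: power_mult[symmetric])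
    then show ?thesis using B lt by simp
  qed
  finally have "X \<le> sqrt (1 - w' / 2)"
    using lt by (intro power_le_imp_le_base[of X 3]) (auto simp: eval_nat_numeral)
  then show "exp (\<eta> * (gp / 4) - ln (1 + g) / 4) * (1 / sqrt (1 - w' / 2)) \<le> 1"
    using lt by (simp add: X_def)
qed

section \<open>Uniform control of the noise over all selections\<close>
text \<open>One random variable \<open>Z\<close> with logarithmically small expectation dominates the noise of every selection \<open>S\<close>, up to the
combinatorial penalty. Selections that leave out at least the fraction \<open>\<eta>\<close> of the coordinates are
handled by the mixture bound, one mixture \<open>F p\<close> for each cardinality. For almost full selections the odds \<open>p / (1 - p)\<close>
are unbounded and the mixture bound fails; there \<open>S\<close> is enlarged to all of \<open>U\<close>, which costs at most \<open>gp / 2\<close> per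
missing coordinate, and half of the exponent is used.\<close>

lemma selection_noise_bound:
  fixes z :: "'i \<Rightarrow> 'w \<Rightarrow> real" and g :: "'i \<Rightarrow> real"
  assumes P: "prob_space P" and U: "finite U" "U \<noteq> {}" and z: "std_subgaussian P U z"
    and gm: "0 < gm" and g: "\<And>i. i \<in> U \<Longrightarrow> gm \<le> g i \<and> g i \<le> gp"
    and e: "0 < \<epsilon>" "0 < R" "\<epsilon> * R \<le> exp (- 2 * gp)" "4 * gp * \<epsilon> \<le> 1" "8 * \<epsilon> \<le> shrinkage gm"
    and \<eta>: "0 < \<eta>" "\<eta> < 1" "R = (1 - \<eta>) / \<eta>" "exp (\<eta> * gp) \<le> 1 + (shrinkage gm)\<^sup>2 / 8"
  shows "\<exists>Z. Z \<in> borel_measurable P \<and> (\<forall>w. 0 \<le> Z w) \<and>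
    (\<integral>\<^sup>+w. ennreal (Z w) \<partial>P) \<le> ennreal (2 * ln (real (card U) + 1) + 3) \<and>
    (\<forall>w. \<forall>S\<subseteq>U. (\<Sum>i\<in>S. shrinkage (g i) * ((1 + 2 * \<epsilon>) / (1 + \<epsilon>)) / 2 * (z i w)\<^sup>2 - ln (1 + g i) / 2)
        \<le> ln (real (card U choose card S)) + Z w)"
proof -
  interpret prob_space P by fact
  define n where "n = card U"
  have n: "0 < n" using U by (simp add: n_def card_gt_0_iff)
  have zm[measurable]: "z i \<in> borel_measurable P" if "i \<in> U" for i
    using z that by (auto simp: std_subgaussian_def)
  define ww where "ww i = shrinkage (g i) * ((1 + 2 * \<epsilon>) / (1 + \<epsilon>))" for i
  define u where "u i w = ww i / 2 * (z i w)\<^sup>2 - ln (1 + g i) / 2" for i w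
  define \<beta> where "\<beta> i = (\<epsilon> * R) powr \<epsilon> * exp (- (1 + \<epsilon>) * (ln (1 + g i) / 2))" for i
  define a where "a i = shrinkage (g i) * (1 + 2 * \<epsilon>)" for i
  (* for p = k / n, F p dominates p^k * (1 - p)^(n - k) times the exponential of any sum of u over k coordinates *)
  define F where "F p w = (\<Prod>i\<in>U. p * (\<beta> i * exp (a i / 2 * (z i w)\<^sup>2)) + (1 - p))" for p w
  define K where "K = {k. k \<le> n \<and> real k \<le> (1 - \<eta>) * real n}"
  have finK: "finite K" and cardK: "card K \<le> n + 1"
    unfolding K_def using card_mono[of "{..n}" "{k. k \<le> n \<and> real k \<le> (1 - \<eta>) * real n}"] by auto
  define Q1 where "Q1 w = (\<Sum>k\<in>K. (real n + 1) * F (real k / real n) w)" for w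
  (* the factor exp (eta * gp / 4) per coordinate pays for the coordinates missing from an almost full selection *)
  define Q2 where "Q2 w = exp (\<Sum>i\<in>U. \<eta> * (gp / 4) + u i w / 2)" for w
  define N where "N = (real n + 1)\<^sup>2"
  (* ln Q1 <= ln N + Q1 / N, with N chosen so that Q1 / N has expectation at most 1 *)
  define Z where "Z w = ln N + Q1 w / N + 2 * Q2 w" for w
  have g0: "0 < g i" "gm \<le> g i" "g i \<le> gp" if "i \<in> U" for i using g[OF that] gm by auto
  have gp: "0 < gp" using U g gm by force
  have a1: "0 \<le> a i \<and> a i < 1" if "i \<in> U" for i
    using tilted_moment_le_1(1)[OF g0(1)[OF that] g0(3)[OF that] e(1,2,3,4)] shrinkage_bounds(1)[OF g0(1)[OF that]] e
    by (simp add: a_def)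
  have b1: "0 \<le> \<beta> i \<and> \<beta> i * (1 / sqrt (1 - a i)) \<le> 1" if "i \<in> U" for i
    using tilted_moment_le_1(2)[OF g0(1)[OF that] g0(3)[OF that] e(1,2,3,4)]
    unfolding a_def \<beta>_def by simp
  have F0: "0 \<le> F p w" if "0 \<le> p" "p \<le> 1" for p w
    unfolding F_def using that b1 by (intro prod_nonneg) (auto intro!: add_nonneg_nonneg mult_nonneg_nonneg)
  have pK: "0 \<le> real k / real n" "real k / real n \<le> 1" "real k / real n \<le> 1 - \<eta>" if "k \<in> K" for k
    using that n by (auto simp: K_def field_simps)
  have Q10: "0 \<le> Q1 w" for w unfolding Q1_def by (intro sum_nonneg mult_nonneg_nonneg F0 pK) auto
  have Q20: "0 \<le> Q2 w" for w by (simp add: Q2_def)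
  have N1: "1 \<le> N" by (simp add: N_def)
  have Fm[measurable]: "F p \<in> borel_measurable P" for p unfolding F_def by measurable
  have Q1m[measurable]: "Q1 \<in> borel_measurable P" unfolding Q1_def by measurable
  have Q2m[measurable]: "Q2 \<in> borel_measurable P" unfolding Q2_def u_def by measurable
  have Zm: "Z \<in> borel_measurable P" unfolding Z_def by measurable
  have EF: "(\<integral>\<^sup>+w. ennreal (F p w) \<partial>P) \<le> 1" if "0 \<le> p" "p \<le> 1" for p
    unfolding F_def by (rule mixture_expectation_le_1[OF P U(1) z that a1 b1])
  have EQ1: "(\<integral>\<^sup>+w. ennreal (Q1 w) \<partial>P) \<le> ennreal N"
  proof -
    have "(\<integral>\<^sup>+w. ennreal (Q1 w) \<partial>P) = (\<integral>\<^sup>+w. (\<Sum>k\<in>K. ennreal (real n + 1) * ennreal (F (real k / real n) w)) \<partial>P)"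
      unfolding Q1_def using F0 pK
      by (intro nn_integral_cong) (auto simp: ennreal_mult sum_ennreal[symmetric] intro!: sum.cong simp del: sum_ennreal)
    also have "\<dots> = (\<Sum>k\<in>K. ennreal (real n + 1) * (\<integral>\<^sup>+w. ennreal (F (real k / real n) w) \<partial>P))"
      by (subst nn_integral_sum) (auto simp: nn_integral_cmult)
    also have "\<dots> \<le> (\<Sum>k\<in>K. ennreal (real n + 1) * 1)"
      by (intro sum_mono mult_left_mono EF pK) auto
    also have "\<dots> = ennreal (real (card K) * (real n + 1))"
      by (simp add: ennreal_mult ennreal_of_nat_eq_real_of_nat)
    also have "\<dots> \<le> ennreal N"
      using cardK by (intro ennreal_leI) (auto simp: N_def power2_eq_square intro!: mult_right_mono)
    finally show ?thesis .
  qed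
  have EQ2: "(\<integral>\<^sup>+w. ennreal (Q2 w) \<partial>P) \<le> 1"
  proof -
    have H: "0 \<le> ww i / 2" "ww i / 2 < 1" "exp (\<eta> * (gp / 4) - ln (1 + g i) / 4) * (1 / sqrt (1 - ww i / 2)) \<le> 1"
      if "i \<in> U" for i
      using half_tilted_moment_le_1[OF gm g0(2,3)[OF that] e(1,5) \<eta>(1,4)] unfolding ww_def by auto
    have "Q2 w = exp (\<Sum>i\<in>U. \<eta> * (gp / 4) - ln (1 + g i) / 4) * exp (\<Sum>i\<in>U. ww i / 2 / 2 * (z i w)\<^sup>2)" for w
      unfolding Q2_def u_def exp_add[symmetric] sum.distrib[symmetric]
      by (intro arg_cong[of _ _ exp] sum.cong refl) (simp add: field_simps)
    then have "(\<integral>\<^sup>+w. ennreal (Q2 w) \<partial>P) = ennreal (exp (\<Sum>i\<in>U. \<eta> * (gp / 4) - ln (1 + g i) / 4)) *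
       (\<integral>\<^sup>+w. ennreal (exp (\<Sum>i\<in>U. ww i / 2 / 2 * (z i w)\<^sup>2)) \<partial>P)"
      by (subst nn_integral_cmult[symmetric]) (auto simp: ennreal_mult intro!: nn_integral_cong)
    also have "\<dots> \<le> ennreal (exp (\<Sum>i\<in>U. \<eta> * (gp / 4) - ln (1 + g i) / 4)) * ennreal (\<Prod>i\<in>U. 1 / sqrt (1 - ww i / 2))"
      by (intro mult_left_mono subgaussian_quadratic_mgf[OF P U(1) z]) (use H in auto)
    also have "\<dots> = ennreal (\<Prod>i\<in>U. exp (\<eta> * (gp / 4) - ln (1 + g i) / 4) * (1 / sqrt (1 - ww i / 2)))"
    proof (subst ennreal_mult[symmetric])
      show "0 \<le> (\<Prod>i\<in>U. 1 / sqrt (1 - ww i / 2))"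
        using H(2) by (intro prod_nonneg) (auto simp: less_imp_le)
      show "ennreal (exp (\<Sum>i\<in>U. \<eta> * (gp / 4) - ln (1 + g i) / 4) * (\<Prod>i\<in>U. 1 / sqrt (1 - ww i / 2)))
        = ennreal (\<Prod>i\<in>U. exp (\<eta> * (gp / 4) - ln (1 + g i) / 4) * (1 / sqrt (1 - ww i / 2)))"
        unfolding exp_sum[OF U(1)] prod.distrib[symmetric] ..
    qed simp
    also have "\<dots> \<le> ennreal 1"
    proof (intro ennreal_leI prod_le_1)
      fix i assume "i \<in> U"
      then show "0 \<le> exp (\<eta> * (gp / 4) - ln (1 + g i) / 4) * (1 / sqrt (1 - ww i / 2)) \<and>
        exp (\<eta> * (gp / 4) - ln (1 + g i) / 4) * (1 / sqrt (1 - ww i / 2)) \<le> 1"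
        using H[of i] by (auto simp: less_imp_le)
    qed
    finally show ?thesis by simp
  qed
  have EZ: "(\<integral>\<^sup>+w. ennreal (Z w) \<partial>P) \<le> ennreal (2 * ln (real n + 1) + 3)"
  proof -
    have lnN: "ln N = 2 * ln (real n + 1)" by (simp add: N_def ln_realpow)
    have "(\<integral>\<^sup>+w. ennreal (Z w) \<partial>P) = (\<integral>\<^sup>+w. ennreal (ln N) + ennreal (1 / N) * ennreal (Q1 w) + 2 * ennreal (Q2 w) \<partial>P)"
    proof (intro nn_integral_cong)
      fix w
      have "ennreal (1 / N) * ennreal (Q1 w) = ennreal (Q1 w / N)"
        using Q10[of w] N1 by (simp add: ennreal_mult'[symmetric])
      moreover have "2 * ennreal (Q2 w) = ennreal (2 * Q2 w)" by (simp add: ennreal_mult')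
      ultimately show "ennreal (Z w) = ennreal (ln N) + ennreal (1 / N) * ennreal (Q1 w) + 2 * ennreal (Q2 w)"
        unfolding Z_def using Q10[of w] Q20[of w] N1 by (simp add: ennreal_plus[symmetric] del: ennreal_plus)
    qed
    also have "\<dots> = ennreal (ln N) + ennreal (1 / N) * (\<integral>\<^sup>+w. ennreal (Q1 w) \<partial>P) + 2 * (\<integral>\<^sup>+w. ennreal (Q2 w) \<partial>P)"
      by (simp add: nn_integral_add nn_integral_cmult emeasure_space_1)
    also have "\<dots> \<le> ennreal (ln N) + ennreal (1 / N) * ennreal N + 2 * 1"
      by (intro add_mono mult_left_mono EQ1 EQ2) auto
    also have "\<dots> = ennreal (2 * ln (real n + 1) + 3)"
      using N1 by (simp add: lnN ennreal_mult[symmetric] ennreal_plus[symmetric] del: ennreal_plus)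
        (simp flip: ennreal_1 ennreal_plus ennreal_numeral)
    finally show ?thesis .
  qed
  have main: "(\<Sum>i\<in>S. u i w) \<le> ln (real (n choose card S)) + Z w" if S: "S \<subseteq> U" for S w
  proof -
    have finS: "finite S" using S U finite_subset by blast
    have cS: "card S \<le> n" unfolding n_def using S U by (simp add: card_mono)
    have ch: "1 \<le> real (n choose card S)" using cS by (simp add: Suc_leI)
    show ?thesis
    proof (cases "real (card S) \<le> (1 - \<eta>) * real n")
      case True
      define p where "p = real (card S) / real n"
      have kK: "card S \<in> K" using True cS by (simp add: K_def)
      have p: "0 \<le> p" "p < 1" "p \<le> R * (1 - p)"
      proof -
        have "p \<le> 1 - \<eta>" "0 \<le> p" using pK[OF kK] by (auto simp: p_def)
        then show "0 \<le> p" "p < 1" using \<eta> by auto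
        have "R * \<eta> \<le> R * (1 - p)" using \<open>p \<le> 1 - \<eta>\<close> e by (intro mult_left_mono) auto
        moreover have "R * \<eta> = 1 - \<eta>" using \<eta> by simp
        ultimately show "p \<le> R * (1 - p)" using \<open>p \<le> 1 - \<eta>\<close> by simp
      qed
      (* the trade of the exponent, with t the exponential of the single summand u i w *)
      have tb: "p * exp (u i w) \<le> (1 - p) + p * (\<beta> i * exp (a i / 2 * (z i w)\<^sup>2))" for i
      proof -
        have "a i = (1 + \<epsilon>) * ww i" unfolding ww_def a_def using e by (simp add: field_simps)
        then have "(1 + \<epsilon>) * u i w = - (1 + \<epsilon>) * (ln (1 + g i) / 2) + a i / 2 * (z i w)\<^sup>2"
          unfolding u_def by (simp add: field_simps)
        then have "exp (u i w) powr (1 + \<epsilon>) = exp (- (1 + \<epsilon>) * (ln (1 + g i) / 2)) * exp (a i / 2 * (z i w)\<^sup>2)"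
          by (simp only: powr_def exp_add[symmetric]) simp
        then show ?thesis using mixture_le_power[OF p, of "exp (u i w)" \<epsilon>] e by (simp add: \<beta>_def mult.assoc)
      qed
      have "exp (\<Sum>i\<in>S. u i w) * (p ^ card S * (1 - p) ^ (n - card S))
         = (\<Prod>i\<in>S. p * exp (u i w)) * (\<Prod>i\<in>U - S. 1 - p)"
        using finS S U by (simp add: exp_sum prod.distrib card_Diff_subset n_def)
      also have "\<dots> \<le> (\<Prod>i\<in>S. p * (\<beta> i * exp (a i / 2 * (z i w)\<^sup>2)) + (1 - p)) * (\<Prod>i\<in>U - S. p * (\<beta> i * exp (a i / 2 * (z i w)\<^sup>2)) + (1 - p))"
      proof (rule mult_mono)
        show "(\<Prod>i\<in>S. p * exp (u i w)) \<le> (\<Prod>i\<in>S. p * (\<beta> i * exp (a i / 2 * (z i w)\<^sup>2)) + (1 - p))"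
          using tb p by (intro prod_mono) (auto simp: add.commute)
        show "(\<Prod>i\<in>U - S. 1 - p) \<le> (\<Prod>i\<in>U - S. p * (\<beta> i * exp (a i / 2 * (z i w)\<^sup>2)) + (1 - p))"
          using b1 p by (intro prod_mono) auto
        show "0 \<le> (\<Prod>i\<in>S. p * (\<beta> i * exp (a i / 2 * (z i w)\<^sup>2)) + (1 - p))"
          using b1 p S by (intro prod_nonneg) (auto intro!: add_nonneg_nonneg mult_nonneg_nonneg)
      qed (use p in \<open>auto intro!: prod_nonneg\<close>)
      also have "\<dots> = F p w" unfolding F_def
        using U S by (subst mult.commute) (rule prod.subset_diff[symmetric], auto)
      finally have F: "exp (\<Sum>i\<in>S. u i w) * (p ^ card S * (1 - p) ^ (n - card S)) \<le> F p w" .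
      have "exp (\<Sum>i\<in>S. u i w) \<le> exp (\<Sum>i\<in>S. u i w) * ((real n + 1) * (real (n choose card S) * p ^ card S * (1 - p) ^ (n - card S)))"
        using binomial_mode_bound[OF cS n] by (simp add: p_def)
      also have "\<dots> = (real n + 1) * real (n choose card S) * (exp (\<Sum>i\<in>S. u i w) * (p ^ card S * (1 - p) ^ (n - card S)))"
        by (simp add: mult_ac)
      also have "\<dots> \<le> (real n + 1) * real (n choose card S) * F p w"
        using F by (intro mult_left_mono) auto
      also have "\<dots> = real (n choose card S) * ((real n + 1) * F p w)" by simp
      also have "\<dots> \<le> real (n choose card S) * Q1 w"
      proof (intro mult_left_mono)
        have "(real n + 1) * F (real (card S) / real n) w \<le> Q1 w"
          unfolding Q1_def by (rule member_le_sum[OF kK _ finK]) (use F0 pK in auto)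
        then show "(real n + 1) * F p w \<le> Q1 w" by (simp add: p_def)
      qed auto
      finally have le: "exp (\<Sum>i\<in>S. u i w) \<le> real (n choose card S) * Q1 w" .
      have Q1p: "0 < Q1 w"
        using le Q10[of w] exp_gt_zero[of "\<Sum>i\<in>S. u i w"] by (cases "Q1 w = 0") auto
      have "0 < real (n choose card S) * Q1 w" using Q1p ch by (intro mult_pos_pos) linarith+
      then have "(\<Sum>i\<in>S. u i w) \<le> ln (real (n choose card S) * Q1 w)"
        using le by (subst ln_ge_iff) auto
      also have "\<dots> = ln (real (n choose card S)) + ln (N * (Q1 w / N))"
      proof -
        have "real (n choose card S) \<noteq> 0" "Q1 w \<noteq> 0" using ch Q1p by linarith+
        moreover have "N * (Q1 w / N) = Q1 w" using N1 by simp
        ultimately show ?thesis by (simp add: ln_mult)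
      qed
      also have "ln (N * (Q1 w / N)) = ln N + ln (Q1 w / N)"
        using Q1p N1 by (subst ln_mult) auto
      also have "ln (Q1 w / N) \<le> Q1 w / N"
        using ln_le_minus_one[of "Q1 w / N"] Q1p N1 by simp
      finally show ?thesis using Q20[of w] by (simp add: Z_def)
    next
      case False
      have "(\<Sum>i\<in>U - S. - u i w) \<le> (\<Sum>i\<in>U - S. gp / 2)"
      proof (intro sum_mono)
        fix i assume "i \<in> U - S"
        then have i: "i \<in> U" by simp
        have "- u i w \<le> ln (1 + g i) / 2"
          using e shrinkage_bounds(1)[OF g0(1)[OF i]] by (simp add: u_def ww_def)
        also have "ln (1 + g i) \<le> g i" using g0(1)[OF i] by (intro ln_add_one_self_le_self) simp
        finally show "- u i w \<le> gp / 2" using g0(3)[OF i] by simp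
      qed
      also have "\<dots> = real (n - card S) * (gp / 2)" using finS S U by (simp add: card_Diff_subset n_def)
      also have "\<dots> \<le> (\<eta> * real n) * (gp / 2)"
        using False cS gp by (intro mult_right_mono) (auto simp: algebra_simps)
      finally have 1: "(\<Sum>i\<in>U - S. - u i w) \<le> \<eta> * real n * (gp / 2)" .
      have "(\<Sum>i\<in>S. u i w) = (\<Sum>i\<in>U. u i w) + (\<Sum>i\<in>U - S. - u i w)"
        using sum.subset_diff[OF S U(1), of "\<lambda>i. u i w"] by (simp add: sum_negf)
      also have "\<dots> \<le> (\<Sum>i\<in>U. u i w) + \<eta> * real n * (gp / 2)" using 1 by simp
      also have "\<dots> = 2 * (\<Sum>i\<in>U. \<eta> * (gp / 4) + u i w / 2)"
        by (simp add: sum.distrib sum_divide_distrib[symmetric] n_def[symmetric] algebra_simps)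
      also have "\<dots> \<le> 2 * Q2 w"
        unfolding Q2_def using exp_ge_add_one_self[of "\<Sum>i\<in>U. \<eta> * (gp / 4) + u i w / 2"] by linarith
      finally show ?thesis using ch Q10[of w] N1 by (simp add: Z_def add_increasing)
    qed
  qed
  show ?thesis
    unfolding n_def[symmetric]
    using Zm EZ main Q10 Q20 N1 unfolding u_def ww_def by (intro exI[of _ Z]) (auto simp: Z_def)
qed

section \<open>Risk of a penalized maximizer\<close>
text \<open>A deterministic comparison. Common coordinates of \<open>S\<close> and \<open>A\<close> cancel in the optimality inequality. On \<open>S - A\<close>
the gain is split by Young's inequality into noise and bias. Since the noise bound has the inflated factor
\<open>(1 + 2 * \<epsilon>) / (1 + \<epsilon>)\<close> and Young's inequality with \<open>\<delta>\<close> uses only half of it, a multiple \<open>\<eta>\<close> of the noise energy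
stays on the left. On \<open>A - S\<close> the gain forgone bounds the missed signal.\<close>

lemma maximizer_vs_competitor:
  fixes \<mu> z w \<l> :: "'i \<Rightarrow> real"
  assumes U: "finite U" "S \<subseteq> U" "A \<subseteq> U"
    and w: "0 < wm" "\<And>i. i \<in> U \<Longrightarrow> wm \<le> w i \<and> w i \<le> 1"
    and \<l>: "\<And>i. i \<in> U \<Longrightarrow> 0 \<le> \<l> i \<and> \<l> i \<le> Lp"
    and e: "0 < \<epsilon>"
    and opt: "(\<Sum>i\<in>A. w i / 2 * (\<mu> i + z i)\<^sup>2 - \<l> i) - pA \<le> (\<Sum>i\<in>S. w i / 2 * (\<mu> i + z i)\<^sup>2 - \<l> i) - pS"
    and noise: "(\<Sum>i\<in>S. w i * ((1 + 2 * \<epsilon>) / (1 + \<epsilon>)) / 2 * (z i)\<^sup>2 - \<l> i) \<le> pS + Z"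
  defines "\<eta> \<equiv> wm * \<epsilon> / (4 * (1 + \<epsilon>))" and "\<delta> \<equiv> \<epsilon> / (2 * (1 + \<epsilon>))"
  shows "(\<Sum>i\<in>S. (z i)\<^sup>2) + (\<Sum>i\<in>U - S. (\<mu> i)\<^sup>2) \<le> 3 * (\<Sum>i\<in>A. (z i)\<^sup>2) + (\<Sum>i\<in>U - A. (\<mu> i)\<^sup>2)
     + (1 / \<eta> + 4 / wm) * (2 * Lp * real (card A) + pA + (1 + 1 / \<delta>) / 2 * (\<Sum>i\<in>U - A. (\<mu> i)\<^sup>2) + Z)"
proof -
  define K where "K = 2 * Lp * real (card A) + pA + (1 + 1 / \<delta>) / 2 * (\<Sum>i\<in>U - A. (\<mu> i)\<^sup>2) + Z"
  have fin: "finite S" "finite A" using U finite_subset by auto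
  have \<eta>: "0 < \<eta>" and \<delta>: "0 < \<delta>" using w e by (auto simp: \<eta>_def \<delta>_def)
  define q where "q i = w i / 2 * (\<mu> i + z i)\<^sup>2 - \<l> i" for i
  define u where "u i = w i * ((1 + 2 * \<epsilon>) / (1 + \<epsilon>)) / 2 * (z i)\<^sup>2 - \<l> i" for i
  have split: "sum h T = sum h (T \<inter> T') + sum h (T - T')" if "finite T" for h :: "'i \<Rightarrow> real" and T T'
    using sum.Int_Diff[OF that] .
  have "sum q (A - S) - pA \<le> sum q (S - A) - pS"
    using opt split[OF fin(1), of q A] split[OF fin(2), of q S] unfolding q_def[symmetric] by (simp add: Int_commute)
  moreover have "sum q (A - S) = (\<Sum>i\<in>A - S. w i / 2 * (\<mu> i + z i)\<^sup>2) - sum \<l> (A - S)"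
    by (simp add: q_def sum_subtractf)
  moreover have "sum \<l> (A - S) \<le> Lp * real (card A)"
  proof -
    have "sum \<l> (A - S) \<le> sum \<l> A" using fin U \<l> by (intro sum_mono2) auto
    also have "\<dots> \<le> (\<Sum>i\<in>A. Lp)" using U \<l> by (intro sum_mono) auto
    finally show ?thesis by (simp add: mult.commute)
  qed
  moreover have "sum q (S - A) \<le> (\<Sum>i\<in>S - A. u i - \<eta> * (z i)\<^sup>2 + (1 + 1 / \<delta>) / 2 * (\<mu> i)\<^sup>2)"
  proof (intro sum_mono)
    fix i assume "i \<in> S - A"
    then have i: "i \<in> U" using U by auto
    have wi: "0 < w i" "w i \<le> 1" "wm \<le> w i" using w(2)[OF i] w(1) by auto
    (* delta is half of eps / (1 + eps), so (1 + delta) stays below the inflation factor of the noise bound *)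
    have young: "(\<mu> i + z i)\<^sup>2 \<le> (1 + \<delta>) * (z i)\<^sup>2 + (1 + 1 / \<delta>) * (\<mu> i)\<^sup>2"
    proof -
      have "0 \<le> (\<delta> * z i - \<mu> i)\<^sup>2 / \<delta>" using \<delta> by simp
      also have "\<dots> = \<delta> * (z i)\<^sup>2 + (\<mu> i)\<^sup>2 / \<delta> - 2 * (\<mu> i * z i)"
        using \<delta> by (simp add: power2_eq_square field_simps)
      finally show ?thesis by (simp add: power2_eq_square algebra_simps)
    qed
    have "w i / 2 * (\<mu> i + z i)\<^sup>2 \<le> w i / 2 * ((1 + \<delta>) * (z i)\<^sup>2 + (1 + 1 / \<delta>) * (\<mu> i)\<^sup>2)"
      using young wi by (intro mult_left_mono) auto
    also have "\<dots> = w i * (1 + \<delta>) / 2 * (z i)\<^sup>2 + w i * ((1 + 1 / \<delta>) / 2 * (\<mu> i)\<^sup>2)"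
      by (simp add: algebra_simps add_divide_distrib)
    also have "w i * ((1 + 1 / \<delta>) / 2 * (\<mu> i)\<^sup>2) \<le> 1 * ((1 + 1 / \<delta>) / 2 * (\<mu> i)\<^sup>2)"
      using wi \<delta> by (intro mult_right_mono mult_nonneg_nonneg) auto
    also have "w i * (1 + \<delta>) / 2 * (z i)\<^sup>2 \<le> (w i * ((1 + 2 * \<epsilon>) / (1 + \<epsilon>)) / 2 - \<eta>) * (z i)\<^sup>2"
    proof (intro mult_right_mono)
      define k where "k = \<epsilon> / (1 + \<epsilon>)"
      have k: "(1 + 2 * \<epsilon>) / (1 + \<epsilon>) = 1 + k" "\<delta> = k / 2" "w i * \<epsilon> / (4 * (1 + \<epsilon>)) = w i * k / 4"
        using e by (auto simp: k_def \<delta>_def field_simps)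
      have "w i * ((1 + 2 * \<epsilon>) / (1 + \<epsilon>)) / 2 - w i * (1 + \<delta>) / 2 = w i * \<epsilon> / (4 * (1 + \<epsilon>))"
        unfolding k by (simp add: field_simps)
      moreover have "\<eta> \<le> w i * \<epsilon> / (4 * (1 + \<epsilon>))"
        unfolding \<eta>_def using wi e by (intro divide_right_mono mult_right_mono) auto
      ultimately show "w i * (1 + \<delta>) / 2 \<le> w i * ((1 + 2 * \<epsilon>) / (1 + \<epsilon>)) / 2 - \<eta>" by linarith
    qed simp
    finally show "q i \<le> u i - \<eta> * (z i)\<^sup>2 + (1 + 1 / \<delta>) / 2 * (\<mu> i)\<^sup>2"
      by (simp add: q_def u_def left_diff_distrib)
  qed
  moreover have "(\<Sum>i\<in>S - A. u i - \<eta> * (z i)\<^sup>2 + (1 + 1 / \<delta>) / 2 * (\<mu> i)\<^sup>2)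
      = sum u (S - A) - \<eta> * (\<Sum>i\<in>S - A. (z i)\<^sup>2) + (1 + 1 / \<delta>) / 2 * (\<Sum>i\<in>S - A. (\<mu> i)\<^sup>2)"
    by (simp add: sum.distrib sum_subtractf sum_distrib_left)
  moreover have "(1 + 1 / \<delta>) / 2 * (\<Sum>i\<in>S - A. (\<mu> i)\<^sup>2) \<le> (1 + 1 / \<delta>) / 2 * (\<Sum>i\<in>U - A. (\<mu> i)\<^sup>2)"
    using U \<delta> by (intro mult_left_mono sum_mono2) auto
  (* removing the common part of S and A from the noise bound costs at most Lp per coordinate of A *)
  moreover have "sum u (S - A) \<le> pS + Z + Lp * real (card A)"
  proof -
    have "- sum u (S \<inter> A) \<le> (\<Sum>i\<in>S \<inter> A. Lp)"
      unfolding sum_negf[symmetric]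
    proof (intro sum_mono)
      fix i assume "i \<in> S \<inter> A"
      then have i: "i \<in> U" using U by auto
      have "0 \<le> w i * ((1 + 2 * \<epsilon>) / (1 + \<epsilon>)) / 2 * (z i)\<^sup>2"
        using w(1) w(2)[OF i] e by (intro mult_nonneg_nonneg divide_nonneg_nonneg) auto
      then show "- u i \<le> Lp" using \<l>[OF i] by (simp add: u_def)
    qed
    also have "\<dots> \<le> Lp * real (card A)"
    proof -
      have "real (card (S \<inter> A)) \<le> real (card A)" using fin by (simp add: card_mono)
      moreover have "0 \<le> Lp \<or> S \<inter> A = {}" using \<l> U by fastforce
      moreover have "0 \<le> Lp \<or> A = {}" using \<l> U by fastforce
      ultimately show ?thesis by (auto simp: mult.commute intro: mult_left_mono)
    qed
    finally have "- sum u (S \<inter> A) \<le> Lp * real (card A)" .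
    moreover have "sum u S \<le> pS + Z" using noise by (simp add: u_def)
    ultimately show ?thesis using split[OF fin(1), of u A] by linarith
  qed
  ultimately have key: "(\<Sum>i\<in>A - S. w i / 2 * (\<mu> i + z i)\<^sup>2) + \<eta> * (\<Sum>i\<in>S - A. (z i)\<^sup>2) \<le> K"
    unfolding K_def by linarith
  have pos1: "0 \<le> (\<Sum>i\<in>A - S. w i / 2 * (\<mu> i + z i)\<^sup>2)"
    using w U by (intro sum_nonneg mult_nonneg_nonneg) force+
  have pos2: "0 \<le> \<eta> * (\<Sum>i\<in>S - A. (z i)\<^sup>2)" using \<eta> by (intro mult_nonneg_nonneg sum_nonneg) auto
  have z1: "(\<Sum>i\<in>S. (z i)\<^sup>2) \<le> (\<Sum>i\<in>A. (z i)\<^sup>2) + 1 / \<eta> * K"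
  proof -
    have "(\<Sum>i\<in>S - A. (z i)\<^sup>2) \<le> 1 / \<eta> * K" using key pos1 \<eta> by (simp add: field_simps)
    moreover have "(\<Sum>i\<in>S \<inter> A. (z i)\<^sup>2) \<le> (\<Sum>i\<in>A. (z i)\<^sup>2)" using fin by (intro sum_mono2) auto
    ultimately show ?thesis using split[OF fin(1), of "\<lambda>i. (z i)\<^sup>2" A] by linarith
  qed
  have m1: "(\<Sum>i\<in>U - S. (\<mu> i)\<^sup>2) \<le> (\<Sum>i\<in>U - A. (\<mu> i)\<^sup>2) + 2 * (\<Sum>i\<in>A. (z i)\<^sup>2) + 4 / wm * K"
  proof -
    have "(\<Sum>i\<in>U - S. (\<mu> i)\<^sup>2) \<le> (\<Sum>i\<in>(U - A) \<union> (A - S). (\<mu> i)\<^sup>2)"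
      using U fin by (intro sum_mono2) auto
    also have "\<dots> = (\<Sum>i\<in>U - A. (\<mu> i)\<^sup>2) + (\<Sum>i\<in>A - S. (\<mu> i)\<^sup>2)"
      using U fin by (intro sum.union_disjoint) auto
    also have "(\<Sum>i\<in>A - S. (\<mu> i)\<^sup>2) \<le> (\<Sum>i\<in>A - S. 2 * (z i)\<^sup>2 + 4 / wm * (w i / 2 * (\<mu> i + z i)\<^sup>2))"
    proof (intro sum_mono)
      fix i assume "i \<in> A - S"
      then have i: "i \<in> U" using U by auto
      have "(\<mu> i)\<^sup>2 \<le> 2 * (z i)\<^sup>2 + 2 * (\<mu> i + z i)\<^sup>2"
        using zero_le_power2[of "\<mu> i + 2 * z i"] by (simp add: power2_eq_square algebra_simps)
      also have "2 * (\<mu> i + z i)\<^sup>2 \<le> (2 * (w i / wm)) * (\<mu> i + z i)\<^sup>2"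
      proof (intro mult_right_mono)
        have "1 \<le> w i / wm" using w(1) w(2)[OF i] by (simp add: le_divide_eq)
        then show "2 \<le> 2 * (w i / wm)" by linarith
      qed simp
      finally show "(\<mu> i)\<^sup>2 \<le> 2 * (z i)\<^sup>2 + 4 / wm * (w i / 2 * (\<mu> i + z i)\<^sup>2)" by simp
    qed
    also have "\<dots> = 2 * (\<Sum>i\<in>A - S. (z i)\<^sup>2) + 4 / wm * (\<Sum>i\<in>A - S. w i / 2 * (\<mu> i + z i)\<^sup>2)"
      by (simp add: sum.distrib sum_distrib_left)
    also have "\<dots> \<le> 2 * (\<Sum>i\<in>A. (z i)\<^sup>2) + 4 / wm * K"
    proof (intro add_mono mult_left_mono)
      show "(\<Sum>i\<in>A - S. w i / 2 * (\<mu> i + z i)\<^sup>2) \<le> K" using key pos2 by linarith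
      show "(\<Sum>i\<in>A - S. (z i)\<^sup>2) \<le> (\<Sum>i\<in>A. (z i)\<^sup>2)" using fin by (intro sum_mono2) auto
    qed (use w in auto)
    finally show ?thesis by simp
  qed
  show ?thesis using z1 m1 unfolding K_def[symmetric] by (simp add: distrib_right)
qed

lemma subgaussian_second_moment:
  assumes "prob_space P" "finite U" "std_subgaussian P U z" "i \<in> U"
  shows "(\<integral>\<^sup>+w. ennreal ((z i w)\<^sup>2) \<partial>P) \<le> 6"
proof -
  have [measurable]: "z i \<in> borel_measurable P" using assms by (auto simp: std_subgaussian_def)
  have "(\<integral>\<^sup>+w. ennreal ((z i w)\<^sup>2) \<partial>P) \<le> (\<integral>\<^sup>+w. 4 * ennreal (exp (\<Sum>i\<in>{i}. (1/2) / 2 * (z i w)\<^sup>2)) \<partial>P)"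
  proof (intro nn_integral_mono)
    fix w
    have "1 + (z i w)\<^sup>2 / 4 \<le> exp ((z i w)\<^sup>2 / 4)" by (rule exp_ge_add_one_self)
    then have "(z i w)\<^sup>2 \<le> 4 * exp ((z i w)\<^sup>2 / 4)" by linarith
    also have "(z i w)\<^sup>2 / 4 = (1/2) / 2 * (z i w)\<^sup>2" by simp
    finally have "(z i w)\<^sup>2 \<le> 4 * exp ((1/2) / 2 * (z i w)\<^sup>2)" .
    then have "ennreal ((z i w)\<^sup>2) \<le> ennreal (4 * exp ((1/2) / 2 * (z i w)\<^sup>2))" by (rule ennreal_leI)
    then show "ennreal ((z i w)\<^sup>2) \<le> 4 * ennreal (exp (\<Sum>i\<in>{i}. (1/2) / 2 * (z i w)\<^sup>2))"
      by (simp add: ennreal_mult)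
  qed
  also have "\<dots> = 4 * (\<integral>\<^sup>+w. ennreal (exp (\<Sum>i\<in>{i}. (1/2) / 2 * (z i w)\<^sup>2)) \<partial>P)"
    by (rule nn_integral_cmult) simp
  also have "\<dots> \<le> 4 * ennreal (\<Prod>i\<in>{i}. 1 / sqrt (1 - 1 / 2))"
    by (intro mult_left_mono subgaussian_quadratic_mgf[OF assms(1,2,3)]) (use assms in auto)
  also have "\<dots> = ennreal (4 * (1 / sqrt (1 - 1 / 2)))" by (subst ennreal_mult) auto
  also have "\<dots> \<le> ennreal 6"
  proof (intro ennreal_leI)
    have "sqrt 2 \<le> 3 / 2" by (rule real_le_lsqrt) (auto simp: power2_eq_square)
    then show "4 * (1 / sqrt (1 - 1 / 2)) \<le> (6::real)" by (simp add: real_sqrt_divide)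
  qed
  finally show ?thesis by simp
qed

text \<open>The order of choice matters: \<open>\<eta>\<close> from the slack of the half exponent, then \<open>R\<close> as the bound on the odds of
a selection that leaves out the fraction \<open>\<eta>\<close>, then \<open>\<epsilon>\<close> small relative to \<open>R\<close>.\<close>

lemma selection_constants_exist:
  assumes "0 < gm" "gm \<le> (gp::real)"
  obtains \<epsilon> R \<eta> :: real where "0 < \<epsilon>" "0 < R" "\<epsilon> * R \<le> exp (- 2 * gp)" "4 * gp * \<epsilon> \<le> 1" "8 * \<epsilon> \<le> shrinkage gm"
    "0 < \<eta>" "\<eta> < 1" "R = (1 - \<eta>) / \<eta>" "exp (\<eta> * gp) \<le> 1 + (shrinkage gm)\<^sup>2 / 8"
proof -
  define v where "v = shrinkage gm"
  have v: "0 < v" "v < 1" using shrinkage_bounds[OF assms(1)] by (auto simp: v_def)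
  have vg: "v \<le> gm" unfolding v_def shrinkage_def using assms by (simp add: field_simps)
  have gp: "0 < gp" using assms by simp
  define \<eta> where "\<eta> = ln (1 + v\<^sup>2 / 8) / gp"
  define R where "R = (1 - \<eta>) / \<eta>"
  define \<epsilon> where "\<epsilon> = min (exp (- 2 * gp) / R) (min (1 / (4 * gp)) (v / 8))"
  have \<eta>: "0 < \<eta>" using v gp unfolding \<eta>_def by (intro divide_pos_pos ln_gt_zero) auto
  have "ln (1 + v\<^sup>2 / 8) \<le> v\<^sup>2 / 8" by (intro ln_add_one_self_le_self) simp
  also have "v\<^sup>2 / 8 < gp"
  proof -
    have "v * v \<le> v * 1" using v by (intro mult_left_mono) auto
    then show ?thesis using v vg assms unfolding power2_eq_square by linarith
  qed
  finally have \<eta>1: "\<eta> < 1" using gp by (simp add: \<eta>_def)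
  have R: "0 < R" using \<eta> \<eta>1 by (simp add: R_def)
  have "exp (\<eta> * gp) \<le> 1 + v\<^sup>2 / 8" using gp by (simp add: \<eta>_def add_pos_nonneg)
  moreover have "0 < \<epsilon>" using R v gp by (simp add: \<epsilon>_def)
  moreover have "\<epsilon> * R \<le> exp (- 2 * gp)"
  proof -
    have "\<epsilon> \<le> exp (- 2 * gp) / R" by (simp add: \<epsilon>_def)
    then show ?thesis using R by (simp add: pos_le_divide_eq)
  qed
  moreover have "4 * gp * \<epsilon> \<le> 1"
  proof -
    have "\<epsilon> \<le> 1 / (4 * gp)" by (simp add: \<epsilon>_def)
    then show ?thesis using gp by (simp add: pos_le_divide_eq mult_ac)
  qed
  moreover have "8 * \<epsilon> \<le> v" by (simp add: \<epsilon>_def)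
  ultimately show ?thesis using that[of \<epsilon> R \<eta>] R \<eta> \<eta>1 by (simp add: R_def v_def)
qed

text \<open>The selection \<open>S\<close> is an arbitrary function of the outcome, and the sums over it are not claimed to be
measurable. The risk is therefore stated through a measurable majorant \<open>X\<close>, for which integrals are additive.\<close>

theorem penalized_selection_risk:
  assumes gm: "0 < gm" "gm \<le> gp"
  shows "\<exists>C>0. \<forall>(P :: 'w measure) (U :: 'i set) z \<mu> g A pA S pS.
     prob_space P \<longrightarrow> finite U \<longrightarrow> U \<noteq> {} \<longrightarrow> std_subgaussian P U z \<longrightarrow> (\<forall>i\<in>U. gm \<le> g i \<and> g i \<le> gp) \<longrightarrow>
     A \<subseteq> U \<longrightarrow> 0 \<le> pA \<longrightarrow>
     (\<forall>w. S w \<subseteq> U \<and> ln (real (card U choose card (S w))) \<le> pS w \<and>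
        (\<Sum>i\<in>A. shrinkage (g i) / 2 * (\<mu> i + z i w)\<^sup>2 - ln (1 + g i) / 2) - pA
          \<le> (\<Sum>i\<in>S w. shrinkage (g i) / 2 * (\<mu> i + z i w)\<^sup>2 - ln (1 + g i) / 2) - pS w) \<longrightarrow>
     (\<exists>X \<in> borel_measurable P. (\<forall>w. 0 \<le> X w \<and> (\<Sum>i\<in>S w. (z i w)\<^sup>2) + (\<Sum>i\<in>U - S w. (\<mu> i)\<^sup>2) \<le> X w) \<and>
       (\<integral>\<^sup>+w. ennreal (X w) \<partial>P)
         \<le> ennreal (C * ((\<Sum>i\<in>U - A. (\<mu> i)\<^sup>2) + real (card A) + pA + ln (real (card U) + 1) + 1)))"
proof -
  obtain \<epsilon> R \<eta> where c: "0 < \<epsilon>" "0 < R" "\<epsilon> * R \<le> exp (- 2 * gp)" "4 * gp * \<epsilon> \<le> 1" "8 * \<epsilon> \<le> shrinkage gm"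
    "0 < \<eta>" "\<eta> < 1" "R = (1 - \<eta>) / \<eta>" "exp (\<eta> * gp) \<le> 1 + (shrinkage gm)\<^sup>2 / 8"
    using selection_constants_exist[OF gm] by metis
  define wm where "wm = shrinkage gm"
  have wm: "0 < wm" using shrinkage_bounds[OF gm(1)] by (simp add: wm_def)
  define \<eta>' where "\<eta>' = wm * \<epsilon> / (4 * (1 + \<epsilon>))"
  define \<delta> where "\<delta> = \<epsilon> / (2 * (1 + \<epsilon>))"
  define B where "B = 1 / \<eta>' + 4 / wm"
  define C where "C = 18 + 1 + B * (gp + 1 + (1 + 1 / \<delta>) / 2 + 3)"
  have pos: "0 < \<eta>'" "0 < \<delta>" "0 < B" using wm c by (auto simp: \<eta>'_def \<delta>_def B_def intro!: add_pos_pos divide_pos_pos)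
  have C: "0 < C" unfolding C_def using pos gm by (intro add_pos_pos mult_pos_pos divide_pos_pos) auto
  show ?thesis
  proof (intro exI[of _ C] conjI C allI impI)
    fix P :: "'w measure" and U :: "'i set" and z \<mu> g A pA S pS
    assume P: "prob_space P" and U: "finite U" "U \<noteq> {}" and z: "std_subgaussian P U z"
      and g: "\<forall>i\<in>U. gm \<le> g i \<and> g i \<le> gp" and A: "A \<subseteq> U" and pA: "0 \<le> pA"
      and S: "\<forall>w. S w \<subseteq> U \<and> ln (real (card U choose card (S w))) \<le> pS w \<and>
        (\<Sum>i\<in>A. shrinkage (g i) / 2 * (\<mu> i + z i w)\<^sup>2 - ln (1 + g i) / 2) - pA
          \<le> (\<Sum>i\<in>S w. shrinkage (g i) / 2 * (\<mu> i + z i w)\<^sup>2 - ln (1 + g i) / 2) - pS w"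
    interpret prob_space P by fact
    have zm[measurable]: "z i \<in> borel_measurable P" if "i \<in> U" for i
      using z that by (auto simp: std_subgaussian_def)
    have zmA[measurable]: "z i \<in> borel_measurable P" if "i \<in> A" for i
      by (rule zm[OF subsetD[OF A that]])
    have gU: "gm \<le> g i \<and> g i \<le> gp" if "i \<in> U" for i using g that by blast
    obtain Z where Z: "Z \<in> borel_measurable P" "\<And>w. 0 \<le> Z w"
        "(\<integral>\<^sup>+w. ennreal (Z w) \<partial>P) \<le> ennreal (2 * ln (real (card U) + 1) + 3)"
        "\<And>w S. S \<subseteq> U \<Longrightarrow> (\<Sum>i\<in>S. shrinkage (g i) * ((1 + 2 * \<epsilon>) / (1 + \<epsilon>)) / 2 * (z i w)\<^sup>2 - ln (1 + g i) / 2)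
        \<le> ln (real (card U choose card S)) + Z w"
      using selection_noise_bound[where g=g, OF P U z gm(1) _ c] gU by blast
    note Z(1)[measurable]
    have sg: "wm \<le> shrinkage (g i) \<and> shrinkage (g i) \<le> 1" if "i \<in> U" for i
    proof -
      have gi: "gm \<le> g i" "0 < g i" using g that gm by force+
      show ?thesis using shrinkage_mono[OF gm(1) gi(1)] shrinkage_bounds[OF gi(2)] by (simp add: wm_def)
    qed
    have lg: "0 \<le> ln (1 + g i) / 2 \<and> ln (1 + g i) / 2 \<le> gp / 2" if "i \<in> U" for i
    proof -
      have gi: "0 \<le> g i" "g i \<le> gp" using g that gm by force+
      show ?thesis using ln_add_one_self_le_self[OF gi(1)] gi by auto
    qed
    define M where "M = (\<Sum>i\<in>U - A. (\<mu> i)\<^sup>2)"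
    define D where "D = M + B * (gp * real (card A) + pA + (1 + 1 / \<delta>) / 2 * M)"
    have M0: "0 \<le> M" unfolding M_def by (intro sum_nonneg) auto
    have D0: "0 \<le> D" unfolding D_def using M0 pos pA gm by (intro add_nonneg_nonneg mult_nonneg_nonneg) auto
    define X where "X w = 3 * (\<Sum>i\<in>A. (z i w)\<^sup>2) + D + B * Z w" for w
    have Xm: "X \<in> borel_measurable P" unfolding X_def by measurable
    have X0: "0 \<le> X w" for w
      unfolding X_def using D0 pos Z(2)[of w] by (intro add_nonneg_nonneg mult_nonneg_nonneg sum_nonneg) auto
    have maj: "(\<Sum>i\<in>S w. (z i w)\<^sup>2) + (\<Sum>i\<in>U - S w. (\<mu> i)\<^sup>2) \<le> X w" for w
    proof -
      have "(\<Sum>i\<in>S w. shrinkage (g i) * ((1 + 2 * \<epsilon>) / (1 + \<epsilon>)) / 2 * (z i w)\<^sup>2 - ln (1 + g i) / 2) \<le> pS w + Z w"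
        using order_trans[OF Z(4)[of "S w" w] add_right_mono] S by blast
      then have "(\<Sum>i\<in>S w. (z i w)\<^sup>2) + (\<Sum>i\<in>U - S w. (\<mu> i)\<^sup>2) \<le> 3 * (\<Sum>i\<in>A. (z i w)\<^sup>2) + M
         + B * (2 * (gp / 2) * real (card A) + pA + (1 + 1 / \<delta>) / 2 * M + Z w)"
        using maximizer_vs_competitor[OF U(1) conjunct1[OF spec[OF S]] A wm _ _ c(1), where w="\<lambda>i. shrinkage (g i)" and \<l>="\<lambda>i. ln (1 + g i) / 2" and Lp="gp / 2" and \<mu>=\<mu> and z="\<lambda>i. z i w" and pA=pA and pS="pS w" and Z="Z w"] S sg lg
        unfolding M_def B_def \<eta>'_def \<delta>_def by blast
      also have "\<dots> = 3 * (\<Sum>i\<in>A. (z i w)\<^sup>2) + D + B * Z w"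
        by (simp add: D_def algebra_simps)
      finally show ?thesis by (simp add: X_def)
    qed
    have "(\<integral>\<^sup>+w. ennreal (X w) \<partial>P) = (\<integral>\<^sup>+w. 3 * (\<Sum>i\<in>A. ennreal ((z i w)\<^sup>2)) + ennreal D + ennreal B * ennreal (Z w) \<partial>P)"
      unfolding X_def using D0 pos Z(2) by (intro nn_integral_cong) (simp add: ennreal_mult sum_nonneg)
    also have "\<dots> = 3 * (\<Sum>i\<in>A. \<integral>\<^sup>+w. ennreal ((z i w)\<^sup>2) \<partial>P) + ennreal D + ennreal B * (\<integral>\<^sup>+w. ennreal (Z w) \<partial>P)"
      by (simp add: nn_integral_add nn_integral_cmult nn_integral_sum emeasure_space_1 del: sum_ennreal)
    also have "\<dots> \<le> 3 * (\<Sum>i\<in>A. 6) + ennreal D + ennreal B * ennreal (2 * ln (real (card U) + 1) + 3)"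
      by (intro add_mono mult_left_mono sum_mono Z(3) subgaussian_second_moment[OF P U(1) z]) (use A in auto)
    also have "\<dots> = ennreal (18 * real (card A) + D + B * (2 * ln (real (card U) + 1) + 3))"
    proof -
      have "3 * (\<Sum>i\<in>A. (6::ennreal)) = ennreal (18 * real (card A))"
        by (simp add: ennreal_mult ennreal_of_nat_eq_real_of_nat mult.commute flip: ennreal_numeral)
          (simp add: ennreal_mult[symmetric] flip: ennreal_numeral)
      then show ?thesis using D0 pos by (simp add: ennreal_mult)
    qed
    also have "\<dots> \<le> ennreal (C * (M + real (card A) + pA + ln (real (card U) + 1) + 1))"
    proof (intro ennreal_leI)
      define l where "l = ln (real (card U) + 1)"
      have l0: "0 \<le> l" by (simp add: l_def)
      define T where "T = M + real (card A) + pA + l + 1"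
      have T: "M \<le> T" "real (card A) \<le> T" "pA \<le> T" "l + 1 \<le> T" using M0 pA l0 by (auto simp: T_def)
      have "gp * real (card A) + pA + (1 + 1 / \<delta>) / 2 * M + (2 * l + 3) \<le> gp * T + 1 * T + (1 + 1 / \<delta>) / 2 * T + 3 * T"
        using T gm pos l0 by (intro add_mono mult_left_mono) auto
      also have "\<dots> = (gp + 1 + (1 + 1 / \<delta>) / 2 + 3) * T" by (simp add: algebra_simps)
      finally have "B * (gp * real (card A) + pA + (1 + 1 / \<delta>) / 2 * M + (2 * l + 3)) \<le> B * ((gp + 1 + (1 + 1 / \<delta>) / 2 + 3) * T)"
        using pos by (intro mult_left_mono) auto
      moreover have "18 * real (card A) + M \<le> (18 + 1) * T" using T by simp
      ultimately have "18 * real (card A) + M + B * (gp * real (card A) + pA + (1 + 1 / \<delta>) / 2 * M + (2 * l + 3)) \<le> C * T"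
        unfolding C_def by (simp only: distrib_right mult.assoc)
      then show "18 * real (card A) + D + B * (2 * ln (real (card U) + 1) + 3) \<le> C * (M + real (card A) + pA + ln (real (card U) + 1) + 1)"
        unfolding D_def T_def l_def by (simp add: distrib_left)
    qed
    finally have EX: "(\<integral>\<^sup>+w. ennreal (X w) \<partial>P) \<le> ennreal (C * (M + real (card A) + pA + ln (real (card U) + 1) + 1))" .
    show "\<exists>X \<in> borel_measurable P. (\<forall>w. 0 \<le> X w \<and> (\<Sum>i\<in>S w. (z i w)\<^sup>2) + (\<Sum>i\<in>U - S w. (\<mu> i)\<^sup>2) \<le> X w) \<and>
       (\<integral>\<^sup>+w. ennreal (X w) \<partial>P)
         \<le> ennreal (C * ((\<Sum>i\<in>U - A. (\<mu> i)\<^sup>2) + real (card A) + pA + ln (real (card U) + 1) + 1))"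
      using Xm X0 maj EX unfolding M_def by blast
  qed
qed

section \<open>Square-integrable functions on the unit interval\<close>
text \<open>Functions on the unit interval are extended by zero, so that Lebesgue integrals over the whole line can be used.\<close>

definition cut01 :: "(real \<Rightarrow> real) \<Rightarrow> real \<Rightarrow> real" where
  "cut01 f x = indicator {0..1} x * f x"

definition sq_int :: "(real \<Rightarrow> real) \<Rightarrow> bool" where
  "sq_int u \<longleftrightarrow> u \<in> borel_measurable lborel \<and> integrable lborel (\<lambda>x. (u x)\<^sup>2)"

lemma sq_intD [measurable_dest]: "sq_int u \<Longrightarrow> u \<in> borel_measurable lborel"
  by (simp add: sq_int_def)

lemma sq_int_integrable: "sq_int u \<Longrightarrow> integrable lborel (\<lambda>x. (u x)\<^sup>2)"
  by (simp add: sq_int_def)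

lemma sq_int_mult:
  assumes "sq_int u" "sq_int v"
  shows "integrable lborel (\<lambda>x. u x * v x)"
proof (rule Bochner_Integration.integrable_bound)
  show "integrable lborel (\<lambda>x. (u x)\<^sup>2 + (v x)\<^sup>2)" using assms by (auto simp: sq_int_def)
  show "(\<lambda>x. u x * v x) \<in> borel_measurable lborel" using assms by (auto simp: sq_int_def)
  have "\<bar>u x * v x\<bar> \<le> (u x)\<^sup>2 + (v x)\<^sup>2" for x
  proof -
    have "2 * (\<bar>u x\<bar> * \<bar>v x\<bar>) \<le> (u x)\<^sup>2 + (v x)\<^sup>2"
      using zero_le_power2[of "\<bar>u x\<bar> - \<bar>v x\<bar>"] by (simp add: power2_eq_square algebra_simps)
    then show ?thesis by (simp add: abs_mult) (use mult_nonneg_nonneg[of "\<bar>u x\<bar>" "\<bar>v x\<bar>"] in linarith)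
  qed
  then show "AE x in lborel. norm (u x * v x) \<le> norm ((u x)\<^sup>2 + (v x)\<^sup>2)" by simp
qed

lemma sq_int_add:
  assumes "sq_int u" "sq_int v" shows "sq_int (\<lambda>x. u x + v x)"
proof -
  have "integrable lborel (\<lambda>x. (u x)\<^sup>2 + (v x)\<^sup>2 + 2 * (u x * v x))"
    using assms sq_int_mult[OF assms] by (auto simp: sq_int_def)
  moreover have "(u x + v x)\<^sup>2 = (u x)\<^sup>2 + (v x)\<^sup>2 + 2 * (u x * v x)" for x
    by (simp add: power2_sum)
  ultimately show ?thesis using assms by (auto simp: sq_int_def)
qed

lemma sq_int_scale: "sq_int u \<Longrightarrow> sq_int (\<lambda>x. c * u x)"
  by (auto simp: sq_int_def power_mult_distrib)

lemma sq_int_diff: "sq_int u \<Longrightarrow> sq_int v \<Longrightarrow> sq_int (\<lambda>x. u x - v x)"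
  using sq_int_add[of u "\<lambda>x. (-1) * v x"] sq_int_scale[of v "-1"] by simp

lemma sq_int_sum: "(\<And>i. i \<in> I \<Longrightarrow> sq_int (u i)) \<Longrightarrow> sq_int (\<lambda>x. \<Sum>i\<in>I. u i x)"
proof (induction I rule: infinite_finite_induct)
  case (insert i I)
  then show ?case using sq_int_add[of "u i" "\<lambda>x. \<Sum>i\<in>I. u i x"] by simp
qed (auto simp: sq_int_def)

lemma sq_int_indicator: "sq_int (indicator {a<..b})"
proof -
  have "integrable lborel (indicator {a<..b} :: real \<Rightarrow> real)"
  proof (rule integrable_real_indicator)
    show "emeasure lborel {a<..b} < \<infinity>"
    proof (cases "a \<le> b")
      case False
      then have "{a<..b} = {}" by auto
      then show ?thesis by simp
    qed (simp add: emeasure_lborel_Ioc)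
  qed simp
  moreover have "(indicator {a<..b} x)\<^sup>2 = (indicator {a<..b} x :: real)" for x by (simp add: indicator_def)
  ultimately show ?thesis by (simp add: sq_int_def)
qed

lemma L2_01_iff: "f \<in> L2_01 \<longleftrightarrow> sq_int (cut01 f)"
proof -
  have "indicator {0..1} x *\<^sub>R (f x)\<^sup>2 = (cut01 f x)\<^sup>2" for x by (simp add: cut01_def indicator_def)
  then show ?thesis
    by (simp add: L2_01_def meas01_def sq_int_def set_integrable_def set_borel_measurable_def cut01_def[abs_def])
qed

lemma inner01_eq: "inner01 f g = (\<integral>x. cut01 f x * cut01 g x \<partial>lborel)"
  unfolding inner01_def set_lebesgue_integral_def
  by (intro Bochner_Integration.integral_cong) (auto simp: cut01_def indicator_def)

text \<open>From the non-negativity of \<open>t \<mapsto> \<integral>(u - t * v)\<^sup>2\<close>.\<close>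

lemma Cauchy_Schwarz_integral:
  assumes "sq_int u" "sq_int v"
  shows "(\<integral>x. u x * v x \<partial>lborel)\<^sup>2 \<le> (\<integral>x. (u x)\<^sup>2 \<partial>lborel) * (\<integral>x. (v x)\<^sup>2 \<partial>lborel)"
proof -
  define a where "a = (\<integral>x. (u x)\<^sup>2 \<partial>lborel)"
  define b where "b = (\<integral>x. u x * v x \<partial>lborel)"
  define c where "c = (\<integral>x. (v x)\<^sup>2 \<partial>lborel)"
  have q: "0 \<le> a - 2 * t * b + t\<^sup>2 * c" for t
  proof -
    have "0 \<le> (\<integral>x. (u x - t * v x)\<^sup>2 \<partial>lborel)" by simp
    also have "\<dots> = (\<integral>x. (u x)\<^sup>2 - (2 * t) * (u x * v x) + t\<^sup>2 * (v x)\<^sup>2 \<partial>lborel)"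
      by (intro Bochner_Integration.integral_cong) (auto simp: power2_eq_square algebra_simps)
    also have "\<dots> = a - 2 * t * b + t\<^sup>2 * c"
      using assms sq_int_mult[OF assms] unfolding a_def b_def c_def by (simp add: sq_int_def)
    finally show ?thesis .
  qed
  have "c \<ge> 0" by (simp add: c_def)
  show ?thesis
  proof (cases "c = 0")
    case True
    have "b = 0"
    proof (rule ccontr)
      assume "b \<noteq> 0"
      then show False using q[of "(a + 1) / (2 * b)"] True by simp
    qed
    then show ?thesis using True by (simp add: a_def b_def c_def)
  next
    case False
    then have "0 \<le> (a - 2 * (b / c) * b + (b / c)\<^sup>2 * c) * c" using q[of "b / c"] \<open>c \<ge> 0\<close> by simp
    also have "\<dots> = a * c - b\<^sup>2" using False by (simp add: power2_eq_square field_simps)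
    finally show ?thesis by (simp add: a_def b_def c_def)
  qed
qed

lemma nn_integral_square_eq:
  assumes "sq_int u" shows "(\<integral>\<^sup>+x. ennreal ((u x)\<^sup>2) \<partial>lborel) = ennreal (\<integral>x. (u x)\<^sup>2 \<partial>lborel)"
  using assms by (intro nn_integral_eq_integral) (auto simp: sq_int_def)

section \<open>Empirical wavelet coefficients are jointly sub-Gaussian\<close>
text \<open>Independence of increments is available for one partition only, so step functions with different nodes are first
rewritten on a common one. The identity is stated for every \<open>F\<close> because it is used both for the Wiener path
and, with \<open>F\<close> an indicator of a half-line, for the step functions themselves.\<close>

lemma common_refinement:
  fixes lo hi c :: "'q \<Rightarrow> real"
  assumes Q: "finite Q" and int: "\<And>q. q \<in> Q \<Longrightarrow> lo q \<in> {0..1} \<and> hi q \<in> {0..1} \<and> lo q \<le> hi q"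
  shows "\<exists>(N::nat) (t::nat \<Rightarrow> real) d. (\<forall>i\<le>N. t i \<in> {0..1}) \<and> (\<forall>i<N. t i < t (Suc i)) \<and>
    (\<forall>F::real \<Rightarrow> real. (\<Sum>q\<in>Q. c q * (F (hi q) - F (lo q))) = (\<Sum>i<N. d i * (F (t (Suc i)) - F (t i))))"
proof -
  define T where "T = insert 0 (lo ` Q \<union> hi ` Q)"
  have T: "finite T" "T \<noteq> {}" "T \<subseteq> {0..1}" using Q int by (auto simp: T_def)
  define xs where "xs = sorted_list_of_set T"
  define N where "N = length xs - 1"
  define t where "t i = xs ! i" for i
  have xs: "set xs = T" "sorted_wrt (<) xs" "xs \<noteq> []"
    using T by (auto simp: xs_def strict_sorted_list_of_set)
  have len: "length xs = Suc N" using xs(3) by (simp add: N_def)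
  have tT: "t i \<in> T" if "i \<le> N" for i using that len xs(1) nth_mem[of i xs] by (simp add: t_def)
  have lt: "t i < t j" if "i < j" "j \<le> N" for i j
    using sorted_wrt_nth_less[OF xs(2), of i j] that len by (simp add: t_def)
  have idx: "\<exists>a. a \<le> N \<and> t a = x" if "x \<in> T" for x
    using that xs(1) len by (metis in_set_conv_nth less_Suc_eq_le t_def)
  have ex: "\<exists>a. a \<le> N \<and> t a = lo q" "\<exists>b. b \<le> N \<and> t b = hi q" if "q \<in> Q" for q
    using idx[of "lo q"] idx[of "hi q"] that by (auto simp: T_def)
  define a where "a q = (SOME a. a \<le> N \<and> t a = lo q)" for q
  define b where "b q = (SOME b. b \<le> N \<and> t b = hi q)" for q
  have a: "a q \<le> N" "t (a q) = lo q" if "q \<in> Q" for q using someI_ex[OF ex(1)[OF that]] by (auto simp: a_def)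
  have b: "b q \<le> N" "t (b q) = hi q" if "q \<in> Q" for q using someI_ex[OF ex(2)[OF that]] by (auto simp: b_def)
  have ab: "a q \<le> b q" if "q \<in> Q" for q
    using a[OF that] b[OF that] int[OF that] lt[of "b q" "a q"] by (metis linorder_not_le)
  (* the value of the step function on cell i is the sum of the c q whose interval covers this cell *)
  define d where "d i = (\<Sum>q\<in>Q. if a q \<le> i \<and> i < b q then c q else 0)" for i
  show ?thesis
  proof (rule exI[of _ N], rule exI[of _ t], rule exI[of _ d], intro conjI allI impI)
    fix F :: "real \<Rightarrow> real"
    have "(\<Sum>q\<in>Q. c q * (F (hi q) - F (lo q))) = (\<Sum>q\<in>Q. \<Sum>i<N. (if a q \<le> i \<and> i < b q then c q else 0) * (F (t (Suc i)) - F (t i)))"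
    proof (intro sum.cong refl)
      fix q assume q: "q \<in> Q"
      have "F (hi q) - F (lo q) = (\<Sum>i=a q..<b q. F (t (Suc i)) - F (t i))"
        using sum_Suc_diff'[OF ab[OF q], of "\<lambda>i. F (t i)"] a[OF q] b[OF q] by simp
      then have "c q * (F (hi q) - F (lo q)) = (\<Sum>i=a q..<b q. c q * (F (t (Suc i)) - F (t i)))"
        by (simp add: sum_distrib_left)
      also have "\<dots> = (\<Sum>i<N. (if a q \<le> i \<and> i < b q then c q else 0) * (F (t (Suc i)) - F (t i)))"
        using b(1)[OF q] by (intro sum.mono_neutral_cong_left) auto
      finally show "c q * (F (hi q) - F (lo q)) = \<dots>" .
    qed
    also have "\<dots> = (\<Sum>i<N. d i * (F (t (Suc i)) - F (t i)))"
      by (subst sum.swap) (simp add: d_def sum_distrib_right)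
    finally show "(\<Sum>q\<in>Q. c q * (F (hi q) - F (lo q))) = (\<Sum>i<N. d i * (F (t (Suc i)) - F (t i)))" .
  next
    show "t i \<in> {0..1}" if "i \<le> N" for i using subsetD[OF T(3) tT[OF that]] .
    show "t i < t (Suc i)" if "i < N" for i using lt[of i "Suc i"] that by simp
  qed
qed

lemma partition_step_square_integral:
  fixes t d :: "nat \<Rightarrow> real"
  assumes "\<And>i. i < N \<Longrightarrow> t i < t (Suc i)"
  shows "(\<integral>\<^sup>+x. ennreal ((\<Sum>i<N. d i * indicator {t i<..t (Suc i)} x)\<^sup>2) \<partial>lborel) = ennreal (\<Sum>i<N. (d i)\<^sup>2 * (t (Suc i) - t i))"
proof -
  have mono: "t i \<le> t j" if "i \<le> j" "j \<le> N" for i j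
    using that(1) that(2) by (induction rule: dec_induct) (use assms in \<open>auto dest: less_imp_le intro: order_trans simp: Suc_le_eq\<close>)
  have disj: "indicator {t i<..t (Suc i)} x * indicator {t j<..t (Suc j)} x = (0::real)" if "i < N" "j < N" "i \<noteq> j" for i j x
  proof -
    have "Suc i \<le> j \<or> Suc j \<le> i" using that by linarith
    then show ?thesis using mono[of "Suc i" j] mono[of "Suc j" i] that by (auto simp: indicator_def)
  qed
  have "(\<Sum>i<N. d i * indicator {t i<..t (Suc i)} x)\<^sup>2 = (\<Sum>i<N. (d i)\<^sup>2 * indicator {t i<..t (Suc i)} x)" for x
  proof -
    have "(\<Sum>i<N. d i * indicator {t i<..t (Suc i)} x)\<^sup>2
      = (\<Sum>i<N. \<Sum>j<N. (d i * d j) * (indicator {t i<..t (Suc i)} x * indicator {t j<..t (Suc j)} x))"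
      unfolding power2_eq_square sum_product by (simp only: mult_ac)
    also have "\<dots> = (\<Sum>i<N. \<Sum>j<N. if j = i then (d i)\<^sup>2 * indicator {t i<..t (Suc i)} x else 0)"
      using disj by (intro sum.cong refl) (auto simp: power2_eq_square indicator_def)
    also have "\<dots> = (\<Sum>i<N. (d i)\<^sup>2 * indicator {t i<..t (Suc i)} x)" by simp
    finally show ?thesis .
  qed
  then have "(\<integral>\<^sup>+x. ennreal ((\<Sum>i<N. d i * indicator {t i<..t (Suc i)} x)\<^sup>2) \<partial>lborel)
     = (\<integral>\<^sup>+x. (\<Sum>i<N. ennreal ((d i)\<^sup>2) * indicator {t i<..t (Suc i)} x) \<partial>lborel)"
    by (intro nn_integral_cong)
      (auto simp: sum_ennreal[symmetric] ennreal_mult ennreal_indicator simp del: sum_ennreal intro!: sum.cong)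
  also have "\<dots> = (\<Sum>i<N. ennreal ((d i)\<^sup>2) * ennreal (t (Suc i) - t i))"
    using assms by (subst nn_integral_sum) (auto simp: nn_integral_cmult less_imp_le)
  also have "\<dots> = (\<Sum>i<N. ennreal ((d i)\<^sup>2 * (t (Suc i) - t i)))"
    using assms by (intro sum.cong refl ennreal_mult[symmetric]) (auto simp: less_imp_le)
  also have "\<dots> = ennreal (\<Sum>i<N. (d i)\<^sup>2 * (t (Suc i) - t i))"
    using assms by (intro sum_ennreal) (auto simp: less_imp_le)
  finally show ?thesis .
qed

lemma wiener_partition_mgf:
  fixes t d :: "nat \<Rightarrow> real"
  assumes W: "wiener_process P W" and t: "\<And>i. i \<le> N \<Longrightarrow> t i \<in> {0..1}" "\<And>i. i < N \<Longrightarrow> t i < t (Suc i)"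
  shows "(\<integral>\<^sup>+w. ennreal (exp (\<Sum>i<N. d i * (W (t (Suc i)) w - W (t i) w))) \<partial>P)
     = ennreal (exp ((\<Sum>i<N. (d i)\<^sup>2 * (t (Suc i) - t i)) / 2))"
proof -
  interpret prob_space P using W by (simp add: wiener_process_def)
  have ind: "indep_vars (\<lambda>_. borel) (\<lambda>i w. W (t (Suc i)) w - W (t i) w) {..<N}"
    using W t unfolding wiener_process_def by blast
  have ind2: "indep_vars (\<lambda>_. borel) (\<lambda>i w. ennreal (exp (d i * (W (t (Suc i)) w - W (t i) w)))) {..<N}"
    by (rule indep_vars_compose2[OF ind]) measurable
  have one: "(\<integral>\<^sup>+w. ennreal (exp (d i * (W (t (Suc i)) w - W (t i) w))) \<partial>P) = ennreal (exp ((d i)\<^sup>2 * (t (Suc i) - t i) / 2))"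
    if i: "i < N" for i
  proof -
    have lt: "t i < t (Suc i)" using t(2)[OF i] .
    have "0 \<le> t i" "t (Suc i) \<le> 1" using t(1)[of i] t(1)[of "Suc i"] i by auto
    then have D: "distributed P lborel (\<lambda>w. W (t (Suc i)) w - W (t i) w) (normal_density 0 (sqrt (t (Suc i) - t i)))"
      using W lt unfolding wiener_process_def by blast
    have "(\<integral>\<^sup>+w. ennreal (exp (d i * (W (t (Suc i)) w - W (t i) w))) \<partial>P)
       = (\<integral>\<^sup>+x. ennreal (normal_density 0 (sqrt (t (Suc i) - t i)) x) * ennreal (exp (d i * x)) \<partial>lborel)"
      by (subst distributed_nn_integral[OF D, symmetric]) auto
    also have "\<dots> = ennreal (exp ((d i)\<^sup>2 * (sqrt (t (Suc i) - t i))\<^sup>2 / 2))"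
      using lt by (intro normal_mgf) simp
    finally show ?thesis using lt by simp
  qed
  have "(\<integral>\<^sup>+w. ennreal (exp (\<Sum>i<N. d i * (W (t (Suc i)) w - W (t i) w))) \<partial>P)
     = (\<integral>\<^sup>+w. (\<Prod>i<N. ennreal (exp (d i * (W (t (Suc i)) w - W (t i) w)))) \<partial>P)"
    by (simp add: exp_sum prod_ennreal)
  also have "\<dots> = (\<Prod>i<N. \<integral>\<^sup>+w. ennreal (exp (d i * (W (t (Suc i)) w - W (t i) w))) \<partial>P)"
    by (rule indep_vars_nn_integral[OF _ ind2]) auto
  also have "\<dots> = (\<Prod>i<N. ennreal (exp ((d i)\<^sup>2 * (t (Suc i) - t i) / 2)))"
    using one by (intro prod.cong) auto
  also have "\<dots> = ennreal (exp ((\<Sum>i<N. (d i)\<^sup>2 * (t (Suc i) - t i)) / 2))"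
    by (simp add: exp_sum prod_ennreal sum_divide_distrib)
  finally show ?thesis .
qed

text \<open>The Wiener integral of a step function is centred normal with variance its squared \<open>L\<^sup>2\<close> norm.\<close>

lemma elementary_integral_mgf:
  fixes lo hi c :: "'q \<Rightarrow> real"
  assumes W: "wiener_process P W" and Q: "finite Q"
    and int: "\<And>q. q \<in> Q \<Longrightarrow> lo q \<in> {0..1} \<and> hi q \<in> {0..1} \<and> lo q \<le> hi q"
  obtains v where "0 \<le> v"
    "(\<integral>\<^sup>+x. ennreal ((\<Sum>q\<in>Q. c q * indicator {lo q<..hi q} x)\<^sup>2) \<partial>lborel) = ennreal v"
    "(\<integral>\<^sup>+w. ennreal (exp (\<Sum>q\<in>Q. c q * (W (hi q) w - W (lo q) w))) \<partial>P) = ennreal (exp (v / 2))"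
proof -
  obtain N t d where t: "\<And>i. i \<le> N \<Longrightarrow> t i \<in> {0..1}" "\<And>i. i < N \<Longrightarrow> t i < t (Suc i)"
    and F: "\<And>F::real \<Rightarrow> real. (\<Sum>q\<in>Q. c q * (F (hi q) - F (lo q))) = (\<Sum>i<N. d i * (F (t (Suc i)) - F (t i)))"
    using common_refinement[where lo=lo and hi=hi and c=c, OF Q int] by blast
  define v where "v = (\<Sum>i<N. (d i)\<^sup>2 * (t (Suc i) - t i))"
  have "(\<Sum>q\<in>Q. c q * indicator {lo q<..hi q} x) = (\<Sum>i<N. d i * indicator {t i<..t (Suc i)} x)" for x
  proof -
    have "(\<Sum>q\<in>Q. c q * indicator {lo q<..hi q} x) = (\<Sum>q\<in>Q. c q * (indicator {x..} (hi q) - indicator {x..} (lo q)))"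
      using int by (intro sum.cong refl) (force simp: indicator_def)
    also have "\<dots> = (\<Sum>i<N. d i * (indicator {x..} (t (Suc i)) - indicator {x..} (t i)))" by (rule F)
    also have "\<dots> = (\<Sum>i<N. d i * indicator {t i<..t (Suc i)} x)"
      using t(2) by (intro sum.cong refl) (force simp: indicator_def)
    finally show ?thesis .
  qed
  then have "(\<integral>\<^sup>+x. ennreal ((\<Sum>q\<in>Q. c q * indicator {lo q<..hi q} x)\<^sup>2) \<partial>lborel) = ennreal v"
    using partition_step_square_integral[where t=t and N=N and d=d] t(2) by (simp add: v_def)
  moreover have "(\<integral>\<^sup>+w. ennreal (exp (\<Sum>q\<in>Q. c q * (W (hi q) w - W (lo q) w))) \<partial>P) = ennreal (exp (v / 2))"
    using wiener_partition_mgf[where t=t and N=N and d=d, OF W] t F[of "\<lambda>s. W s _"] by (simp add: v_def)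
  moreover have "0 \<le> v" unfolding v_def using t(2) by (intro sum_nonneg) (auto simp: less_imp_le)
  ultimately show ?thesis using that by blast
qed

text \<open>Mean-square convergence gives almost sure convergence along a subsequence, and Fatou's lemma then passes the
bound to the limit.\<close>

lemma mgf_limit:
  fixes V :: "nat \<Rightarrow> 'w \<Rightarrow> real"
  assumes P: "prob_space P" and [measurable]: "\<And>l. V l \<in> borel_measurable P" "X \<in> borel_measurable P"
    and lim: "(\<lambda>l. \<integral>\<^sup>+w. ennreal ((V l w - X w)\<^sup>2) \<partial>P) \<longlonglongrightarrow> 0"
    and mgf: "\<And>l. (\<integral>\<^sup>+w. ennreal (exp (V l w)) \<partial>P) \<le> ennreal (exp (v l / 2))"
    and v: "\<And>\<eta>. 0 < \<eta> \<Longrightarrow> eventually (\<lambda>l. v l \<le> \<kappa> + \<eta>) sequentially"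
  shows "(\<integral>\<^sup>+w. ennreal (exp (X w)) \<partial>P) \<le> ennreal (exp (\<kappa> / 2))"
proof -
  (* from some index L on the distances are finite, so that they are integrable functions *)
  have "eventually (\<lambda>l. (\<integral>\<^sup>+w. ennreal ((V l w - X w)\<^sup>2) \<partial>P) < 1) sequentially"
    by (rule order_tendstoD(2)[OF lim]) simp
  then obtain L where L: "\<And>l. L \<le> l \<Longrightarrow> (\<integral>\<^sup>+w. ennreal ((V l w - X w)\<^sup>2) \<partial>P) < 1"
    by (auto simp: eventually_sequentially)
  define u where "u l w = (V (l + L) w - X w)\<^sup>2" for l w
  have um[measurable]: "u l \<in> borel_measurable P" for l unfolding u_def by measurable
  have ui: "integrable P (u l)" for l
  proof (rule integrableI_nonneg)
    show "(\<integral>\<^sup>+w. ennreal (u l w) \<partial>P) < \<infinity>"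
      using L[of "l + L"] unfolding u_def by (rule less_trans) auto
  qed (auto simp: u_def)
  have "(\<lambda>l. ennreal (\<integral>w. u l w \<partial>P)) \<longlonglongrightarrow> ennreal 0"
    using LIMSEQ_ignore_initial_segment[OF lim, of L]
    by (subst nn_integral_eq_integral[OF ui, symmetric]) (auto simp: u_def)
  then have "(\<lambda>l. \<integral>w. u l w \<partial>P) \<longlonglongrightarrow> 0"
    by (subst (asm) tendsto_ennreal_iff) (auto intro!: integral_nonneg_AE simp: u_def[abs_def])
  then have "(\<lambda>l. \<integral>w. norm (u l w) \<partial>P) \<longlonglongrightarrow> 0" by (simp add: u_def)
  from tendsto_L1_AE_subseq[OF ui this] obtain r where r: "strict_mono r" "AE w in P. (\<lambda>l. u (r l) w) \<longlonglongrightarrow> 0"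
    by blast
  have ae: "AE w in P. ennreal (exp (X w)) = liminf (\<lambda>l. ennreal (exp (V (r l + L) w)))"
    using r(2)
  proof eventually_elim
    case (elim w)
    then have "(\<lambda>l. sqrt (u (r l) w)) \<longlonglongrightarrow> sqrt 0" by (intro tendsto_intros)
    then have "(\<lambda>l. V (r l + L) w - X w) \<longlonglongrightarrow> 0"
      by (simp add: u_def tendsto_rabs_zero_iff)
    then have "(\<lambda>l. V (r l + L) w) \<longlonglongrightarrow> X w" by (simp add: LIM_zero_iff)
    then have "(\<lambda>l. ennreal (exp (V (r l + L) w))) \<longlonglongrightarrow> ennreal (exp (X w))"
      by (intro tendsto_ennrealI tendsto_exp)
    then show ?case by (intro lim_imp_Liminf[symmetric]) auto
  qed
  have bound: "(\<integral>\<^sup>+w. ennreal (exp (X w)) \<partial>P) \<le> ennreal (exp ((\<kappa> + \<eta>) / 2))" if "0 < \<eta>" for \<eta>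
  proof -
    have "(\<integral>\<^sup>+w. ennreal (exp (X w)) \<partial>P) = (\<integral>\<^sup>+w. liminf (\<lambda>l. ennreal (exp (V (r l + L) w))) \<partial>P)"
      by (rule nn_integral_cong_AE[OF ae])
    also have "\<dots> \<le> liminf (\<lambda>l. \<integral>\<^sup>+w. ennreal (exp (V (r l + L) w)) \<partial>P)"
      by (rule nn_integral_liminf) auto
    also have "\<dots> \<le> liminf (\<lambda>l. ennreal (exp ((\<kappa> + \<eta>) / 2)))"
    proof (rule Liminf_mono)
      have "filterlim (\<lambda>l. r l + L) sequentially sequentially"
        using filterlim_subseq[OF r(1)] by (rule filterlim_compose[OF filterlim_add_const_nat_at_top])
      from eventually_compose_filterlim[OF v[OF that] this]
      show "eventually (\<lambda>l. (\<integral>\<^sup>+w. ennreal (exp (V (r l + L) w)) \<partial>P) \<le> ennreal (exp ((\<kappa> + \<eta>) / 2))) sequentially"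
        by eventually_elim (rule order_trans[OF mgf], auto intro!: ennreal_leI)
    qed
    also have "\<dots> = ennreal (exp ((\<kappa> + \<eta>) / 2))" by (simp add: Liminf_const)
    finally show ?thesis .
  qed
  have "((\<lambda>\<eta>. ennreal (exp ((\<kappa> + \<eta>) / 2))) \<longlongrightarrow> ennreal (exp ((\<kappa> + 0) / 2))) (at_right 0)"
    by (intro tendsto_intros) auto
  then show ?thesis
    using tendsto_lowerbound[of "\<lambda>\<eta>. ennreal (exp ((\<kappa> + \<eta>) / 2))" _ "at_right 0"] bound
    by (simp add: eventually_at_right_less[of 0] eventually_at_filter)
qed

text \<open>In the elementary integrals of the observation process the drift contributes \<open>\<integral>f * St l\<close>, which converges to the true
coefficient by the Cauchy-Schwarz inequality. What remains is an elementary integral of the Wiener process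
alone.\<close>

lemma white_noise_integral_limit:
  assumes W: "wiener_process P W" and \<sigma>: "0 < \<sigma>" and n: "0 < n" and f: "f \<in> L2_01" and g: "g \<in> L2_01"
    and I: "stoch_integral P (white_noise_obs \<sigma> n f W) g I"
  shows "\<exists>(N :: nat \<Rightarrow> nat) (t :: nat \<Rightarrow> nat \<Rightarrow> real) (c :: nat \<Rightarrow> nat \<Rightarrow> real).
    (\<forall>l. (\<forall>k\<le>N l. t l k \<in> {0..1}) \<and> (\<forall>k<N l. t l k \<le> t l (Suc k))) \<and>
    (\<lambda>l. \<integral>\<^sup>+x. ennreal (((\<Sum>k<N l. c l k * indicator {t l k<..t l (Suc k)} x) - cut01 g x)\<^sup>2) \<partial>lborel) \<longlonglongrightarrow> 0 \<and>
    (\<lambda>l. \<integral>\<^sup>+w. ennreal (((\<Sum>k<N l. c l k * (W (t l (Suc k)) w - W (t l k) w)) - sqrt n / \<sigma> * (I w - inner01 f g))\<^sup>2) \<partial>P) \<longlonglongrightarrow> 0"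
proof -
  interpret prob_space P using W by (simp add: wiener_process_def)
  have Im[measurable]: "I \<in> borel_measurable P" using I by (simp add: stoch_integral_def)
  obtain N :: "nat \<Rightarrow> nat" and t c :: "nat \<Rightarrow> nat \<Rightarrow> real" where
    t: "\<And>l k. k \<le> N l \<Longrightarrow> t l k \<in> {0..1}" "\<And>l k. k < N l \<Longrightarrow> t l k \<le> t l (Suc k)" and
    S: "(\<lambda>l. \<integral>\<^sup>+x\<in>{0..1}. ennreal (((\<Sum>i<N l. c l i * indicator {t l i<..t l (Suc i)} x) - g x)\<^sup>2) \<partial>lborel) \<longlonglongrightarrow> 0" and
    E: "(\<lambda>l. \<integral>\<^sup>+w. ennreal (((\<Sum>i<N l. c l i * (white_noise_obs \<sigma> n f W (t l (Suc i)) w - white_noise_obs \<sigma> n f W (t l i) w)) - I w)\<^sup>2) \<partial>P) \<longlonglongrightarrow> 0"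
    using I unfolding stoch_integral_def by blast
  define St where "St l x = (\<Sum>k<N l. c l k * indicator {t l k<..t l (Suc k)} x)" for l x
  define El where "El l w = (\<Sum>k<N l. c l k * (W (t l (Suc k)) w - W (t l k) w))" for l w
  define D where "D l w = (\<Sum>i<N l. c l i * (white_noise_obs \<sigma> n f W (t l (Suc i)) w - white_noise_obs \<sigma> n f W (t l i) w)) - I w" for l w
  define s where "s = \<sigma> / sqrt n"
  have s: "0 < s" using \<sigma> n by (simp add: s_def)
  have Wm[measurable]: "W (t l k) \<in> borel_measurable P" if "k \<le> N l" for l k
    using W t(1)[OF that] by (simp add: wiener_process_def)
  have Elm[measurable]: "El l \<in> borel_measurable P" for l unfolding El_def by measurable
  have sqf: "sq_int (cut01 f)" and sqg: "sq_int (cut01 g)" using f g by (auto simp: L2_01_iff)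
  have sqS: "sq_int (St l)" for l unfolding St_def by (intro sq_int_sum sq_int_scale sq_int_indicator)
  have drift: "(LBINT u:{0..b}. f u) - (LBINT u:{0..a}. f u) = (\<integral>x. indicator {a<..b} x * cut01 f x \<partial>lborel)"
    if "0 \<le> a" "a \<le> b" "b \<le> 1" for a b
  proof -
    have i: "integrable lborel (\<lambda>x. indicator {c<..d} x * cut01 f x)" for c d
      using sq_int_mult[OF sq_int_indicator sqf] by simp
    have e: "(LBINT u:{0..b}. f u) = (\<integral>x. indicator {0<..b} x * cut01 f x \<partial>lborel)" if "0 \<le> b" "b \<le> 1" for b
      unfolding set_lebesgue_integral_def
    proof (rule integral_cong_AE)
      have *: "(\<lambda>x. indicator {0..b} x *\<^sub>R f x) = (\<lambda>x. indicator {0..b} x * cut01 f x)"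
        using that by (auto simp: cut01_def indicator_def fun_eq_iff)
      show "(\<lambda>x. indicator {0..b} x *\<^sub>R f x) \<in> borel_measurable lborel"
        unfolding * using sqf by (auto simp: sq_int_def)
      show "(\<lambda>x. indicator {0<..b} x * cut01 f x) \<in> borel_measurable lborel" using sqf by (auto simp: sq_int_def)
      show "AE x in lborel. indicator {0..b} x *\<^sub>R f x = indicator {0<..b} x * cut01 f x"
        using AE_lborel_singleton[of "0::real"] by eventually_elim (use that in \<open>auto simp: cut01_def indicator_def\<close>)
    qed
    have "(LBINT u:{0..b}. f u) - (LBINT u:{0..a}. f u)
       = (\<integral>x. indicator {0<..b} x * cut01 f x - indicator {0<..a} x * cut01 f x \<partial>lborel)"
      using that i by (simp add: e)
    also have "\<dots> = (\<integral>x. indicator {a<..b} x * cut01 f x \<partial>lborel)"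
      using that by (intro Bochner_Integration.integral_cong) (auto simp: indicator_def)
    finally show ?thesis .
  qed
  define \<delta> where "\<delta> l = (\<integral>x. (St l x - cut01 g x) * cut01 f x \<partial>lborel)" for l
  have El_eq: "El l w - sqrt n / \<sigma> * (I w - inner01 f g) = (D l w - \<delta> l) / s" for l w
  proof -
    have "(\<Sum>i<N l. c l i * (white_noise_obs \<sigma> n f W (t l (Suc i)) w - white_noise_obs \<sigma> n f W (t l i) w))
      = (\<Sum>i<N l. c l i * (\<integral>x. indicator {t l i<..t l (Suc i)} x * cut01 f x \<partial>lborel) + s * (c l i * (W (t l (Suc i)) w - W (t l i) w)))"
    proof (intro sum.cong refl)
      fix i assume "i \<in> {..<N l}"
      then have i: "i < N l" by simp
      have "(LBINT u:{0..t l (Suc i)}. f u) - (LBINT u:{0..t l i}. f u) = (\<integral>x. indicator {t l i<..t l (Suc i)} x * cut01 f x \<partial>lborel)"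
        using t(1)[of i l] t(1)[of "Suc i" l] t(2)[OF i] i by (intro drift) auto
      then show "c l i * (white_noise_obs \<sigma> n f W (t l (Suc i)) w - white_noise_obs \<sigma> n f W (t l i) w)
        = c l i * (\<integral>x. indicator {t l i<..t l (Suc i)} x * cut01 f x \<partial>lborel) + s * (c l i * (W (t l (Suc i)) w - W (t l i) w))"
        unfolding white_noise_obs_def s_def[symmetric] by (simp add: algebra_simps)
    qed
    also have "\<dots> = (\<Sum>i<N l. c l i * (\<integral>x. indicator {t l i<..t l (Suc i)} x * cut01 f x \<partial>lborel)) + s * El l w"
      by (simp add: sum.distrib El_def sum_distrib_left)
    also have "(\<Sum>i<N l. c l i * (\<integral>x. indicator {t l i<..t l (Suc i)} x * cut01 f x \<partial>lborel)) = (\<integral>x. St l x * cut01 f x \<partial>lborel)"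
    proof -
      have "(\<integral>x. St l x * cut01 f x \<partial>lborel) = (\<integral>x. (\<Sum>i<N l. c l i * (indicator {t l i<..t l (Suc i)} x * cut01 f x)) \<partial>lborel)"
        by (simp only: St_def sum_distrib_right mult.assoc)
      also have "\<dots> = (\<Sum>i<N l. c l i * (\<integral>x. indicator {t l i<..t l (Suc i)} x * cut01 f x \<partial>lborel))"
        using sq_int_mult[OF sq_int_indicator sqf] by (subst Bochner_Integration.integral_sum) auto
      finally show ?thesis by simp
    qed
    finally have "D l w = (\<integral>x. St l x * cut01 f x \<partial>lborel) + s * El l w - I w" by (simp add: D_def)
    moreover have "\<delta> l = (\<integral>x. St l x * cut01 f x \<partial>lborel) - inner01 f g"
      unfolding \<delta>_def inner01_eq left_diff_distrib
      using sq_int_mult[OF sqS sqf] sq_int_mult[OF sqg sqf] by (simp add: mult.commute)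
    ultimately have 1: "D l w - \<delta> l = s * El l w - (I w - inner01 f g)" by simp
    have 2: "sqrt n / \<sigma> = 1 / s" by (simp add: s_def)
    show ?thesis unfolding 1 2 using s by (simp add: field_simps)
  qed
  have Dm[measurable]: "D l \<in> borel_measurable P" for l
  proof -
    have "D l = (\<lambda>w. s * (El l w - sqrt n / \<sigma> * (I w - inner01 f g)) + \<delta> l)"
      unfolding El_eq using s by (simp add: fun_eq_iff)
    then show ?thesis by simp
  qed
  have S': "(\<lambda>l. \<integral>\<^sup>+x. ennreal ((St l x - cut01 g x)\<^sup>2) \<partial>lborel) \<longlonglongrightarrow> 0"
  proof -
    have "(\<integral>\<^sup>+x\<in>{0..1}. ennreal ((St l x - g x)\<^sup>2) \<partial>lborel) = (\<integral>\<^sup>+x. ennreal ((St l x - cut01 g x)\<^sup>2) \<partial>lborel)" for l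
    proof (intro nn_integral_cong)
      fix x :: real
      have "St l x = 0" if "x \<notin> {0..1}"
        unfolding St_def
      proof (rule sum.neutral, intro ballI)
        fix k assume "k \<in> {..<N l}"
        then show "c l k * indicator {t l k<..t l (Suc k)} x = 0"
          using that t(1)[of k l] t(1)[of "Suc k" l] by (auto simp: indicator_def)
      qed
      then show "ennreal ((St l x - g x)\<^sup>2) * indicator {0..1} x = ennreal ((St l x - cut01 g x)\<^sup>2)"
        by (cases "x \<in> {0..1}") (auto simp: cut01_def)
    qed
    then show ?thesis using S unfolding St_def by simp
  qed
  have \<delta>: "ennreal ((\<delta> l)\<^sup>2) \<le> ennreal (\<integral>x. (cut01 f x)\<^sup>2 \<partial>lborel) * (\<integral>\<^sup>+x. ennreal ((St l x - cut01 g x)\<^sup>2) \<partial>lborel)" for l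
  proof -
    have "(\<delta> l)\<^sup>2 \<le> (\<integral>x. (cut01 f x)\<^sup>2 \<partial>lborel) * (\<integral>x. (St l x - cut01 g x)\<^sup>2 \<partial>lborel)"
      unfolding \<delta>_def using Cauchy_Schwarz_integral[OF sq_int_diff[OF sqS sqg] sqf] by (simp add: mult.commute)
    then show ?thesis
      by (subst nn_integral_square_eq[OF sq_int_diff[OF sqS sqg]]) (simp add: ennreal_mult[symmetric] ennreal_leI)
  qed
  have bd: "(\<integral>\<^sup>+w. ennreal ((El l w - sqrt n / \<sigma> * (I w - inner01 f g))\<^sup>2) \<partial>P)
     \<le> ennreal (2 / s\<^sup>2) * (\<integral>\<^sup>+w. ennreal ((D l w)\<^sup>2) \<partial>P) +
       ennreal (2 / s\<^sup>2) * (ennreal (\<integral>x. (cut01 f x)\<^sup>2 \<partial>lborel) * (\<integral>\<^sup>+x. ennreal ((St l x - cut01 g x)\<^sup>2) \<partial>lborel))" for l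
  proof -
    have "(\<integral>\<^sup>+w. ennreal ((El l w - sqrt n / \<sigma> * (I w - inner01 f g))\<^sup>2) \<partial>P)
       \<le> (\<integral>\<^sup>+w. ennreal (2 / s\<^sup>2) * ennreal ((D l w)\<^sup>2) + ennreal (2 / s\<^sup>2) * ennreal ((\<delta> l)\<^sup>2) \<partial>P)"
    proof (rule nn_integral_mono)
      fix w
      have "((D l w - \<delta> l) / s)\<^sup>2 \<le> 2 / s\<^sup>2 * (D l w)\<^sup>2 + 2 / s\<^sup>2 * (\<delta> l)\<^sup>2"
      proof -
        have "(D l w - \<delta> l)\<^sup>2 \<le> 2 * (D l w)\<^sup>2 + 2 * (\<delta> l)\<^sup>2"
          using zero_le_power2[of "D l w + \<delta> l"] by (simp add: power2_eq_square algebra_simps)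
        then have "(D l w - \<delta> l)\<^sup>2 / s\<^sup>2 \<le> (2 * (D l w)\<^sup>2 + 2 * (\<delta> l)\<^sup>2) / s\<^sup>2" by (rule divide_right_mono) simp
        then show ?thesis by (simp add: power_divide add_divide_distrib)
      qed
      then have "ennreal (((D l w - \<delta> l) / s)\<^sup>2) \<le> ennreal (2 / s\<^sup>2 * (D l w)\<^sup>2 + 2 / s\<^sup>2 * (\<delta> l)\<^sup>2)" by (rule ennreal_leI)
      also have "\<dots> = ennreal (2 / s\<^sup>2) * ennreal ((D l w)\<^sup>2) + ennreal (2 / s\<^sup>2) * ennreal ((\<delta> l)\<^sup>2)"
        by (subst ennreal_plus) (auto simp: ennreal_mult[symmetric])
      finally show "ennreal ((El l w - sqrt n / \<sigma> * (I w - inner01 f g))\<^sup>2) \<le> ennreal (2 / s\<^sup>2) * ennreal ((D l w)\<^sup>2) + ennreal (2 / s\<^sup>2) * ennreal ((\<delta> l)\<^sup>2)"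
        unfolding El_eq .
    qed
    also have "\<dots> = ennreal (2 / s\<^sup>2) * (\<integral>\<^sup>+w. ennreal ((D l w)\<^sup>2) \<partial>P) + ennreal (2 / s\<^sup>2) * ennreal ((\<delta> l)\<^sup>2)"
      by (subst nn_integral_add) (auto simp: nn_integral_cmult emeasure_space_1)
    finally show ?thesis using \<delta>[of l] by (meson add_left_mono mult_left_mono order_trans zero_le)
  qed
  have rhs: "(\<lambda>l. ennreal (2 / s\<^sup>2) * (\<integral>\<^sup>+w. ennreal ((D l w)\<^sup>2) \<partial>P) +
       ennreal (2 / s\<^sup>2) * (ennreal (\<integral>x. (cut01 f x)\<^sup>2 \<partial>lborel) * (\<integral>\<^sup>+x. ennreal ((St l x - cut01 g x)\<^sup>2) \<partial>lborel)))
      \<longlonglongrightarrow> ennreal (2 / s\<^sup>2) * 0 + ennreal (2 / s\<^sup>2) * (ennreal (\<integral>x. (cut01 f x)\<^sup>2 \<partial>lborel) * 0)"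
    using E S' unfolding D_def by (intro tendsto_add ennreal_tendsto_cmult) auto
  have lim: "(\<lambda>l. \<integral>\<^sup>+w. ennreal ((El l w - sqrt n / \<sigma> * (I w - inner01 f g))\<^sup>2) \<partial>P) \<longlonglongrightarrow> 0"
    by (rule tendsto_sandwich[OF _ _ tendsto_const]) (use bd rhs in auto)
  show ?thesis
    by (rule exI[of _ N], rule exI[of _ t], rule exI[of _ c]) (use t S' lim in \<open>auto simp: St_def El_def\<close>)
qed

text \<open>The weight \<open>\<eta>\<close> allows the factor of the first term to be arbitrarily close to 1, as needed to compare
\<open>L\<^sup>2\<close> norms in the limit.\<close>

lemma nn_integral_square_add_le:
  assumes [measurable]: "u \<in> borel_measurable M" "v \<in> borel_measurable M" and \<eta>: "0 < (\<eta>::real)"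
  shows "(\<integral>\<^sup>+x. ennreal ((u x + v x)\<^sup>2) \<partial>M) \<le> ennreal (1 + \<eta>) * (\<integral>\<^sup>+x. ennreal ((u x)\<^sup>2) \<partial>M) + ennreal (1 + 1 / \<eta>) * (\<integral>\<^sup>+x. ennreal ((v x)\<^sup>2) \<partial>M)"
proof -
  have "(\<integral>\<^sup>+x. ennreal ((u x + v x)\<^sup>2) \<partial>M) \<le> (\<integral>\<^sup>+x. ennreal (1 + \<eta>) * ennreal ((u x)\<^sup>2) + ennreal (1 + 1 / \<eta>) * ennreal ((v x)\<^sup>2) \<partial>M)"
  proof (rule nn_integral_mono)
    fix x
    have "0 \<le> (\<eta> * u x - v x)\<^sup>2 / \<eta>" using \<eta> by simp
    also have "\<dots> = \<eta> * (u x)\<^sup>2 + (v x)\<^sup>2 / \<eta> - 2 * (u x * v x)"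
      using \<eta> by (simp add: power2_eq_square field_simps)
    finally have "(u x + v x)\<^sup>2 \<le> (1 + \<eta>) * (u x)\<^sup>2 + (1 + 1 / \<eta>) * (v x)\<^sup>2"
      by (simp add: power2_eq_square algebra_simps)
    then have "ennreal ((u x + v x)\<^sup>2) \<le> ennreal ((1 + \<eta>) * (u x)\<^sup>2 + (1 + 1 / \<eta>) * (v x)\<^sup>2)" by (rule ennreal_leI)
    also have "\<dots> = ennreal (1 + \<eta>) * ennreal ((u x)\<^sup>2) + ennreal (1 + 1 / \<eta>) * ennreal ((v x)\<^sup>2)"
    proof -
      have "ennreal ((1 + \<eta>) * (u x)\<^sup>2) = ennreal (1 + \<eta>) * ennreal ((u x)\<^sup>2)"
        using \<eta> by (intro ennreal_mult) auto
      moreover have "ennreal ((1 + 1 / \<eta>) * (v x)\<^sup>2) = ennreal (1 + 1 / \<eta>) * ennreal ((v x)\<^sup>2)"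
        using \<eta> by (intro ennreal_mult) auto
      moreover have "0 \<le> (1 + \<eta>) * (u x)\<^sup>2" "0 \<le> (1 + 1 / \<eta>) * (v x)\<^sup>2"
        using \<eta> by (auto intro!: mult_nonneg_nonneg)
      ultimately show ?thesis by (simp only: ennreal_plus)
    qed
    finally show "ennreal ((u x + v x)\<^sup>2) \<le> \<dots>" .
  qed
  also have "\<dots> = ennreal (1 + \<eta>) * (\<integral>\<^sup>+x. ennreal ((u x)\<^sup>2) \<partial>M) + ennreal (1 + 1 / \<eta>) * (\<integral>\<^sup>+x. ennreal ((v x)\<^sup>2) \<partial>M)"
    by (subst nn_integral_add) (auto simp: nn_integral_cmult)
  finally show ?thesis .
qed

lemma nn_integral_square_combination_tendsto_0:
  fixes u :: "'i \<Rightarrow> nat \<Rightarrow> 'x \<Rightarrow> real"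
  assumes U: "finite U" and [measurable]: "\<And>i l. i \<in> U \<Longrightarrow> u i l \<in> borel_measurable M"
    and lim: "\<And>i. i \<in> U \<Longrightarrow> (\<lambda>l. \<integral>\<^sup>+x. ennreal ((u i l x)\<^sup>2) \<partial>M) \<longlonglongrightarrow> 0"
  shows "(\<lambda>l. \<integral>\<^sup>+x. ennreal ((\<Sum>i\<in>U. a i * u i l x)\<^sup>2) \<partial>M) \<longlonglongrightarrow> 0"
  using assms
proof (induction U rule: finite_induct)
  case (insert j U)
  have m[measurable]: "\<And>i l. i \<in> U \<Longrightarrow> u i l \<in> borel_measurable M" "\<And>l. u j l \<in> borel_measurable M" using insert by auto
  have IH: "(\<lambda>l. \<integral>\<^sup>+x. ennreal ((\<Sum>i\<in>U. a i * u i l x)\<^sup>2) \<partial>M) \<longlonglongrightarrow> 0" using insert by auto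
  have bd: "(\<integral>\<^sup>+x. ennreal ((\<Sum>i\<in>insert j U. a i * u i l x)\<^sup>2) \<partial>M)
     \<le> ennreal (1 + 1) * (ennreal ((a j)\<^sup>2) * (\<integral>\<^sup>+x. ennreal ((u j l x)\<^sup>2) \<partial>M)) + ennreal (1 + 1 / 1) * (\<integral>\<^sup>+x. ennreal ((\<Sum>i\<in>U. a i * u i l x)\<^sup>2) \<partial>M)" for l
  proof -
    have "(\<integral>\<^sup>+x. ennreal ((\<Sum>i\<in>insert j U. a i * u i l x)\<^sup>2) \<partial>M) = (\<integral>\<^sup>+x. ennreal ((a j * u j l x + (\<Sum>i\<in>U. a i * u i l x))\<^sup>2) \<partial>M)"
      using insert(1,2) by simp
    also have "\<dots> \<le> ennreal (1 + 1) * (\<integral>\<^sup>+x. ennreal ((a j * u j l x)\<^sup>2) \<partial>M) + ennreal (1 + 1 / 1) * (\<integral>\<^sup>+x. ennreal ((\<Sum>i\<in>U. a i * u i l x)\<^sup>2) \<partial>M)"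
      by (rule nn_integral_square_add_le) auto
    also have "(\<integral>\<^sup>+x. ennreal ((a j * u j l x)\<^sup>2) \<partial>M) = ennreal ((a j)\<^sup>2) * (\<integral>\<^sup>+x. ennreal ((u j l x)\<^sup>2) \<partial>M)"
      by (subst nn_integral_cmult[symmetric]) (auto simp: power_mult_distrib ennreal_mult)
    finally show ?thesis .
  qed
  have "(\<lambda>l. ennreal (1 + 1) * (ennreal ((a j)\<^sup>2) * (\<integral>\<^sup>+x. ennreal ((u j l x)\<^sup>2) \<partial>M)) + ennreal (1 + 1 / 1) * (\<integral>\<^sup>+x. ennreal ((\<Sum>i\<in>U. a i * u i l x)\<^sup>2) \<partial>M))
    \<longlonglongrightarrow> ennreal (1 + 1) * (ennreal ((a j)\<^sup>2) * 0) + ennreal (1 + 1 / 1) * 0"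
    using IH insert.prems(2)[of j] by (intro tendsto_add ennreal_tendsto_cmult) auto
  then have lim: "(\<lambda>l. ennreal (1 + 1) * (ennreal ((a j)\<^sup>2) * (\<integral>\<^sup>+x. ennreal ((u j l x)\<^sup>2) \<partial>M)) + ennreal (1 + 1 / 1) * (\<integral>\<^sup>+x. ennreal ((\<Sum>i\<in>U. a i * u i l x)\<^sup>2) \<partial>M))
    \<longlonglongrightarrow> 0" by (simp only: mult_zero_right add_0_left)
  show ?case
    by (rule tendsto_sandwich[OF always_eventually always_eventually tendsto_const lim]) (intro allI zero_le, intro allI bd)
qed simp

text \<open>A linear combination of the coefficients is approximated by the elementary integrals of the combined step functions, whose
squared norms converge to that of \<open>\<Sum>i\<in>U. a i * e i\<close>, which is \<open>\<Sum>i\<in>U. (a i)\<^sup>2\<close> by orthonormality.\<close>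

theorem white_noise_coefficients_subgaussian:
  fixes e :: "'i \<Rightarrow> real \<Rightarrow> real"
  assumes W: "wiener_process P W" and \<sigma>: "0 < \<sigma>" and n: "0 < n" and f: "f \<in> L2_01" and U: "finite U"
    and e: "\<And>i. i \<in> U \<Longrightarrow> e i \<in> L2_01"
    and on: "\<And>i j. i \<in> U \<Longrightarrow> j \<in> U \<Longrightarrow> inner01 (e i) (e j) = (if i = j then 1 else 0)"
    and I: "\<And>i. i \<in> U \<Longrightarrow> stoch_integral P (white_noise_obs \<sigma> n f W) (e i) (I i)"
  shows "std_subgaussian P U (\<lambda>i w. sqrt n / \<sigma> * (I i w - inner01 f (e i)))"
  unfolding std_subgaussian_def
proof (intro conjI ballI allI)
  have P: "prob_space P" using W by (simp add: wiener_process_def)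
  interpret prob_space P by (rule P)
  have Im: "I i \<in> borel_measurable P" if "i \<in> U" for i using I[OF that] by (simp add: stoch_integral_def)
  define z where "z i w = sqrt n / \<sigma> * (I i w - inner01 f (e i))" for i w
  have zm: "z i \<in> borel_measurable P" if "i \<in> U" for i unfolding z_def using Im[OF that] by measurable
  then show "\<And>i. i \<in> U \<Longrightarrow> (\<lambda>w. sqrt n / \<sigma> * (I i w - inner01 f (e i))) \<in> borel_measurable P" by (simp add: z_def[abs_def])
  fix a :: "'i \<Rightarrow> real"
  have "\<forall>i. \<exists>N t c. i \<in> U \<longrightarrow> (\<forall>l. (\<forall>k\<le>N l. t l k \<in> {0..1}) \<and> (\<forall>k<N l. t l k \<le> t l (Suc k))) \<and>
    (\<lambda>l. \<integral>\<^sup>+x. ennreal (((\<Sum>k<N l. c l k * indicator {t l k<..t l (Suc k)} x) - cut01 (e i) x)\<^sup>2) \<partial>lborel) \<longlonglongrightarrow> 0 \<and>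
    (\<lambda>l. \<integral>\<^sup>+w. ennreal (((\<Sum>k<N l. c l k * (W (t l (Suc k)) w - W (t l k) w)) - z i w)\<^sup>2) \<partial>P) \<longlonglongrightarrow> 0"
    using white_noise_integral_limit[OF W \<sigma> n f e I] unfolding z_def by blast
  then obtain N :: "'i \<Rightarrow> nat \<Rightarrow> nat" and t c :: "'i \<Rightarrow> nat \<Rightarrow> nat \<Rightarrow> real" where
    H: "\<And>i. i \<in> U \<Longrightarrow> (\<forall>l. (\<forall>k\<le>N i l. t i l k \<in> {0..1}) \<and> (\<forall>k<N i l. t i l k \<le> t i l (Suc k))) \<and>
    (\<lambda>l. \<integral>\<^sup>+x. ennreal (((\<Sum>k<N i l. c i l k * indicator {t i l k<..t i l (Suc k)} x) - cut01 (e i) x)\<^sup>2) \<partial>lborel) \<longlonglongrightarrow> 0 \<and>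
    (\<lambda>l. \<integral>\<^sup>+w. ennreal (((\<Sum>k<N i l. c i l k * (W (t i l (Suc k)) w - W (t i l k) w)) - z i w)\<^sup>2) \<partial>P) \<longlonglongrightarrow> 0"
    by (simp only: choice_iff) blast
  define St where "St i l x = (\<Sum>k<N i l. c i l k * indicator {t i l k<..t i l (Suc k)} x)" for i l x
  define El where "El i l w = (\<Sum>k<N i l. c i l k * (W (t i l (Suc k)) w - W (t i l k) w))" for i l w
  have nodes: "t i l k \<in> {0..1}" if "i \<in> U" "k \<le> N i l" for i l k using H[OF that(1)] that(2) by blast
  have nodes2: "t i l k \<le> t i l (Suc k)" if "i \<in> U" "k < N i l" for i l k using H[OF that(1)] that(2) by blast
  have Slim: "(\<lambda>l. \<integral>\<^sup>+x. ennreal ((St i l x - cut01 (e i) x)\<^sup>2) \<partial>lborel) \<longlonglongrightarrow> 0" if "i \<in> U" for i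
    using H[OF that] by (simp add: St_def)
  have Elim: "(\<lambda>l. \<integral>\<^sup>+w. ennreal ((El i l w - z i w)\<^sup>2) \<partial>P) \<longlonglongrightarrow> 0" if "i \<in> U" for i
    using H[OF that] by (simp add: El_def)
  have Wm: "W (t i l k) \<in> borel_measurable P" if "i \<in> U" "k \<le> N i l" for i l k
    using W nodes[OF that] by (simp add: wiener_process_def)
  have Elm: "El i l \<in> borel_measurable P" if "i \<in> U" for i l
    unfolding El_def using Wm[OF that] by (intro borel_measurable_sum borel_measurable_times borel_measurable_diff) auto
  have Sm: "St i l \<in> borel_measurable lborel" for i l unfolding St_def by measurable
  have em: "sq_int (cut01 (e i))" if "i \<in> U" for i using e[OF that] by (simp add: L2_01_iff)
  define V where "V l w = (\<Sum>i\<in>U. a i * El i l w)" for l w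
  define X where "X w = (\<Sum>i\<in>U. a i * z i w)" for w
  define G where "G x = (\<Sum>i\<in>U. a i * cut01 (e i) x)" for x
  define T where "T l x = (\<Sum>i\<in>U. a i * St i l x)" for l x
  have Gsq: "sq_int G" unfolding G_def using em by (intro sq_int_sum sq_int_scale)
  have Gm: "G \<in> borel_measurable lborel" using Gsq by (simp add: sq_int_def)
  have Tm: "T l \<in> borel_measurable lborel" for l unfolding T_def using Sm by measurable
  have Vlim: "(\<lambda>l. \<integral>\<^sup>+w. ennreal ((V l w - X w)\<^sup>2) \<partial>P) \<longlonglongrightarrow> 0"
    using nn_integral_square_combination_tendsto_0[OF U, of "\<lambda>i l w. El i l w - z i w" P a] Elim Elm zm
    by (simp add: V_def X_def sum_subtractf right_diff_distrib)
  have Tlim: "(\<lambda>l. \<integral>\<^sup>+x. ennreal ((T l x - G x)\<^sup>2) \<partial>lborel) \<longlonglongrightarrow> 0"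
  proof -
    have m: "(\<lambda>x. St i l x - cut01 (e i) x) \<in> borel_measurable lborel" if "i \<in> U" for i l
      using Sm em[OF that] by (intro borel_measurable_diff) (auto simp: sq_int_def)
    show ?thesis
      using nn_integral_square_combination_tendsto_0[where u="\<lambda>i l x. St i l x - cut01 (e i) x" and a=a, OF U m Slim]
      by (simp add: T_def G_def sum_subtractf right_diff_distrib)
  qed
  define \<kappa> where "\<kappa> = (\<Sum>i\<in>U. (a i)\<^sup>2)"
  have Gint: "(\<integral>\<^sup>+x. ennreal ((G x)\<^sup>2) \<partial>lborel) = ennreal \<kappa>"
  proof -
    have "(\<integral>x. (G x)\<^sup>2 \<partial>lborel) = (\<integral>x. (\<Sum>i\<in>U. \<Sum>j\<in>U. (a i * a j) * (cut01 (e i) x * cut01 (e j) x)) \<partial>lborel)"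
      unfolding G_def power2_eq_square sum_product by (simp only: mult_ac)
    also have "\<dots> = (\<Sum>i\<in>U. \<Sum>j\<in>U. (a i * a j) * inner01 (e i) (e j))"
      using sq_int_mult[OF em em] by (simp add: inner01_eq)
    also have "\<dots> = (\<Sum>i\<in>U. \<Sum>j\<in>U. if j = i then (a i)\<^sup>2 else 0)"
      using on by (intro sum.cong refl) (auto simp: power2_eq_square)
    also have "\<dots> = \<kappa>" using U by (simp add: \<kappa>_def)
    finally show ?thesis by (simp add: nn_integral_square_eq[OF Gsq])
  qed
  have "\<exists>v. 0 \<le> v \<and> (\<integral>\<^sup>+x. ennreal ((T l x)\<^sup>2) \<partial>lborel) = ennreal v \<and> (\<integral>\<^sup>+w. ennreal (exp (V l w)) \<partial>P) = ennreal (exp (v / 2))" for l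
  proof -
    define Q where "Q = (SIGMA i:U. {..<N i l})"
    have Q: "finite Q" using U by (simp add: Q_def)
    have T: "T l x = (\<Sum>q\<in>Q. (a (fst q) * c (fst q) l (snd q)) * indicator {t (fst q) l (snd q)<..t (fst q) l (Suc (snd q))} x)" for x
      unfolding Q_def T_def St_def sum_distrib_left mult.assoc[symmetric] using U
      by (subst sum.Sigma) (auto simp only: split_def finite_lessThan)
    have V: "V l w = (\<Sum>q\<in>Q. (a (fst q) * c (fst q) l (snd q)) * (W (t (fst q) l (Suc (snd q))) w - W (t (fst q) l (snd q)) w))" for w
      unfolding Q_def V_def El_def sum_distrib_left mult.assoc[symmetric] using U
      by (subst sum.Sigma) (auto simp only: split_def finite_lessThan)
    have b: "t (fst q) l (snd q) \<in> {0..1} \<and> t (fst q) l (Suc (snd q)) \<in> {0..1} \<and> t (fst q) l (snd q) \<le> t (fst q) l (Suc (snd q))" if "q \<in> Q" for q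
      using that nodes[of "fst q" "snd q" l] nodes[of "fst q" "Suc (snd q)" l] nodes2[of "fst q" "snd q" l] by (auto simp: Q_def)
    obtain v where "0 \<le> v"
      "(\<integral>\<^sup>+x. ennreal ((\<Sum>q\<in>Q. (a (fst q) * c (fst q) l (snd q)) * indicator {t (fst q) l (snd q)<..t (fst q) l (Suc (snd q))} x)\<^sup>2) \<partial>lborel) = ennreal v"
      "(\<integral>\<^sup>+w. ennreal (exp (\<Sum>q\<in>Q. (a (fst q) * c (fst q) l (snd q)) * (W (t (fst q) l (Suc (snd q))) w - W (t (fst q) l (snd q)) w))) \<partial>P) = ennreal (exp (v / 2))"
      by (rule elementary_integral_mgf[where c="\<lambda>q. a (fst q) * c (fst q) l (snd q)" and lo="\<lambda>q. t (fst q) l (snd q)" and hi="\<lambda>q. t (fst q) l (Suc (snd q))", OF W Q b])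
    then show ?thesis unfolding T[symmetric] V[symmetric] by blast
  qed
  then have "\<forall>l. \<exists>v. 0 \<le> v \<and> (\<integral>\<^sup>+x. ennreal ((T l x)\<^sup>2) \<partial>lborel) = ennreal v \<and> (\<integral>\<^sup>+w. ennreal (exp (V l w)) \<partial>P) = ennreal (exp (v / 2))" ..
  from choice[OF this] obtain v where v': "\<forall>l. 0 \<le> v l \<and> (\<integral>\<^sup>+x. ennreal ((T l x)\<^sup>2) \<partial>lborel) = ennreal (v l) \<and> (\<integral>\<^sup>+w. ennreal (exp (V l w)) \<partial>P) = ennreal (exp (v l / 2))"
    by blast
  then have v: "\<And>l. 0 \<le> v l" "\<And>l. (\<integral>\<^sup>+x. ennreal ((T l x)\<^sup>2) \<partial>lborel) = ennreal (v l)"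
    "\<And>l. (\<integral>\<^sup>+w. ennreal (exp (V l w)) \<partial>P) = ennreal (exp (v l / 2))" by auto
  have \<kappa>0: "0 \<le> \<kappa>" by (simp add: \<kappa>_def sum_nonneg)
  have vlim: "eventually (\<lambda>l. v l \<le> \<kappa> + \<eta>) sequentially" if \<eta>: "0 < \<eta>" for \<eta>
  proof -
    (* h is small enough that (1 + h) * kappa exceeds kappa by at most half of eta *)
    define h where "h = (\<eta> / 2) / (\<kappa> + 1)"
    have h1: "0 < h" using \<eta> \<kappa>0 by (simp add: h_def)
    have "h * \<kappa> \<le> h * (\<kappa> + 1)" using h1 by simp
    also have "\<dots> = \<eta> / 2"
    proof -
      have nz: "\<kappa> + 1 \<noteq> 0" using \<kappa>0 by linarith
      show ?thesis using h_def by (simp only: nonzero_eq_divide_eq[OF nz])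
    qed
    finally have h: "0 < h" "h * \<kappa> \<le> \<eta> / 2" using h1 by auto
    have "(\<lambda>l. ennreal (1 + 1 / h) * (\<integral>\<^sup>+x. ennreal ((T l x - G x)\<^sup>2) \<partial>lborel)) \<longlonglongrightarrow> ennreal (1 + 1 / h) * 0"
      using Tlim by (intro ennreal_tendsto_cmult) auto
    then have lim0: "(\<lambda>l. ennreal (1 + 1 / h) * (\<integral>\<^sup>+x. ennreal ((T l x - G x)\<^sup>2) \<partial>lborel)) \<longlonglongrightarrow> 0" by simp
    have "ennreal 0 < ennreal (\<eta> / 2)" using \<eta> by (intro ennreal_lessI) auto
    then have "0 < ennreal (\<eta> / 2)" by (simp only: ennreal_0)
    from order_tendstoD(2)[OF lim0 this]
    have "eventually (\<lambda>l. ennreal (1 + 1 / h) * (\<integral>\<^sup>+x. ennreal ((T l x - G x)\<^sup>2) \<partial>lborel) < ennreal (\<eta> / 2)) sequentially" .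
    then show ?thesis
    proof eventually_elim
      case (elim l)
      have "ennreal (v l) = (\<integral>\<^sup>+x. ennreal ((G x + (T l x - G x))\<^sup>2) \<partial>lborel)" by (simp add: v(2)[symmetric])
      also have "\<dots> \<le> ennreal (1 + h) * (\<integral>\<^sup>+x. ennreal ((G x)\<^sup>2) \<partial>lborel) + ennreal (1 + 1 / h) * (\<integral>\<^sup>+x. ennreal ((T l x - G x)\<^sup>2) \<partial>lborel)"
        by (rule nn_integral_square_add_le[OF Gm borel_measurable_diff[OF Tm Gm] h(1)])
      also have "\<dots> \<le> ennreal (1 + h) * ennreal \<kappa> + ennreal (\<eta> / 2)"
        unfolding Gint using elim by (intro add_mono order_refl less_imp_le)
      also have "\<dots> = ennreal ((1 + h) * \<kappa> + \<eta> / 2)"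
      proof -
        have "ennreal ((1 + h) * \<kappa>) = ennreal (1 + h) * ennreal \<kappa>" using h \<kappa>0 by (intro ennreal_mult) auto
        moreover have "ennreal ((1 + h) * \<kappa> + \<eta> / 2) = ennreal ((1 + h) * \<kappa>) + ennreal (\<eta> / 2)"
          using h \<kappa>0 \<eta> by (intro ennreal_plus mult_nonneg_nonneg) auto
        ultimately show ?thesis by (simp only:)
      qed
      finally have le: "ennreal (v l) \<le> ennreal ((1 + h) * \<kappa> + \<eta> / 2)" .
      have "0 \<le> (1 + h) * \<kappa> + \<eta> / 2" using h \<kappa>0 \<eta> by (intro add_nonneg_nonneg mult_nonneg_nonneg) auto
      from le this have "v l \<le> (1 + h) * \<kappa> + \<eta> / 2" by (simp only: ennreal_le_iff)
      then show ?case using h(2) unfolding distrib_right by linarith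
    qed
  qed
  have "(\<integral>\<^sup>+w. ennreal (exp (X w)) \<partial>P) \<le> ennreal (exp (\<kappa> / 2))"
  proof (rule mgf_limit[OF P _ _ Vlim _ vlim])
    show "V l \<in> borel_measurable P" for l unfolding V_def using Elm by (intro borel_measurable_sum borel_measurable_times) auto
    show "X \<in> borel_measurable P" unfolding X_def using zm by (intro borel_measurable_sum borel_measurable_times) auto
  qed (simp_all only: v(3) order_refl)
  then show "(\<integral>\<^sup>+w. ennreal (exp (\<Sum>i\<in>U. a i * (sqrt n / \<sigma> * (I i w - inner01 f (e i))))) \<partial>P) \<le> ennreal (exp ((\<Sum>i\<in>U. (a i)\<^sup>2) / 2))"
    by (simp add: X_def z_def \<kappa>_def)
qed

section \<open>Parseval's identity for a complete orthonormal family\<close>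
lemma cut01_idem: "indicator {0..1} x * cut01 f x = cut01 f x"
  by (simp add: cut01_def indicator_def)

locale orthonormal_family =
  fixes e :: "'i \<Rightarrow> real \<Rightarrow> real" and I :: "'i set"
  assumes L2: "\<And>i. i \<in> I \<Longrightarrow> e i \<in> L2_01"
    and orth: "\<And>i j. i \<in> I \<Longrightarrow> j \<in> I \<Longrightarrow> inner01 (e i) (e j) = (if i = j then 1 else 0)"
begin

lemma sq: "i \<in> I \<Longrightarrow> sq_int (cut01 (e i))" using L2 by (simp add: L2_01_iff)

lemma combination_sq: "K \<subseteq> I \<Longrightarrow> sq_int (\<lambda>x. \<Sum>i\<in>K. c i * cut01 (e i) x)"
  by (intro sq_int_sum sq_int_scale sq) auto

lemma inner_combination:
  assumes "K \<subseteq> I" "finite K" "sq_int u"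
  shows "(\<integral>x. u x * (\<Sum>i\<in>K. c i * cut01 (e i) x) \<partial>lborel) = (\<Sum>i\<in>K. c i * (\<integral>x. u x * cut01 (e i) x \<partial>lborel))"
proof -
  have "(\<integral>x. u x * (\<Sum>i\<in>K. c i * cut01 (e i) x) \<partial>lborel) = (\<integral>x. (\<Sum>i\<in>K. c i * (u x * cut01 (e i) x)) \<partial>lborel)"
    by (simp only: sum_distrib_left mult.left_commute)
  also have "\<dots> = (\<Sum>i\<in>K. c i * (\<integral>x. u x * cut01 (e i) x \<partial>lborel))"
    using sq_int_mult[OF assms(3) sq] assms(1) by (subst Bochner_Integration.integral_sum) auto
  finally show ?thesis .
qed

lemma inner_combination_basis:
  assumes "K \<subseteq> I" "finite K" "j \<in> I"
  shows "(\<integral>x. cut01 (e j) x * (\<Sum>i\<in>K. c i * cut01 (e i) x) \<partial>lborel) = (if j \<in> K then c j else 0)"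
proof -
  have "(\<integral>x. cut01 (e j) x * (\<Sum>i\<in>K. c i * cut01 (e i) x) \<partial>lborel) = (\<Sum>i\<in>K. c i * inner01 (e j) (e i))"
    using inner_combination[OF assms(1,2) sq[OF assms(3)], of c] by (simp add: inner01_eq)
  also have "\<dots> = (\<Sum>i\<in>K. if i = j then c i else 0)"
    using orth[OF assms(3)] assms(1) by (intro sum.cong refl) auto
  also have "\<dots> = (if j \<in> K then c j else 0)" using assms(2) by simp
  finally show ?thesis .
qed

lemma combination_norm:
  assumes "K \<subseteq> I" "finite K"
  shows "(\<integral>x. (\<Sum>i\<in>K. c i * cut01 (e i) x)\<^sup>2 \<partial>lborel) = (\<Sum>i\<in>K. (c i)\<^sup>2)"
proof -
  have "(\<integral>x. (\<Sum>i\<in>K. c i * cut01 (e i) x)\<^sup>2 \<partial>lborel) = (\<Sum>i\<in>K. c i * (\<integral>x. (\<Sum>i\<in>K. c i * cut01 (e i) x) * cut01 (e i) x \<partial>lborel))"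
    unfolding power2_eq_square by (rule inner_combination[OF assms combination_sq[OF assms(1)]])
  also have "\<dots> = (\<Sum>i\<in>K. (c i)\<^sup>2)"
    using inner_combination_basis[OF assms, of _ c] assms(1)
    by (intro sum.cong refl) (auto simp: mult.commute[of "sum _ _"] power2_eq_square)
  finally show ?thesis .
qed

lemma distance_to_combination:
  assumes "K \<subseteq> I" "finite K" "f \<in> L2_01"
  shows "(\<integral>x. (cut01 f x - (\<Sum>i\<in>K. c i * cut01 (e i) x))\<^sup>2 \<partial>lborel)
    = (\<integral>x. (cut01 f x)\<^sup>2 \<partial>lborel) - (\<Sum>i\<in>K. (inner01 f (e i))\<^sup>2) + (\<Sum>i\<in>K. (c i - inner01 f (e i))\<^sup>2)"
proof -
  define h where "h x = (\<Sum>i\<in>K. c i * cut01 (e i) x)" for x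
  have h: "sq_int h" unfolding h_def using assms(1) by (rule combination_sq)
  have f: "sq_int (cut01 f)" using assms(3) by (simp add: L2_01_iff)
  have "(\<integral>x. (cut01 f x - h x)\<^sup>2 \<partial>lborel) = (\<integral>x. (cut01 f x)\<^sup>2 - 2 * (cut01 f x * h x) + (h x)\<^sup>2 \<partial>lborel)"
    by (intro Bochner_Integration.integral_cong) (auto simp: power2_eq_square algebra_simps)
  also have "\<dots> = (\<integral>x. (cut01 f x)\<^sup>2 \<partial>lborel) - 2 * (\<integral>x. cut01 f x * h x \<partial>lborel) + (\<integral>x. (h x)\<^sup>2 \<partial>lborel)"
    using sq_int_integrable[OF f] sq_int_integrable[OF h] sq_int_mult[OF f h] by simp
  also have "(\<integral>x. cut01 f x * h x \<partial>lborel) = (\<Sum>i\<in>K. c i * inner01 f (e i))"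
    unfolding h_def inner_combination[OF assms(1,2) f] by (simp add: inner01_eq)
  also have "(\<integral>x. (h x)\<^sup>2 \<partial>lborel) = (\<Sum>i\<in>K. (c i)\<^sup>2)"
    unfolding h_def by (rule combination_norm[OF assms(1,2)])
  finally have 1: "(\<integral>x. (cut01 f x - h x)\<^sup>2 \<partial>lborel)
     = (\<integral>x. (cut01 f x)\<^sup>2 \<partial>lborel) - 2 * (\<Sum>i\<in>K. c i * inner01 f (e i)) + (\<Sum>i\<in>K. (c i)\<^sup>2)" .
  have 2: "(\<Sum>i\<in>K. (c i - inner01 f (e i))\<^sup>2)
     = (\<Sum>i\<in>K. (c i)\<^sup>2) + (\<Sum>i\<in>K. (inner01 f (e i))\<^sup>2) - 2 * (\<Sum>i\<in>K. c i * inner01 f (e i))"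
    by (simp add: power2_diff sum.distrib sum_subtractf sum_distrib_left mult.assoc)
  show ?thesis unfolding h_def[symmetric] 1 2 by simp
qed

text \<open>The Riesz-Fischer argument. The partial sums are Cauchy in \<open>L\<^sup>2\<close>, hence in \<open>L\<^sup>1\<close> on the unit interval, so a
subsequence converges almost everywhere to some \<open>H\<close>; Fatou's lemma shows that the convergence is in \<open>L\<^sup>2\<close>. The
difference \<open>f - H\<close> is orthogonal to the family and vanishes by completeness.\<close>

lemma parseval_limit:
  assumes K: "\<And>L. finite (K L)" "\<And>L. K L \<subseteq> K (Suc L)" "I = (\<Union>L. K L)"
    and complete: "\<And>g. g \<in> L2_01 \<Longrightarrow> (\<And>i. i \<in> I \<Longrightarrow> inner01 g (e i) = 0) \<Longrightarrow> AE x in lborel. x \<in> {0..1} \<longrightarrow> g x = 0"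
    and f: "f \<in> L2_01"
  shows "(\<lambda>L. \<Sum>i\<in>K L. (inner01 f (e i))\<^sup>2) \<longlonglongrightarrow> (\<integral>x. (cut01 f x)\<^sup>2 \<partial>lborel)"
proof -
  define \<theta> where "\<theta> i = inner01 f (e i)" for i
  define h where "h L x = (\<Sum>i\<in>K L. \<theta> i * cut01 (e i) x)" for L x
  define s where "s L = (\<Sum>i\<in>K L. (\<theta> i)\<^sup>2)" for L
  define A where "A = (\<integral>x. (cut01 f x)\<^sup>2 \<partial>lborel)"
  have KI: "K L \<subseteq> I" for L using K(3) by auto
  have Kmono: "K L \<subseteq> K L'" if "L \<le> L'" for L L' using that by (rule lift_Suc_mono_le[of K, OF K(2)])
  have hs: "sq_int (h L)" for L unfolding h_def by (rule combination_sq[OF KI])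
  note hm[measurable] = sq_intD[OF hs]
  have fs: "sq_int (cut01 f)" using f by (simp add: L2_01_iff)
  have dist: "(\<integral>x. (cut01 f x - h L x)\<^sup>2 \<partial>lborel) = A - s L" for L
    unfolding h_def using distance_to_combination[OF KI K(1) f, of \<theta> L] by (simp add: \<theta>_def[symmetric] A_def s_def)
  have sA: "s L \<le> A" for L
    using dist[of L] integral_nonneg_AE[of "\<lambda>x. (cut01 f x - h L x)\<^sup>2" lborel] by simp
  have smono: "s L \<le> s L'" if "L \<le> L'" for L L'
    unfolding s_def by (intro sum_mono2 K(1) Kmono that) auto
  obtain S where S: "s \<longlonglongrightarrow> S"
  proof -
    have "incseq s" using smono by (auto simp: incseq_def)
    from incseq_convergent[OF this, of A] sA that show ?thesis by blast
  qed
  have sS: "s L \<le> S" for L using incseq_le[OF _ S] smono by (auto simp: incseq_def)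
  have hd: "(\<integral>x. (h L' x - h L x)\<^sup>2 \<partial>lborel) = s L' - s L" if "L \<le> L'" for L L'
  proof -
    have "h L' x - h L x = (\<Sum>i\<in>K L' - K L. \<theta> i * cut01 (e i) x)" for x
      unfolding h_def using sum_diff[OF K(1)[of L'] Kmono[OF that], of "\<lambda>i. \<theta> i * cut01 (e i) x"] by simp
    then have "(\<integral>x. (h L' x - h L x)\<^sup>2 \<partial>lborel) = (\<Sum>i\<in>K L' - K L. (\<theta> i)\<^sup>2)"
      using combination_norm[of "K L' - K L" \<theta>] KI K(1) by auto
    also have "\<dots> = s L' - s L" unfolding s_def by (rule sum_diff[OF K(1) Kmono[OF that]])
    finally show ?thesis .
  qed
  have supp: "indicator {0..1} x * h L x = h L x" for L x
    by (simp add: h_def sum_distrib_left mult.left_commute cut01_idem)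
  have ind: "sq_int (indicator {0..1} :: real \<Rightarrow> real)"
  proof -
    have "(indicator {0..1} x)\<^sup>2 = (indicator {0..1} x :: real)" for x :: real by (simp add: indicator_def)
    then show ?thesis unfolding sq_int_def by (auto intro!: integrable_real_indicator)
  qed
  have hint: "integrable lborel (h L)" for L
    using sq_int_mult[OF ind hs, of L] by (simp add: supp)
  have L1: "(\<integral>x. norm (h L' x - h L x) \<partial>lborel) \<le> sqrt (s L' - s L)" if "L \<le> L'" for L L'
  proof (rule real_le_rsqrt)
    have d: "sq_int (\<lambda>x. \<bar>h L' x - h L x\<bar>)"
      using sq_int_diff[OF hs[of L'] hs[of L]] by (auto simp: sq_int_def)
    have "(\<integral>x. norm (h L' x - h L x) \<partial>lborel) = (\<integral>x. indicator {0..1} x * \<bar>h L' x - h L x\<bar> \<partial>lborel)"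
    proof (intro Bochner_Integration.integral_cong refl)
      fix x
      have "indicator {0..1} x * \<bar>h L' x - h L x\<bar> = \<bar>indicator {0..1} x * h L' x - indicator {0..1} x * h L x\<bar>"
        by (auto simp: indicator_def)
      then show "norm (h L' x - h L x) = indicator {0..1} x * \<bar>h L' x - h L x\<bar>" by (simp add: supp)
    qed
    also have "\<dots>\<^sup>2 \<le> (\<integral>x. (indicator {0..1::real} x)\<^sup>2 \<partial>lborel) * (\<integral>x. \<bar>h L' x - h L x\<bar>\<^sup>2 \<partial>lborel)"
      using Cauchy_Schwarz_integral[OF ind d] by simp
    also have "(\<integral>x. (indicator {0..1::real} x :: real)\<^sup>2 \<partial>lborel) = 1"
    proof -
      have "(indicator {0..1} x :: real)\<^sup>2 = indicator {0..1} x" for x :: real by (simp add: indicator_def)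
      then show ?thesis by simp
    qed
    finally show "(\<integral>x. norm (h L' x - h L x) \<partial>lborel)\<^sup>2 \<le> s L' - s L" using hd[OF that] by simp
  qed
  have cauchy: "\<exists>N. \<forall>i\<ge>N. \<forall>j\<ge>N. (\<integral>x. norm (h i x - h j x) \<partial>lborel) < \<eta>" if "0 < \<eta>" for \<eta>
  proof -
    have "eventually (\<lambda>L. S - \<eta>\<^sup>2 < s L) sequentially" using S that by (intro order_tendstoD) auto
    then obtain N where N: "\<And>L. N \<le> L \<Longrightarrow> S - \<eta>\<^sup>2 < s L" by (auto simp: eventually_sequentially)
    have lt: "(\<integral>x. norm (h j x - h i x) \<partial>lborel) < \<eta>" if "N \<le> i" "i \<le> j" for i j
    proof -
      have "sqrt (s j - s i) < \<eta>"
        using N[OF that(1)] sS[of j] \<open>0 < \<eta>\<close> by (intro real_less_lsqrt) auto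
      then show ?thesis using L1[OF that(2)] by simp
    qed
    have "(\<integral>x. norm (h i x - h j x) \<partial>lborel) < \<eta>" if "N \<le> i" "N \<le> j" for i j
      using lt[of i j] lt[of j i] that by (cases "i \<le> j") (auto simp: abs_minus_commute)
    then show ?thesis by blast
  qed
  obtain r where r: "strict_mono r" "AE x in lborel. Cauchy (\<lambda>i. h (r i) x)"
    using cauchy_L1_AE_cauchy_subseq[OF hint cauchy] by blast
  define H where "H x = lim (\<lambda>i. h (r i) x)" for x
  have Hm[measurable]: "H \<in> borel_measurable lborel" unfolding H_def by measurable
  have conv: "AE x in lborel. (\<lambda>i. h (r i) x) \<longlonglongrightarrow> H x"
    using r(2) by eventually_elim (auto simp: H_def convergent_LIMSEQ_iff[symmetric] Cauchy_convergent_iff)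
  (* Fatou along the subsequence, with the distances between partial sums known exactly *)
  have HhL: "(\<integral>\<^sup>+x. ennreal ((H x - h L x)\<^sup>2) \<partial>lborel) \<le> ennreal (S - s L)" for L
  proof -
    have "(\<integral>\<^sup>+x. ennreal ((H x - h L x)\<^sup>2) \<partial>lborel) = (\<integral>\<^sup>+x. liminf (\<lambda>i. ennreal ((h (r i) x - h L x)\<^sup>2)) \<partial>lborel)"
    proof (rule nn_integral_cong_AE)
      show "AE x in lborel. ennreal ((H x - h L x)\<^sup>2) = liminf (\<lambda>i. ennreal ((h (r i) x - h L x)\<^sup>2))"
        using conv
      proof eventually_elim
        case (elim x)
        then have "(\<lambda>i. ennreal ((h (r i) x - h L x)\<^sup>2)) \<longlonglongrightarrow> ennreal ((H x - h L x)\<^sup>2)"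
          by (intro tendsto_intros)
        then show ?case by (intro lim_imp_Liminf[symmetric]) auto
      qed
    qed
    also have "\<dots> \<le> liminf (\<lambda>i. \<integral>\<^sup>+x. ennreal ((h (r i) x - h L x)\<^sup>2) \<partial>lborel)"
      by (rule nn_integral_liminf) measurable
    also have "\<dots> \<le> liminf (\<lambda>i. ennreal (S - s L))"
    proof (rule Liminf_mono)
      have "(\<integral>\<^sup>+x. ennreal ((h (r i) x - h L x)\<^sup>2) \<partial>lborel) \<le> ennreal (S - s L)" if "L \<le> i" for i
      proof -
        have "L \<le> r i" using that seq_suble[OF r(1), of i] by simp
        then show ?thesis
          using sS[of "r i"] by (subst nn_integral_square_eq[OF sq_int_diff[OF hs hs]]) (auto simp: hd intro!: ennreal_leI)
      qed
      then show "eventually (\<lambda>i. (\<integral>\<^sup>+x. ennreal ((h (r i) x - h L x)\<^sup>2) \<partial>lborel) \<le> ennreal (S - s L)) sequentially"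
        unfolding eventually_sequentially by blast
    qed
    also have "\<dots> = ennreal (S - s L)" by (simp add: Liminf_const)
    finally show ?thesis .
  qed
  have Hh: "sq_int (\<lambda>x. H x - h L x)" for L
    unfolding sq_int_def
  proof
    show "integrable lborel (\<lambda>x. (H x - h L x)\<^sup>2)"
      using HhL[of L] by (intro integrableI_nonneg) (auto intro: le_less_trans)
  qed measurable
  have Hs: "sq_int H" using sq_int_add[OF Hh[of 0] hs[of 0]] by simp
  have Hint: "(\<integral>x. (H x - h L x)\<^sup>2 \<partial>lborel) \<le> S - s L" for L
    using HhL[of L] sS[of L] by (simp add: nn_integral_square_eq[OF Hh] )
  have Hlim: "(\<lambda>L. \<integral>x. (H x - h L x)\<^sup>2 \<partial>lborel) \<longlonglongrightarrow> 0"
  proof (rule tendsto_sandwich[OF _ _ tendsto_const])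
    show "(\<lambda>L. S - s L) \<longlonglongrightarrow> 0" using tendsto_diff[OF tendsto_const S, of S] by simp
  qed (use Hint in auto)
  define g where "g x = f x - H x" for x
  have cutH: "sq_int (cut01 H)"
  proof -
    have "(\<lambda>x. (cut01 H x)\<^sup>2) = (\<lambda>x. indicator {0..1} x *\<^sub>R (H x)\<^sup>2)" by (auto simp: cut01_def indicator_def fun_eq_iff)
    moreover have "integrable lborel (\<lambda>x. indicator {0..1} x *\<^sub>R (H x)\<^sup>2)"
      using sq_int_integrable[OF Hs] by (intro integrable_mult_indicator) auto
    ultimately show ?thesis by (auto simp: sq_int_def cut01_def[abs_def])
  qed
  have cg: "cut01 g x = cut01 f x - cut01 H x" for x by (simp add: cut01_def g_def algebra_simps)
  have gL: "g \<in> L2_01" using sq_int_diff[OF fs cutH] by (simp add: L2_01_iff cg[abs_def])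
  have "inner01 g (e i) = 0" if i: "i \<in> I" for i
  proof -
    have Hi: "(\<integral>x. cut01 H x * cut01 (e i) x \<partial>lborel) = (\<integral>x. H x * cut01 (e i) x \<partial>lborel)"
      by (intro Bochner_Integration.integral_cong) (auto simp: cut01_def indicator_def)
    have "inner01 g (e i) = \<theta> i - (\<integral>x. H x * cut01 (e i) x \<partial>lborel)"
      unfolding inner01_eq cg left_diff_distrib \<theta>_def Hi[symmetric]
      using sq_int_mult[OF fs sq[OF i]] sq_int_mult[OF cutH sq[OF i]] by simp
    moreover have "(\<integral>x. H x * cut01 (e i) x \<partial>lborel) = \<theta> i"
    proof -
      obtain L0 where L0: "i \<in> K L0" using i K(3) by auto
      have eq: "(\<integral>x. (H x - h L x) * cut01 (e i) x \<partial>lborel) = (\<integral>x. H x * cut01 (e i) x \<partial>lborel) - \<theta> i" if "L0 \<le> L" for L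
      proof -
        have "i \<in> K L" using L0 Kmono[OF that] by auto
        then have "(\<integral>x. h L x * cut01 (e i) x \<partial>lborel) = \<theta> i"
          unfolding h_def using inner_combination_basis[OF KI[of L] K(1)[of L] i, where c=\<theta>] by (simp add: mult.commute)
        then show ?thesis
          unfolding left_diff_distrib using sq_int_mult[OF Hs sq[OF i]] sq_int_mult[OF hs[of L] sq[OF i]] by simp
      qed
      have one: "(\<integral>x. (cut01 (e i) x)\<^sup>2 \<partial>lborel) = 1"
        using orth[OF i i] by (simp add: inner01_eq power2_eq_square)
      have "((\<integral>x. H x * cut01 (e i) x \<partial>lborel) - \<theta> i)\<^sup>2 \<le> (\<integral>x. (H x - h L x)\<^sup>2 \<partial>lborel)" if "L0 \<le> L" for L
        using Cauchy_Schwarz_integral[OF Hh[of L] sq[OF i]] by (simp add: eq[OF that] one)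
      then have "((\<integral>x. H x * cut01 (e i) x \<partial>lborel) - \<theta> i)\<^sup>2 \<le> 0"
        using Hlim by (intro tendsto_lowerbound[OF Hlim]) (auto simp: eventually_sequentially)
      then show ?thesis by simp
    qed
    ultimately show ?thesis by simp
  qed
  then have ae: "AE x in lborel. x \<in> {0..1} \<longrightarrow> g x = 0" using complete[OF gL] by blast
  (* the limit inherits the support of the partial sums, so that cut01 H and H agree almost everywhere *)
  have outside: "AE x in lborel. x \<notin> {0..1} \<longrightarrow> H x = 0"
    using conv
  proof eventually_elim
    case (elim x)
    have "h L x = 0" if "x \<notin> {0..1}" for L using supp[of x L] that by simp
    then show ?case using elim LIMSEQ_unique[OF elim] by (auto simp: tendsto_const)
  qed
  have "(\<integral>x. (H x - h L x)\<^sup>2 \<partial>lborel) = A - s L" for L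
  proof -
    have "AE x in lborel. (H x - h L x)\<^sup>2 = (cut01 f x - h L x)\<^sup>2"
      using ae outside by eventually_elim (auto simp: g_def cut01_def indicator_def)
    then have "(\<integral>x. (H x - h L x)\<^sup>2 \<partial>lborel) = (\<integral>x. (cut01 f x - h L x)\<^sup>2 \<partial>lborel)"
      using sq_intD[OF Hh] sq_intD[OF sq_int_diff[OF fs hs]] by (intro integral_cong_AE) (auto simp: measurable_lborel2)
    then show ?thesis by (simp add: dist)
  qed
  then have "(\<lambda>L. A - s L) \<longlonglongrightarrow> 0" using Hlim by simp
  from tendsto_diff[OF tendsto_const[of A] this] show ?thesis
    by (simp add: s_def A_def \<theta>_def)
qed

end

section \<open>Lagrange interpolation and finite differences\<close>
text \<open>The Lagrange interpolation polynomial with nodes \<open>\<xi> t\<close> and values \<open>a t\<close>, for \<open>t < m\<close>.\<close>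

definition lagrange :: "nat \<Rightarrow> (nat \<Rightarrow> real) \<Rightarrow> (nat \<Rightarrow> real) \<Rightarrow> real \<Rightarrow> real" where
  "lagrange m \<xi> a y = (\<Sum>t<m. a t * (\<Prod>s\<in>{..<m} - {t}. (y - \<xi> s) / (\<xi> t - \<xi> s)))"

lemma lagrange_is_poly:
  assumes "0 < m"
  shows "\<exists>P. degree P < m \<and> (\<forall>y. lagrange m \<xi> a y = poly P y)"
proof -
  define P where "P = (\<Sum>t<m. smult (a t) (\<Prod>s\<in>{..<m} - {t}. smult (1 / (\<xi> t - \<xi> s)) [:- \<xi> s, 1:]))"
  have "degree P \<le> m - 1"
    unfolding P_def
  proof (rule degree_sum_le)
    fix t assume t: "t \<in> {..<m}"
    have "degree (\<Prod>s\<in>{..<m} - {t}. smult (1 / (\<xi> t - \<xi> s)) [:- \<xi> s, 1:])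
       \<le> (\<Sum>s\<in>{..<m} - {t}. degree (smult (1 / (\<xi> t - \<xi> s)) [:- \<xi> s, 1:]))"
      using degree_prod_sum_le[of "{..<m} - {t}" "\<lambda>s. smult (1 / (\<xi> t - \<xi> s)) [:- \<xi> s, 1:]"] by (simp add: comp_def)
    also have "\<dots> \<le> (\<Sum>s\<in>{..<m} - {t}. 1)"
      by (intro sum_mono order_trans[OF degree_smult_le]) simp
    also have "\<dots> = m - 1" using t by (simp add: card_Diff_singleton)
    finally show "degree (smult (a t) (\<Prod>s\<in>{..<m} - {t}. smult (1 / (\<xi> t - \<xi> s)) [:- \<xi> s, 1:])) \<le> m - 1"
      using degree_smult_le order_trans by blast
  qed simp
  moreover have "lagrange m \<xi> a y = poly P y" for y
    by (simp add: lagrange_def P_def poly_sum poly_prod diff_divide_distrib)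
  ultimately show ?thesis using assms by (intro exI[of _ P]) auto
qed

lemma lagrange_interpolates:
  assumes "inj_on \<xi> {..<m}" "t < m"
  shows "lagrange m \<xi> a (\<xi> t) = a t"
proof -
  have "(\<Prod>s\<in>{..<m} - {i}. (\<xi> t - \<xi> s) / (\<xi> i - \<xi> s)) = (if i = t then 1 else 0)" if "i < m" for i
  proof (cases "i = t")
    case True
    have "(\<Prod>s\<in>{..<m} - {i}. (\<xi> t - \<xi> s) / (\<xi> i - \<xi> s)) = (\<Prod>s\<in>{..<m} - {i}. 1)"
    proof (intro prod.cong refl)
      fix s assume "s \<in> {..<m} - {i}"
      then have "\<xi> t \<noteq> \<xi> s" using inj_onD[OF assms(1), of t s] assms(2) True by auto
      then show "(\<xi> t - \<xi> s) / (\<xi> i - \<xi> s) = 1" using True by simp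
    qed
    then show ?thesis using True by simp
  next
    case False
    then have "\<exists>s\<in>{..<m} - {i}. (\<xi> t - \<xi> s) / (\<xi> i - \<xi> s) = 0" using assms(2) by (intro bexI[of _ t]) auto
    then show ?thesis using False by (simp add: prod_zero)
  qed
  then have "lagrange m \<xi> a (\<xi> t) = (\<Sum>i<m. if i = t then a i else 0)"
    unfolding lagrange_def by (intro sum.cong refl) auto
  then show ?thesis using assms(2) by simp
qed

lemma lagrange_reproduces_poly:
  assumes "inj_on \<xi> {..<m}" "degree P < m"
  shows "lagrange m \<xi> (\<lambda>t. poly P (\<xi> t)) y = poly P y"
proof -
  obtain Q where Q: "degree Q < m" "\<And>y. lagrange m \<xi> (\<lambda>t. poly P (\<xi> t)) y = poly Q y"
    using lagrange_is_poly[of m \<xi> "\<lambda>t. poly P (\<xi> t)"] assms(2) by auto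
  have "Q - P = 0"
  proof (rule ccontr)
    assume nz: "Q - P \<noteq> 0"
    have "\<xi> ` {..<m} \<subseteq> {x. poly (Q - P) x = 0}"
      using lagrange_interpolates[OF assms(1), of _ "\<lambda>t. poly P (\<xi> t)"] Q(2) by auto
    then have "card (\<xi> ` {..<m}) \<le> card {x. poly (Q - P) x = 0}"
      using poly_roots_finite[OF nz] by (intro card_mono)
    also have "\<dots> \<le> degree (Q - P)" using nz by (rule card_poly_roots_bound)
    also have "\<dots> < m" using Q(1) assms(2) by (rule degree_diff_less)
    finally show False using card_image[OF assms(1)] by simp
  qed
  then show ?thesis using Q(2) by simp
qed

lemma lagrange_bound:
  assumes "\<And>s. s < m \<Longrightarrow> \<bar>y - \<xi> s\<bar> \<le> Y * h" "\<And>s t. s < m \<Longrightarrow> t < m \<Longrightarrow> s \<noteq> t \<Longrightarrow> h \<le> \<bar>\<xi> t - \<xi> s\<bar>" "0 < h" "1 \<le> Y"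
  shows "\<bar>lagrange m \<xi> a y\<bar> \<le> Y ^ m * (\<Sum>t<m. \<bar>a t\<bar>)"
proof -
  have "\<bar>lagrange m \<xi> a y\<bar> \<le> (\<Sum>t<m. \<bar>a t\<bar> * (\<Prod>s\<in>{..<m} - {t}. \<bar>y - \<xi> s\<bar> / \<bar>\<xi> t - \<xi> s\<bar>))"
    unfolding lagrange_def by (rule order_trans[OF sum_abs]) (simp add: abs_mult abs_prod)
  also have "\<dots> \<le> (\<Sum>t<m. \<bar>a t\<bar> * Y ^ m)"
  proof (intro sum_mono mult_left_mono)
    fix t assume t: "t \<in> {..<m}"
    have "(\<Prod>s\<in>{..<m} - {t}. \<bar>y - \<xi> s\<bar> / \<bar>\<xi> t - \<xi> s\<bar>) \<le> (\<Prod>s\<in>{..<m} - {t}. Y)"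
    proof (intro prod_mono conjI)
      fix s assume s: "s \<in> {..<m} - {t}"
      have h1: "h \<le> \<bar>\<xi> t - \<xi> s\<bar>" using assms(2)[of s t] s t by auto
      have "\<bar>y - \<xi> s\<bar> \<le> Y * h" using assms(1)[of s] s by auto
      also have "\<dots> \<le> Y * \<bar>\<xi> t - \<xi> s\<bar>" using h1 assms by (intro mult_left_mono) auto
      finally show "\<bar>y - \<xi> s\<bar> / \<bar>\<xi> t - \<xi> s\<bar> \<le> Y" using h1 assms(3) by (simp add: divide_le_eq)
    qed simp
    also have "\<dots> = Y ^ (m - 1)" using t by (simp add: card_Diff_singleton)
    also have "\<dots> \<le> Y ^ m" using assms(4) by (intro power_increasing) auto
    finally show "(\<Prod>s\<in>{..<m} - {t}. \<bar>y - \<xi> s\<bar> / \<bar>\<xi> t - \<xi> s\<bar>) \<le> Y ^ m" .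
  qed simp
  finally show ?thesis by (simp add: sum_distrib_right[symmetric] mult.commute)
qed

lemma lagrange_diff: "lagrange m \<xi> (\<lambda>t. a t - b t) y = lagrange m \<xi> a y - lagrange m \<xi> b y"
  by (simp add: lagrange_def left_diff_distrib sum_subtractf)

lemma fin_diff_Suc:
  "fin_diff (Suc m) h f x = fin_diff m h (\<lambda>x. f (x + h) - f x) x"
proof -
  have "fin_diff (Suc m) h f x = (\<Sum>i\<le>Suc m. (-1) ^ (Suc m - i) * real (Suc m choose i) * f (x + real i * h))"
    by (simp only: fin_diff_def)
  also have "\<dots> = (-1) ^ Suc m * f x + (\<Sum>i\<le>m. (-1) ^ (m - i) * real (Suc m choose Suc i) * f (x + real (Suc i) * h))"
    by (subst sum.atMost_Suc_shift) simp
  also have "(\<Sum>i\<le>m. (-1) ^ (m - i) * real (Suc m choose Suc i) * f (x + real (Suc i) * h))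
     = (\<Sum>i\<le>m. (-1) ^ (m - i) * real (m choose i) * f (x + real (Suc i) * h)) + (\<Sum>i\<le>m. (-1) ^ (m - i) * real (m choose Suc i) * f (x + real (Suc i) * h))"
    by (simp add: sum.distrib[symmetric] algebra_simps)
  also have "(\<Sum>i\<le>m. (-1) ^ (m - i) * real (m choose Suc i) * f (x + real (Suc i) * h))
     = (\<Sum>i\<le>Suc m. (-1) ^ (Suc m - i) * real (m choose i) * f (x + real i * h)) - (-1) ^ Suc m * f x"
    by (subst sum.atMost_Suc_shift) simp
  also have "(\<Sum>i\<le>Suc m. (-1) ^ (Suc m - i) * real (m choose i) * f (x + real i * h))
     = - (\<Sum>i\<le>m. (-1) ^ (m - i) * real (m choose i) * f (x + real i * h))"
    by (subst sum.atMost_Suc, simp add: binomial_eq_0 sum_negf[symmetric], intro sum.cong refl) (simp add: Suc_diff_le)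
  finally show ?thesis
    by (simp add: fin_diff_def sum_subtractf right_diff_distrib algebra_simps)
qed

lemma degree_poly_difference:
  fixes P :: "real poly"
  assumes "degree P \<le> Suc k"
  shows "degree (pcompose P [:h, 1:] - P) \<le> k"
proof (rule degree_le, intro allI impI)
  fix i assume i: "k < i"
  show "coeff (pcompose P [:h, 1:] - P) i = 0"
  proof (cases "i = Suc k \<and> degree P = Suc k")
    case True
    have "coeff (pcompose P [:h, 1:]) (degree (pcompose P [:h, 1:])) = lead_coeff P * lead_coeff [:h, 1:] ^ degree P"
      by (rule lead_coeff_comp) simp
    then show ?thesis using True by (simp add: degree_pcompose)
  next
    case False
    then have "degree P < i" using i assms by auto
    then show ?thesis by (simp add: coeff_eq_0 degree_pcompose)
  qed
qed

lemma fin_diff_poly_eq_0: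
  "degree P < m \<Longrightarrow> fin_diff m h (poly P) x = 0"
proof (induction m arbitrary: P)
  case (Suc m)
  have "fin_diff (Suc m) h (poly P) x = fin_diff m h (poly (pcompose P [:h, 1:] - P)) x"
    unfolding fin_diff_Suc by (intro arg_cong2[where f="fin_diff m h"]) (auto simp: poly_pcompose add.commute fun_eq_iff)
  also have "\<dots> = 0"
  proof (cases m)
    case 0
    then obtain c where "P = [:c:]" using Suc.prems by (metis degree_eq_zeroE less_Suc0)
    then show ?thesis using 0 by (simp add: fin_diff_def)
  next
    case (Suc k)
    then show ?thesis using Suc.prems degree_poly_difference[of P k h] by (intro Suc.IH) auto
  qed
  finally show ?case .
qed simp

text \<open>Two blocks of \<open>m\<close> nodes on the same fine grid give interpolants that differ only by \<open>m\<close>-th differences. To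
see this, the interpolant \<open>R\<close> of the first block is subtracted from \<open>f\<close>; the remainder \<open>b\<close> has the same differences,
vanishes on the first block, and grows along the grid at most by the recursion that the differences impose. The step
\<open>g\<close> allows the second block to belong to a coarser grid.\<close>

lemma block_comparison:
  fixes Y h z0 y :: real and N0 N c g m :: nat
  assumes m: "0 < m" and Y: "0 \<le> Y"
  defines "K \<equiv> (Y + real N0 + 1) ^ m * (real m * (1 + 2 ^ m) ^ N0)"
  assumes h: "0 < h" and N: "N \<le> N0" and c: "1 \<le> g" "c + g * (m - 1) \<le> N" and y: "\<bar>y - z0\<bar> \<le> Y * h"
  shows "\<bar>lagrange m (\<lambda>t. z0 + real (c + g * t) * h) (\<lambda>t. f (z0 + real (c + g * t) * h)) y
    - lagrange m (\<lambda>t. z0 + real t * h) (\<lambda>t. f (z0 + real t * h)) y\<bar>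
    \<le> K * (\<Sum>e | e + m \<le> N. \<bar>fin_diff m h f (z0 + real e * h)\<bar>)"
proof -
  define z where "z i = z0 + real i * h" for i
  obtain R where R: "degree R < m" "\<And>y. lagrange m z (\<lambda>t. f (z t)) y = poly R y"
    using lagrange_is_poly[OF m] by blast
  have injz: "inj_on z A" for A using h by (auto simp: inj_on_def z_def)
  define b where "b x = f x - poly R x" for x
  define S where "S = (\<Sum>e | e + m \<le> N. \<bar>fin_diff m h f (z e)\<bar>)"
  have fin: "finite {e. e + m \<le> N}" by (rule finite_subset[of _ "{..N}"]) auto
  have S0: "0 \<le> S" unfolding S_def by (intro sum_nonneg) auto
  have b0: "b (z i) = 0" if "i < m" for i
    using lagrange_interpolates[OF injz that, of "\<lambda>t. f (z t)"] R(2) by (simp add: b_def)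
  have fd: "fin_diff m h b x = fin_diff m h f x" for x
  proof -
    have "fin_diff m h b x = fin_diff m h f x - fin_diff m h (poly R) x"
      by (simp add: fin_diff_def b_def right_diff_distrib sum_subtractf)
    then show ?thesis using fin_diff_poly_eq_0[OF R(1)] by simp
  qed
  (* each difference expresses b at node i through the m preceding nodes *)
  have bi: "i \<le> N \<longrightarrow> \<bar>b (z i)\<bar> \<le> (1 + 2 ^ m) ^ i * S" for i
  proof (induction i rule: less_induct)
    case (less i)
    show ?case
    proof (intro impI)
      assume iN: "i \<le> N"
      show "\<bar>b (z i)\<bar> \<le> (1 + 2 ^ m) ^ i * S"
      proof (cases "i < m")
        case True
        then show ?thesis using b0 S0 by simp
      next
        case False
        define e where "e = i - m"
        have ie: "i = e + m" using False by (simp add: e_def)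
        have zi: "z e + real k * h = z (e + k)" for k by (simp add: z_def algebra_simps)
        have "fin_diff m h b (z e) = (\<Sum>k<m. (-1) ^ (m - k) * real (m choose k) * b (z (e + k))) + b (z i)"
          unfolding fin_diff_def zi using lessThan_Suc_atMost[of m, symmetric] by (simp add: ie)
        then have "b (z i) = fin_diff m h f (z e) - (\<Sum>k<m. (-1) ^ (m - k) * real (m choose k) * b (z (e + k)))"
          by (simp add: fd)
        then have "\<bar>b (z i)\<bar> \<le> \<bar>fin_diff m h f (z e)\<bar> + (\<Sum>k<m. real (m choose k) * \<bar>b (z (e + k))\<bar>)"
          using sum_abs[of "\<lambda>k. (-1) ^ (m - k) * real (m choose k) * b (z (e + k))" "{..<m}"] by (simp add: abs_mult)
        also have "\<bar>fin_diff m h f (z e)\<bar> \<le> S"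
          unfolding S_def by (rule member_le_sum[OF _ _ fin]) (use iN ie in auto)
        also have "(\<Sum>k<m. real (m choose k) * \<bar>b (z (e + k))\<bar>) \<le> (\<Sum>k<m. real (m choose k) * ((1 + 2 ^ m) ^ (i - 1) * S))"
        proof (intro sum_mono mult_left_mono)
          fix k assume k: "k \<in> {..<m}"
          then have "\<bar>b (z (e + k))\<bar> \<le> (1 + 2 ^ m) ^ (e + k) * S" using less.IH[of "e + k"] ie iN by auto
          also have "\<dots> \<le> (1 + 2 ^ m) ^ (i - 1) * S"
            using k ie S0 by (intro mult_right_mono power_increasing) auto
          finally show "\<bar>b (z (e + k))\<bar> \<le> (1 + 2 ^ m) ^ (i - 1) * S" .
        qed simp
        also have "(\<Sum>k<m. real (m choose k) * ((1 + 2 ^ m) ^ (i - 1) * S)) \<le> 2 ^ m * ((1 + 2 ^ m) ^ (i - 1) * S)"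
        proof -
          have "(\<Sum>k<m. real (m choose k)) \<le> (\<Sum>k\<le>m. real (m choose k))" by (intro sum_mono2) auto
          also have "\<dots> = 2 ^ m" using choose_row_sum[of m] by (metis of_nat_numeral of_nat_power of_nat_sum)
          finally show ?thesis unfolding sum_distrib_right[symmetric] using S0 by (intro mult_right_mono) auto
        qed
        also have "S + 2 ^ m * ((1 + 2 ^ m) ^ (i - 1) * S) \<le> (1 + 2 ^ m) ^ (i - 1) * S + 2 ^ m * ((1 + 2 ^ m) ^ (i - 1) * S)"
        proof -
          have "1 * S \<le> (1 + 2 ^ m) ^ (i - 1) * S" using S0 by (intro mult_right_mono one_le_power) auto
          then show ?thesis by simp
        qed
        also have "\<dots> = (1 + 2 ^ m) ^ Suc (i - 1) * S" by (simp add: algebra_simps)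
        also have "Suc (i - 1) = i" using ie m by simp
        finally show ?thesis by simp
      qed
    qed
  qed
  have idx: "c + g * t \<le> N" if "t < m" for t
  proof -
    have "g * t \<le> g * (m - 1)" using that by (intro mult_le_mono2) simp
    then show ?thesis using c by linarith
  qed
  have injc: "inj_on (\<lambda>t. z (c + g * t)) {..<m}" using h c by (auto simp: inj_on_def z_def)
  have "lagrange m (\<lambda>t. z (c + g * t)) (\<lambda>t. f (z (c + g * t))) y - lagrange m z (\<lambda>t. f (z t)) y
     = lagrange m (\<lambda>t. z (c + g * t)) (\<lambda>t. b (z (c + g * t))) y"
    using lagrange_reproduces_poly[OF injc R(1), of y] by (simp add: b_def lagrange_diff R(2))
  also have "\<bar>\<dots>\<bar> \<le> (Y + real N0 + 1) ^ m * (\<Sum>t<m. \<bar>b (z (c + g * t))\<bar>)"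
  proof (rule lagrange_bound[where h=h])
    fix s assume s: "s < m"
    have "real (c + g * s) \<le> real N0" using idx[OF s] N by linarith
    then have "real (c + g * s) * h \<le> real N0 * h" using h by (intro mult_right_mono) auto
    moreover have "\<bar>y - z (c + g * s)\<bar> \<le> \<bar>y - z0\<bar> + real (c + g * s) * h"
    proof -
      have "0 \<le> real (c + g * s) * h" using h by (intro mult_nonneg_nonneg) auto
      then show ?thesis unfolding z_def by linarith
    qed
    ultimately show "\<bar>y - z (c + g * s)\<bar> \<le> (Y + real N0 + 1) * h"
      using y h by (simp add: algebra_simps)
  next
    fix s t assume "s < m" "t < m" "s \<noteq> t"
    then have "g * s \<noteq> g * t" using c by auto
    then have "1 \<le> \<bar>real (g * t) - real (g * s)\<bar>" by linarith
    then have "1 * h \<le> \<bar>real (g * t) - real (g * s)\<bar> * h" using h by (intro mult_right_mono) auto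
    also have "\<dots> = \<bar>z (c + g * t) - z (c + g * s)\<bar>"
      using h by (simp add: z_def abs_mult[symmetric] left_diff_distrib[symmetric] del: of_nat_mult) (simp add: abs_mult)
    finally show "h \<le> \<bar>z (c + g * t) - z (c + g * s)\<bar>" by simp
  qed (use h Y in auto)
  also have "(\<Sum>t<m. \<bar>b (z (c + g * t))\<bar>) \<le> (\<Sum>t<m. (1 + 2 ^ m) ^ N0 * S)"
  proof (intro sum_mono)
    fix t assume "t \<in> {..<m}"
    then have i: "c + g * t \<le> N" using idx by simp
    then have "\<bar>b (z (c + g * t))\<bar> \<le> (1 + 2 ^ m) ^ (c + g * t) * S" using bi by blast
    also have "\<dots> \<le> (1 + 2 ^ m) ^ N0 * S" using i N S0 by (intro mult_right_mono power_increasing) auto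
    finally show "\<bar>b (z (c + g * t))\<bar> \<le> (1 + 2 ^ m) ^ N0 * S" .
  qed
  finally show ?thesis
    using Y by (simp add: K_def S_def z_def[abs_def] mult.assoc mult_left_mono)
qed

section \<open>Interpolation on nested grids with a random offset\<close>
text \<open>The offset at level \<open>l\<close> is the residue of \<open>u\<close> modulo the mesh \<open>1 / 2 ^ l\<close>. With this choice the grids of all
levels are nested for each fixed \<open>u\<close>, and for uniform \<open>u\<close> every grid point is uniformly distributed in its cell.\<close>

definition offset :: "nat \<Rightarrow> real \<Rightarrow> real" where
  "offset l u = frac (2 ^ l * u) / 2 ^ l"

definition node :: "nat \<Rightarrow> real \<Rightarrow> nat \<Rightarrow> real" where
  "node l u i = offset l u + real i / 2 ^ l"

text \<open>The first node index of the block used at \<open>y\<close>; the minimum keeps all \<open>m\<close> nodes inside the unit interval.\<close>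

definition block :: "nat \<Rightarrow> nat \<Rightarrow> real \<Rightarrow> nat" where
  "block m l y = min (nat \<lfloor>2 ^ l * y\<rfloor>) (2 ^ l - m)"

definition local_interp :: "nat \<Rightarrow> (real \<Rightarrow> real) \<Rightarrow> nat \<Rightarrow> real \<Rightarrow> nat \<Rightarrow> real \<Rightarrow> real" where
  "local_interp m f l u i y = lagrange m (\<lambda>t. node l u (i + t)) (\<lambda>t. f (node l u (i + t))) y"

definition grid_interp :: "nat \<Rightarrow> (real \<Rightarrow> real) \<Rightarrow> nat \<Rightarrow> real \<Rightarrow> real \<Rightarrow> real" where
  "grid_interp m f l u y = local_interp m f l u (block m l y) y"

lemma offset_bounds: "0 \<le> offset l u" "offset l u < 1 / 2 ^ l"
  by (auto simp: offset_def frac_lt_1 divide_strict_right_mono)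

lemma node_bounds: "real i / 2 ^ l \<le> node l u i" "node l u i < real (Suc i) / 2 ^ l"
  using offset_bounds[of l u] by (auto simp: node_def add_divide_distrib)

lemma node_shift: "node l u (i + t) = node l u i + real t * (1 / 2 ^ l)"
  by (simp add: node_def add_divide_distrib)

lemma node_in_unit:
  assumes "i < 2 ^ l" shows "0 \<le> node l u i" "node l u i < 1"
proof -
  have "0 \<le> real i / 2 ^ l" by simp
  then show "0 \<le> node l u i" using node_bounds(1)[of i l u] by linarith
  have "real (Suc i) \<le> real (2 ^ l)" using assms by (simp only: of_nat_le_iff Suc_le_eq)
  then have "real (Suc i) / 2 ^ l \<le> 1" by (simp add: divide_le_eq)
  then show "node l u i < 1" using node_bounds(2)[of l u i] by linarith
qed

text \<open>The grids are nested: \<open>b\<close> is the binary digit of \<open>u\<close> that distinguishes the two levels.\<close>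

lemma node_refine:
  obtains b where "b \<le> 1" "\<And>i. node l u i = node (Suc l) u (2 * i + b)"
proof -
  define x where "x = 2 ^ l * u"
  define b where "b = nat \<lfloor>2 * frac x\<rfloor>"
  have fx: "0 \<le> frac x" "frac x < 1" by (auto simp: frac_lt_1)
  have b: "real b = of_int \<lfloor>2 * frac x\<rfloor>" using fx by (simp add: b_def)
  have b1: "b \<le> 1"
  proof -
    have "\<lfloor>2 * frac x\<rfloor> < 2" using fx by (simp add: floor_less_iff)
    then show ?thesis unfolding b_def by linarith
  qed
  have "2 * x = 2 * frac x + of_int (2 * \<lfloor>x\<rfloor>)" by (simp add: frac_def)
  then have "\<lfloor>2 * x\<rfloor> = \<lfloor>2 * frac x\<rfloor> + 2 * \<lfloor>x\<rfloor>" by (metis floor_add_int)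
  then have "frac (2 * x) = 2 * frac x - real b"
    unfolding b by (simp add: frac_def)
  then have o: "offset (Suc l) u = (2 * frac x - real b) / 2 ^ Suc l" "offset l u = frac x / 2 ^ l"
    by (simp_all add: offset_def x_def mult.assoc)
  have "node l u i = node (Suc l) u (2 * i + b)" for i
    unfolding node_def o by (simp add: field_simps)
  with b1 show ?thesis using that by blast
qed

lemma block_bounds:
  assumes "0 < m" "m \<le> 2 ^ l" "0 \<le> y" "y < 1"
  shows "real (block m l y) / 2 ^ l \<le> y" "y < real (block m l y + m) / 2 ^ l" "block m l y + m \<le> 2 ^ l"
proof -
  define i where "i = nat \<lfloor>2 ^ l * y\<rfloor>"
  have i: "real i = of_int \<lfloor>2 ^ l * y\<rfloor>" using assms by (simp add: i_def)
  have i1: "real i \<le> 2 ^ l * y" "2 ^ l * y < real i + 1" unfolding i by linarith+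
  have "2 ^ l * y < (2::real) ^ l" using assms by simp
  then have "real i < 2 ^ l" using i1(1) by linarith
  then have i2: "i < 2 ^ l" by simp
  have bl: "block m l y = min i (2 ^ l - m)" by (simp add: block_def i_def)
  have "real (block m l y) \<le> 2 ^ l * y" using i1 unfolding bl by (meson min.cobounded1 of_nat_le_iff order_trans)
  then show "real (block m l y) / 2 ^ l \<le> y" by (simp add: divide_le_eq mult.commute)
  have "i + 1 \<le> block m l y + m" using i2 assms unfolding bl by auto
  then have "real i + 1 \<le> real (block m l y + m)" by linarith
  then have "2 ^ l * y < real (block m l y + m)" using i1 by linarith
  then show "y < real (block m l y + m) / 2 ^ l" by (simp add: less_divide_eq mult.commute)
  show "block m l y + m \<le> 2 ^ l" using assms unfolding bl by auto
qed

lemma block_refine: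
  assumes "0 < m" "m \<le> 2 ^ l" "0 \<le> y" "y < 1"
  shows "2 * block m l y \<le> block m (Suc l) y" "block m (Suc l) y \<le> 2 * block m l y + m"
proof -
  define x where "x = 2 ^ l * y"
  have x0: "0 \<le> x" using assms by (simp add: x_def)
  define i where "i = nat \<lfloor>x\<rfloor>"
  define i' where "i' = nat \<lfloor>2 * x\<rfloor>"
  have "2 * \<lfloor>x\<rfloor> \<le> \<lfloor>2 * x\<rfloor>" "\<lfloor>2 * x\<rfloor> \<le> 2 * \<lfloor>x\<rfloor> + 1" by linarith+
  then have ii: "2 * i \<le> i'" "i' \<le> 2 * i + 1" using x0 unfolding i_def i'_def by (auto simp: nat_le_iff le_nat_iff)
  have "x < 2 ^ l" using assms by (simp add: x_def)
  then have "i < 2 ^ l" unfolding i_def using x0 by (simp add: nat_less_iff floor_less_iff)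
  moreover have "block m l y = min i (2 ^ l - m)" "block m (Suc l) y = min i' (2 * 2 ^ l - m)"
    by (simp_all add: block_def i_def i'_def x_def mult.assoc)
  ultimately show "2 * block m l y \<le> block m (Suc l) y" "block m (Suc l) y \<le> 2 * block m l y + m"
    using ii assms(1,2) by auto
qed

text \<open>The first summand comes from comparing blocks at the starting level across the support of one wavelet, the second one from
passing to the next finer grid.\<close>

definition refine_const :: "nat \<Rightarrow> nat \<Rightarrow> real" where
  "refine_const m \<rho> =
     ((real (2 * \<rho> + m + 1)) + real (2 * \<rho> + 2 * m) + 1) ^ m * (real m * (1 + 2 ^ m) ^ (2 * \<rho> + 2 * m)) * real (2 * \<rho> + m)
     + 2 * ((2 * real m + real (2 * m - 1) + 1) ^ m * (real m * (1 + 2 ^ m) ^ (2 * m - 1)) * real m)"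

text \<open>The coarse and the fine block at \<open>y\<close> both lie among \<open>2 * m\<close> consecutive nodes of the fine grid, so each of them can be
compared with the block that starts at the first of these nodes.\<close>

lemma refinement_step:
  assumes m: "0 < m" "m \<le> 2 ^ l" and y: "0 \<le> y" "y < 1"
  defines "K \<equiv> (2 * real m + real (2 * m - 1) + 1) ^ m * (real m * (1 + 2 ^ m) ^ (2 * m - 1))"
  shows "\<bar>grid_interp m f (Suc l) u y - grid_interp m f l u y\<bar>
    \<le> 2 * (K * (\<Sum>e<m. \<bar>fin_diff m (1 / 2 ^ Suc l) f (node (Suc l) u (2 * block m l y + e))\<bar>))"
proof -
  define i where "i = block m l y"
  define h :: real where "h = 1 / 2 ^ Suc l"
  have h: "0 < h" by (simp add: h_def)
  define z0 where "z0 = node (Suc l) u (2 * i)"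
  define W where "W = (\<Sum>e<m. \<bar>fin_diff m h f (z0 + real e * h)\<bar>)"
  obtain b where b: "b \<le> 1" "\<And>i. node l u i = node (Suc l) u (2 * i + b)" using node_refine by metis
  note bi = block_bounds[OF m y, folded i_def]
  have z: "node (Suc l) u (2 * i + k) = z0 + real k * h" for k
    unfolding z0_def h_def by (rule node_shift)
  have set: "{e. e + m \<le> 2 * m - 1} = {..<m}" using m by auto
  have hh: "real k / 2 ^ l = real (2 * k) * h" for k by (simp add: h_def)
  have yz: "\<bar>y - z0\<bar> \<le> (2 * real m) * h"
  proof -
    have "real (2 * i) * h \<le> z0" "z0 < real (Suc (2 * i)) * h"
      using node_bounds(1)[of "2 * i" "Suc l" u] node_bounds(2)[of "Suc l" u "2 * i"] by (auto simp: z0_def h_def)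
    moreover have "real (2 * i) * h \<le> y" "y < real (2 * (i + m)) * h" using bi unfolding hh by auto
    moreover have "real (Suc (2 * i)) * h \<le> real (2 * (i + m)) * h" using h m by (intro mult_right_mono) auto
    moreover have "real (2 * (i + m)) * h = real (2 * i) * h + 2 * real m * h" by (simp add: algebra_simps)
    ultimately show ?thesis by linarith
  qed
  define B where "B = lagrange m (\<lambda>t. z0 + real t * h) (\<lambda>t. f (z0 + real t * h)) y"
  have cmp: "\<bar>lagrange m (\<lambda>t. z0 + real (c + g * t) * h) (\<lambda>t. f (z0 + real (c + g * t) * h)) y - B\<bar> \<le> K * W"
    if "1 \<le> g" "c + g * (m - 1) \<le> 2 * m - 1" for c g
    unfolding B_def W_def K_def set[symmetric]
    using block_comparison[OF m(1) _ h order_refl that yz, of f] by simp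
  have c1: "1 * (m - 1) + (block m (Suc l) y - 2 * i) \<le> 2 * m - 1"
    using block_refine[OF m y] m by (simp add: i_def)
  have "grid_interp m f (Suc l) u y = lagrange m (\<lambda>t. z0 + real ((block m (Suc l) y - 2 * i) + 1 * t) * h) (\<lambda>t. f (z0 + real ((block m (Suc l) y - 2 * i) + 1 * t) * h)) y"
    unfolding grid_interp_def local_interp_def z[symmetric]
    using block_refine(1)[OF m y] by (simp add: i_def[symmetric] add.assoc[symmetric])
  then have 1: "\<bar>grid_interp m f (Suc l) u y - B\<bar> \<le> K * W" using cmp[of 1 "block m (Suc l) y - 2 * i"] c1 by simp
  have "grid_interp m f l u y = lagrange m (\<lambda>t. z0 + real (b + 2 * t) * h) (\<lambda>t. f (z0 + real (b + 2 * t) * h)) y"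
    unfolding grid_interp_def local_interp_def z[symmetric] i_def[symmetric] b(2)
    by (simp add: algebra_simps)
  then have 2: "\<bar>grid_interp m f l u y - B\<bar> \<le> K * W" using cmp[of 2 b] b m by simp
  have "\<bar>grid_interp m f (Suc l) u y - grid_interp m f l u y\<bar> \<le> 2 * (K * W)" using 1 2 by linarith
  then show ?thesis unfolding W_def z[symmetric] by (simp add: h_def i_def)
qed

text \<open>Near \<open>c\<close>, at the scale \<open>1 / 2 ^ j\<close>, a single polynomial approximates the interpolants of all finer
levels. It is the interpolant on the leftmost block used in this neighbourhood; the error telescopes over the
levels.\<close>

lemma multiscale_approximation:
  assumes m: "0 < m" "m \<le> 2 ^ j"
    and A: "\<And>l i. j \<le> l \<Longrightarrow> i + m < 2 ^ l \<Longrightarrow> \<bar>node l u i - c\<bar> \<le> real (\<rho> + 2 * m) / 2 ^ j \<Longrightarrow>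
        \<bar>fin_diff m (1 / 2 ^ l) f (node l u i)\<bar> \<le> A l"
    and A0: "\<And>l. 0 \<le> A l"
  shows "\<exists>P. degree P < m \<and> (\<forall>y L. 0 \<le> y \<longrightarrow> y < 1 \<longrightarrow> \<bar>y - c\<bar> \<le> real \<rho> / 2 ^ j \<longrightarrow> j \<le> L \<longrightarrow>
      \<bar>grid_interp m f L u y - poly P y\<bar> \<le> refine_const m \<rho> * (\<Sum>l=j..L. A l))"
proof (cases "\<exists>y. 0 \<le> y \<and> y < 1 \<and> \<bar>y - c\<bar> \<le> real \<rho> / 2 ^ j")
  case False
  then show ?thesis using m by (intro exI[of _ 0]) auto
next
  case True
  define S where "S = {y. 0 \<le> y \<and> y < 1 \<and> \<bar>y - c\<bar> \<le> real \<rho> / 2 ^ j}"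
  define h :: real where "h = 1 / 2 ^ j"
  have h: "0 < h" by (simp add: h_def)
  have hd: "real k / 2 ^ j = real k * h" for k by (simp add: h_def)
  (* the leftmost block that is used at some point of the neighbourhood S *)
  define i0 where "i0 = (LEAST i. \<exists>y\<in>S. block m j y = i)"
  have "\<exists>i. \<exists>y\<in>S. block m j y = i" using True by (auto simp: S_def)
  then have "\<exists>y\<in>S. block m j y = i0" unfolding i0_def by (rule LeastI_ex)
  then obtain y0 where y0: "y0 \<in> S" "block m j y0 = i0" by blast
  have least: "i0 \<le> block m j y" if "y \<in> S" for y unfolding i0_def using that by (intro Least_le) blast
  define z0 where "z0 = node j u i0"
  have z: "node j u (i0 + k) = z0 + real k * h" for k
    unfolding z0_def h_def by (rule node_shift)
  have injn: "inj_on (\<lambda>t. node j u (i0 + t)) {..<m}" using h by (auto simp: inj_on_def z)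
  obtain P where P: "degree P < m" "\<And>y. local_interp m f j u i0 y = poly P y"
    using lagrange_is_poly[OF m(1)] unfolding local_interp_def by blast
  define K1 where "K1 = ((real (2 * \<rho> + m + 1)) + real (2 * \<rho> + 2 * m) + 1) ^ m * (real m * (1 + 2 ^ m) ^ (2 * \<rho> + 2 * m))"
  define K2 where "K2 = (2 * real m + real (2 * m - 1) + 1) ^ m * (real m * (1 + 2 ^ m) ^ (2 * m - 1))"
  have K0: "0 \<le> K1" "0 \<le> K2" by (simp_all add: K1_def K2_def)
  have C: "refine_const m \<rho> = K1 * real (2 * \<rho> + m) + 2 * (K2 * real m)"
    by (simp add: refine_const_def K1_def K2_def)
  have b0: "real i0 * h \<le> y0" "y0 < real (i0 + m) * h"
    using block_bounds[OF m, of y0, unfolded hd] y0 by (auto simp: S_def)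
  have base_err: "\<bar>grid_interp m f j u y - poly P y\<bar> \<le> K1 * real (2 * \<rho> + m) * A j" if yS: "y \<in> S" for y
  proof -
    define i where "i = block m j y"
    have y: "0 \<le> y" "y < 1" "\<bar>y - c\<bar> \<le> real \<rho> * h" using yS by (auto simp: S_def hd)
    have y0c: "\<bar>y0 - c\<bar> \<le> real \<rho> * h" using y0 by (auto simp: S_def hd)
    note bi = block_bounds[OF m y(1,2), folded i_def, unfolded hd]
    have i0i: "i0 \<le> i" using least[OF yS] by (simp add: i_def)
    define n where "n = i - i0"
    have i: "i = i0 + n" using i0i by (simp add: n_def)
    have lo: "c - (real \<rho> + real m) * h \<le> real i0 * h" using b0 y0c by (simp add: algebra_simps)
    have nb: "n \<le> 2 * \<rho> + m"
    proof -
      have "real n * h = real i * h - real i0 * h" by (simp add: i algebra_simps)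
      also have "\<dots> \<le> real (2 * \<rho> + m) * h" using bi(1) y(3) lo by (simp add: algebra_simps)
      finally show ?thesis using h by (simp only: mult_le_cancel_right_pos of_nat_le_iff)
    qed
    have zb: "real i0 * h \<le> z0" "z0 < real (Suc i0) * h"
      using node_bounds(1)[of i0 j u] node_bounds(2)[of j u i0] unfolding z0_def hd[symmetric] by auto
    have yz: "\<bar>y - z0\<bar> \<le> real (2 * \<rho> + m + 1) * h"
    proof -
      have "real i0 * h \<le> real i * h" using i0i h by (intro mult_right_mono) auto
      moreover have q: "real (2 * \<rho> + m + 1) * h = 2 * (real \<rho> * h) + real m * h + h" by (simp add: algebra_simps)
      moreover have "z0 < real i0 * h + h" using zb(2) by (simp add: algebra_simps)
      moreover have "c - real \<rho> * h - real m * h \<le> real i0 * h" using lo by (simp add: algebra_simps)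
      moreover have "0 \<le> real \<rho> * h" "0 \<le> real m * h" using h by auto
      ultimately show ?thesis unfolding q using zb(1) bi(1) y(3) h unfolding abs_le_iff by linarith
    qed
    have "grid_interp m f j u y = lagrange m (\<lambda>t. z0 + real (n + 1 * t) * h) (\<lambda>t. f (z0 + real (n + 1 * t) * h)) y"
      unfolding grid_interp_def local_interp_def i_def[symmetric] i z[symmetric] by (simp add: add.assoc)
    moreover have "poly P y = lagrange m (\<lambda>t. z0 + real t * h) (\<lambda>t. f (z0 + real t * h)) y"
      unfolding P(2)[symmetric] local_interp_def z[symmetric] ..
    moreover have "n + 1 * (m - 1) \<le> n + (m - 1)" "n + (m - 1) \<le> 2 * \<rho> + 2 * m" using nb by auto
    ultimately have "\<bar>grid_interp m f j u y - poly P y\<bar> \<le> K1 * (\<Sum>e | e + m \<le> n + (m - 1). \<bar>fin_diff m h f (z0 + real e * h)\<bar>)"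
      using block_comparison[OF m(1) _ h _ order_refl _ yz, of "n + (m - 1)" "2 * \<rho> + 2 * m" n f] unfolding K1_def by simp
    also have "(\<Sum>e | e + m \<le> n + (m - 1). \<bar>fin_diff m h f (z0 + real e * h)\<bar>) \<le> (\<Sum>e | e + m \<le> n + (m - 1). A j)"
    proof (intro sum_mono)
      fix e assume "e \<in> {e. e + m \<le> n + (m - 1)}"
      then have e: "e < n" using m by simp
      have ei: "i0 + e < i" using e by (simp add: i)
      have "\<bar>node j u (i0 + e) - c\<bar> \<le> real (\<rho> + 2 * m) * h"
      proof -
        have "real i0 * h \<le> real (i0 + e) * h" using h by (intro mult_right_mono) auto
        moreover have "real (Suc (i0 + e)) * h \<le> real i * h" using ei h by (intro mult_right_mono) auto
        moreover have "real (i0 + e) * h \<le> node j u (i0 + e)" "node j u (i0 + e) < real (Suc (i0 + e)) * h"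
          using node_bounds(1)[of "i0 + e" j u] node_bounds(2)[of j u "i0 + e"] unfolding hd[symmetric] by auto
        moreover have "0 \<le> real m * h" using h by simp
        ultimately show ?thesis using lo bi(1) y(3) by (simp only: distrib_right of_nat_add of_nat_mult of_nat_numeral left_diff_distrib)
      qed
      then have "\<bar>fin_diff m (1 / 2 ^ j) f (node j u (i0 + e))\<bar> \<le> A j"
        unfolding hd[symmetric] using bi(3) ei by (intro A) auto
      then show "\<bar>fin_diff m h f (z0 + real e * h)\<bar> \<le> A j" unfolding z h_def .
    qed
    also have "\<dots> = real n * A j"
    proof -
      have "{e. e + m \<le> n + (m - 1)} = {..<n}" using m by auto
      then show ?thesis by simp
    qed
    also have "\<dots> \<le> real (2 * \<rho> + m) * A j" using nb A0 by (intro mult_right_mono) auto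
    finally show ?thesis using K0 by (simp add: mult.assoc mult_left_mono)
  qed
  have step_err: "\<bar>grid_interp m f (Suc l) u y - grid_interp m f l u y\<bar> \<le> 2 * (K2 * real m) * A (Suc l)"
    if yS: "y \<in> S" and l: "j \<le> l" for y l
  proof -
    have y: "0 \<le> y" "y < 1" "\<bar>y - c\<bar> \<le> real \<rho> * h" using yS by (auto simp: S_def hd)
    have "(2::nat) ^ j \<le> 2 ^ l" using l by (intro power_increasing) auto
    then have ml: "m \<le> 2 ^ l" using m(2) by linarith
    define i where "i = block m l y"
    define h' :: real where "h' = 1 / 2 ^ Suc l"
    have h': "0 < h'" "h' \<le> h"
      using power_increasing[of j "Suc l" "2::real"] l by (auto simp: h'_def h_def intro!: divide_left_mono)
    note bi = block_bounds[OF m(1) ml y(1,2), folded i_def]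
    have "(\<Sum>e<m. \<bar>fin_diff m (1 / 2 ^ Suc l) f (node (Suc l) u (2 * i + e))\<bar>) \<le> (\<Sum>e<m. A (Suc l))"
    proof (intro sum_mono)
      fix e assume "e \<in> {..<m}"
      then have e: "e < m" by simp
      define x where "x = node (Suc l) u (2 * i + e)"
      have "real (2 * i + e) * h' \<le> x" "x < real (Suc (2 * i + e)) * h'"
        using node_bounds(1)[of "2 * i + e" "Suc l" u] node_bounds(2)[of "Suc l" u "2 * i + e"] by (auto simp: x_def h'_def)
      moreover have "real (2 * i) * h' \<le> real (2 * i + e) * h'" "real (Suc (2 * i + e)) * h' \<le> real (2 * i + 2 * m) * h'"
        using e h' by (intro mult_right_mono; simp)+
      moreover have "real (2 * i) * h' \<le> y" "y < real (2 * i + 2 * m) * h'"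
      proof -
        have "real (2 * i) * h' = real i / 2 ^ l" "real (2 * i + 2 * m) * h' = real (i + m) / 2 ^ l"
          by (simp_all add: h'_def field_simps)
        then show "real (2 * i) * h' \<le> y" "y < real (2 * i + 2 * m) * h'" using bi(1,2) by (simp_all only:)
      qed
      moreover have "real (2 * i + 2 * m) * h' = real (2 * i) * h' + real (2 * m) * h'" by (simp add: algebra_simps)
      moreover have "real (2 * m) * h' \<le> real (2 * m) * h" using h' by (intro mult_left_mono) auto
      ultimately have "\<bar>x - y\<bar> \<le> real (2 * m) * h" by linarith
      then have "\<bar>x - c\<bar> \<le> real (\<rho> + 2 * m) * h" using y(3) by (simp add: algebra_simps)
      moreover have "(2 * i + e) + m < 2 ^ Suc l" using e bi(3) by simp
      ultimately show "\<bar>fin_diff m (1 / 2 ^ Suc l) f (node (Suc l) u (2 * i + e))\<bar> \<le> A (Suc l)"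
        unfolding x_def hd[symmetric] using l by (intro A) auto
    qed
    then have "2 * (K2 * (\<Sum>e<m. \<bar>fin_diff m (1 / 2 ^ Suc l) f (node (Suc l) u (2 * i + e))\<bar>)) \<le> 2 * (K2 * (real m * A (Suc l)))"
      using K0 by (intro mult_left_mono) auto
    moreover have "\<bar>grid_interp m f (Suc l) u y - grid_interp m f l u y\<bar>
        \<le> 2 * (K2 * (\<Sum>e<m. \<bar>fin_diff m (1 / 2 ^ Suc l) f (node (Suc l) u (2 * i + e))\<bar>))"
      unfolding K2_def i_def by (rule refinement_step[OF m(1) ml y(1,2)])
    ultimately show ?thesis by (simp only: mult.assoc)
  qed
  have main: "\<bar>grid_interp m f L u y - poly P y\<bar> \<le> refine_const m \<rho> * (\<Sum>l=j..L. A l)" if "y \<in> S" "j \<le> L" for y L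
    using that(2)
  proof (induction rule: dec_induct)
    case base
    have "K1 * real (2 * \<rho> + m) * A j \<le> refine_const m \<rho> * A j"
      unfolding C using K0 A0 by (intro mult_right_mono) auto
    then show ?case using base_err[OF that(1)] by simp
  next
    case (step l)
    have "2 * (K2 * real m) * A (Suc l) \<le> refine_const m \<rho> * A (Suc l)"
      unfolding C using K0 A0 by (intro mult_right_mono) auto
    moreover have "(\<Sum>l=j..Suc l. A l) = (\<Sum>l=j..l. A l) + A (Suc l)" using step.hyps by simp
    ultimately show ?case
      using step.IH step_err[OF that(1) step.hyps(1)]
      by (simp add: distrib_left)
  qed
  show ?thesis using P(1) main by (intro exI[of _ P]) (auto simp: S_def)
qed

section \<open>Averaging over the offset\<close>
lemma node_on_cell:
  assumes "real k / 2 ^ l \<le> u" "u < real (Suc k) / 2 ^ l"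
  shows "node l u i = (real i - real k) / 2 ^ l + u"
proof -
  have "real k \<le> 2 ^ l * u" "2 ^ l * u < real k + 1"
    using assms by (auto simp: field_simps)
  then have "\<lfloor>2 ^ l * u\<rfloor> = int k" by (intro floor_unique) auto
  then have "frac (2 ^ l * u) = 2 ^ l * u - real k" by (simp add: frac_def)
  then show ?thesis by (simp add: node_def offset_def field_simps)
qed

lemma measurable_node[measurable]: "(\<lambda>u. node l u i) \<in> borel_measurable borel"
  unfolding node_def offset_def frac_def by measurable

lemma sum_cell_indicators:
  "(\<Sum>k<n. indicator {real k / 2 ^ l..<real (Suc k) / 2 ^ l} x) = (indicator {0..<real n / 2 ^ l} x :: ennreal)"
proof (induction n)
  case (Suc n)
  have "0 \<le> real n / 2 ^ l" "real n / 2 ^ l \<le> real (Suc n) / 2 ^ l" by (auto simp: divide_right_mono)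
  then have "0 \<le> x" if "real n / 2 ^ l \<le> x" using that by linarith
  moreover have "x < real (Suc n) / 2 ^ l" if "x < real n / 2 ^ l"
    using that \<open>real n / 2 ^ l \<le> real (Suc n) / 2 ^ l\<close> by linarith
  ultimately show ?case unfolding sum.lessThan_Suc Suc by (auto simp: indicator_def not_le simp del: of_nat_Suc)
qed simp

text \<open>As \<open>u\<close> runs through the cells of the dyadic partition at level \<open>l\<close>, the node runs \<open>2 ^ l\<close> times through its own cell.\<close>

lemma offset_average_cell:
  assumes [measurable]: "\<psi> \<in> borel_measurable borel"
  shows "(\<integral>\<^sup>+u. indicator {0..<1} u * \<psi> (node l u i) \<partial>lborel)
    = 2 ^ l * (\<integral>\<^sup>+x. indicator {real i / 2 ^ l..<real (Suc i) / 2 ^ l} x * \<psi> x \<partial>lborel)"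
proof -
  have cell: "(\<integral>\<^sup>+u. indicator {real k / 2 ^ l..<real (Suc k) / 2 ^ l} u * \<psi> (node l u i) \<partial>lborel)
     = (\<integral>\<^sup>+x. indicator {real i / 2 ^ l..<real (Suc i) / 2 ^ l} x * \<psi> x \<partial>lborel)" for k
  proof -
    have "(\<integral>\<^sup>+x. indicator {real i / 2 ^ l..<real (Suc i) / 2 ^ l} x * \<psi> x \<partial>lborel)
      = ennreal \<bar>1\<bar> * (\<integral>\<^sup>+u. indicator {real i / 2 ^ l..<real (Suc i) / 2 ^ l} ((real i - real k) / 2 ^ l + 1 * u) * \<psi> ((real i - real k) / 2 ^ l + 1 * u) \<partial>lborel)"
      by (rule nn_integral_real_affine) auto
    also have "\<dots> = (\<integral>\<^sup>+u. indicator {real k / 2 ^ l..<real (Suc k) / 2 ^ l} u * \<psi> (node l u i) \<partial>lborel)"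
    proof -
      have "indicator {real i / 2 ^ l..<real (Suc i) / 2 ^ l} ((real i - real k) / 2 ^ l + 1 * u) * \<psi> ((real i - real k) / 2 ^ l + 1 * u)
        = indicator {real k / 2 ^ l..<real (Suc k) / 2 ^ l} u * \<psi> (node l u i)" for u
      proof (cases "u \<in> {real k / 2 ^ l..<real (Suc k) / 2 ^ l}")
        case True
        then have "(real i - real k) / 2 ^ l + 1 * u \<in> {real i / 2 ^ l..<real (Suc i) / 2 ^ l}" by (auto simp: add_divide_distrib diff_divide_distrib)
        then show ?thesis using True node_on_cell[of k l u i] by simp
      next
        case False
        then have "(real i - real k) / 2 ^ l + 1 * u \<notin> {real i / 2 ^ l..<real (Suc i) / 2 ^ l}" by (auto simp: add_divide_distrib diff_divide_distrib)
        then show ?thesis using False by simp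
      qed
      then show ?thesis by simp
    qed
    finally show ?thesis ..
  qed
  have "(\<integral>\<^sup>+u. indicator {0..<1} u * \<psi> (node l u i) \<partial>lborel)
     = (\<integral>\<^sup>+u. (\<Sum>k<2 ^ l. indicator {real k / 2 ^ l..<real (Suc k) / 2 ^ l} u * \<psi> (node l u i)) \<partial>lborel)"
    unfolding sum_distrib_right[symmetric] sum_cell_indicators by simp
  also have "\<dots> = (\<Sum>k<2 ^ l. \<integral>\<^sup>+u. indicator {real k / 2 ^ l..<real (Suc k) / 2 ^ l} u * \<psi> (node l u i) \<partial>lborel)"
    by (rule nn_integral_sum) measurable
  also have "\<dots> = 2 ^ l * (\<integral>\<^sup>+x. indicator {real i / 2 ^ l..<real (Suc i) / 2 ^ l} x * \<psi> x \<partial>lborel)"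
    unfolding cell by simp
  finally show ?thesis .
qed

lemma offset_average:
  assumes [measurable]: "\<psi> \<in> borel_measurable borel"
  shows "(\<integral>\<^sup>+u. indicator {0..<1} u * (\<Sum>i<n. \<psi> (node l u i)) \<partial>lborel)
    = 2 ^ l * (\<integral>\<^sup>+x. indicator {0..<real n / 2 ^ l} x * \<psi> x \<partial>lborel)"
proof -
  have "(\<integral>\<^sup>+u. indicator {0..<1} u * (\<Sum>i<n. \<psi> (node l u i)) \<partial>lborel)
    = (\<Sum>i<n. \<integral>\<^sup>+u. indicator {0..<1} u * \<psi> (node l u i) \<partial>lborel)"
    unfolding sum_distrib_left by (rule nn_integral_sum) measurable
  also have "\<dots> = 2 ^ l * (\<Sum>i<n. \<integral>\<^sup>+x. indicator {real i / 2 ^ l..<real (Suc i) / 2 ^ l} x * \<psi> x \<partial>lborel)"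
    unfolding offset_average_cell[OF assms] sum_distrib_left ..
  also have "(\<Sum>i<n. \<integral>\<^sup>+x. indicator {real i / 2 ^ l..<real (Suc i) / 2 ^ l} x * \<psi> x \<partial>lborel)
     = (\<integral>\<^sup>+x. (\<Sum>i<n. indicator {real i / 2 ^ l..<real (Suc i) / 2 ^ l} x * \<psi> x) \<partial>lborel)"
    by (rule nn_integral_sum[symmetric]) measurable
  also have "\<dots> = (\<integral>\<^sup>+x. indicator {0..<real n / 2 ^ l} x * \<psi> x \<partial>lborel)"
    by (simp only: sum_distrib_right[symmetric] sum_cell_indicators)
  finally show ?thesis .
qed

lemma grid_interp_diff: "grid_interp m (\<lambda>x. f x - g x) l u y = grid_interp m f l u y - grid_interp m g l u y"
  by (simp add: grid_interp_def local_interp_def lagrange_diff)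

lemma grid_nodes_close:
  assumes "0 < m" "m \<le> 2 ^ l" "0 \<le> y" "y < 1" "t < m"
  shows "\<bar>y - node l u (block m l y + t)\<bar> \<le> real m * (1 / 2 ^ l)" "block m l y + t < 2 ^ l"
proof -
  define i where "i = block m l y"
  note b = block_bounds[OF assms(1-4), folded i_def]
  have "real i / 2 ^ l \<le> real (i + t) / 2 ^ l" "real (Suc (i + t)) / 2 ^ l \<le> real (i + m) / 2 ^ l"
    using assms(5) by (auto intro!: divide_right_mono)
  moreover have "real (i + m) / 2 ^ l = real i / 2 ^ l + real m * (1 / 2 ^ l)" by (simp add: add_divide_distrib)
  ultimately show "\<bar>y - node l u (block m l y + t)\<bar> \<le> real m * (1 / 2 ^ l)"
    using b(1,2) node_bounds(1)[of "i + t" l u] node_bounds(2)[of l u "i + t"] unfolding i_def[symmetric] abs_le_iff by linarith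
  show "block m l y + t < 2 ^ l" using b(3) assms(5) by (simp add: i_def)
qed

lemma grid_interp_bound:
  assumes "0 < m" "m \<le> 2 ^ l" "0 \<le> y" "y < 1"
  shows "\<bar>grid_interp m f l u y\<bar> \<le> real m ^ m * (\<Sum>t<m. \<bar>f (node l u (block m l y + t))\<bar>)"
  unfolding grid_interp_def local_interp_def
proof (rule lagrange_bound[where h="1 / 2 ^ l"])
  show "\<And>s. s < m \<Longrightarrow> \<bar>y - node l u (block m l y + s)\<bar> \<le> real m * (1 / 2 ^ l)"
    by (rule grid_nodes_close[OF assms])
  fix s t assume "s < m" "t < m" "s \<noteq> t"
  then have "1 \<le> \<bar>real t - real s\<bar>" by linarith
  then have "1 * (1 / 2 ^ l) \<le> \<bar>real t - real s\<bar> * (1 / 2 ^ l)" by (intro mult_right_mono) auto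
  also have "\<dots> = \<bar>node l u (block m l y + t) - node l u (block m l y + s)\<bar>"
    by (simp add: node_def diff_divide_distrib[symmetric] abs_divide)
  finally show "1 / 2 ^ l \<le> \<bar>node l u (block m l y + t) - node l u (block m l y + s)\<bar>" by simp
qed (use assms in auto)

text \<open>Interpolation reproduces the constant \<open>g y\<close>, and the nodes used at \<open>y\<close> approach \<open>y\<close> uniformly in \<open>u\<close>.\<close>

lemma grid_interp_continuous_limit:
  assumes m: "0 < m" and g: "continuous_on {0..1} g" and \<epsilon>: "0 < \<epsilon>"
  obtains L0 where "\<And>L u y. L0 \<le> L \<Longrightarrow> 0 \<le> y \<Longrightarrow> y < 1 \<Longrightarrow> \<bar>grid_interp m g L u y - g y\<bar> \<le> \<epsilon>"
proof -
  define \<epsilon>' where "\<epsilon>' = \<epsilon> / (real m ^ m * real m)"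
  have \<epsilon>': "0 < \<epsilon>'" using \<epsilon> m by (simp add: \<epsilon>'_def)
  have "uniformly_continuous_on {0..1} g" using g by (intro compact_uniformly_continuous) auto
  then obtain d where d: "0 < d" "\<And>x x'. x \<in> {0..1} \<Longrightarrow> x' \<in> {0..1} \<Longrightarrow> dist x' x < d \<Longrightarrow> dist (g x') (g x) < \<epsilon>'"
    using \<epsilon>' unfolding uniformly_continuous_on_def by metis
  obtain L1 where L1: "real m / d < 2 ^ L1" using real_arch_pow[of 2 "real m / d"] by auto
  have "m < 2 ^ m" by simp
  define L0 where "L0 = max L1 m"
  show ?thesis
  proof (rule that[of L0])
    fix L u y assume L: "L0 \<le> L" and y: "0 \<le> y" "y < (1::real)"
    have "(2::nat) ^ m \<le> 2 ^ L" using L by (intro power_increasing) (auto simp: L0_def)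
    then have mL: "m \<le> 2 ^ L" using \<open>m < 2 ^ m\<close> by linarith
    have "(2::real) ^ L1 \<le> 2 ^ L" using L by (intro power_increasing) (auto simp: L0_def)
    then have "real m / d < 2 ^ L" using L1 by linarith
    then have md: "real m * (1 / 2 ^ L) < d" using d(1) by (simp add: field_simps)
    have const: "grid_interp m (\<lambda>_. g y) L u y = g y"
    proof -
      have inj: "inj_on (\<lambda>t. node L u (block m L y + t)) {..<m}" by (auto simp: inj_on_def node_def)
      show ?thesis
        using lagrange_reproduces_poly[OF inj, of "[:g y:]" y] m by (simp add: grid_interp_def local_interp_def)
    qed
    have "\<bar>grid_interp m g L u y - g y\<bar> = \<bar>grid_interp m (\<lambda>x. g x - g y) L u y\<bar>"
      by (simp add: grid_interp_diff const)
    also have "\<dots> \<le> real m ^ m * (\<Sum>t<m. \<bar>g (node L u (block m L y + t)) - g y\<bar>)"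
      by (rule grid_interp_bound[OF m mL y])
    also have "\<dots> \<le> real m ^ m * (\<Sum>t<m. \<epsilon>')"
    proof (intro mult_left_mono sum_mono)
      fix t assume t: "t \<in> {..<m}"
      define x where "x = node L u (block m L y + t)"
      have "\<bar>y - x\<bar> \<le> real m * (1 / 2 ^ L)" and i: "block m L y + t < 2 ^ L"
        using grid_nodes_close(1)[OF m mL y, where t=t and u=u] grid_nodes_close(2)[OF m mL y, where t=t] t by (auto simp: x_def)
      then have "dist x y < d" using md by (simp add: dist_real_def abs_minus_commute)
      moreover have "x \<in> {0..1}" using node_in_unit[OF i, of u] by (auto simp: x_def)
      ultimately show "\<bar>g (node L u (block m L y + t)) - g y\<bar> \<le> \<epsilon>'"
        using d(2)[of y x] y by (auto simp: dist_real_def x_def)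
    qed simp
    also have "\<dots> = \<epsilon>" using m by (simp add: \<epsilon>'_def)
    finally show "\<bar>grid_interp m g L u y - g y\<bar> \<le> \<epsilon>" .
  qed
qed

text \<open>Valid for all \<open>p > 0\<close>: for \<open>p < 1\<close> it replaces the triangle inequality, at the price of the geometric weights.\<close>

lemma power_of_sum_weighted:
  fixes A :: "nat \<Rightarrow> real"
  assumes p: "0 < p" and e: "0 < e" and A: "\<And>l. 0 \<le> A l"
  shows "(\<Sum>l=j..L. A l) powr p \<le> (1 / (1 - 2 powr (- e))) powr p * (\<Sum>l=j..L. 2 powr (e * p * real (l - j)) * A l powr p)"
proof -
  define T where "T = (\<Sum>l=j..L. 2 powr (e * p * real (l - j)) * A l powr p)"
  define q :: real where "q = 2 powr (- e)"
  have q: "0 < q" "q < 1" using e by (auto simp: q_def powr_less_one)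
  have T0: "0 \<le> T" unfolding T_def by (intro sum_nonneg) auto
  have Al: "A l \<le> T powr (1 / p) * q ^ (l - j)" if "l \<in> {j..L}" for l
  proof -
    have "2 powr (e * p * real (l - j)) * A l powr p \<le> T"
      unfolding T_def by (rule member_le_sum[OF that]) auto
    then have "(2 powr (e * p * real (l - j)) * A l powr p) powr (1 / p) \<le> T powr (1 / p)"
      using p by (intro powr_mono2) auto
    moreover have "(2 powr (e * p * real (l - j)) * A l powr p) powr (1 / p) = 2 powr (e * real (l - j)) * A l"
      using p A[of l] by (simp add: powr_mult powr_powr)
    ultimately have "2 powr (e * real (l - j)) * A l \<le> T powr (1 / p)" by simp
    then have "2 powr (e * real (l - j)) * A l * q ^ (l - j) \<le> T powr (1 / p) * q ^ (l - j)"
      using q by (intro mult_right_mono) auto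
    moreover have "2 powr (e * real (l - j)) * q ^ (l - j) = 1"
    proof -
      have "q ^ (l - j) = 2 powr (- e * real (l - j))" unfolding q_def by (subst powr_power) (auto simp: mult_ac)
      then show ?thesis by (simp add: powr_add[symmetric])
    qed
    ultimately show ?thesis by (simp add: mult_ac)
  qed
  have "(\<Sum>l=j..L. A l) \<le> (\<Sum>l=j..L. T powr (1 / p) * q ^ (l - j))" by (intro sum_mono Al)
  also have "\<dots> = T powr (1 / p) * (\<Sum>l=j..L. q ^ (l - j))" by (simp add: sum_distrib_left)
  also have "(\<Sum>l=j..L. q ^ (l - j)) \<le> 1 / (1 - q)"
  proof -
    have "(\<Sum>l=j..L. q ^ (l - j)) = (\<Sum>i\<in>(\<lambda>l. l - j) ` {j..L}. q ^ i)"
      by (subst sum.reindex) (auto simp: inj_on_def)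
    also have "\<dots> \<le> (\<Sum>i. q ^ i)" using q by (intro sum_le_suminf) (auto simp: summable_geometric)
    also have "\<dots> = 1 / (1 - q)" using q by (intro suminf_geometric) auto
    finally show ?thesis .
  qed
  finally have "(\<Sum>l=j..L. A l) \<le> T powr (1 / p) * (1 / (1 - q))" by (simp add: mult_left_mono)
  then have "(\<Sum>l=j..L. A l) powr p \<le> (T powr (1 / p) * (1 / (1 - q))) powr p"
    using p A by (intro powr_mono2 sum_nonneg) auto
  also have "\<dots> = (1 / (1 - q)) powr p * T"
    using p q T0 by (subst powr_mult) (auto simp: powr_powr)
  finally show ?thesis by (simp add: T_def q_def)
qed

section \<open>Power sums of wavelet coefficients at one level\<close>
lemma grid_interp_bound_indicator:
  assumes "0 < m" "m \<le> 2 ^ l" "0 \<le> y" "y < 1"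
  shows "\<bar>grid_interp m f l u y\<bar> \<le> real m ^ m *
    (\<Sum>k<2 ^ l. indicator {node l u k - real m * (1 / 2 ^ l)..node l u k + real m * (1 / 2 ^ l)} y * \<bar>f (node l u k)\<bar>)"
proof -
  define i where "i = block m l y"
  define H where "H k = indicator {node l u k - real m * (1 / 2 ^ l)..node l u k + real m * (1 / 2 ^ l)} y * \<bar>f (node l u k)\<bar>" for k
  have "(\<Sum>t<m. \<bar>f (node l u (i + t))\<bar>) = (\<Sum>t<m. H (i + t))"
  proof (intro sum.cong refl)
    fix t assume "t \<in> {..<m}"
    then have "\<bar>y - node l u (i + t)\<bar> \<le> real m * (1 / 2 ^ l)"
      using grid_nodes_close(1)[OF assms, where t=t and u=u] by (simp add: i_def)
    then have "y \<in> {node l u (i + t) - real m * (1 / 2 ^ l)..node l u (i + t) + real m * (1 / 2 ^ l)}" by auto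
    then show "\<bar>f (node l u (i + t))\<bar> = H (i + t)" by (simp add: H_def)
  qed
  also have "\<dots> = (\<Sum>k\<in>(\<lambda>t. i + t) ` {..<m}. H k)" by (subst sum.reindex) auto
  also have "\<dots> \<le> (\<Sum>k<2 ^ l. H k)"
    using grid_nodes_close(2)[OF assms] by (intro sum_mono2) (auto simp: H_def i_def)
  finally have "(\<Sum>t<m. \<bar>f (node l u (i + t))\<bar>) \<le> (\<Sum>k<2 ^ l. H k)" .
  then have "real m ^ m * (\<Sum>t<m. \<bar>f (node l u (i + t))\<bar>) \<le> real m ^ m * (\<Sum>k<2 ^ l. H k)"
    by (intro mult_left_mono) auto
  with grid_interp_bound[OF assms, of f u] show ?thesis unfolding i_def H_def by linarith
qed

lemma nn_integral_interval_indicator: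
  fixes a b :: real
  assumes "a \<le> b" shows "(\<integral>\<^sup>+y. ennreal (indicator {a..b} y) \<partial>lborel) = ennreal (b - a)"
  using assms by (simp add: ennreal_indicator)

text \<open>Subtracting the polynomial of \<open>multiscale_approximation\<close> does not change the coefficient. The remainder is split
as \<open>f - g\<close>, \<open>g\<close> minus its interpolant, the interpolant of \<open>g - f\<close>, and the interpolant of \<open>f\<close> minus the polynomial; only
the last term is of the order of the coefficient, the others tend to zero with the approximation of \<open>f\<close>
by a continuous function \<open>g\<close>.\<close>

lemma coefficient_offset_bound:
  fixes f psi g :: "real \<Rightarrow> real"
  assumes m: "0 < m" "m \<le> 2 ^ j" and L: "j \<le> L"
    and [measurable]: "f \<in> borel_measurable borel" "psi \<in> borel_measurable borel"
    and f1: "integrable lborel (\<lambda>y. indicator {0..<1} y * f y)"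
    and B: "0 \<le> B" "\<And>y. 0 \<le> y \<Longrightarrow> y < 1 \<Longrightarrow> \<bar>psi y\<bar> \<le> B"
    and supp: "\<And>y. 0 \<le> y \<Longrightarrow> y < 1 \<Longrightarrow> psi y \<noteq> 0 \<Longrightarrow> \<bar>y - c\<bar> \<le> real \<rho> / 2 ^ j"
    and orth: "\<And>P. degree P < m \<Longrightarrow> (\<integral>y. indicator {0..<1} y * (poly P y * psi y) \<partial>lborel) = 0"
    and gm[measurable]: "g \<in> borel_measurable borel"
    and gL: "\<And>y. 0 \<le> y \<Longrightarrow> y < 1 \<Longrightarrow> \<bar>grid_interp m g L u y - g y\<bar> \<le> \<epsilon>" and \<epsilon>: "0 \<le> \<epsilon>"
    and gf: "(\<integral>\<^sup>+y. ennreal (indicator {0..<1} y * \<bar>f y - g y\<bar>) \<partial>lborel) \<le> ennreal \<delta>" and \<delta>: "0 \<le> \<delta>"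
    and A: "\<And>l i. j \<le> l \<Longrightarrow> i + m < 2 ^ l \<Longrightarrow> \<bar>node l u i - c\<bar> \<le> real (\<rho> + 2 * m) / 2 ^ j \<Longrightarrow>
        \<bar>fin_diff m (1 / 2 ^ l) f (node l u i)\<bar> \<le> A l" and A0: "\<And>l. 0 \<le> A l"
  shows "\<bar>\<integral>y. indicator {0..<1} y * (f y * psi y) \<partial>lborel\<bar>
    \<le> B * (\<delta> + \<epsilon> + real m ^ m * (2 * real m / 2 ^ L) * (\<Sum>k<2 ^ L. \<bar>f (node L u k) - g (node L u k)\<bar>))
      + B * (refine_const m \<rho> * (\<Sum>l=j..L. A l)) * (2 * real \<rho> / 2 ^ j)"
proof -
  obtain P where P: "degree P < m" and app: "\<And>y. 0 \<le> y \<Longrightarrow> y < 1 \<Longrightarrow> \<bar>y - c\<bar> \<le> real \<rho> / 2 ^ j \<Longrightarrow>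
      \<bar>grid_interp m f L u y - poly P y\<bar> \<le> refine_const m \<rho> * (\<Sum>l=j..L. A l)"
    using multiscale_approximation[where A=A and f=f and u=u and c=c and \<rho>=\<rho>, OF m A A0] L by metis
  have "(2::nat) ^ j \<le> 2 ^ L" using L by (intro power_increasing) auto
  then have mL: "m \<le> 2 ^ L" using m(2) by linarith
  define E where "E = refine_const m \<rho> * (\<Sum>l=j..L. A l)"
  have "0 \<le> refine_const m \<rho>" unfolding refine_const_def by (intro add_nonneg_nonneg mult_nonneg_nonneg) auto
  then have E0: "0 \<le> E" unfolding E_def using A0 by (intro mult_nonneg_nonneg sum_nonneg) auto
  define r where "r = real m * (1 / 2 ^ L)"
  have r0: "0 \<le> r" by (simp add: r_def)
  define H where "H k y = indicator {node L u k - r..node L u k + r} y * \<bar>f (node L u k) - g (node L u k)\<bar>" for k y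
  define N where "N = {c - real \<rho> / 2 ^ j..c + real \<rho> / 2 ^ j}"
  have pint: "integrable lborel (\<lambda>y. indicator {0..<1} y * (poly Q y * psi y))" for Q
  proof -
    obtain b where b: "\<And>y. y \<in> {0..1} \<Longrightarrow> \<bar>poly Q y\<bar> \<le> b"
    proof -
      have "compact (poly Q ` {0..1})" by (intro compact_continuous_image continuous_intros) auto
      then have "bounded (poly Q ` {0..1})" by (rule compact_imp_bounded)
      then obtain a where "\<forall>x\<in>{0..1}. \<bar>poly Q x\<bar> \<le> a" by (auto simp: bounded_iff)
      then show ?thesis using that[of a] by blast
    qed
    show ?thesis
    proof (rule Bochner_Integration.integrable_bound)
      show "integrable lborel (\<lambda>y. b * B * indicator {0..<1::real} y)" by (intro integrable_mult_right integrable_real_indicator) auto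
      show "(\<lambda>y. indicator {0..<1} y * (poly Q y * psi y)) \<in> borel_measurable lborel"
      proof -
        have [measurable]: "poly Q \<in> borel_measurable borel" by (intro borel_measurable_continuous_onI continuous_intros)
        show ?thesis by measurable
      qed
      have "\<bar>poly Q y * psi y\<bar> \<le> b * B" if "0 \<le> y" "y < 1" for y
        unfolding abs_mult using b[of y] B(2)[of y] that B(1) by (intro mult_mono) (auto intro: order_trans[OF abs_ge_zero])
      then show "AE y in lborel. norm (indicator {0..<1} y * (poly Q y * psi y)) \<le> norm (b * B * indicator {0..<1::real} y)"
        by (intro always_eventually allI) (auto simp: indicator_def intro: order_trans[OF _ abs_ge_self])
    qed
  qed
  have fint: "integrable lborel (\<lambda>y. indicator {0..<1} y * (f y * psi y))"
  proof (rule Bochner_Integration.integrable_bound)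
    show "integrable lborel (\<lambda>y. B * (indicator {0..<1} y * f y))" using f1 by simp
    show "AE y in lborel. norm (indicator {0..<1} y * (f y * psi y)) \<le> norm (B * (indicator {0..<1} y * f y))"
    proof (intro always_eventually allI)
      fix y
      show "norm (indicator {0..<1} y * (f y * psi y)) \<le> norm (B * (indicator {0..<1} y * f y))"
        using mult_right_mono[OF B(2)[of y], of "\<bar>f y\<bar>"] B(1) by (auto simp: indicator_def abs_mult mult.commute)
    qed
  qed measurable
  define \<theta> where "\<theta> = (\<integral>y. indicator {0..<1} y * (f y * psi y) \<partial>lborel)"
  have \<theta>: "\<theta> = (\<integral>y. indicator {0..<1} y * (f y * psi y) - indicator {0..<1} y * (poly P y * psi y) \<partial>lborel)"
    using fint pint[of P] orth[OF P] by (simp add: \<theta>_def)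
  have "ennreal \<bar>\<theta>\<bar> \<le> (\<integral>\<^sup>+y. ennreal (norm (indicator {0..<1} y * (f y * psi y) - indicator {0..<1} y * (poly P y * psi y))) \<partial>lborel)"
    unfolding \<theta> real_norm_def[symmetric] by (rule integral_norm_bound_ennreal[OF Bochner_Integration.integrable_diff[OF fint pint]])
  also have "\<dots> \<le> (\<integral>\<^sup>+y. ennreal B * (ennreal (indicator {0..<1} y * \<bar>f y - g y\<bar>) + ennreal \<epsilon> * ennreal (indicator {0..1} y)
      + ennreal (real m ^ m) * (\<Sum>k<2 ^ L. ennreal (H k y)) + ennreal E * ennreal (indicator N y)) \<partial>lborel)"
  proof (rule nn_integral_mono)
    fix y
    show "ennreal (norm (indicator {0..<1} y * (f y * psi y) - indicator {0..<1} y * (poly P y * psi y)))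
      \<le> ennreal B * (ennreal (indicator {0..<1} y * \<bar>f y - g y\<bar>) + ennreal \<epsilon> * ennreal (indicator {0..1} y)
      + ennreal (real m ^ m) * (\<Sum>k<2 ^ L. ennreal (H k y)) + ennreal E * ennreal (indicator N y))"
    proof (cases "0 \<le> y \<and> y < 1 \<and> psi y \<noteq> 0")
      case False
      then show ?thesis by (auto simp: indicator_def)
    next
      case True
      then have y: "0 \<le> y" "y < 1" "psi y \<noteq> 0" by auto
      have yN: "y \<in> N" using supp[OF y] by (auto simp: N_def)
      have S0: "0 \<le> (\<Sum>k<2 ^ L. H k y)" by (intro sum_nonneg) (auto simp: H_def)
      have "\<bar>grid_interp m (\<lambda>x. f x - g x) L u y\<bar> \<le> real m ^ m * (\<Sum>k<2 ^ L. H k y)"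
        unfolding H_def r_def by (rule grid_interp_bound_indicator[OF m(1) mL y(1,2)])
      then have "\<bar>grid_interp m f L u y - grid_interp m g L u y\<bar> \<le> real m ^ m * (\<Sum>k<2 ^ L. H k y)"
        unfolding grid_interp_diff .
      moreover have "\<bar>grid_interp m f L u y - poly P y\<bar> \<le> E" unfolding E_def by (rule app[OF y(1,2) supp[OF y]])
      ultimately have fp: "\<bar>f y - poly P y\<bar> \<le> \<bar>f y - g y\<bar> + \<epsilon> + real m ^ m * (\<Sum>k<2 ^ L. H k y) + E"
        using gL[OF y(1,2)] by linarith
      have "norm (indicator {0..<1} y * (f y * psi y) - indicator {0..<1} y * (poly P y * psi y)) = \<bar>psi y\<bar> * \<bar>f y - poly P y\<bar>"
        using y by (simp add: abs_mult[symmetric] algebra_simps)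
      also have "\<dots> \<le> B * (\<bar>f y - g y\<bar> + \<epsilon> + real m ^ m * (\<Sum>k<2 ^ L. H k y) + E)"
        using fp B y by (intro mult_mono) auto
      finally have "ennreal (norm (indicator {0..<1} y * (f y * psi y) - indicator {0..<1} y * (poly P y * psi y)))
        \<le> ennreal (B * (\<bar>f y - g y\<bar> + \<epsilon> + real m ^ m * (\<Sum>k<2 ^ L. H k y) + E))" by (rule ennreal_leI)
      also have "\<dots> = ennreal B * (ennreal \<bar>f y - g y\<bar> + ennreal \<epsilon> + ennreal (real m ^ m) * ennreal (\<Sum>k<2 ^ L. H k y) + ennreal E)"
        using B S0 \<epsilon> E0 by (simp add: ennreal_mult)
      also have "ennreal (\<Sum>k<2 ^ L. H k y) = (\<Sum>k<2 ^ L. ennreal (H k y))"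
        by (intro sum_ennreal[symmetric]) (simp add: H_def)
      finally show ?thesis using y yN by simp
    qed
  qed
  also have "\<dots> = ennreal B * ((\<integral>\<^sup>+y. ennreal (indicator {0..<1} y * \<bar>f y - g y\<bar>) \<partial>lborel) + ennreal \<epsilon> * (\<integral>\<^sup>+y. ennreal (indicator {0..1::real} y) \<partial>lborel)
      + ennreal (real m ^ m) * (\<Sum>k<2 ^ L. \<integral>\<^sup>+y. ennreal (H k y) \<partial>lborel) + ennreal E * (\<integral>\<^sup>+y. ennreal (indicator N y) \<partial>lborel))"
  proof -
    have [measurable]: "H k \<in> borel_measurable borel" for k unfolding H_def by measurable
    have [measurable]: "N \<in> sets borel" by (simp add: N_def)
    show ?thesis
      by (simp add: nn_integral_add nn_integral_cmult nn_integral_sum del: sum_ennreal)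
  qed
  also have "\<dots> \<le> ennreal B * (ennreal \<delta> + ennreal \<epsilon> * 1
      + ennreal (real m ^ m) * (\<Sum>k<2 ^ L. ennreal (2 * real m / 2 ^ L * \<bar>f (node L u k) - g (node L u k)\<bar>)) + ennreal E * ennreal (2 * real \<rho> / 2 ^ j))"
  proof (intro mult_left_mono add_mono gf sum_mono)
    show "(\<integral>\<^sup>+y. ennreal (indicator {0..1::real} y) \<partial>lborel) \<le> 1" using nn_integral_interval_indicator[of 0 1] by simp
    show "(\<integral>\<^sup>+y. ennreal (indicator N y) \<partial>lborel) \<le> ennreal (2 * real \<rho> / 2 ^ j)"
      unfolding N_def by (subst nn_integral_interval_indicator) (auto simp: divide_nonneg_nonneg intro: order_trans[of _ c])
    fix k
    have "(\<integral>\<^sup>+y. ennreal (H k y) \<partial>lborel) = (\<integral>\<^sup>+y. ennreal (indicator {node L u k - r..node L u k + r} y) * ennreal \<bar>f (node L u k) - g (node L u k)\<bar> \<partial>lborel)"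
      by (simp add: H_def ennreal_mult)
    also have "\<dots> = ennreal (2 * r) * ennreal \<bar>f (node L u k) - g (node L u k)\<bar>"
      using r0 by (subst nn_integral_multc) (auto simp: ennreal_indicator)
    also have "\<dots> = ennreal (2 * real m / 2 ^ L * \<bar>f (node L u k) - g (node L u k)\<bar>)"
      using r0 by (subst ennreal_mult[symmetric]) (auto simp: r_def)
    finally show "(\<integral>\<^sup>+y. ennreal (H k y) \<partial>lborel) \<le> ennreal (2 * real m / 2 ^ L * \<bar>f (node L u k) - g (node L u k)\<bar>)" by simp
  qed auto
  also have "\<dots> = ennreal (B * (\<delta> + \<epsilon> + real m ^ m * (2 * real m / 2 ^ L) * (\<Sum>k<2 ^ L. \<bar>f (node L u k) - g (node L u k)\<bar>))
      + B * E * (2 * real \<rho> / 2 ^ j))"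
  proof -
    define S where "S = (\<Sum>k<2 ^ L. \<bar>f (node L u k) - g (node L u k)\<bar>)"
    have S0: "0 \<le> S" unfolding S_def by (intro sum_nonneg) auto
    have s: "(\<Sum>k<2 ^ L. ennreal (2 * real m / 2 ^ L * \<bar>f (node L u k) - g (node L u k)\<bar>)) = ennreal (2 * real m / 2 ^ L * S)"
      by (subst sum_ennreal) (auto simp: S_def sum_distrib_left)
    define M where "M = real m ^ m" define q where "q = 2 * real m / 2 ^ L" define w where "w = 2 * real \<rho> / 2 ^ j"
    have nn: "0 \<le> M" "0 \<le> q" "0 \<le> w" by (auto simp: M_def q_def w_def)
    have "ennreal B * (ennreal \<delta> + ennreal \<epsilon> * 1 + ennreal M * ennreal (q * S) + ennreal E * ennreal w)
       = ennreal (B * (\<delta> + \<epsilon> + M * (q * S) + E * w))"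
      using B(1) \<delta> \<epsilon> S0 E0 nn by (simp add: ennreal_mult)
    also have "B * (\<delta> + \<epsilon> + M * (q * S) + E * w) = B * (\<delta> + \<epsilon> + M * q * S) + B * E * w" by (simp add: algebra_simps)
    finally show ?thesis unfolding s S_def[symmetric] M_def q_def w_def .
  qed
  finally show ?thesis
    unfolding E_def[symmetric] \<theta>_def[symmetric] using B(1) \<delta> \<epsilon> E0
    by (subst (asm) ennreal_le_iff) (auto intro!: add_nonneg_nonneg mult_nonneg_nonneg sum_nonneg)
qed

lemma measurable_fin_diff[measurable]:
  assumes [measurable]: "f \<in> borel_measurable borel"
  shows "fin_diff m h f \<in> borel_measurable borel"
  unfolding fin_diff_def by measurable

text \<open>The preceding bound has the form \<open>|\<theta>| \<le> X u + Y u\<close> for every offset \<open>u\<close>, with the average of \<open>X\<close> at most \<open>|\<theta>| / 4\<close>. By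
Markov's inequality \<open>Y u \<ge> |\<theta>| / 2\<close> with probability at least one half. Averaging \<open>Y u powr p\<close> rather than \<open>Y u\<close>
makes the argument work for \<open>p < 1\<close>.\<close>

lemma coefficient_power_bound:
  fixes f psi :: "real \<Rightarrow> real"
  assumes m: "0 < m" "m \<le> 2 ^ j" and p: "0 < p" and e: "0 < e"
    and fm[measurable]: "f \<in> borel_measurable borel" and psim[measurable]: "psi \<in> borel_measurable borel"
    and f1: "integrable lborel (\<lambda>y. indicator {0..<1} y * f y)"
    and B: "0 < B" "\<And>y. 0 \<le> y \<Longrightarrow> y < 1 \<Longrightarrow> \<bar>psi y\<bar> \<le> B"
    and supp: "\<And>y. 0 \<le> y \<Longrightarrow> y < 1 \<Longrightarrow> psi y \<noteq> 0 \<Longrightarrow> \<bar>y - c\<bar> \<le> real \<rho> / 2 ^ j"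
    and orth: "\<And>P. degree P < m \<Longrightarrow> (\<integral>y. indicator {0..<1} y * (poly P y * psi y) \<partial>lborel) = 0"
    and dense: "\<And>\<delta>. 0 < \<delta> \<Longrightarrow> \<exists>g. g \<in> borel_measurable borel \<and> continuous_on {0..1} g \<and>
        (\<integral>\<^sup>+y. ennreal (indicator {0..<1} y * \<bar>f y - g y\<bar>) \<partial>lborel) \<le> ennreal \<delta>"
  defines "\<theta> \<equiv> (\<integral>y. indicator {0..<1} y * (f y * psi y) \<partial>lborel)"
    and "G \<equiv> 2 * 2 powr p * (B * refine_const m \<rho> * (2 * real \<rho> / 2 ^ j)) powr p * (1 / (1 - 2 powr (- e))) powr p"
  shows "\<exists>L0. \<forall>L\<ge>L0. ennreal (\<bar>\<theta>\<bar> powr p) \<le> ennreal G * (\<Sum>l=j..L. ennreal (2 powr (e * p * real (l - j))) *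
      (2 ^ l * (\<integral>\<^sup>+x. indicator {0..<real (2 ^ l - m) / 2 ^ l} x *
        ennreal (indicator {c - real (\<rho> + 2 * m) / 2 ^ j..c + real (\<rho> + 2 * m) / 2 ^ j} x * \<bar>fin_diff m (1 / 2 ^ l) f x\<bar> powr p) \<partial>lborel)))"
proof (cases "\<theta> = 0")
  case True
  then show ?thesis using p by simp
next
  case False
  then have t0: "0 < \<bar>\<theta>\<bar>" by simp
  define M where "M = real m ^ m"
  define \<kappa> where "\<kappa> = 2 + 2 * real m * M"
  (* chosen so that the average of the error term X below is at most a quarter of the coefficient *)
  define \<delta> where "\<delta> = \<bar>\<theta>\<bar> / (4 * B * \<kappa>)"
  have M0: "0 \<le> M" by (simp add: M_def)
  have \<kappa>: "0 < \<kappa>" unfolding \<kappa>_def using M0 by (intro add_pos_nonneg) auto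
  have \<delta>: "0 < \<delta>" using t0 B(1) \<kappa> by (simp add: \<delta>_def)
  obtain g where g[measurable]: "g \<in> borel_measurable borel" and gc: "continuous_on {0..1} g"
    and gf: "(\<integral>\<^sup>+y. ennreal (indicator {0..<1} y * \<bar>f y - g y\<bar>) \<partial>lborel) \<le> ennreal \<delta>" using dense[OF \<delta>] by blast
  obtain L1 where L1: "\<And>L u y. L1 \<le> L \<Longrightarrow> 0 \<le> y \<Longrightarrow> y < 1 \<Longrightarrow> \<bar>grid_interp m g L u y - g y\<bar> \<le> \<delta>"
    using grid_interp_continuous_limit[OF m(1) gc \<delta>] by blast
  define \<psi> where "\<psi> l x = indicator {c - real (\<rho> + 2 * m) / 2 ^ j..c + real (\<rho> + 2 * m) / 2 ^ j} x * \<bar>fin_diff m (1 / 2 ^ l) f x\<bar> powr p" for l x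
  have \<psi>m[measurable]: "\<psi> l \<in> borel_measurable borel" for l unfolding \<psi>_def by measurable
  have \<psi>0: "0 \<le> \<psi> l x" for l x by (simp add: \<psi>_def)
  define D where "D l u = (\<Sum>i<2 ^ l - m. \<psi> l (node l u i))" for l u
  have D0: "0 \<le> D l u" for l u unfolding D_def by (intro sum_nonneg \<psi>0)
  (* bounds the supremum of the differences near c by their l^p sum over the grid points *)
  define A where "A u l = D l u powr (1 / p)" for u l
  have A0: "0 \<le> A u l" for u l by (simp add: A_def)
  have Ap: "A u l powr p = D l u" for u l using p D0 by (simp add: A_def powr_powr)
  have Acond: "\<bar>fin_diff m (1 / 2 ^ l) f (node l u i)\<bar> \<le> A u l"
    if "i + m < 2 ^ l" "\<bar>node l u i - c\<bar> \<le> real (\<rho> + 2 * m) / 2 ^ j" for l u i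
  proof -
    have "node l u i \<in> {c - real (\<rho> + 2 * m) / 2 ^ j..c + real (\<rho> + 2 * m) / 2 ^ j}" using that(2) by (simp add: abs_le_iff)
    then have "\<bar>fin_diff m (1 / 2 ^ l) f (node l u i)\<bar> powr p = \<psi> l (node l u i)" by (simp add: \<psi>_def)
    also have "\<dots> \<le> D l u" unfolding D_def using that(1) \<psi>0 by (intro member_le_sum) auto
    finally have "(\<bar>fin_diff m (1 / 2 ^ l) f (node l u i)\<bar> powr p) powr (1 / p) \<le> A u l"
      unfolding A_def using p by (intro powr_mono2) auto
    then show ?thesis using p by (simp add: powr_powr)
  qed
  define L0 where "L0 = max j L1"
  show ?thesis
  proof (intro exI[of _ L0] allI impI)
    fix L assume L: "L0 \<le> L"
    then have jL: "j \<le> L" "L1 \<le> L" by (auto simp: L0_def)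
    define S where "S u = (\<Sum>k<2 ^ L. \<bar>f (node L u k) - g (node L u k)\<bar>)" for u
    define X where "X u = B * (\<delta> + \<delta> + M * (2 * real m / 2 ^ L) * S u)" for u
    define Y where "Y u = B * (refine_const m \<rho> * (\<Sum>l=j..L. A u l)) * (2 * real \<rho> / 2 ^ j)" for u
    have S0: "0 \<le> S u" for u by (simp add: S_def sum_nonneg)
    have X0: "0 \<le> X u" for u unfolding X_def using B \<delta> M0 S0 by (intro mult_nonneg_nonneg add_nonneg_nonneg) auto
    have rc: "0 \<le> refine_const m \<rho>" unfolding refine_const_def by (intro add_nonneg_nonneg mult_nonneg_nonneg) auto
    have Y0: "0 \<le> Y u" for u unfolding Y_def using B A0 rc by (intro mult_nonneg_nonneg sum_nonneg) auto
    have XY: "\<bar>\<theta>\<bar> \<le> X u + Y u" for u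
      unfolding \<theta>_def X_def Y_def S_def M_def
      by (rule coefficient_offset_bound[OF m jL(1) fm psim f1 less_imp_le[OF B(1)] B(2) supp orth g L1[OF jL(2)] less_imp_le[OF \<delta>] gf less_imp_le[OF \<delta>] Acond A0])
    define T where "T = (\<bar>\<theta>\<bar> / 2) powr p"
    have T0: "0 < T" using t0 by (simp add: T_def)
    define b where "b = (B * refine_const m \<rho> * (2 * real \<rho> / 2 ^ j)) powr p"
    define q where "q = (1 / (1 - 2 powr (- e))) powr p"
    have bq0: "0 \<le> b" "0 \<le> q" by (auto simp: b_def q_def)
    have Gbq: "G = 2 * 2 powr p * b * q" by (simp add: G_def b_def q_def)
    define w where "w l = 2 powr (e * p * real (l - j))" for l
    have w0: "0 \<le> w l" for l by (simp add: w_def)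
    have Yp: "Y u powr p \<le> b * (q * (\<Sum>l=j..L. w l * D l u))" for u
    proof -
      have "Y u = (B * refine_const m \<rho> * (2 * real \<rho> / 2 ^ j)) * (\<Sum>l=j..L. A u l)" by (simp add: Y_def mult_ac)
      then have "Y u powr p = b * (\<Sum>l=j..L. A u l) powr p"
        unfolding b_def by (simp only: powr_mult)
      also have "\<dots> \<le> b * (q * (\<Sum>l=j..L. w l * A u l powr p))"
        unfolding q_def w_def by (intro mult_left_mono power_of_sum_weighted p e A0 bq0)
      finally show ?thesis by (simp add: Ap)
    qed
    (* if X u is at least half of the coefficient the first term exceeds T, otherwise Y u is at least the other half *)
    have pt: "T \<le> T * (2 / \<bar>\<theta>\<bar>) * X u + b * (q * (\<Sum>l=j..L. w l * D l u))" for u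
    proof (cases "\<bar>\<theta>\<bar> / 2 \<le> X u")
      case True
      then have "1 \<le> 2 / \<bar>\<theta>\<bar> * X u" using t0 by (simp add: field_simps)
      then have "T * 1 \<le> T * (2 / \<bar>\<theta>\<bar> * X u)" using T0 by (intro mult_left_mono) auto
      moreover have "0 \<le> Y u powr p" by simp
      ultimately show ?thesis using Yp[of u] unfolding mult.assoc by linarith
    next
      case False
      then have "\<bar>\<theta>\<bar> / 2 \<le> Y u" using XY[of u] by linarith
      then have "T \<le> Y u powr p" unfolding T_def using p t0 by (intro powr_mono2) auto
      moreover have "0 \<le> T * (2 / \<bar>\<theta>\<bar>) * X u" using T0 X0 t0 by (intro mult_nonneg_nonneg) auto
      ultimately show ?thesis using Yp[of u] by linarith
    qed
    have Xm[measurable]: "X \<in> borel_measurable borel" unfolding X_def S_def by measurable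
    have Dm[measurable]: "D l \<in> borel_measurable borel" for l unfolding D_def by measurable
    have i01: "(\<integral>\<^sup>+u. indicator {0..<1::real} u * ennreal a \<partial>lborel) = ennreal a" for a
      by (subst nn_integral_multc) auto
    have EX: "(\<integral>\<^sup>+u. indicator {0..<1} u * ennreal (X u) \<partial>lborel) \<le> ennreal (\<bar>\<theta>\<bar> / 4)"
    proof -
      have ES: "(\<integral>\<^sup>+u. indicator {0..<1} u * ennreal (S u) \<partial>lborel) \<le> ennreal (2 ^ L * \<delta>)"
      proof -
        have "ennreal (S u) = (\<Sum>k<2 ^ L. ennreal \<bar>f (node L u k) - g (node L u k)\<bar>)" for u
          unfolding S_def by (intro sum_ennreal[symmetric]) auto
        then have "(\<integral>\<^sup>+u. indicator {0..<1} u * ennreal (S u) \<partial>lborel)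
          = 2 ^ L * (\<integral>\<^sup>+x. indicator {0..<real (2 ^ L) / 2 ^ L} x * ennreal \<bar>f x - g x\<bar> \<partial>lborel)"
          using offset_average[where \<psi>="\<lambda>x. ennreal \<bar>f x - g x\<bar>" and n="2 ^ L" and l=L] by (simp del: sum_ennreal)
        also have "(\<integral>\<^sup>+x. indicator {0..<real (2 ^ L) / 2 ^ L} x * ennreal \<bar>f x - g x\<bar> \<partial>lborel)
           = (\<integral>\<^sup>+y. ennreal (indicator {0..<1} y * \<bar>f y - g y\<bar>) \<partial>lborel)"
          by (intro nn_integral_cong) (auto simp: indicator_def)
        also have "2 ^ L * \<dots> \<le> 2 ^ L * ennreal \<delta>" by (intro mult_left_mono gf) auto
        also have "2 ^ L * ennreal \<delta> = ennreal (2 ^ L * \<delta>)" using \<delta> by (simp add: ennreal_mult ennreal_power[symmetric])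
        finally show ?thesis .
      qed
      define a where "a = B * (\<delta> + \<delta>)" define d where "d = B * M * (2 * real m / 2 ^ L)"
      have ad: "0 \<le> a" "0 \<le> d" using B \<delta> M0 by (auto simp: a_def d_def intro!: mult_nonneg_nonneg)
      have Xe: "X u = a + d * S u" for u by (simp add: X_def a_def d_def algebra_simps)
      have Sm[measurable]: "S \<in> borel_measurable borel" unfolding S_def by measurable
      have "(\<integral>\<^sup>+u. indicator {0..<1} u * ennreal (X u) \<partial>lborel)
        = (\<integral>\<^sup>+u. indicator {0..<1} u * ennreal a + ennreal d * (indicator {0..<1} u * ennreal (S u)) \<partial>lborel)"
        unfolding Xe using ad S0 by (intro nn_integral_cong) (auto simp: ennreal_mult indicator_def)
      also have "\<dots> = ennreal a + ennreal d * (\<integral>\<^sup>+u. indicator {0..<1} u * ennreal (S u) \<partial>lborel)"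
        by (simp add: nn_integral_add nn_integral_cmult i01)
      also have "\<dots> \<le> ennreal a + ennreal d * ennreal (2 ^ L * \<delta>)" by (intro add_left_mono mult_left_mono ES) auto
      also have "\<dots> = ennreal (a + d * (2 ^ L * \<delta>))"
        using ad \<delta> by (simp add: ennreal_mult)
      also have "a + d * (2 ^ L * \<delta>) = B * \<kappa> * \<delta>"
        by (simp add: a_def d_def \<kappa>_def algebra_simps)
      also have "\<dots> = \<bar>\<theta>\<bar> / 4" using B \<kappa> by (simp add: \<delta>_def)
      finally show ?thesis .
    qed
    have ED: "(\<integral>\<^sup>+u. indicator {0..<1} u * ennreal (D l u) \<partial>lborel) = 2 ^ l * (\<integral>\<^sup>+x. indicator {0..<real (2 ^ l - m) / 2 ^ l} x * ennreal (\<psi> l x) \<partial>lborel)" for l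
    proof -
      have "ennreal (D l u) = (\<Sum>i<2 ^ l - m. ennreal (\<psi> l (node l u i)))" for u
        unfolding D_def by (intro sum_ennreal[symmetric] \<psi>0)
      then show ?thesis using offset_average[where \<psi>="\<lambda>x. ennreal (\<psi> l x)" and n="2 ^ l - m" and l=l] by (simp del: sum_ennreal)
    qed
    define Q where "Q = ennreal (b * q) * (\<Sum>l=j..L. ennreal (w l) * (2 ^ l * (\<integral>\<^sup>+x. indicator {0..<real (2 ^ l - m) / 2 ^ l} x * ennreal (\<psi> l x) \<partial>lborel)))"
    have "ennreal T = (\<integral>\<^sup>+u. indicator {0..<1::real} u * ennreal T \<partial>lborel)" by (simp add: i01)
    also have "\<dots> \<le> (\<integral>\<^sup>+u. ennreal (T * (2 / \<bar>\<theta>\<bar>)) * (indicator {0..<1} u * ennreal (X u)) + ennreal (b * q) * (\<Sum>l=j..L. ennreal (w l) * (indicator {0..<1} u * ennreal (D l u))) \<partial>lborel)"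
    proof (rule nn_integral_mono)
      fix u :: real
      have "ennreal T \<le> ennreal (T * (2 / \<bar>\<theta>\<bar>) * X u + b * (q * (\<Sum>l=j..L. w l * D l u)))" by (intro ennreal_leI pt)
      also have "\<dots> = ennreal (T * (2 / \<bar>\<theta>\<bar>)) * ennreal (X u) + ennreal (b * q) * ennreal (\<Sum>l=j..L. w l * D l u)"
      proof -
        have "0 \<le> T * (2 / \<bar>\<theta>\<bar>)" "0 \<le> b * q" "0 \<le> (\<Sum>l=j..L. w l * D l u)" using T0 t0 bq0 w0 D0 by (auto intro!: sum_nonneg mult_nonneg_nonneg)
        then show ?thesis using X0[of u] by (simp only: mult.assoc[of b q, symmetric] ennreal_mult[symmetric] ennreal_plus[symmetric] mult_nonneg_nonneg)
      qed
      also have "ennreal (\<Sum>l=j..L. w l * D l u) = (\<Sum>l=j..L. ennreal (w l) * ennreal (D l u))"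
      proof -
        have "ennreal (\<Sum>l=j..L. w l * D l u) = (\<Sum>l=j..L. ennreal (w l * D l u))"
          by (intro sum_ennreal[symmetric] mult_nonneg_nonneg w0 D0)
        also have "\<dots> = (\<Sum>l=j..L. ennreal (w l) * ennreal (D l u))"
          by (intro sum.cong refl ennreal_mult w0 D0)
        finally show ?thesis .
      qed
      finally show "indicator {0..<1} u * ennreal T \<le> ennreal (T * (2 / \<bar>\<theta>\<bar>)) * (indicator {0..<1} u * ennreal (X u)) + ennreal (b * q) * (\<Sum>l=j..L. ennreal (w l) * (indicator {0..<1} u * ennreal (D l u)))"
        by (cases "u \<in> {0..<1}") auto
    qed
    also have "\<dots> = ennreal (T * (2 / \<bar>\<theta>\<bar>)) * (\<integral>\<^sup>+u. indicator {0..<1} u * ennreal (X u) \<partial>lborel) + Q"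
      unfolding Q_def ED[symmetric] by (simp add: nn_integral_add nn_integral_cmult nn_integral_sum)
    also have "\<dots> \<le> ennreal (T * (2 / \<bar>\<theta>\<bar>)) * ennreal (\<bar>\<theta>\<bar> / 4) + Q"
      by (intro add_right_mono mult_left_mono EX) auto
    also have "ennreal (T * (2 / \<bar>\<theta>\<bar>)) * ennreal (\<bar>\<theta>\<bar> / 4) = ennreal (T / 2)"
      using T0 t0 by (subst ennreal_mult[symmetric]) auto
    finally have "ennreal T \<le> ennreal (T / 2) + Q" .
    moreover have "ennreal T = ennreal (T / 2) + ennreal (T / 2)" using T0 by (subst ennreal_plus[symmetric]) auto
    ultimately have half: "ennreal (T / 2) \<le> Q" by (simp add: ennreal_add_left_cancel_le)
    have "\<bar>\<theta>\<bar> powr p = 2 * 2 powr p * (T / 2)" using t0 by (simp add: T_def powr_divide)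
    moreover have "ennreal (2 * 2 powr p * (T / 2)) = ennreal (2 * 2 powr p) * ennreal (T / 2)" using T0 by (intro ennreal_mult) auto
    ultimately have "ennreal (\<bar>\<theta>\<bar> powr p) = ennreal (2 * 2 powr p) * ennreal (T / 2)" by (simp only:)
    also have "\<dots> \<le> ennreal (2 * 2 powr p) * Q" by (intro mult_left_mono half) auto
    also have "\<dots> = ennreal G * (\<Sum>l=j..L. ennreal (w l) * (2 ^ l * (\<integral>\<^sup>+x. indicator {0..<real (2 ^ l - m) / 2 ^ l} x * ennreal (\<psi> l x) \<partial>lborel)))"
    proof -
      have "ennreal G = ennreal (2 * 2 powr p) * ennreal (b * q)"
        unfolding Gbq using bq0 by (subst ennreal_mult[symmetric]) (auto simp: mult.assoc)
      then show ?thesis by (simp only: Q_def mult.assoc)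
    qed
    finally show "ennreal (\<bar>\<theta>\<bar> powr p) \<le> ennreal G * (\<Sum>l=j..L. ennreal (2 powr (e * p * real (l - j))) *
      (2 ^ l * (\<integral>\<^sup>+x. indicator {0..<real (2 ^ l - m) / 2 ^ l} x *
        ennreal (indicator {c - real (\<rho> + 2 * m) / 2 ^ j..c + real (\<rho> + 2 * m) / 2 ^ j} x * \<bar>fin_diff m (1 / 2 ^ l) f x\<bar> powr p) \<partial>lborel)))"
      unfolding w_def \<psi>_def .
  qed
qed

text \<open>Summation over the wavelets of one level uses the bounded overlap of their supports. The exponent
\<open>e = (s - 1 / p) / 2\<close> of the weights leaves half of the margin \<open>s - 1 / p > 0\<close> for the convergence of the sum over the
finer levels.\<close>

lemma level_power_sum_bound:
  fixes f :: "real \<Rightarrow> real" and psi :: "nat \<Rightarrow> real \<Rightarrow> real"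
  assumes m: "0 < m" "m \<le> 2 ^ j" and p: "0 < p" and s: "1 / p < s"
    and fm[measurable]: "f \<in> borel_measurable borel" and psim: "\<And>k. k < n \<Longrightarrow> psi k \<in> borel_measurable borel"
    and f1: "integrable lborel (\<lambda>y. indicator {0..<1} y * f y)"
    and B: "0 < B" "\<And>k y. k < n \<Longrightarrow> 0 \<le> y \<Longrightarrow> y < 1 \<Longrightarrow> \<bar>psi k y\<bar> \<le> B"
    and supp: "\<And>k y. k < n \<Longrightarrow> 0 \<le> y \<Longrightarrow> y < 1 \<Longrightarrow> psi k y \<noteq> 0 \<Longrightarrow> \<bar>y - c k\<bar> \<le> real \<rho> / 2 ^ j"
    and orth: "\<And>k P. k < n \<Longrightarrow> degree P < m \<Longrightarrow> (\<integral>y. indicator {0..<1} y * (poly P y * psi k y) \<partial>lborel) = 0"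
    and dense: "\<And>\<delta>. 0 < \<delta> \<Longrightarrow> \<exists>g. g \<in> borel_measurable borel \<and> continuous_on {0..1} g \<and>
        (\<integral>\<^sup>+y. ennreal (indicator {0..<1} y * \<bar>f y - g y\<bar>) \<partial>lborel) \<le> ennreal \<delta>"
    and overlap: "\<And>x. card {k. k < n \<and> \<bar>x - c k\<bar> \<le> real (\<rho> + 2 * m) / 2 ^ j} \<le> Kov"
    and M: "0 \<le> M" and smooth: "\<And>l. j \<le> l \<Longrightarrow> (\<integral>\<^sup>+x. indicator {0..1 - real m / 2 ^ l} x * ennreal (\<bar>fin_diff m (1 / 2 ^ l) f x\<bar> powr p) \<partial>lborel)
        \<le> ennreal (M * 2 powr (- real l * s * p))"
  shows "(\<Sum>k<n. \<bar>\<integral>y. indicator {0..<1} y * (f y * psi k y) \<partial>lborel\<bar> powr p)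
    \<le> 2 * 2 powr p * (B * refine_const m \<rho> * (2 * real \<rho> / 2 ^ j)) powr p * (1 / (1 - 2 powr (- ((s - 1 / p) / 2)))) powr p
       * (real Kov * M * 2 powr (real j * (1 - s * p)) / (1 - 2 powr (- ((s * p - 1) / 2))))"
proof -
  define e where "e = (s - 1 / p) / 2"
  have e: "0 < e" using s by (simp add: e_def)
  have ep: "e * p = (s * p - 1) / 2" using p by (simp add: e_def field_simps)
  define G where "G = 2 * 2 powr p * (B * refine_const m \<rho> * (2 * real \<rho> / 2 ^ j)) powr p * (1 / (1 - 2 powr (- e))) powr p"
  have G0: "0 \<le> G" unfolding G_def by (intro mult_nonneg_nonneg) auto
  define \<theta> where "\<theta> k = (\<integral>y. indicator {0..<1} y * (f y * psi k y) \<partial>lborel)" for k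
  define I where "I k l x = (indicator {0..<real (2 ^ l - m) / 2 ^ l} x *
        ennreal (indicator {c k - real (\<rho> + 2 * m) / 2 ^ j..c k + real (\<rho> + 2 * m) / 2 ^ j} x * \<bar>fin_diff m (1 / 2 ^ l) f x\<bar> powr p))" for k l x
  have "\<exists>L0. \<forall>L\<ge>L0. ennreal (\<bar>\<theta> k\<bar> powr p) \<le> ennreal G * (\<Sum>l=j..L. ennreal (2 powr (e * p * real (l - j))) * (2 ^ l * (\<integral>\<^sup>+x. I k l x \<partial>lborel)))"
    if k: "k < n" for k
    unfolding \<theta>_def G_def I_def
    by (rule coefficient_power_bound[OF m p e fm psim[OF k] f1 B(1) B(2)[OF k] supp[OF k] orth[OF k] dense])
  then have "\<forall>k. \<exists>L0. k < n \<longrightarrow> (\<forall>L\<ge>L0. ennreal (\<bar>\<theta> k\<bar> powr p) \<le> ennreal G * (\<Sum>l=j..L. ennreal (2 powr (e * p * real (l - j))) * (2 ^ l * (\<integral>\<^sup>+x. I k l x \<partial>lborel))))"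
    by blast
  from choice[OF this] obtain L0 where L0: "\<And>k L. k < n \<Longrightarrow> L0 k \<le> L \<Longrightarrow>
      ennreal (\<bar>\<theta> k\<bar> powr p) \<le> ennreal G * (\<Sum>l=j..L. ennreal (2 powr (e * p * real (l - j))) * (2 ^ l * (\<integral>\<^sup>+x. I k l x \<partial>lborel)))"
    by blast
  define L where "L = (\<Sum>k<n. L0 k)"
  have LL: "L0 k \<le> L" if "k < n" for k unfolding L_def using that by (intro member_le_sum) auto
  have Im[measurable]: "I k l \<in> borel_measurable borel" for k l unfolding I_def by measurable
  have loc: "(\<Sum>k<n. \<integral>\<^sup>+x. I k l x \<partial>lborel) \<le> ennreal (real Kov * M * 2 powr (- real l * s * p))" if l: "j \<le> l" for l
  proof -
    have "(2::nat) ^ j \<le> 2 ^ l" using l by (intro power_increasing) auto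
    then have ml: "m \<le> 2 ^ l" using m(2) by linarith
    have sub: "real (2 ^ l - m) / 2 ^ l = 1 - real m / 2 ^ l" using ml by (simp add: of_nat_diff diff_divide_distrib)
    have "(\<Sum>k<n. \<integral>\<^sup>+x. I k l x \<partial>lborel) = (\<integral>\<^sup>+x. (\<Sum>k<n. I k l x) \<partial>lborel)"
      by (rule nn_integral_sum[symmetric]) measurable
    also have "\<dots> \<le> (\<integral>\<^sup>+x. ennreal (real Kov) * (indicator {0..1 - real m / 2 ^ l} x * ennreal (\<bar>fin_diff m (1 / 2 ^ l) f x\<bar> powr p)) \<partial>lborel)"
    proof (rule nn_integral_mono)
      fix x
      define a where "a = \<bar>fin_diff m (1 / 2 ^ l) f x\<bar> powr p"
      have a0: "0 \<le> a" by (simp add: a_def)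
      define N where "N = {k. k < n \<and> \<bar>x - c k\<bar> \<le> real (\<rho> + 2 * m) / 2 ^ j}"
      have "(\<Sum>k<n. I k l x) = (\<Sum>k<n. if k \<in> N then indicator {0..<1 - real m / 2 ^ l} x * ennreal a else 0)"
        unfolding I_def sub a_def[symmetric] by (intro sum.cong refl) (auto simp: N_def indicator_def abs_le_iff)
      also have "\<dots> = (\<Sum>k\<in>N. indicator {0..<1 - real m / 2 ^ l} x * ennreal a)"
        by (intro sum.mono_neutral_cong_right) (auto simp: N_def)
      also have "\<dots> = ennreal (real (card N)) * (indicator {0..<1 - real m / 2 ^ l} x * ennreal a)"
        by (simp add: ennreal_of_nat_eq_real_of_nat)
      also have "\<dots> \<le> ennreal (real Kov) * (indicator {0..1 - real m / 2 ^ l} x * ennreal a)"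
        using overlap[of x] by (intro mult_mono ennreal_leI) (auto simp: N_def indicator_def)
      finally show "(\<Sum>k<n. I k l x) \<le> ennreal (real Kov) * (indicator {0..1 - real m / 2 ^ l} x * ennreal (\<bar>fin_diff m (1 / 2 ^ l) f x\<bar> powr p))"
        by (simp add: a_def)
    qed
    also have "\<dots> = ennreal (real Kov) * (\<integral>\<^sup>+x. indicator {0..1 - real m / 2 ^ l} x * ennreal (\<bar>fin_diff m (1 / 2 ^ l) f x\<bar> powr p) \<partial>lborel)"
      by (rule nn_integral_cmult) measurable
    also have "\<dots> \<le> ennreal (real Kov) * ennreal (M * 2 powr (- real l * s * p))"
      by (intro mult_left_mono smooth l) auto
    also have "\<dots> = ennreal (real Kov * M * 2 powr (- real l * s * p))"
      using M by (simp add: ennreal_mult[symmetric] mult.assoc)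
    finally show ?thesis .
  qed
  define r :: real where "r = 2 powr (- ((s * p - 1) / 2))"
  have "1 < s * p" using s p by (simp add: field_simps)
  then have r: "0 < r" "r < 1" by (auto simp: r_def powr_less_one)
  have summand: "2 powr (e * p * real (l - j)) * (2 ^ l * (real Kov * M * 2 powr (- real l * s * p))) = real Kov * M * 2 powr (real j * (1 - s * p)) * r ^ (l - j)"
    if l: "j \<le> l" for l
  proof -
    have lr: "real l = real j + real (l - j)" using l by simp
    have "2 powr (e * p * real (l - j)) * (2 ^ l * 2 powr (- real l * s * p)) = 2 powr (e * p * real (l - j) + (real l + - real l * s * p))"
    proof -
      have "(2::real) ^ l = 2 powr real l" by (simp add: powr_realpow)
      then show ?thesis by (simp only: powr_add)
    qed
    also have "e * p * real (l - j) + (real l + - real l * s * p) = real j * (1 - s * p) + real (l - j) * (- ((s * p - 1) / 2))"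
      unfolding ep lr by (simp add: field_simps)
    also have "2 powr \<dots> = 2 powr (real j * (1 - s * p)) * r ^ (l - j)"
      unfolding powr_add r_def by (subst powr_power) auto
    finally show ?thesis by (simp add: mult_ac)
  qed
  have "ennreal (\<Sum>k<n. \<bar>\<theta> k\<bar> powr p) = (\<Sum>k<n. ennreal (\<bar>\<theta> k\<bar> powr p))" by (simp add: sum_ennreal)
  also have "\<dots> \<le> (\<Sum>k<n. ennreal G * (\<Sum>l=j..L. ennreal (2 powr (e * p * real (l - j))) * (2 ^ l * (\<integral>\<^sup>+x. I k l x \<partial>lborel))))"
    by (intro sum_mono L0 LL) auto
  also have "\<dots> = ennreal G * (\<Sum>l=j..L. ennreal (2 powr (e * p * real (l - j))) * (2 ^ l * (\<Sum>k<n. \<integral>\<^sup>+x. I k l x \<partial>lborel)))"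
    unfolding sum_distrib_left by (rule sum.swap)
  also have "\<dots> \<le> ennreal G * (\<Sum>l=j..L. ennreal (2 powr (e * p * real (l - j))) * (2 ^ l * ennreal (real Kov * M * 2 powr (- real l * s * p))))"
    by (intro mult_left_mono sum_mono loc) auto
  also have "(\<Sum>l=j..L. ennreal (2 powr (e * p * real (l - j))) * (2 ^ l * ennreal (real Kov * M * 2 powr (- real l * s * p))))
     = (\<Sum>l=j..L. ennreal (real Kov * M * 2 powr (real j * (1 - s * p)) * r ^ (l - j)))"
  proof (intro sum.cong refl)
    fix l assume "l \<in> {j..L}"
    then have l: "j \<le> l" by simp
    have n: "0 \<le> real Kov * M * 2 powr (- real l * s * p)" using M by simp
    have "(2::ennreal) ^ l = ennreal (2 ^ l)" by (simp add: ennreal_power[symmetric])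
    then have "ennreal (2 powr (e * p * real (l - j))) * (2 ^ l * ennreal (real Kov * M * 2 powr (- real l * s * p)))
       = ennreal (2 powr (e * p * real (l - j)) * (2 ^ l * (real Kov * M * 2 powr (- real l * s * p))))"
      using n by (simp only: ennreal_mult powr_ge_zero zero_le_power zero_le_numeral mult_nonneg_nonneg)
    then show "ennreal (2 powr (e * p * real (l - j))) * (2 ^ l * ennreal (real Kov * M * 2 powr (- real l * s * p)))
       = ennreal (real Kov * M * 2 powr (real j * (1 - s * p)) * r ^ (l - j))"
      by (simp only: summand[OF l])
  qed
  also have "\<dots> = ennreal (\<Sum>l=j..L. real Kov * M * 2 powr (real j * (1 - s * p)) * r ^ (l - j))"
    using M r by (intro sum_ennreal) auto
  also have "ennreal G * \<dots> = ennreal (G * (\<Sum>l=j..L. real Kov * M * 2 powr (real j * (1 - s * p)) * r ^ (l - j)))"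
    using G0 M r by (intro ennreal_mult[symmetric] sum_nonneg) auto
  finally have "(\<Sum>k<n. \<bar>\<theta> k\<bar> powr p) \<le> G * (\<Sum>l=j..L. real Kov * M * 2 powr (real j * (1 - s * p)) * r ^ (l - j))"
    using G0 M r by (subst (asm) ennreal_le_iff) (auto intro!: mult_nonneg_nonneg sum_nonneg)
  also have "\<dots> \<le> G * (real Kov * M * 2 powr (real j * (1 - s * p)) / (1 - r))"
  proof (intro mult_left_mono G0)
    have "(\<Sum>l=j..L. r ^ (l - j)) = (\<Sum>i\<in>(\<lambda>l. l - j) ` {j..L}. r ^ i)"
      by (subst sum.reindex) (auto simp: inj_on_def)
    also have "\<dots> \<le> (\<Sum>i. r ^ i)" using r by (intro sum_le_suminf) (auto simp: summable_geometric)
    also have "\<dots> = 1 / (1 - r)" using r by (intro suminf_geometric) auto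
    finally have "real Kov * M * 2 powr (real j * (1 - s * p)) * (\<Sum>l=j..L. r ^ (l - j)) \<le> real Kov * M * 2 powr (real j * (1 - s * p)) * (1 / (1 - r))"
      using M by (intro mult_left_mono) auto
    then show "(\<Sum>l=j..L. real Kov * M * 2 powr (real j * (1 - s * p)) * r ^ (l - j)) \<le> real Kov * M * 2 powr (real j * (1 - s * p)) / (1 - r)"
      by (simp add: sum_distrib_left)
  qed
  finally show ?thesis unfolding G_def r_def \<theta>_def e_def .
qed

section \<open>From the Besov seminorm to finite differences\<close>
lemma epowr_mono: "x \<le> y \<Longrightarrow> 0 \<le> a \<Longrightarrow> epowr x a \<le> epowr y a"
  unfolding epowr_def
  by (auto simp: top_unique less_top intro!: ennreal_leI powr_mono2 enn2real_mono)

lemma epowr_le_imp_le: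
  assumes a: "0 < a" and c: "0 \<le> c" and le: "epowr x a \<le> ennreal c"
  shows "x \<le> ennreal (c powr (1 / a))"
proof -
  have fin: "x \<noteq> \<infinity>" using le by (auto simp: epowr_def top_unique)
  then have "enn2real x powr a \<le> c" using le c by (simp add: epowr_def)
  then have "(enn2real x powr a) powr (1 / a) \<le> c powr (1 / a)" using a by (intro powr_mono2) auto
  then have "enn2real x \<le> c powr (1 / a)" using a by (simp add: powr_powr)
  then have "ennreal (enn2real x) \<le> ennreal (c powr (1 / a))" by (rule ennreal_leI)
  moreover have "ennreal (enn2real x) = x" using fin by (simp add: less_top)
  ultimately show ?thesis by (simp only:)
qed

lemma mod_smooth_mono: "t \<le> t' \<Longrightarrow> mod_smooth m p f t \<le> mod_smooth m p f t'"
  unfolding mod_smooth_def by (intro SUP_subset_mono) auto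

lemma weighted_le_imp_le:
  assumes t: "0 < t" and c: "0 \<le> c" and le: "ennreal (t powr (- s)) * X \<le> ennreal c"
  shows "X \<le> ennreal (c * t powr s)"
proof -
  have "X = ennreal (t powr s) * (ennreal (t powr (- s)) * X)"
    using t by (simp add: mult.assoc[symmetric] ennreal_mult[symmetric] powr_add[symmetric])
  also have "\<dots> \<le> ennreal (t powr s) * ennreal c" by (intro mult_left_mono le) auto
  also have "\<dots> = ennreal (c * t powr s)" using c by (simp add: ennreal_mult[symmetric] mult.commute)
  finally show ?thesis .
qed

text \<open>For finite \<open>q\<close> the integral is bounded below by its part over \<open>{t..2 * t}\<close>, where the modulus of smoothness is at least
its value at \<open>t\<close>. This is where \<open>t \<le> 1 / 2\<close> enters.\<close>

lemma besov_modulus_bound: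
  assumes q: "0 < q" and M: "0 < M" and s: "0 < s"
  shows "\<exists>M1\<ge>0. \<forall>f\<in>besov_ball s p q M. \<forall>t. 0 < t \<longrightarrow> t \<le> 1 / 2 \<longrightarrow> mod_smooth (nat \<lfloor>s\<rfloor> + 1) p f t \<le> ennreal (M1 * t powr s)"
proof (cases "q = \<infinity>")
  case True
  show ?thesis
  proof (intro exI[of _ M] conjI ballI allI impI)
    fix f t assume f: "f \<in> besov_ball s p q M" and t: "0 < t" "t \<le> (1 / 2 :: real)"
    have "ennreal (t powr (- s)) * mod_smooth (nat \<lfloor>s\<rfloor> + 1) p f t \<le> besov_seminorm s p q f"
      unfolding besov_seminorm_def Let_def using True t by (auto intro!: SUP_upper)
    also have "\<dots> \<le> ennreal M"
      using f unfolding besov_ball_def by (auto intro: order_trans[rotated] simp: add_increasing)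
    finally show "mod_smooth (nat \<lfloor>s\<rfloor> + 1) p f t \<le> ennreal (M * t powr s)"
      using t M by (intro weighted_le_imp_le) auto
  qed (use M in auto)
next
  case False
  define q' where "q' = enn2real q"
  have q': "0 < q'" using q False by (simp add: q'_def enn2real_positive_iff less_top)
  define M1 where "M1 = (2 * M powr q') powr (1 / q') * 2 powr s"
  show ?thesis
  proof (intro exI[of _ M1] conjI ballI allI impI)
    show "0 \<le> M1" by (simp add: M1_def)
    fix f t assume f: "f \<in> besov_ball s p q M" and t: "0 < t" "t \<le> (1 / 2 :: real)"
    define \<omega> where "\<omega> = mod_smooth (nat \<lfloor>s\<rfloor> + 1) p f"
    define X where "X = (\<integral>\<^sup>+u\<in>{0<..1}. epowr (ennreal (u powr (- s)) * \<omega> u) q' * ennreal (1 / u) \<partial>lborel)"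
    have "epowr X (1 / q') = besov_seminorm s p q f"
      unfolding besov_seminorm_def Let_def X_def \<omega>_def q'_def using False by simp
    also have "\<dots> \<le> ennreal M"
      using f unfolding besov_ball_def by (auto intro: order_trans[rotated] simp: add_increasing)
    finally have "X \<le> ennreal (M powr (1 / (1 / q')))"
      using q' M by (intro epowr_le_imp_le) auto
    then have X: "X \<le> ennreal (M powr q')" by simp
    define E where "E = epowr (ennreal ((2 * t) powr (- s)) * \<omega> t) q'"
    (* the weight 1 / u is at least 1 / (2 * t) on an interval of length t *)
    have "E * ennreal (1 / 2) = E * ennreal (1 / (2 * t)) * ennreal (2 * t - t)"
      using t by (simp add: mult.assoc ennreal_mult[symmetric])
    also have "\<dots> = (\<integral>\<^sup>+u. E * ennreal (1 / (2 * t)) * indicator {t..2 * t} u \<partial>lborel)"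
      using t by (subst nn_integral_cmult) auto
    also have "\<dots> \<le> X"
      unfolding X_def
    proof (intro nn_integral_mono)
      fix u :: real
      show "E * ennreal (1 / (2 * t)) * indicator {t..2 * t} u \<le> epowr (ennreal (u powr (- s)) * \<omega> u) q' * ennreal (1 / u) * indicator {0<..1} u"
      proof (cases "u \<in> {t..2 * t}")
        case True
        then have u: "t \<le> u" "u \<le> 2 * t" "0 < u" "u \<le> 1" using t by auto
        have "(2 * t) powr (- s) \<le> u powr (- s)" using u s by (intro powr_mono2') auto
        then have "E \<le> epowr (ennreal (u powr (- s)) * \<omega> u) q'"
          unfolding E_def \<omega>_def using q' u by (intro epowr_mono mult_mono ennreal_leI mod_smooth_mono) auto
        moreover have "ennreal (1 / (2 * t)) \<le> ennreal (1 / u)" using u t by (intro ennreal_leI divide_left_mono) auto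
        ultimately show ?thesis using u True by (auto intro!: mult_mono)
      qed simp
    qed
    finally have "E * ennreal (1 / 2) \<le> ennreal (M powr q')" using X by (rule order_trans)
    then have "E * ennreal (1 / 2) * ennreal 2 \<le> ennreal (M powr q') * ennreal 2" by (rule mult_right_mono) simp
    moreover have "E * ennreal (1 / 2) * ennreal 2 = E"
    proof -
      have "ennreal (1 / 2) * ennreal 2 = ennreal ((1 / 2) * 2)" by (rule ennreal_mult[symmetric]) auto
      then show ?thesis by (simp add: mult.assoc)
    qed
    moreover have "ennreal (M powr q') * ennreal 2 = ennreal (2 * M powr q')"
      by (subst ennreal_mult[symmetric]) (auto simp: mult.commute)
    ultimately have "E \<le> ennreal (2 * M powr q')" by simp
    then have "ennreal ((2 * t) powr (- s)) * \<omega> t \<le> ennreal ((2 * M powr q') powr (1 / q'))"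
      unfolding E_def using q' by (intro epowr_le_imp_le) auto
    then have "\<omega> t \<le> ennreal ((2 * M powr q') powr (1 / q') * (2 * t) powr s)"
      using t by (intro weighted_le_imp_le) auto
    also have "(2 * M powr q') powr (1 / q') * (2 * t) powr s = M1 * t powr s"
      unfolding M1_def by (simp add: powr_mult mult.assoc)
    finally show "mod_smooth (nat \<lfloor>s\<rfloor> + 1) p f t \<le> ennreal (M1 * t powr s)" by (simp add: \<omega>_def)
  qed
qed

text \<open>An infinite \<open>p\<close> is replaced by the finite exponent \<open>2 / s\<close>, which still satisfies \<open>1 / p' < s\<close>.\<close>

lemma besov_difference_bound:
  assumes p: "0 < p" and q: "0 < q" and ps: "1 / p < ennreal s" and M: "0 < M"
  shows "\<exists>p' M'. 0 < p' \<and> 1 / p' < s \<and> 0 \<le> M' \<and> (\<forall>f\<in>besov_ball s p q M. \<forall>h. 0 < h \<longrightarrow> h \<le> 1 / 2 \<longrightarrow>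
     (\<integral>\<^sup>+x. indicator {0..1 - real (nat \<lfloor>s\<rfloor> + 1) * h} x * ennreal (\<bar>fin_diff (nat \<lfloor>s\<rfloor> + 1) h f x\<bar> powr p') \<partial>lborel) \<le> ennreal (M' * h powr (s * p')))"
proof -
  define m where "m = nat \<lfloor>s\<rfloor> + 1"
  have "0 < ennreal s" using ps by (rule le_less_trans[OF zero_le])
  then have s: "0 < s" by (simp add: ennreal_less_zero_iff)
  obtain M1 where M1: "0 \<le> M1" "\<And>f t. f \<in> besov_ball s p q M \<Longrightarrow> 0 < t \<Longrightarrow> t \<le> 1 / 2 \<Longrightarrow> mod_smooth m p f t \<le> ennreal (M1 * t powr s)"
    using besov_modulus_bound[OF q M s] unfolding m_def by blast
  have Lp: "Lp_norm p {0..1 - real m * h} (fin_diff m h f) \<le> ennreal (M1 * h powr s)"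
    if "f \<in> besov_ball s p q M" "0 < h" "h \<le> 1 / 2" for f h
  proof -
    have "Lp_norm p {0..1 - real m * h} (fin_diff m h f) \<le> mod_smooth m p f h"
      unfolding mod_smooth_def using that by (intro SUP_upper) auto
    also have "\<dots> \<le> ennreal (M1 * h powr s)" by (rule M1(2)[OF that])
    finally show ?thesis .
  qed
  have Mp: "(M1 * h powr s) powr r = M1 powr r * h powr (s * r)" for h r by (simp add: powr_mult powr_powr)
  show ?thesis
  proof (cases "p = \<infinity>")
    case False
    define p' where "p' = enn2real p"
    have p': "0 < p'" using p False by (simp add: p'_def enn2real_positive_iff less_top)
    have pe: "p = ennreal p'" using False by (simp add: p'_def less_top)
    have "1 / p = ennreal (1 / p')" unfolding pe using p' by (metis divide_ennreal ennreal_1 zero_le_one)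
    then have "1 / p' < s" using ps p' by (simp add: ennreal_less_iff)
    moreover have "(\<integral>\<^sup>+x. indicator {0..1 - real m * h} x * ennreal (\<bar>fin_diff m h f x\<bar> powr p') \<partial>lborel) \<le> ennreal (M1 powr p' * h powr (s * p'))"
      if "f \<in> besov_ball s p q M" "0 < h" "h \<le> 1 / 2" for f h
    proof -
      have "epowr (\<integral>\<^sup>+x\<in>{0..1 - real m * h}. ennreal (\<bar>fin_diff m h f x\<bar> powr p') \<partial>lborel) (1 / p') \<le> ennreal (M1 * h powr s)"
        using Lp[OF that] False unfolding Lp_norm_def p'_def by simp
      then have "(\<integral>\<^sup>+x\<in>{0..1 - real m * h}. ennreal (\<bar>fin_diff m h f x\<bar> powr p') \<partial>lborel) \<le> ennreal ((M1 * h powr s) powr (1 / (1 / p')))"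
        using p' M1(1) by (intro epowr_le_imp_le) auto
      then show ?thesis by (simp add: Mp mult.commute)
    qed
    ultimately show ?thesis using p' unfolding m_def by (intro exI[of _ p'] exI[of _ "M1 powr p'"]) auto
  next
    case True
    define p' where "p' = 2 / s"
    have p': "0 < p'" "1 / p' < s" using s by (auto simp: p'_def)
    moreover have "(\<integral>\<^sup>+x. indicator {0..1 - real m * h} x * ennreal (\<bar>fin_diff m h f x\<bar> powr p') \<partial>lborel) \<le> ennreal (M1 powr p' * h powr (s * p'))"
      if f: "f \<in> besov_ball s p q M" "0 < h" "h \<le> 1 / 2" for f h
    proof -
      define A where "A = {0..1 - real m * h}"
      define c where "c = M1 * h powr s"
      have c0: "0 \<le> c" using M1(1) by (simp add: c_def)
      have "esssup (restrict_space lborel A) (\<lambda>x. ennreal \<bar>fin_diff m h f x\<bar>) \<le> ennreal c"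
        using Lp[OF f] True unfolding Lp_norm_def A_def c_def by simp
      moreover have "AE x in restrict_space lborel A. ennreal \<bar>fin_diff m h f x\<bar> \<le> esssup (restrict_space lborel A) (\<lambda>x. ennreal \<bar>fin_diff m h f x\<bar>)"
        by (rule esssup_AE)
      ultimately have "AE x in restrict_space lborel A. ennreal \<bar>fin_diff m h f x\<bar> \<le> ennreal c" by auto
      then have "AE x in lborel. x \<in> A \<longrightarrow> ennreal \<bar>fin_diff m h f x\<bar> \<le> ennreal c"
        by (subst (asm) AE_restrict_space_iff) (auto simp: A_def)
      then have "AE x in lborel. indicator A x * ennreal (\<bar>fin_diff m h f x\<bar> powr p') \<le> ennreal (c powr p') * indicator {0..1} x"
      proof eventually_elim
        case (elim x)
        show ?case
        proof (cases "x \<in> A")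
          case True
          then have "\<bar>fin_diff m h f x\<bar> \<le> c" using elim c0 by (simp add: ennreal_le_iff)
          then have "\<bar>fin_diff m h f x\<bar> powr p' \<le> c powr p'" using p' by (intro powr_mono2) auto
          moreover have "x \<in> {0..1}"
          proof -
            have "0 \<le> real m * h" using f(2) by simp
            then show ?thesis using True unfolding A_def by simp
          qed
          ultimately show ?thesis using True by (simp add: ennreal_leI)
        qed simp
      qed
      then have "(\<integral>\<^sup>+x. indicator A x * ennreal (\<bar>fin_diff m h f x\<bar> powr p') \<partial>lborel) \<le> (\<integral>\<^sup>+x. ennreal (c powr p') * indicator {0..1::real} x \<partial>lborel)"
        by (rule nn_integral_mono_AE)
      also have "\<dots> = ennreal (c powr p')" by (subst nn_integral_cmult) auto
      finally show ?thesis by (simp add: A_def c_def Mp)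
    qed
    ultimately show ?thesis unfolding m_def by (intro exI[of _ p'] exI[of _ "M1 powr p'"]) auto
  qed
qed

section \<open>Localization and cancellation of boundary wavelets\<close>
text \<open>Edge functions are only specified on a half-line, hence the set \<open>H\<close>.\<close>

definition localized :: "real set \<Rightarrow> (real \<Rightarrow> real) \<Rightarrow> bool" where
  "localized H g \<longleftrightarrow> continuous_on H g \<and> (\<exists>a. \<forall>x\<in>H. \<bar>g x\<bar> \<le> a \<and> (g x \<noteq> 0 \<longrightarrow> \<bar>x\<bar> \<le> a))"

lemma localized_finite_uniform:
  assumes "finite I" "\<And>i. i \<in> I \<Longrightarrow> localized H (g i)"
  shows "\<exists>a. \<forall>i\<in>I. \<forall>x\<in>H. \<bar>g i x\<bar> \<le> a \<and> (g i x \<noteq> 0 \<longrightarrow> \<bar>x\<bar> \<le> a)"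
proof -
  have "\<forall>i. \<exists>a. i \<in> I \<longrightarrow> (\<forall>x\<in>H. \<bar>g i x\<bar> \<le> a \<and> (g i x \<noteq> 0 \<longrightarrow> \<bar>x\<bar> \<le> a))"
    using assms(2) unfolding localized_def by blast
  from choice[OF this] obtain a where a: "\<And>i x. i \<in> I \<Longrightarrow> x \<in> H \<Longrightarrow> \<bar>g i x\<bar> \<le> a i \<and> (g i x \<noteq> 0 \<longrightarrow> \<bar>x\<bar> \<le> a i)" by blast
  define b where "b = (\<Sum>i\<in>I. \<bar>a i\<bar>)"
  have "a i \<le> b" if "i \<in> I" for i
    using member_le_sum[OF that, of "\<lambda>i. \<bar>a i\<bar>"] assms(1) by (simp add: b_def)
  then show ?thesis using a by (intro exI[of _ b]) (meson order_trans)
qed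

lemma localized_combination:
  assumes \<phi>: "localized UNIV \<phi>" and F: "finite F" and q: "1 \<le> (q::real)"
    and g: "\<And>x. x \<in> H \<Longrightarrow> g x = (\<Sum>m\<in>F. c m * \<phi> (q * x - of_int m))"
  shows "localized H g"
proof -
  obtain a where a: "\<And>x. \<bar>\<phi> x\<bar> \<le> a" "\<And>x. \<phi> x \<noteq> 0 \<Longrightarrow> \<bar>x\<bar> \<le> a" using \<phi> by (auto simp: localized_def)
  have a0: "0 \<le> a" using a(1)[of 0] by linarith
  have cont: "continuous_on A \<phi>" for A using \<phi> continuous_on_subset by (auto simp: localized_def)
  have "continuous_on H (\<lambda>x. \<Sum>m\<in>F. c m * \<phi> (q * x - of_int m))"
    by (intro continuous_intros continuous_on_compose2[OF cont]) auto
  then have c1: "continuous_on H g" using g by (simp cong: continuous_on_cong)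
  define b where "b = a + (\<Sum>m\<in>F. \<bar>c m\<bar> * a + \<bar>of_int m\<bar>)"
  have "\<bar>g x\<bar> \<le> b \<and> (g x \<noteq> 0 \<longrightarrow> \<bar>x\<bar> \<le> b)" if x: "x \<in> H" for x
  proof (intro conjI impI)
    have "\<bar>g x\<bar> \<le> (\<Sum>m\<in>F. \<bar>c m\<bar> * \<bar>\<phi> (q * x - of_int m)\<bar>)"
      unfolding g[OF x] by (rule order_trans[OF sum_abs]) (simp add: abs_mult)
    also have "\<dots> \<le> (\<Sum>m\<in>F. \<bar>c m\<bar> * a + \<bar>of_int m\<bar>)"
      using a(1) by (intro sum_mono add_increasing2 mult_left_mono) auto
    finally show "\<bar>g x\<bar> \<le> b" using a0 by (simp add: b_def)
    assume "g x \<noteq> 0"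
    then obtain m where m: "m \<in> F" "\<phi> (q * x - of_int m) \<noteq> 0"
      unfolding g[OF x] by (metis (no_types, lifting) mult_zero_right sum.neutral)
    have "\<bar>q * x - of_int m\<bar> \<le> a" by (rule a(2)[OF m(2)])
    then have "\<bar>q * x\<bar> \<le> a + \<bar>of_int m\<bar>" by linarith
    moreover have "\<bar>x\<bar> \<le> \<bar>q * x\<bar>" using q mult_right_mono[of 1 q "\<bar>x\<bar>"] by (simp add: abs_mult)
    moreover have "\<bar>of_int m\<bar> \<le> (\<Sum>m\<in>F. \<bar>c m\<bar> * a + \<bar>of_int m :: real\<bar>)"
    proof -
      have "\<bar>c m\<bar> * a + \<bar>of_int m :: real\<bar> \<le> (\<Sum>m\<in>F. \<bar>c m\<bar> * a + \<bar>of_int m :: real\<bar>)"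
        by (rule member_le_sum[OF m(1) _ F]) (use a0 in \<open>auto intro!: add_nonneg_nonneg mult_nonneg_nonneg\<close>)
      moreover have "0 \<le> \<bar>c m\<bar> * a" using a0 by simp
      ultimately show ?thesis by linarith
    qed
    ultimately show "\<bar>x\<bar> \<le> b" unfolding b_def by linarith
  qed
  then show ?thesis using c1 unfolding localized_def by blast
qed

lemma scaling_function_localized:
  assumes "scaling_function r h \<phi>" "0 < r"
  shows "localized UNIV \<phi>"
proof -
  have "\<forall>x. \<phi> field_differentiable at x" using assms unfolding scaling_function_def by (metis funpow_0)
  then have "continuous_on UNIV \<phi>"
    by (intro continuous_at_imp_continuous_on ballI field_differentiable_imp_continuous_at) auto
  obtain A where A: "\<And>x. \<bar>x\<bar> > A \<Longrightarrow> \<phi> x = 0" using assms unfolding scaling_function_def by blast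
  have "compact (\<phi> ` {-A..A})"
    using \<open>continuous_on UNIV \<phi>\<close> by (intro compact_continuous_image) (auto intro: continuous_on_subset)
  then obtain b where b: "\<And>x. x \<in> {-A..A} \<Longrightarrow> \<bar>\<phi> x\<bar> \<le> b" using compact_imp_bounded by (force simp: bounded_iff)
  have "\<bar>\<phi> x\<bar> \<le> max \<bar>A\<bar> \<bar>b\<bar> \<and> (\<phi> x \<noteq> 0 \<longrightarrow> \<bar>x\<bar> \<le> max \<bar>A\<bar> \<bar>b\<bar>)" for x
  proof (cases "\<bar>x\<bar> > A")
    case False
    then have "\<bar>\<phi> x\<bar> \<le> b" by (intro b) auto
    then show ?thesis using False by auto
  qed (simp add: A)
  then show ?thesis using \<open>continuous_on UNIV \<phi>\<close> unfolding localized_def by blast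
qed

lemma mother_wavelet_localized:
  assumes "scaling_function r h \<phi>" "0 < r"
  shows "localized UNIV (mother_wavelet h \<phi>)"
proof (rule localized_combination[OF scaling_function_localized[OF assms], of "{m. h (1 - m) \<noteq> 0}" 2])
  have "finite {m. h m \<noteq> 0}" using assms by (simp add: scaling_function_def)
  then have "finite ((\<lambda>m. 1 - m) ` {m. h m \<noteq> 0})" by simp
  moreover have "{m. h (1 - m) \<noteq> 0} \<subseteq> (\<lambda>m. 1 - m) ` {m. h m \<noteq> 0}"
  proof
    fix m assume "m \<in> {m. h (1 - m) \<noteq> 0}"
    then show "m \<in> (\<lambda>m. 1 - m) ` {m. h m \<noteq> 0}" by (intro image_eqI[of _ _ "1 - m"]) auto
  qed
  ultimately show "finite {m. h (1 - m) \<noteq> 0}" by (rule finite_subset[rotated])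
  show "mother_wavelet h \<phi> x = (\<Sum>m\<in>{m. h (1 - m) \<noteq> 0}. (sqrt 2 * (((-1) powi m) * h (1 - m))) * \<phi> (2 * x - of_int m))" for x
    by (simp add: mother_wavelet_def sum_distrib_left mult.assoc)
qed simp

lemma edge_function_localized:
  assumes "edge_function q \<phi> H g" "localized UNIV \<phi>" "1 \<le> q"
  shows "localized H g"
  using assms localized_combination unfolding edge_function_def by blast

lemma edge_adapted_continuous:
  assumes lev: "edge_adapted_level j N el er d L g R G"
    and L: "\<And>k. k < el \<Longrightarrow> localized {0..} (L k)" and g: "localized UNIV g" and R: "\<And>k. k < er \<Longrightarrow> localized {..0} (R k)" and k: "k < N"
  shows "continuous_on {0..1} (G k)"
proof -
  have eq: "G k x = sqrt (2 ^ j) *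
        (if k < el then L k (2 ^ j * x)
         else if k < N - er then g (2 ^ j * x - of_int (int k + d))
         else R (N - 1 - k) (2 ^ j * (x - 1)))" if "x \<in> {0..1}" for x
    using lev k that by (auto simp: edge_adapted_level_def)
  consider "k < el" | "\<not> k < el" "k < N - er" | "\<not> k < el" "\<not> k < N - er" by blast
  then show ?thesis
  proof cases
    case 1
    have "continuous_on {0..1} (\<lambda>x. L k (2 ^ j * x))"
    proof (rule continuous_on_compose2[of "{0..}" "L k"])
      show "continuous_on {0..} (L k)" using L[OF 1] by (simp add: localized_def)
      show "continuous_on {0..1} (\<lambda>x::real. 2 ^ j * x)" by (intro continuous_intros)
    qed auto
    then have "continuous_on {0..1} (\<lambda>x. sqrt (2 ^ j) * L k (2 ^ j * x))" by (intro continuous_on_mult continuous_on_const)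
    then show ?thesis by (rule continuous_on_eq) (use eq 1 in simp)
  next
    case 2
    have "continuous_on {0..1} (\<lambda>x. g (2 ^ j * x - of_int (int k + d)))"
    proof (rule continuous_on_compose2[of UNIV g])
      show "continuous_on UNIV g" using g by (simp add: localized_def)
      show "continuous_on {0..1} (\<lambda>x::real. 2 ^ j * x - of_int (int k + d))" by (intro continuous_intros)
    qed auto
    then have "continuous_on {0..1} (\<lambda>x. sqrt (2 ^ j) * g (2 ^ j * x - of_int (int k + d)))" by (intro continuous_on_mult continuous_on_const)
    then show ?thesis by (rule continuous_on_eq) (use eq 2 in simp)
  next
    case 3
    then have "N - 1 - k < er" using k by auto
    then have "localized {..0} (R (N - 1 - k))" by (rule R)
    then have cR: "continuous_on {..0} (R (N - 1 - k))" by (simp add: localized_def)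
    have "continuous_on {0..1} (\<lambda>x. R (N - 1 - k) (2 ^ j * (x - 1)))"
    proof (rule continuous_on_compose2[OF cR])
      show "continuous_on {0..1} (\<lambda>x::real. 2 ^ j * (x - 1))" by (intro continuous_intros)
    qed (auto simp: mult_nonneg_nonpos)
    then have "continuous_on {0..1} (\<lambda>x. sqrt (2 ^ j) * R (N - 1 - k) (2 ^ j * (x - 1)))" by (intro continuous_on_mult continuous_on_const)
    then show ?thesis by (rule continuous_on_eq) (use eq 3 in simp)
  qed
qed

lemma card_nat_near_le:
  "card {k::nat. \<bar>t - real k\<bar> \<le> real a} \<le> 2 * a + 1"
proof -
  have "{k::nat. \<bar>t - real k\<bar> \<le> real a} \<subseteq> nat ` {\<lceil>t - real a\<rceil>..\<lfloor>t + real a\<rfloor>}"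
  proof
    fix k assume "k \<in> {k::nat. \<bar>t - real k\<bar> \<le> real a}"
    then have "t - real a \<le> real k" "real k \<le> t + real a" by auto
    then have "\<lceil>t - real a\<rceil> \<le> int k" "int k \<le> \<lfloor>t + real a\<rfloor>" unfolding ceiling_le_iff le_floor_iff by simp_all
    then show "k \<in> nat ` {\<lceil>t - real a\<rceil>..\<lfloor>t + real a\<rfloor>}" by (intro image_eqI[of _ _ "int k"]) auto
  qed
  then have "card {k::nat. \<bar>t - real k\<bar> \<le> real a} \<le> card (nat ` {\<lceil>t - real a\<rceil>..\<lfloor>t + real a\<rfloor>})"
    by (intro card_mono) auto
  also have "\<dots> \<le> card {\<lceil>t - real a\<rceil>..\<lfloor>t + real a\<rfloor>}" by (rule card_image_le) simp
  also have "\<dots> \<le> 2 * a + 1"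
  proof -
    have "\<lfloor>t + real a\<rfloor> - \<lceil>t - real a\<rceil> \<le> 2 * int a" by linarith
    then show ?thesis by simp
  qed
  finally show ?thesis .
qed

lemma boundary_wavelet_basisD:
  assumes "boundary_wavelet_basis r \<phi> \<psi> j0 C \<Phi> \<Psi>"
  shows basis_scaling: "\<exists>h. scaling_function r h \<phi> \<and> \<psi> = mother_wavelet h \<phi>"
    and basis_scaling_level: "\<exists>el er d L R. (\<forall>k<el. edge_function 1 \<phi> {0..} (L k)) \<and>
        (\<forall>k<er. edge_function 1 \<phi> {..0} (R k)) \<and> edge_adapted_level j0 C el er d L \<phi> R \<Phi>"
    and basis_wavelet_level: "\<exists>el er d L R. (\<forall>k<el. edge_function 2 \<phi> {0..} (L k)) \<and>
        (\<forall>k<er. edge_function 2 \<phi> {..0} (R k)) \<and>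
        (\<forall>j\<ge>j0. edge_adapted_level j (2 ^ j) el er d L \<psi> R (\<Psi> j))"
    and basis_polynomials: "\<forall>i<r. \<exists>c. \<forall>x\<in>{0..1}. x ^ i = (\<Sum>k<C. c k * \<Phi> k x)"
    and basis_orth_scaling: "\<forall>k<C. \<forall>k'<C. inner01 (\<Phi> k) (\<Phi> k') = (if k = k' then 1 else 0)"
    and basis_orth_mixed: "\<forall>k<C. \<forall>j\<ge>j0. \<forall>k'<2 ^ j. inner01 (\<Phi> k) (\<Psi> j k') = 0"
    and basis_orth_wavelet: "\<forall>j\<ge>j0. \<forall>k<2 ^ j. \<forall>j'\<ge>j0. \<forall>k'<2 ^ j'.
        inner01 (\<Psi> j k) (\<Psi> j' k') = (if (j, k) = (j', k') then 1 else 0)"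
    and basis_complete: "\<forall>g\<in>L2_01. (\<forall>k<C. inner01 g (\<Phi> k) = 0) \<and> (\<forall>j\<ge>j0. \<forall>k<2 ^ j. inner01 g (\<Psi> j k) = 0)
        \<longrightarrow> (AE x in lborel. x \<in> {0..1} \<longrightarrow> g x = 0)"
proof -
  note b = assms[unfolded boundary_wavelet_basis_def]
  note b2 = conjunct2[OF b] note b3 = conjunct2[OF b2] note b4 = conjunct2[OF b3] note b5 = conjunct2[OF b4]
  note b6 = conjunct2[OF b5] note b7 = conjunct2[OF b6] note b8 = conjunct2[OF b7]
  show "\<exists>h. scaling_function r h \<phi> \<and> \<psi> = mother_wavelet h \<phi>" by (rule conjunct1[OF b])
  show "\<exists>el er d L R. (\<forall>k<el. edge_function 1 \<phi> {0..} (L k)) \<and>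
        (\<forall>k<er. edge_function 1 \<phi> {..0} (R k)) \<and> edge_adapted_level j0 C el er d L \<phi> R \<Phi>" by (rule conjunct1[OF b2])
  show "\<exists>el er d L R. (\<forall>k<el. edge_function 2 \<phi> {0..} (L k)) \<and>
        (\<forall>k<er. edge_function 2 \<phi> {..0} (R k)) \<and>
        (\<forall>j\<ge>j0. edge_adapted_level j (2 ^ j) el er d L \<psi> R (\<Psi> j))" by (rule conjunct1[OF b3])
  show "\<forall>i<r. \<exists>c. \<forall>x\<in>{0..1}. x ^ i = (\<Sum>k<C. c k * \<Phi> k x)" by (rule conjunct1[OF b4])
  show "\<forall>k<C. \<forall>k'<C. inner01 (\<Phi> k) (\<Phi> k') = (if k = k' then 1 else 0)" by (rule conjunct1[OF b5])
  show "\<forall>k<C. \<forall>j\<ge>j0. \<forall>k'<2 ^ j. inner01 (\<Phi> k) (\<Psi> j k') = 0" by (rule conjunct1[OF b6])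
  show "\<forall>j\<ge>j0. \<forall>k<2 ^ j. \<forall>j'\<ge>j0. \<forall>k'<2 ^ j'.
        inner01 (\<Psi> j k) (\<Psi> j' k') = (if (j, k) = (j', k') then 1 else 0)" by (rule conjunct1[OF b7])
  show "\<forall>g\<in>L2_01. (\<forall>k<C. inner01 g (\<Phi> k) = 0) \<and> (\<forall>j\<ge>j0. \<forall>k<2 ^ j. inner01 g (\<Psi> j k) = 0)
        \<longrightarrow> (AE x in lborel. x \<in> {0..1} \<longrightarrow> g x = 0)" by (rule b8)
qed

text \<open>The centre \<open>c j k\<close> is 0 for left edge wavelets, 1 for right edge wavelets, and the dyadic translation point
otherwise. The edge wavelets of one level share their centre, but their number does not depend on the
level, so the overlap stays bounded.\<close>

lemma wavelet_localization:
  assumes basis: "boundary_wavelet_basis r \<phi> \<psi> j0 C \<Phi> \<Psi>" and r: "0 < r"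
  shows "\<exists>\<rho>::nat. \<exists>B c. 0 < B \<and> (\<forall>j\<ge>j0. \<forall>k<2 ^ j. \<forall>x\<in>{0..1}. \<bar>\<Psi> j k x\<bar> \<le> B * sqrt (2 ^ j) \<and>
      (\<Psi> j k x \<noteq> 0 \<longrightarrow> \<bar>x - c j k\<bar> \<le> real \<rho> / 2 ^ j)) \<and>
    (\<forall>a::nat. \<exists>K. \<forall>j\<ge>j0. \<forall>x. card {k. k < 2 ^ j \<and> \<bar>x - c j k\<bar> \<le> real a / 2 ^ j} \<le> K)"
proof -
  obtain h where sf: "scaling_function r h \<phi>" and \<psi>: "\<psi> = mother_wavelet h \<phi>"
    using basis_scaling[OF basis] by (elim exE conjE)
  obtain el er d L R where L: "\<forall>k<el. edge_function 2 \<phi> {0..} (L k)" and R: "\<forall>k<er. edge_function 2 \<phi> {..0} (R k)"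
    and lev: "\<forall>j\<ge>j0. edge_adapted_level j (2 ^ j) el er d L \<psi> R (\<Psi> j)"
    using basis_wavelet_level[OF basis] by (elim exE conjE)
  note l\<phi> = scaling_function_localized[OF sf r]
  have lL: "localized {0..} (L k)" if "k < el" for k using L that by (intro edge_function_localized[OF _ l\<phi>]) auto
  have lR: "localized {..0} (R k)" if "k < er" for k using R that by (intro edge_function_localized[OF _ l\<phi>]) auto
  obtain aL where aL: "\<forall>i\<in>{..<el}. \<forall>x\<in>{0..}. \<bar>L i x\<bar> \<le> aL \<and> (L i x \<noteq> 0 \<longrightarrow> \<bar>x\<bar> \<le> aL)"
    using localized_finite_uniform[of "{..<el}" "{0..}" L] lL by auto
  obtain aR where aR: "\<forall>i\<in>{..<er}. \<forall>x\<in>{..0}. \<bar>R i x\<bar> \<le> aR \<and> (R i x \<noteq> 0 \<longrightarrow> \<bar>x\<bar> \<le> aR)"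
    using localized_finite_uniform[of "{..<er}" "{..0}" R] lR by auto
  obtain ap where ap: "\<And>x. \<bar>\<psi> x\<bar> \<le> ap \<and> (\<psi> x \<noteq> 0 \<longrightarrow> \<bar>x\<bar> \<le> ap)"
    using mother_wavelet_localized[OF sf r] unfolding \<psi> localized_def by auto
  define A where "A = \<bar>aL\<bar> + \<bar>aR\<bar> + \<bar>ap\<bar> + 1"
  have A: "aL \<le> A" "aR \<le> A" "ap \<le> A" "0 < A" by (auto simp: A_def)
  define \<rho> where "\<rho> = nat \<lceil>A\<rceil>"
  have \<rho>: "A \<le> real \<rho>" unfolding \<rho>_def by linarith
  define c where "c j k = (if k < el then 0 else if k < 2 ^ j - er then of_int (int k + d) / 2 ^ j else (1::real))" for j k :: nat
  have loc: "\<bar>\<Psi> j k x\<bar> \<le> A * sqrt (2 ^ j) \<and> (\<Psi> j k x \<noteq> 0 \<longrightarrow> \<bar>x - c j k\<bar> \<le> real \<rho> / 2 ^ j)"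
    if j: "j0 \<le> j" and k: "k < 2 ^ j" and x: "x \<in> {0..1}" for j k x
  proof -
    have eq: "\<Psi> j k x = sqrt (2 ^ j) *
        (if k < el then L k (2 ^ j * x)
         else if k < 2 ^ j - er then \<psi> (2 ^ j * x - of_int (int k + d))
         else R (2 ^ j - 1 - k) (2 ^ j * (x - 1)))"
      using lev j k x unfolding edge_adapted_level_def by blast
    have "\<exists>v. \<Psi> j k x = sqrt (2 ^ j) * v \<and> \<bar>v\<bar> \<le> A \<and> (v \<noteq> 0 \<longrightarrow> \<bar>2 ^ j * (x - c j k)\<bar> \<le> A)"
    proof -
      consider "k < el" | "\<not> k < el" "k < 2 ^ j - er" | "\<not> k < el" "\<not> k < 2 ^ j - er" by blast
      then show ?thesis
      proof cases
        case 1
        have "2 ^ j * x \<in> {0..}" using x by simp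
        then have "\<bar>L k (2 ^ j * x)\<bar> \<le> aL \<and> (L k (2 ^ j * x) \<noteq> 0 \<longrightarrow> \<bar>2 ^ j * x\<bar> \<le> aL)" using aL 1 by blast
        then show ?thesis using 1 A eq by (intro exI[of _ "L k (2 ^ j * x)"]) (auto simp: c_def)
      next
        case 2
        have e2: "2 ^ j * (x - c j k) = 2 ^ j * x - of_int (int k + d)" using 2 by (simp add: c_def right_diff_distrib)
        show ?thesis unfolding e2 using 2 A eq ap[of "2 ^ j * x - of_int (int k + d)"]
          by (intro exI[of _ "\<psi> (2 ^ j * x - of_int (int k + d))"]) auto
      next
        case 3
        have i: "2 ^ j - 1 - k < er" using 3 k by auto
        have "2 ^ j * (x - 1) \<in> {..0}" using x by (simp add: mult_nonneg_nonpos)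
        then have "\<bar>R (2 ^ j - 1 - k) (2 ^ j * (x - 1))\<bar> \<le> aR \<and> (R (2 ^ j - 1 - k) (2 ^ j * (x - 1)) \<noteq> 0 \<longrightarrow> \<bar>2 ^ j * (x - 1)\<bar> \<le> aR)"
          using aR i by blast
        then show ?thesis using 3 A eq by (intro exI[of _ "R (2 ^ j - 1 - k) (2 ^ j * (x - 1))"]) (auto simp: c_def)
      qed
    qed
    then obtain v where v: "\<Psi> j k x = sqrt (2 ^ j) * v" "\<bar>v\<bar> \<le> A" "v \<noteq> 0 \<Longrightarrow> \<bar>2 ^ j * (x - c j k)\<bar> \<le> A" by blast
    show ?thesis
    proof (intro conjI impI)
      show "\<bar>\<Psi> j k x\<bar> \<le> A * sqrt (2 ^ j)"
        unfolding v(1) abs_mult using v(2) by (simp add: mult.commute mult_right_mono)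
      assume "\<Psi> j k x \<noteq> 0"
      then have "2 ^ j * \<bar>x - c j k\<bar> \<le> A" using v by (auto simp: abs_mult)
      then have "2 ^ j * \<bar>x - c j k\<bar> \<le> real \<rho>" using \<rho> by linarith
      then show "\<bar>x - c j k\<bar> \<le> real \<rho> / 2 ^ j" by (simp add: le_divide_eq mult.commute)
    qed
  qed
  (* indices of left edge, right edge and interior wavelets are counted separately *)
  have ov: "card {k. k < 2 ^ j \<and> \<bar>x - c j k\<bar> \<le> real a / 2 ^ j} \<le> el + er + (2 * a + 1)" for a j :: nat and x
  proof -
    define t where "t = 2 ^ j * x - of_int d"
    have fin: "finite {k::nat. \<bar>t - real k\<bar> \<le> real a}"
    proof (rule finite_subset)
      show "{k::nat. \<bar>t - real k\<bar> \<le> real a} \<subseteq> {..nat \<lfloor>t + real a\<rfloor>}"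
      proof
        fix k assume "k \<in> {k::nat. \<bar>t - real k\<bar> \<le> real a}"
        then have "real k \<le> t + real a" by auto
        then show "k \<in> {..nat \<lfloor>t + real a\<rfloor>}" using le_nat_floor by blast
      qed
    qed simp
    have "{k. k < 2 ^ j \<and> \<bar>x - c j k\<bar> \<le> real a / 2 ^ j} \<subseteq> {..<el} \<union> {2 ^ j - er..<2 ^ j} \<union> {k. \<bar>t - real k\<bar> \<le> real a}"
    proof
      fix k assume k: "k \<in> {k. k < 2 ^ j \<and> \<bar>x - c j k\<bar> \<le> real a / 2 ^ j}"
      show "k \<in> {..<el} \<union> {2 ^ j - er..<2 ^ j} \<union> {k. \<bar>t - real k\<bar> \<le> real a}"
      proof (cases "k < el \<or> \<not> k < 2 ^ j - er")
        case True
        then show ?thesis using k by auto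
      next
        case False
        then have "c j k = of_int (int k + d) / 2 ^ j" by (simp add: c_def)
        then have "t - real k = 2 ^ j * (x - c j k)" by (simp add: t_def right_diff_distrib)
        then have "\<bar>t - real k\<bar> = 2 ^ j * \<bar>x - c j k\<bar>" by (simp add: abs_mult)
        also have "\<dots> \<le> 2 ^ j * (real a / 2 ^ j)" using k by (intro mult_left_mono) auto
        finally show ?thesis by simp
      qed
    qed
    then have "card {k. k < 2 ^ j \<and> \<bar>x - c j k\<bar> \<le> real a / 2 ^ j} \<le> card ({..<el} \<union> {2 ^ j - er..<2 ^ j} \<union> {k. \<bar>t - real k\<bar> \<le> real a})"
      using fin by (intro card_mono) auto
    also have "\<dots> \<le> card {..<el} + card {2 ^ j - er..<2 ^ j} + card {k. \<bar>t - real k\<bar> \<le> real a}"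
      by (rule order_trans[OF card_Un_le add_right_mono[OF card_Un_le]])
    also have "\<dots> \<le> el + er + (2 * a + 1)" using card_nat_near_le[of t a] by (intro add_mono) auto
    finally show ?thesis .
  qed
  show ?thesis using A(4) loc ov by (intro exI[of _ \<rho>] exI[of _ A] exI[of _ c]) blast
qed

lemma basis_continuous:
  assumes basis: "boundary_wavelet_basis r \<phi> \<psi> j0 C \<Phi> \<Psi>" and r: "0 < r"
  shows "k < C \<Longrightarrow> continuous_on {0..1} (\<Phi> k)" "j0 \<le> j \<Longrightarrow> k < 2 ^ j \<Longrightarrow> continuous_on {0..1} (\<Psi> j k)"
proof -
  obtain h where sf: "scaling_function r h \<phi>" and \<psi>: "\<psi> = mother_wavelet h \<phi>"
    using basis_scaling[OF basis] by (elim exE conjE)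
  note l\<phi> = scaling_function_localized[OF sf r]
  obtain el er d L R where L: "\<forall>k<el. edge_function 2 \<phi> {0..} (L k)" and R: "\<forall>k<er. edge_function 2 \<phi> {..0} (R k)"
    and lev: "\<forall>j\<ge>j0. edge_adapted_level j (2 ^ j) el er d L \<psi> R (\<Psi> j)"
    using basis_wavelet_level[OF basis] by (elim exE conjE)
  obtain el' er' d' L' R' where L': "\<forall>k<el'. edge_function 1 \<phi> {0..} (L' k)" and R': "\<forall>k<er'. edge_function 1 \<phi> {..0} (R' k)"
    and lev': "edge_adapted_level j0 C el' er' d' L' \<phi> R' \<Phi>"
    using basis_scaling_level[OF basis] by (elim exE conjE)
  show "k < C \<Longrightarrow> continuous_on {0..1} (\<Phi> k)"
    by (rule edge_adapted_continuous[OF lev' _ l\<phi>]) (use L' R' in \<open>auto intro!: edge_function_localized[OF _ l\<phi>]\<close>)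
  assume j: "j0 \<le> j" "k < 2 ^ j"
  have lev1: "edge_adapted_level j (2 ^ j) el er d L \<psi> R (\<Psi> j)" using lev j by blast
  show "continuous_on {0..1} (\<Psi> j k)"
    by (rule edge_adapted_continuous[OF lev1 _ mother_wavelet_localized[OF sf r, folded \<psi>] _ j(2)])
      (use L R in \<open>auto intro!: edge_function_localized[OF _ l\<phi>]\<close>)
qed

lemma continuous_imp_L2_01:
  assumes "continuous_on {0..1} g" shows "g \<in> L2_01" "cut01 g \<in> borel_measurable borel"
proof -
  have "(\<lambda>x. indicator {0..1} x *\<^sub>R g x) \<in> borel_measurable borel"
    using assms by (intro borel_measurable_continuous_on_indicator) auto
  then show m: "cut01 g \<in> borel_measurable borel" by (simp add: cut01_def[abs_def])
  have "compact (g ` {0..1})" using assms by (intro compact_continuous_image) auto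
  then obtain b where b: "\<And>x. x \<in> {0..1} \<Longrightarrow> \<bar>g x\<bar> \<le> b" using compact_imp_bounded by (force simp: bounded_iff)
  have "integrable lborel (\<lambda>x. (cut01 g x)\<^sup>2)"
  proof (rule Bochner_Integration.integrable_bound)
    show "integrable lborel (\<lambda>x. b\<^sup>2 * indicator {0..1::real} x)" by (intro integrable_mult_right integrable_real_indicator) auto
    show "(\<lambda>x. (cut01 g x)\<^sup>2) \<in> borel_measurable lborel" using m by simp
    have "(g x)\<^sup>2 \<le> b\<^sup>2" if "x \<in> {0..1}" for x
      using power_mono[OF b[OF that], of 2] by simp
    then show "AE x in lborel. norm ((cut01 g x)\<^sup>2) \<le> norm (b\<^sup>2 * indicator {0..1::real} x)"
      by (intro always_eventually allI) (auto simp: cut01_def indicator_def)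
  qed
  then show "g \<in> L2_01" using m by (simp add: L2_01_iff sq_int_def)
qed

text \<open>The dyadic cells partition the half-open interval, the inner product is taken over the closed one.\<close>

lemma integral_half_open_eq:
  assumes "cut01 F \<in> borel_measurable borel"
  shows "(\<integral>y. indicator {0..<1} y * F y \<partial>lborel) = (LBINT y:{0..1}. F y)"
  unfolding set_lebesgue_integral_def
proof (rule integral_cong_AE)
  have e: "(\<lambda>y. indicator {0..<1} y * F y) = (\<lambda>y. indicator {0..<1} y * cut01 F y)" "(\<lambda>y. indicator {0..1} y *\<^sub>R F y) = cut01 F"
    by (auto simp: cut01_def indicator_def fun_eq_iff)
  show "(\<lambda>y. indicator {0..<1} y * F y) \<in> borel_measurable lborel" unfolding e using assms by simp
  show "(\<lambda>y. indicator {0..1} y *\<^sub>R F y) \<in> borel_measurable lborel" unfolding e using assms by simp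
  show "AE y in lborel. indicator {0..<1} y * F y = indicator {0..1} y *\<^sub>R F y"
    using AE_lborel_singleton[of "1::real"] by eventually_elim (auto simp: indicator_def)
qed

text \<open>Every monomial of degree below \<open>r\<close> is a combination of scaling functions on the unit interval, and these are orthogonal to
all wavelets.\<close>

lemma wavelet_vanishing_moments:
  assumes basis: "boundary_wavelet_basis r \<phi> \<psi> j0 C \<Phi> \<Psi>" and j: "j0 \<le> j" "k < 2 ^ j" and P: "degree P < r"
  shows "(\<integral>y. indicator {0..<1} y * (poly P y * \<Psi> j k y) \<partial>lborel) = 0"
proof -
  have r: "0 < r" using P by simp
  have c\<Psi>: "continuous_on {0..1} (\<Psi> j k)" by (rule basis_continuous(2)[OF basis r j])
  have sq\<Psi>: "sq_int (cut01 (\<Psi> j k))" using continuous_imp_L2_01[OF c\<Psi>] by (simp add: L2_01_iff)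
  have mono: "(\<integral>y. y ^ i * cut01 (\<Psi> j k) y \<partial>lborel) = 0 \<and> integrable lborel (\<lambda>y. y ^ i * cut01 (\<Psi> j k) y)" if i: "i < r" for i
  proof -
    obtain c where c: "\<And>x. x \<in> {0..1} \<Longrightarrow> x ^ i = (\<Sum>l<C. c l * \<Phi> l x)"
      using basis_polynomials[OF basis] i by blast
    have sq\<Phi>: "sq_int (cut01 (\<Phi> l))" if "l < C" for l
      using continuous_imp_L2_01[OF basis_continuous(1)[OF basis r that]] by (simp add: L2_01_iff)
    have eq: "y ^ i * cut01 (\<Psi> j k) y = (\<Sum>l<C. c l * (cut01 (\<Phi> l) y * cut01 (\<Psi> j k) y))" for y
      using c[of y] by (auto simp: cut01_def indicator_def sum_distrib_right mult.assoc)
    have int: "integrable lborel (\<lambda>y. c l * (cut01 (\<Phi> l) y * cut01 (\<Psi> j k) y))" if "l < C" for l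
      using sq_int_mult[OF sq\<Phi>[OF that] sq\<Psi>] by simp
    have "(\<integral>y. y ^ i * cut01 (\<Psi> j k) y \<partial>lborel) = (\<Sum>l<C. c l * inner01 (\<Phi> l) (\<Psi> j k))"
      unfolding eq using int by (subst Bochner_Integration.integral_sum) (auto simp: inner01_eq)
    also have "\<dots> = 0"
      using basis_orth_mixed[OF basis] j by (intro sum.neutral) auto
    finally show ?thesis unfolding eq using int by (auto intro!: Bochner_Integration.integrable_sum)
  qed
  have "(\<integral>y. indicator {0..<1} y * (poly P y * \<Psi> j k y) \<partial>lborel) = (LBINT y:{0..1}. poly P y * \<Psi> j k y)"
  proof (rule integral_half_open_eq)
    have "continuous_on {0..1} (\<lambda>y. poly P y * \<Psi> j k y)" by (intro continuous_intros c\<Psi>)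
    then show "cut01 (\<lambda>y. poly P y * \<Psi> j k y) \<in> borel_measurable borel" by (rule continuous_imp_L2_01)
  qed
  also have "\<dots> = (\<integral>y. (\<Sum>i\<le>degree P. coeff P i * (y ^ i * cut01 (\<Psi> j k) y)) \<partial>lborel)"
    unfolding set_lebesgue_integral_def
    by (intro Bochner_Integration.integral_cong) (auto simp: cut01_def indicator_def poly_altdef sum_distrib_right mult.assoc)
  also have "\<dots> = (\<Sum>i\<le>degree P. coeff P i * (\<integral>y. y ^ i * cut01 (\<Psi> j k) y \<partial>lborel))"
    using mono P by (subst Bochner_Integration.integral_sum) auto
  also have "\<dots> = 0" using mono P by (intro sum.neutral) auto
  finally show ?thesis .
qed

section \<open>The competitor set and the rate\<close>
definition rate :: "real \<Rightarrow> nat \<Rightarrow> real" where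
  "rate s J = (ln (2 ^ J) / 2 ^ J) powr (2 * s / (2 * s + 1))"

lemma geometric_block_le:
  fixes \<beta> :: real
  assumes "0 < \<beta>"
  shows "(\<Sum>j=a..<b. 2 powr (- (real j * \<beta>))) \<le> 2 powr (- (real a * \<beta>)) / (1 - 2 powr (- \<beta>))"
proof -
  define r :: real where "r = 2 powr (- \<beta>)"
  have r: "0 < r" "r < 1" using assms by (auto simp: r_def powr_less_one)
  have pw: "2 powr (- (real j * \<beta>)) = r ^ j" for j
    unfolding r_def by (subst powr_power) auto
  have "(\<Sum>j=a..<b. r ^ j) = (\<Sum>j=a..<b. r ^ a * r ^ (j - a))"
    by (intro sum.cong refl) (simp add: power_add[symmetric])
  also have "\<dots> = r ^ a * (\<Sum>i\<in>(\<lambda>l. l - a) ` {a..<b}. r ^ i)"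
    by (subst sum.reindex) (auto simp: inj_on_def sum_distrib_left)
  also have "\<dots> \<le> r ^ a * (\<Sum>i. r ^ i)" using r by (intro mult_left_mono sum_le_suminf) (auto simp: summable_geometric)
  also have "\<dots> = r ^ a / (1 - r)" using r suminf_geometric[of r] by simp
  finally show ?thesis unfolding pw by (simp add: r_def)
qed

lemma coeff_index_level_bounds:
  "finite (coeff_index j0 J)" "card {i \<in> coeff_index j0 J. fst i < a} \<le> 2 ^ a"
proof -
  show "finite (coeff_index j0 J)" by (simp add: coeff_index_def)
  have "{i \<in> coeff_index j0 J. fst i < a} \<subseteq> (SIGMA j:{..<a}. {..<2 ^ j})" by (auto simp: coeff_index_def)
  then have "card {i \<in> coeff_index j0 J. fst i < a} \<le> card (SIGMA j:{..<a}. {..<(2::nat) ^ j})"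
    by (intro card_mono) auto
  also have "\<dots> = (\<Sum>j<a. 2 ^ j)" by simp
  also have "\<dots> \<le> 2 ^ a" by (induction a) auto
  finally show "card {i \<in> coeff_index j0 J. fst i < a} \<le> 2 ^ a" .
qed

lemma high_level_sum_le:
  assumes C1: "0 \<le> C1" and \<beta>: "0 < \<beta>" and j1: "j1 \<le> a"
    and bd: "\<And>j. j1 \<le> j \<Longrightarrow> (\<Sum>k<2 ^ j. F j k) \<le> C1 * 2 powr (- (real j * \<beta>))" and F0: "\<And>j k. 0 \<le> F j (k::nat)"
  shows "(\<Sum>i | i \<in> coeff_index j0 J \<and> a \<le> fst i. F (fst i) (snd i)) \<le> C1 * (2 powr (- (real a * \<beta>)) / (1 - 2 powr (- \<beta>)))"
proof -
  have "(\<Sum>i | i \<in> coeff_index j0 J \<and> a \<le> fst i. F (fst i) (snd i)) \<le> (\<Sum>i\<in>(SIGMA j:{a..<J}. {..<2 ^ j}). F (fst i) (snd i))"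
    using F0 by (intro sum_mono2) (auto simp: coeff_index_def)
  also have "\<dots> = (\<Sum>j=a..<J. \<Sum>k<2 ^ j. F j k)" by (subst sum.Sigma) (auto simp: split_def)
  also have "\<dots> \<le> (\<Sum>j=a..<J. C1 * 2 powr (- (real j * \<beta>)))" using j1 by (intro sum_mono bd) auto
  also have "\<dots> = C1 * (\<Sum>j=a..<J. 2 powr (- (real j * \<beta>)))" by (simp add: sum_distrib_left)
  also have "\<dots> \<le> C1 * (2 powr (- (real a * \<beta>)) / (1 - 2 powr (- \<beta>)))"
    by (intro mult_left_mono geometric_block_le \<beta> C1)
  finally show ?thesis .
qed

text \<open>With \<open>y = n / ln n\<close>, the cut-off \<open>x = y powr (1 / (2 * s + 1))\<close> for the number of coarse coefficients and the
threshold \<open>\<tau> = y powr (- 1 / 2)\<close> for the fine ones balance all contributions: the fine levels contribute at most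
\<open>\<tau> powr (- \<rho>) * x powr (- \<rho> * \<alpha>) = x\<close> coefficients above the threshold, up to a constant, and those below it have
energy at most \<open>\<tau>\<^sup>2\<close> times the same number. Finally \<open>x / y\<close> is the rate.\<close>

lemma competitor_set_exists:
  assumes s: "0 < s" and \<rho>: "0 < \<rho>" "\<rho> \<le> 2" and \<alpha>: "\<alpha> = s + 1 / 2 - 1 / \<rho>" "0 < \<alpha>" and C1: "0 \<le> C1" and c0: "0 < c0"
  shows "\<exists>C2\<ge>0. \<forall>\<^sub>F J in sequentially. \<forall>\<theta> :: nat \<Rightarrow> nat \<Rightarrow> real.
    (\<forall>j\<ge>j1. (\<Sum>k<2 ^ j. \<bar>\<theta> j k\<bar> powr \<rho>) \<le> C1 * 2 powr (- (real j * (\<rho> * \<alpha>)))) \<longrightarrow>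
    (\<exists>A\<subseteq>coeff_index j0 J. 1 \<le> card A \<and> real (card A) \<le> c0 * 2 ^ J \<and>
       real (card A) * (ln (2 ^ J) / 2 ^ J) \<le> C2 * rate s J \<and>
       (\<Sum>i\<in>coeff_index j0 J - A. (\<theta> (fst i) (snd i))\<^sup>2) \<le> C2 * rate s J)"
proof -
  define a where "a = 1 / (2 * s + 1)"
  have a: "0 < a" "a < 1" using s by (auto simp: a_def)
  define Y :: "nat \<Rightarrow> real" where "Y J = 2 ^ J / ln (2 ^ J)" for J
  define X where "X J = Y J powr a" for J
  define \<beta> where "\<beta> = \<rho> * \<alpha>"
  have \<beta>: "0 < \<beta>" using \<rho> \<alpha> by (simp add: \<beta>_def)
  define K where "K = C1 * (2 powr \<beta> / (1 - 2 powr (- \<beta>)))"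
  have "2 powr (- \<beta>) < 1" using \<beta> by (simp add: powr_less_one)
  then have K0: "0 \<le> K" unfolding K_def using C1 by (intro mult_nonneg_nonneg divide_nonneg_nonneg) auto
  define C2 where "C2 = 1 + K"
  have Ytop: "filterlim Y at_top sequentially"
  proof -
    have "filterlim (\<lambda>J::nat. 2 ^ J / (real J * ln 2)) at_top sequentially" by real_asymp
    then show ?thesis by (simp add: Y_def[abs_def] ln_realpow)
  qed
  have Xtop: "filterlim X at_top sequentially"
    unfolding X_def by (rule filterlim_compose[OF real_powr_at_top[OF a(1)] Ytop])
  have Yneg: "((\<lambda>J. Y J powr (a - 1)) \<longlongrightarrow> 0) sequentially"
    using a by (intro tendsto_neg_powr[OF _ Ytop]) simp
  have ev1: "eventually (\<lambda>J. 2 ^ (j1 + j0 + 1) \<le> X J) sequentially" using Xtop by (simp add: filterlim_at_top)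
  have ev2: "eventually (\<lambda>J. Y J powr (a - 1) < c0 / C2) sequentially"
    using K0 c0 by (intro order_tendstoD(2)[OF Yneg]) (simp add: C2_def)
  have ev3: "eventually (\<lambda>J. 1 \<le> ln ((2::real) ^ J)) sequentially"
  proof -
    have "filterlim (\<lambda>J::nat. real J * ln 2) at_top sequentially" by real_asymp
    then show ?thesis by (simp add: ln_realpow filterlim_at_top)
  qed
  have ev4: "eventually (\<lambda>J. j0 < J) sequentially" by (rule eventually_gt_at_top)
  have main: "\<forall>\<^sub>F J in sequentially. \<forall>\<theta> :: nat \<Rightarrow> nat \<Rightarrow> real.
    (\<forall>j\<ge>j1. (\<Sum>k<2 ^ j. \<bar>\<theta> j k\<bar> powr \<rho>) \<le> C1 * 2 powr (- (real j * (\<rho> * \<alpha>)))) \<longrightarrow>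
    (\<exists>A\<subseteq>coeff_index j0 J. 1 \<le> card A \<and> real (card A) \<le> c0 * 2 ^ J \<and>
       real (card A) * (ln (2 ^ J) / 2 ^ J) \<le> C2 * rate s J \<and>
       (\<Sum>i\<in>coeff_index j0 J - A. (\<theta> (fst i) (snd i))\<^sup>2) \<le> C2 * rate s J)"
    using ev1 ev2 ev3 ev4
  proof eventually_elim
    case (elim J)
    show ?case
    proof (intro allI impI)
      fix \<theta> :: "nat \<Rightarrow> nat \<Rightarrow> real"
      assume "\<forall>j\<ge>j1. (\<Sum>k<2 ^ j. \<bar>\<theta> j k\<bar> powr \<rho>) \<le> C1 * 2 powr (- (real j * (\<rho> * \<alpha>)))"
      then have bd: "\<And>j. j1 \<le> j \<Longrightarrow> (\<Sum>k<2 ^ j. \<bar>\<theta> j k\<bar> powr \<rho>) \<le> C1 * 2 powr (- (real j * \<beta>))" by (simp add: \<beta>_def)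
      define y where "y = Y J"
      define x where "x = X J"
      define \<tau> where "\<tau> = y powr (- (1 / 2))"
      have lnp: "1 \<le> ln ((2::real) ^ J)" by (rule elim)
      have y0: "0 < y" unfolding y_def Y_def
        by (rule divide_pos_pos[OF zero_less_power[OF zero_less_numeral] less_le_trans[OF zero_less_one lnp]])
      have x1: "2 ^ (j1 + j0 + 1) \<le> x" using elim by (simp add: x_def)
      have "(1::real) \<le> 2 ^ (j1 + j0 + 1)" by (rule one_le_power) simp
      then have x0: "1 \<le> x" using x1 by linarith
      have lam: "0 < \<tau>" using y0 by (simp add: \<tau>_def)
      have yinv: "ln (2 ^ J) / 2 ^ J = y powr (- 1)" using y0 by (simp add: y_def Y_def powr_minus_divide)
      have rt: "rate s J = x * (ln (2 ^ J) / 2 ^ J)"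
      proof -
        have "rate s J = y powr ((- 1) * (2 * s / (2 * s + 1)))" unfolding rate_def yinv powr_powr ..
        also have "(- 1) * (2 * s / (2 * s + 1)) = a + (- 1)" using s by (simp add: a_def field_simps)
        finally show ?thesis unfolding yinv x_def X_def y_def[symmetric] powr_add .
      qed
      have l2: "\<tau>\<^sup>2 = ln (2 ^ J) / 2 ^ J" unfolding yinv \<tau>_def by (simp add: power2_eq_square powr_add[symmetric])
      define js where "js = nat \<lfloor>log 2 x\<rfloor>"
      have lx: "0 \<le> log 2 x" using x0 by simp
      have js: "real js \<le> log 2 x" "log 2 x < real js + 1" unfolding js_def using lx by linarith+
      have p1: "2 ^ js \<le> x"
        using js(1) x0 by (simp add: powr_realpow[symmetric] powr_le_cancel_iff flip: le_log_iff)
      have p2: "x < 2 * 2 ^ js"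
        using js(2) x0 by (simp add: log_less_iff powr_add powr_realpow)
      have jsge: "j1 \<le> js" "j0 < js"
      proof -
        have "(2::real) ^ (j1 + j0 + 1) < 2 ^ (js + 1)" using le_less_trans[OF x1 p2] by simp
        then have "j1 + j0 + 1 < js + 1" by (rule power_less_imp_less_exp[rotated]) simp
        then show "j1 \<le> js" "j0 < js" by auto
      qed
      have decay: "2 powr (- (real js * \<beta>)) \<le> 2 powr \<beta> * x powr (- \<beta>)"
      proof -
        have "x / 2 \<le> 2 powr real js" using p2 by (simp add: powr_realpow)
        then have "(2 powr real js) powr (- \<beta>) \<le> (x / 2) powr (- \<beta>)" using \<beta> x0 by (intro powr_mono2') auto
        then show ?thesis using x0 by (simp add: powr_powr powr_divide powr_minus_divide field_simps)
      qed
      (* the choice of the exponent a makes the number of large fine coefficients equal to the number of coarse ones *)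
      have balance: "\<tau> powr (- \<rho>) * x powr (- \<beta>) = x"
      proof -
        have "\<tau> powr (- \<rho>) * x powr (- \<beta>) = y powr (\<rho> / 2 + - (a * \<beta>))"
          unfolding \<tau>_def x_def X_def y_def[symmetric] powr_powr powr_add by simp
        also have "\<rho> / 2 + - (a * \<beta>) = a"
        proof -
          have "\<beta> = \<rho> / 2 * (2 * s + 1) - 1" unfolding \<beta>_def \<alpha>(1) using \<rho> by (simp add: algebra_simps)
          moreover have "a * (2 * s + 1) = 1" using s by (simp add: a_def)
          ultimately have "a * \<beta> = \<rho> / 2 * 1 - a" by (metis mult.commute mult.left_commute mult.right_neutral right_diff_distrib)
          then show ?thesis by simp
        qed
        finally show ?thesis by (simp add: x_def X_def y_def)
      qed
      define S where "S = (\<Sum>i | i \<in> coeff_index j0 J \<and> js \<le> fst i. \<bar>\<theta> (fst i) (snd i)\<bar> powr \<rho>)"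
      have "S \<le> C1 * (2 powr (- (real js * \<beta>)) / (1 - 2 powr (- \<beta>)))"
        unfolding S_def by (rule high_level_sum_le[OF C1 \<beta> jsge(1) bd]) auto
      also have "\<dots> \<le> C1 * ((2 powr \<beta> * x powr (- \<beta>)) / (1 - 2 powr (- \<beta>)))"
        using \<open>2 powr (- \<beta>) < 1\<close> by (intro mult_left_mono divide_right_mono decay C1) auto
      also have "\<dots> = K * x powr (- \<beta>)" by (simp add: K_def)
      finally have S: "S \<le> K * x powr (- \<beta>)" .
      have lS: "\<tau> powr (- \<rho>) * S \<le> K * x"
      proof -
        have "\<tau> powr (- \<rho>) * S \<le> \<tau> powr (- \<rho>) * (K * x powr (- \<beta>))" by (intro mult_left_mono S) auto
        also have "\<dots> = K * (\<tau> powr (- \<rho>) * x powr (- \<beta>))" by simp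
        finally show ?thesis unfolding balance .
      qed
      define A1 where "A1 = {i \<in> coeff_index j0 J. fst i < js}"
      define H where "H = {i. i \<in> coeff_index j0 J \<and> js \<le> fst i}"
      define A2 where "A2 = {i \<in> H. \<tau> < \<bar>\<theta> (fst i) (snd i)\<bar>}"
      define A where "A = A1 \<union> A2"
      have fin: "finite A1" "finite H" "finite A2" unfolding A1_def A2_def H_def using coeff_index_level_bounds(1)[of j0 J] by auto
      have sub: "A \<subseteq> coeff_index j0 J" by (auto simp: A_def A1_def A2_def H_def)
      have c1: "real (card A1) \<le> x"
      proof -
        have "real (card A1) \<le> real (2 ^ js)" unfolding A1_def by (intro of_nat_mono coeff_index_level_bounds)
        also have "real (2 ^ js) = 2 ^ js" by simp
        also have "\<dots> \<le> x" by (rule p1)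
        finally show ?thesis .
      qed
      have c2: "real (card A2) \<le> K * x"
      proof -
        have "real (card A2) = (\<Sum>i\<in>A2. 1)" by simp
        also have "\<dots> \<le> (\<Sum>i\<in>A2. \<tau> powr (- \<rho>) * \<bar>\<theta> (fst i) (snd i)\<bar> powr \<rho>)"
        proof (intro sum_mono)
          fix i assume "i \<in> A2"
          then have "\<tau> powr \<rho> \<le> \<bar>\<theta> (fst i) (snd i)\<bar> powr \<rho>" using lam \<rho> by (intro powr_mono2) (auto simp: A2_def)
          then have "\<tau> powr (- \<rho>) * \<tau> powr \<rho> \<le> \<tau> powr (- \<rho>) * \<bar>\<theta> (fst i) (snd i)\<bar> powr \<rho>" by (intro mult_left_mono) auto
          then show "1 \<le> \<tau> powr (- \<rho>) * \<bar>\<theta> (fst i) (snd i)\<bar> powr \<rho>" using lam by (simp add: powr_add[symmetric])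
        qed
        also have "\<dots> \<le> (\<Sum>i\<in>H. \<tau> powr (- \<rho>) * \<bar>\<theta> (fst i) (snd i)\<bar> powr \<rho>)"
          using fin by (intro sum_mono2) (auto simp: A2_def)
        also have "\<dots> = \<tau> powr (- \<rho>) * S" by (simp add: sum_distrib_left S_def H_def)
        also have "\<dots> \<le> K * x" by (rule lS)
        finally show ?thesis .
      qed
      have cA: "real (card A) \<le> C2 * x"
      proof -
        have "card A \<le> card A1 + card A2" unfolding A_def by (rule card_Un_le)
        then have "real (card A) \<le> real (card A1) + real (card A2)" by linarith
        then show ?thesis using c1 c2 by (simp add: C2_def distrib_right)
      qed
      have "(j0, 0) \<in> A" using elim(4) jsge by (auto simp: A_def A1_def coeff_index_def)
      then have cA1: "1 \<le> card A" using fin by (auto simp: A_def Suc_le_eq card_gt_0_iff)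
      have "C2 * x \<le> c0 * 2 ^ J"
      proof -
        have "x = y * y powr (a - 1)" using y0 by (simp add: x_def X_def y_def powr_diff)
        also have "\<dots> \<le> 2 ^ J * (c0 / C2)"
        proof (intro mult_mono)
          have "2 ^ J / ln ((2::real) ^ J) \<le> 2 ^ J / 1"
          proof (rule divide_left_mono[OF lnp])
            show "0 \<le> (2::real) ^ J" by (rule zero_le_power) simp
            show "0 < ln ((2::real) ^ J) * 1" unfolding mult_1_right by (rule less_le_trans[OF zero_less_one lnp])
          qed
          then show "y \<le> 2 ^ J" unfolding y_def Y_def by (simp only: div_by_1)
          show "y powr (a - 1) \<le> c0 / C2" using elim(2) by (simp add: y_def)
        qed auto
        finally show ?thesis using K0 by (simp add: C2_def field_simps)
      qed
      then have cA2: "real (card A) \<le> c0 * 2 ^ J" using cA by linarith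
      have r1: "real (card A) * (ln (2 ^ J) / 2 ^ J) \<le> C2 * rate s J"
        unfolding rt mult.assoc[symmetric] l2[symmetric] by (rule mult_right_mono[OF cA zero_le_power2])
      have r2: "(\<Sum>i\<in>coeff_index j0 J - A. (\<theta> (fst i) (snd i))\<^sup>2) \<le> C2 * rate s J"
      proof -
        have "(\<Sum>i\<in>coeff_index j0 J - A. (\<theta> (fst i) (snd i))\<^sup>2) \<le> (\<Sum>i\<in>coeff_index j0 J - A. \<tau>\<^sup>2 * (\<tau> powr (- \<rho>) * \<bar>\<theta> (fst i) (snd i)\<bar> powr \<rho>))"
        proof (intro sum_mono)
          fix i assume "i \<in> coeff_index j0 J - A"
          then have le: "\<bar>\<theta> (fst i) (snd i)\<bar> \<le> \<tau>" by (auto simp: A_def A1_def A2_def H_def)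
          define t where "t = \<bar>\<theta> (fst i) (snd i)\<bar>"
          show "(\<theta> (fst i) (snd i))\<^sup>2 \<le> \<tau>\<^sup>2 * (\<tau> powr (- \<rho>) * \<bar>\<theta> (fst i) (snd i)\<bar> powr \<rho>)"
          proof (cases "t = 0")
            case False
            then have t: "0 < t" by (simp add: t_def)
            have "t powr (2 - \<rho>) \<le> \<tau> powr (2 - \<rho>)" using le \<rho> t by (intro powr_mono2) (auto simp: t_def)
            then have "t powr (2 - \<rho>) * t powr \<rho> \<le> \<tau> powr (2 - \<rho>) * t powr \<rho>" by (intro mult_right_mono) auto
            moreover have "t powr (2 - \<rho>) * t powr \<rho> = t\<^sup>2" using t by (simp add: powr_add[symmetric] powr_numeral)
            moreover have "\<tau> powr (2 - \<rho>) = \<tau>\<^sup>2 * \<tau> powr (- \<rho>)" using lam powr_add[of \<tau> 2 "- \<rho>"] by (simp add: powr_numeral)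
            ultimately show ?thesis by (simp add: t_def mult.assoc)
          qed (simp add: t_def)
        qed
        also have "\<dots> \<le> (\<Sum>i\<in>H. \<tau>\<^sup>2 * (\<tau> powr (- \<rho>) * \<bar>\<theta> (fst i) (snd i)\<bar> powr \<rho>))"
          using fin by (intro sum_mono2) (auto simp: A_def A1_def H_def)
        also have "\<dots> = \<tau>\<^sup>2 * (\<tau> powr (- \<rho>) * S)" by (simp add: sum_distrib_left S_def H_def)
        also have "\<dots> \<le> \<tau>\<^sup>2 * (K * x)" by (intro mult_left_mono lS) auto
        also have "\<dots> = K * rate s J" by (simp add: rt l2)
        also have "\<dots> \<le> C2 * rate s J" by (intro mult_right_mono) (auto simp: C2_def rate_def)
        finally show ?thesis .
      qed
      show "\<exists>A\<subseteq>coeff_index j0 J. 1 \<le> card A \<and> real (card A) \<le> c0 * 2 ^ J \<and>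
       real (card A) * (ln (2 ^ J) / 2 ^ J) \<le> C2 * rate s J \<and>
       (\<Sum>i\<in>coeff_index j0 J - A. (\<theta> (fst i) (snd i))\<^sup>2) \<le> C2 * rate s J"
        using sub cA1 cA2 r1 r2 by blast
    qed
  qed
  show ?thesis using main K0 by (intro exI[of _ C2]) (auto simp: C2_def)
qed

text \<open>The \<open>\<ell>\<^sup>2\<close> norm at a level is at most the \<open>\<ell>\<^sup>\<rho>\<close> norm, which yields the decay \<open>2 powr (- 2 * \<alpha> * j)\<close> of the energy; \<open>2 * \<alpha>\<close> is
at least the exponent of the rate, and the logarithm only enlarges the rate.\<close>

lemma tail_rate:
  assumes s: "0 < s" and \<rho>: "0 < \<rho>" "\<rho> \<le> 2" and \<alpha>: "0 < \<alpha>" "2 * s / (2 * s + 1) \<le> 2 * \<alpha>" and C1: "0 \<le> C1"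
  shows "\<exists>C3\<ge>0. \<forall>\<^sub>F J in sequentially. \<forall>\<theta> :: nat \<Rightarrow> nat \<Rightarrow> real.
    (\<forall>j\<ge>j1. (\<Sum>k<2 ^ j. \<bar>\<theta> j k\<bar> powr \<rho>) \<le> C1 * 2 powr (- (real j * (\<rho> * \<alpha>)))) \<longrightarrow>
    (\<forall>L. (\<Sum>j=J..<L. \<Sum>k<2 ^ j. (\<theta> j k)\<^sup>2) \<le> C3 * rate s J)"
proof -
  define C3 where "C3 = C1 powr (2 / \<rho>) / (1 - 2 powr (- (2 * \<alpha>)))"
  have "2 powr (- (2 * \<alpha>)) < 1" using \<alpha> by (simp add: powr_less_one)
  then have C3: "0 \<le> C3" by (simp add: C3_def)
  have ev3: "eventually (\<lambda>J. 1 \<le> ln ((2::real) ^ J)) sequentially"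
  proof -
    have "filterlim (\<lambda>J::nat. real J * ln 2) at_top sequentially" by real_asymp
    then show ?thesis by (simp add: ln_realpow filterlim_at_top)
  qed
  have "\<forall>\<^sub>F J in sequentially. \<forall>\<theta> :: nat \<Rightarrow> nat \<Rightarrow> real.
    (\<forall>j\<ge>j1. (\<Sum>k<2 ^ j. \<bar>\<theta> j k\<bar> powr \<rho>) \<le> C1 * 2 powr (- (real j * (\<rho> * \<alpha>)))) \<longrightarrow>
    (\<forall>L. (\<Sum>j=J..<L. \<Sum>k<2 ^ j. (\<theta> j k)\<^sup>2) \<le> C3 * rate s J)"
    using ev3 eventually_ge_at_top[of j1]
  proof eventually_elim
    case (elim J)
    show ?case
    proof (intro allI impI)
      fix \<theta> :: "nat \<Rightarrow> nat \<Rightarrow> real" and L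
      assume bd: "\<forall>j\<ge>j1. (\<Sum>k<2 ^ j. \<bar>\<theta> j k\<bar> powr \<rho>) \<le> C1 * 2 powr (- (real j * (\<rho> * \<alpha>)))"
      (* each term is at most the whole power sum S, hence theta^2 <= |theta|^rho * S^((2 - rho) / rho) *)
      have lev: "(\<Sum>k<2 ^ j. (\<theta> j k)\<^sup>2) \<le> C1 powr (2 / \<rho>) * 2 powr (- (real j * (2 * \<alpha>)))" if j: "J \<le> j" for j
      proof -
        define S where "S = (\<Sum>k<2 ^ j. \<bar>\<theta> j k\<bar> powr \<rho>)"
        have S0: "0 \<le> S" unfolding S_def by (intro sum_nonneg) auto
        have SC: "S \<le> C1 * 2 powr (- (real j * (\<rho> * \<alpha>)))" using bd j elim by (simp add: S_def)
        have "(\<Sum>k<2 ^ j. (\<theta> j k)\<^sup>2) \<le> (\<Sum>k<2 ^ j. \<bar>\<theta> j k\<bar> powr \<rho> * S powr ((2 - \<rho>) / \<rho>))"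
        proof (intro sum_mono)
          fix k assume k: "k \<in> {..<(2::nat) ^ j}"
          define t where "t = \<bar>\<theta> j k\<bar>"
          show "(\<theta> j k)\<^sup>2 \<le> \<bar>\<theta> j k\<bar> powr \<rho> * S powr ((2 - \<rho>) / \<rho>)"
          proof (cases "t = 0")
            case False
            then have t: "0 < t" by (simp add: t_def)
            have "t powr \<rho> \<le> S" unfolding S_def t_def using k by (intro member_le_sum[of k _ "\<lambda>k. \<bar>\<theta> j k\<bar> powr \<rho>"]) auto
            then have "(t powr \<rho>) powr ((2 - \<rho>) / \<rho>) \<le> S powr ((2 - \<rho>) / \<rho>)" using \<rho> by (intro powr_mono2) auto
            then have "t powr (2 - \<rho>) \<le> S powr ((2 - \<rho>) / \<rho>)" using \<rho> by (simp add: powr_powr)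
            then have "t powr \<rho> * t powr (2 - \<rho>) \<le> t powr \<rho> * S powr ((2 - \<rho>) / \<rho>)" by (intro mult_left_mono) auto
            moreover have "t powr \<rho> * t powr (2 - \<rho>) = t\<^sup>2" using t by (simp add: powr_add[symmetric] powr_numeral)
            ultimately show ?thesis by (simp add: t_def)
          qed (simp add: t_def)
        qed
        also have "\<dots> = S * S powr ((2 - \<rho>) / \<rho>)" by (simp add: S_def sum_distrib_right)
        also have "\<dots> = S powr (2 / \<rho>)"
        proof (cases "S = 0")
          case False
          have "S powr (1 + (2 - \<rho>) / \<rho>) = S powr 1 * S powr ((2 - \<rho>) / \<rho>)" by (rule powr_add)
          moreover have "1 + (2 - \<rho>) / \<rho> = 2 / \<rho>" using \<rho> by (simp add: field_simps)
          ultimately show ?thesis using S0 False by simp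
        qed simp
        also have "\<dots> \<le> (C1 * 2 powr (- (real j * (\<rho> * \<alpha>)))) powr (2 / \<rho>)" using SC S0 \<rho> by (intro powr_mono2) auto
        also have "\<dots> = C1 powr (2 / \<rho>) * 2 powr (- (real j * (2 * \<alpha>)))"
          using \<rho> by (simp add: powr_mult powr_powr mult_ac)
        finally show ?thesis .
      qed
      have "(\<Sum>j=J..<L. \<Sum>k<2 ^ j. (\<theta> j k)\<^sup>2) \<le> (\<Sum>j=J..<L. C1 powr (2 / \<rho>) * 2 powr (- (real j * (2 * \<alpha>))))"
        by (intro sum_mono lev) auto
      also have "\<dots> = C1 powr (2 / \<rho>) * (\<Sum>j=J..<L. 2 powr (- (real j * (2 * \<alpha>))))" by (simp add: sum_distrib_left)
      also have "\<dots> \<le> C1 powr (2 / \<rho>) * (2 powr (- (real J * (2 * \<alpha>))) / (1 - 2 powr (- (2 * \<alpha>))))"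
        using \<alpha> by (intro mult_left_mono geometric_block_le) auto
      also have "\<dots> = C3 * 2 powr (- (real J * (2 * \<alpha>)))" by (simp add: C3_def)
      also have "\<dots> \<le> C3 * rate s J"
      proof (intro mult_left_mono C3)
        have "real J * (2 * s / (2 * s + 1)) \<le> real J * (2 * \<alpha>)" using \<alpha> by (intro mult_left_mono) auto
        then have "2 powr (- (real J * (2 * \<alpha>))) \<le> 2 powr (- (real J * (2 * s / (2 * s + 1))))" by (intro powr_mono) auto
        also have "\<dots> = (1 / 2 ^ J) powr (2 * s / (2 * s + 1))"
        proof -
          have "1 / 2 ^ J = 2 powr (- real J)" by (simp add: powr_minus_divide powr_realpow)
          then show ?thesis by (simp add: powr_powr)
        qed
        also have "\<dots> \<le> rate s J" unfolding rate_def using s elim by (intro powr_mono2 divide_right_mono) auto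
        finally show "2 powr (- (real J * (2 * \<alpha>))) \<le> rate s J" .
      qed
      finally show "(\<Sum>j=J..<L. \<Sum>k<2 ^ j. (\<theta> j k)\<^sup>2) \<le> C3 * rate s J" .
    qed
  qed
  then show ?thesis using C3 by blast
qed

section \<open>Wavelet coefficients and loss over a Besov ball\<close>
text \<open>Scaling functions and wavelets as a single family, indexed by a sum type.\<close>

definition wave :: "(nat \<Rightarrow> real \<Rightarrow> real) \<Rightarrow> (nat \<Rightarrow> nat \<Rightarrow> real \<Rightarrow> real) \<Rightarrow> nat + nat \<times> nat \<Rightarrow> real \<Rightarrow> real" where
  "wave \<Phi> \<Psi> i = (case i of Inl k \<Rightarrow> \<Phi> k | Inr jk \<Rightarrow> \<Psi> (fst jk) (snd jk))"

definition wave_index :: "nat \<Rightarrow> nat \<Rightarrow> (nat + nat \<times> nat) set" where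
  "wave_index C j0 = Inl ` {..<C} \<union> Inr ` {jk. j0 \<le> fst jk \<and> snd jk < 2 ^ fst jk}"

definition wave_index_below :: "nat \<Rightarrow> nat \<Rightarrow> nat \<Rightarrow> (nat + nat \<times> nat) set" where
  "wave_index_below C j0 L = Inl ` {..<C} \<union> Inr ` coeff_index j0 L"

lemma wave_index_below:
  "finite (wave_index_below C j0 L)" "wave_index_below C j0 L \<subseteq> wave_index_below C j0 (Suc L)"
  "wave_index C j0 = (\<Union>L. wave_index_below C j0 L)" "wave_index_below C j0 L \<subseteq> wave_index C j0"
proof -
  show "finite (wave_index_below C j0 L)" "wave_index_below C j0 L \<subseteq> wave_index_below C j0 (Suc L)"
    by (auto simp: wave_index_below_def coeff_index_def)
  show s: "wave_index_below C j0 L \<subseteq> wave_index C j0" for L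
    by (auto simp: wave_index_below_def wave_index_def coeff_index_def)
  have "i \<in> (\<Union>L. wave_index_below C j0 L)" if "i \<in> wave_index C j0" for i
  proof (cases i)
    case (Inl k)
    then show ?thesis using that by (auto simp: wave_index_below_def wave_index_def)
  next
    case (Inr jk)
    then have "i \<in> wave_index_below C j0 (Suc (fst jk))" using that
      by (auto simp: wave_index_below_def wave_index_def coeff_index_def)
    then show ?thesis by blast
  qed
  then show "wave_index C j0 = (\<Union>L. wave_index_below C j0 L)" using s by blast
qed

lemma sum_wave_index_below:
  "(\<Sum>i\<in>wave_index_below C j0 L. g i) = (\<Sum>k<C. g (Inl k)) + (\<Sum>i\<in>coeff_index j0 L. g (Inr i))" for g :: "_ \<Rightarrow> real"
proof -
  have "finite (coeff_index j0 L)" by (simp add: coeff_index_def)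
  then show ?thesis unfolding wave_index_below_def
    by (subst sum.union_disjoint) (auto simp: sum.reindex)
qed

lemma wavelet_orthonormal_family:
  assumes basis: "boundary_wavelet_basis r \<phi> \<psi> j0 C \<Phi> \<Psi>" and r: "0 < r"
  shows "orthonormal_family (wave \<Phi> \<Psi>) (wave_index C j0)"
proof
  have comm: "inner01 g h = inner01 h g" for g h by (simp add: inner01_def mult.commute)
  show "wave \<Phi> \<Psi> i \<in> L2_01" if "i \<in> wave_index C j0" for i
    using that basis_continuous[OF basis r] by (auto simp: wave_index_def wave_def intro!: continuous_imp_L2_01)
  show "inner01 (wave \<Phi> \<Psi> i) (wave \<Phi> \<Psi> j) = (if i = j then 1 else 0)" if "i \<in> wave_index C j0" "j \<in> wave_index C j0" for i j
  proof -
    have oS: "inner01 (\<Phi> k) (\<Phi> k') = (if k = k' then 1 else 0)" if "k < C" "k' < C" for k k'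
      using basis_orth_scaling[OF basis] that by blast
    have oM: "inner01 (\<Phi> k) (\<Psi> j k') = 0" if "k < C" "j0 \<le> j" "k' < 2 ^ j" for k j k'
      using basis_orth_mixed[OF basis] that by blast
    have oW: "inner01 (\<Psi> j k) (\<Psi> j' k') = (if (j, k) = (j', k') then 1 else 0)"
      if "j0 \<le> j" "k < 2 ^ j" "j0 \<le> j'" "k' < 2 ^ j'" for j k j' k'
      using basis_orth_wavelet[OF basis] that by blast
    show ?thesis
      using that by (auto simp: wave_index_def wave_def oS oM oW comm[of "\<Psi> _ _" "\<Phi> _"] split: if_splits)
  qed
qed

lemma wavelet_parseval:
  assumes basis: "boundary_wavelet_basis r \<phi> \<psi> j0 C \<Phi> \<Psi>" and r: "0 < r" and f: "f \<in> L2_01"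
  shows "(\<lambda>L. \<Sum>i\<in>wave_index_below C j0 L. (inner01 f (wave \<Phi> \<Psi> i))\<^sup>2) \<longlonglongrightarrow> (\<integral>x. (cut01 f x)\<^sup>2 \<partial>lborel)"
proof (rule orthonormal_family.parseval_limit[OF wavelet_orthonormal_family[OF basis r] wave_index_below(1-3) _ f])
  fix g assume g: "g \<in> L2_01" and z: "\<And>i. i \<in> wave_index C j0 \<Longrightarrow> inner01 g (wave \<Phi> \<Psi> i) = 0"
  have "inner01 g (\<Phi> k) = 0" if "k < C" for k
    using z[of "Inl k"] that by (auto simp: wave_index_def wave_def)
  moreover have "inner01 g (\<Psi> j k) = 0" if "j0 \<le> j" "k < 2 ^ j" for j k
    using z[of "Inr (j, k)"] that by (auto simp: wave_index_def wave_def)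
  ultimately show "AE x in lborel. x \<in> {0..1} \<longrightarrow> g x = 0" using basis_complete[OF basis] g by blast
qed

lemma L1_le_L2_on_unit_interval:
  assumes u: "sq_int u"
  shows "(\<integral>\<^sup>+y. ennreal (indicator {0..<1} y * \<bar>u y\<bar>) \<partial>lborel) \<le> ennreal (sqrt (\<integral>x. (u x)\<^sup>2 \<partial>lborel))"
proof -
  note um[measurable] = sq_intD[OF u]
  define v where "v y = \<bar>u y\<bar>" for y
  have v: "sq_int v" using u by (auto simp: sq_int_def v_def[abs_def])
  have i: "sq_int (indicator {0<..1::real})" by (rule sq_int_indicator)
  have vi: "integrable lborel (\<lambda>y. indicator {0<..1} y * v y)" by (rule sq_int_mult[OF i v])
  have i1: "(\<integral>x. (indicator {0<..1::real} x)\<^sup>2 \<partial>lborel) = (1::real)"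
  proof -
    have "(\<lambda>x. (indicator {0<..1::real} x)\<^sup>2 :: real) = indicator {0<..1}" by (auto simp: indicator_def)
    then show ?thesis by simp
  qed
  have "(\<integral>\<^sup>+y. ennreal (indicator {0..<1} y * \<bar>u y\<bar>) \<partial>lborel) = (\<integral>\<^sup>+y. ennreal (indicator {0<..1} y * v y) \<partial>lborel)"
  proof (rule nn_integral_cong_AE)
    show "AE y in lborel. ennreal (indicator {0..<1} y * \<bar>u y\<bar>) = ennreal (indicator {0<..1} y * v y)"
      using AE_lborel_singleton[of "1::real"] AE_lborel_singleton[of "0::real"]
      by eventually_elim (auto simp: indicator_def v_def)
  qed
  also have "\<dots> = ennreal (\<integral>y. indicator {0<..1} y * v y \<partial>lborel)"
    using vi by (intro nn_integral_eq_integral) (auto simp: v_def)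
  also have "\<dots> \<le> ennreal (sqrt (\<integral>x. (u x)\<^sup>2 \<partial>lborel))"
  proof (intro ennreal_leI real_le_rsqrt)
    show "(\<integral>y. indicator {0<..1} y * v y \<partial>lborel)\<^sup>2 \<le> (\<integral>x. (u x)\<^sup>2 \<partial>lborel)"
      using Cauchy_Schwarz_integral[OF i v] unfolding i1 by (simp add: v_def)
  qed
  finally show ?thesis .
qed

lemma cut01_wave_combination:
  "(\<Sum>i\<in>K. c i * cut01 (e i) x) = cut01 (\<lambda>x. \<Sum>i\<in>K. c i * e i x) x"
  by (simp add: cut01_def sum_distrib_left mult.left_commute)

text \<open>Partial sums of the wavelet expansion are continuous and converge in \<open>L\<^sup>2\<close>, hence in \<open>L\<^sup>1\<close>.\<close>

lemma wavelet_sums_dense: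
  assumes basis: "boundary_wavelet_basis r \<phi> \<psi> j0 C \<Phi> \<Psi>" and r: "0 < r" and f: "f \<in> L2_01" and d: "0 < \<delta>"
  shows "\<exists>g. g \<in> borel_measurable borel \<and> continuous_on {0..1} g \<and>
        (\<integral>\<^sup>+y. ennreal (indicator {0..<1} y * \<bar>cut01 f y - g y\<bar>) \<partial>lborel) \<le> ennreal \<delta>"
proof -
  interpret orthonormal_family "wave \<Phi> \<Psi>" "wave_index C j0" by (rule wavelet_orthonormal_family[OF basis r])
  define A where "A = (\<integral>x. (cut01 f x)\<^sup>2 \<partial>lborel)"
  define \<theta> where "\<theta> i = inner01 f (wave \<Phi> \<Psi> i)" for i
  have lim: "(\<lambda>L. \<Sum>i\<in>wave_index_below C j0 L. (\<theta> i)\<^sup>2) \<longlonglongrightarrow> A"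
    unfolding A_def \<theta>_def by (rule wavelet_parseval[OF basis r f])
  have "eventually (\<lambda>L. A - \<delta>\<^sup>2 < (\<Sum>i\<in>wave_index_below C j0 L. (\<theta> i)\<^sup>2)) sequentially"
    using d by (intro order_tendstoD(1)[OF lim]) simp
  then obtain L where L: "A - \<delta>\<^sup>2 < (\<Sum>i\<in>wave_index_below C j0 L. (\<theta> i)\<^sup>2)"
    by (auto dest: eventually_happens)
  define K where "K = wave_index_below C j0 L"
  have K: "K \<subseteq> wave_index C j0" "finite K" unfolding K_def by (rule wave_index_below)+
  define g where "g x = (\<Sum>i\<in>K. \<theta> i * cut01 (wave \<Phi> \<Psi> i) x)" for x
  have g: "sq_int g" unfolding g_def by (rule combination_sq[OF K(1)])
  have fs: "sq_int (cut01 f)" using f by (simp add: L2_01_iff)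
  have "continuous_on {0..1} (wave \<Phi> \<Psi> i)" if "i \<in> K" for i
    using that K(1) basis_continuous[OF basis r] by (auto simp: wave_index_def wave_def)
  then have "continuous_on {0..1} (\<lambda>x. \<Sum>i\<in>K. \<theta> i * wave \<Phi> \<Psi> i x)" by (intro continuous_on_sum continuous_on_mult_left)
  then have c: "continuous_on {0..1} g"
    by (rule continuous_on_eq) (auto simp: g_def cut01_def)
  have "(\<integral>x. (cut01 f x - g x)\<^sup>2 \<partial>lborel) = A - (\<Sum>i\<in>K. (\<theta> i)\<^sup>2)"
    unfolding g_def distance_to_combination[OF K f] by (simp add: A_def \<theta>_def)
  also have "\<dots> \<le> \<delta>\<^sup>2" using L by (simp add: K_def)
  finally have "sqrt (\<integral>x. (cut01 f x - g x)\<^sup>2 \<partial>lborel) \<le> \<delta>" using d by (intro real_le_lsqrt) auto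
  then have "(\<integral>\<^sup>+y. ennreal (indicator {0..<1} y * \<bar>cut01 f y - g y\<bar>) \<partial>lborel) \<le> ennreal \<delta>"
    by (intro order_trans[OF L1_le_L2_on_unit_interval[OF sq_int_diff[OF fs g]]] ennreal_leI)
  moreover have "g \<in> borel_measurable borel" using sq_intD[OF g] by simp
  ultimately show ?thesis using c by blast
qed

lemma coeff_index_sum_split:
  fixes F :: "nat \<times> nat \<Rightarrow> real"
  assumes "J \<le> L" "j0 \<le> J"
  shows "(\<Sum>i\<in>coeff_index j0 L. F i) = (\<Sum>i\<in>coeff_index j0 J. F i) + (\<Sum>j=J..<L. \<Sum>k<2 ^ j. F (j, k))"
proof -
  define T where "T = (SIGMA j:{J..<L}. {..<(2::nat) ^ j})"
  have "coeff_index j0 L = coeff_index j0 J \<union> T" using assms by (auto simp: coeff_index_def T_def)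
  moreover have "finite (coeff_index j0 J)" "finite T" "coeff_index j0 J \<inter> T = {}"
    by (auto simp: coeff_index_def T_def)
  ultimately have "(\<Sum>i\<in>coeff_index j0 L. F i) = (\<Sum>i\<in>coeff_index j0 J. F i) + (\<Sum>i\<in>T. F i)"
    using sum.union_disjoint[of "coeff_index j0 J" T F] by simp
  moreover have "(\<Sum>j=J..<L. \<Sum>k<2 ^ j. F (j, k)) = (\<Sum>i\<in>T. F i)"
    unfolding T_def by (subst sum.Sigma) (auto simp: split_def)
  ultimately show ?thesis by simp
qed

text \<open>Parseval's identity turns the integrated loss into the error of the estimated coefficients plus the energy of the levels
from \<open>J\<close> on, which the estimator sets to zero.\<close>

lemma wavelet_loss_le:
  assumes basis: "boundary_wavelet_basis r \<phi> \<psi> j0 C \<Phi> \<Psi>" and r: "0 < r" and f: "f \<in> L2_01" and J: "j0 \<le> J"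
    and tail: "\<And>L. (\<Sum>j=J..<L. \<Sum>k<2 ^ j. (inner01 f (\<Psi> j k))\<^sup>2) \<le> T"
  shows "L2_loss (wavelet_estimate j0 C J \<Phi> \<Psi> y0 y x) f
    \<le> ennreal ((\<Sum>k<C. (y0 k - inner01 f (\<Phi> k))\<^sup>2)
      + (\<Sum>i\<in>coeff_index j0 J. ((if x i = 1 then y (fst i) (snd i) else 0) - inner01 f (\<Psi> (fst i) (snd i)))\<^sup>2) + T)"
proof -
  interpret orthonormal_family "wave \<Phi> \<Psi>" "wave_index C j0" by (rule wavelet_orthonormal_family[OF basis r])
  define A where "A = (\<integral>x. (cut01 f x)\<^sup>2 \<partial>lborel)"
  define \<theta> where "\<theta> i = inner01 f (wave \<Phi> \<Psi> i)" for i
  define K where "K = wave_index_below C j0 J"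
  have K: "K \<subseteq> wave_index C j0" "finite K" unfolding K_def by (rule wave_index_below)+
  define c where "c i = (case i of Inl k \<Rightarrow> y0 k | Inr jk \<Rightarrow> if x jk = 1 then y (fst jk) (snd jk) else 0)" for i
  define g where "g x = (\<Sum>i\<in>K. c i * cut01 (wave \<Phi> \<Psi> i) x)" for x
  have g: "sq_int g" unfolding g_def by (rule combination_sq[OF K(1)])
  have fs: "sq_int (cut01 f)" using f by (simp add: L2_01_iff)
  have est: "wavelet_estimate j0 C J \<Phi> \<Psi> y0 y x t = (\<Sum>i\<in>K. c i * wave \<Phi> \<Psi> i t)" for t
    unfolding wavelet_estimate_def K_def sum_wave_index_below
    unfolding coeff_index_def by (subst sum.Sigma) (auto simp: c_def wave_def split_def)
  have "indicator {0..1} t * ennreal ((wavelet_estimate j0 C J \<Phi> \<Psi> y0 y x t - f t)\<^sup>2) = ennreal ((cut01 f t - g t)\<^sup>2)" for t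
    unfolding est g_def cut01_wave_combination by (simp add: cut01_def indicator_def power2_commute)
  then have "L2_loss (wavelet_estimate j0 C J \<Phi> \<Psi> y0 y x) f = (\<integral>\<^sup>+t. ennreal ((cut01 f t - g t)\<^sup>2) \<partial>lborel)"
    by (simp add: L2_loss_def mult.commute)
  also have "\<dots> = ennreal (\<integral>t. (cut01 f t - g t)\<^sup>2 \<partial>lborel)" by (rule nn_integral_square_eq[OF sq_int_diff[OF fs g]])
  also have "(\<integral>t. (cut01 f t - g t)\<^sup>2 \<partial>lborel) = A - (\<Sum>i\<in>K. (\<theta> i)\<^sup>2) + (\<Sum>i\<in>K. (c i - \<theta> i)\<^sup>2)"
    unfolding g_def distance_to_combination[OF K f] by (simp add: A_def \<theta>_def)
  finally have eq: "L2_loss (wavelet_estimate j0 C J \<Phi> \<Psi> y0 y x) f = ennreal (A - (\<Sum>i\<in>K. (\<theta> i)\<^sup>2) + (\<Sum>i\<in>K. (c i - \<theta> i)\<^sup>2))" .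
  have lim: "(\<lambda>L. \<Sum>i\<in>wave_index_below C j0 L. (\<theta> i)\<^sup>2) \<longlonglongrightarrow> A"
    unfolding A_def \<theta>_def by (rule wavelet_parseval[OF basis r f])
  have "A \<le> (\<Sum>i\<in>K. (\<theta> i)\<^sup>2) + T"
  proof (rule LIMSEQ_le_const2[OF lim], intro exI[of _ J] allI impI)
    fix L assume L: "J \<le> L"
    show "(\<Sum>i\<in>wave_index_below C j0 L. (\<theta> i)\<^sup>2) \<le> (\<Sum>i\<in>K. (\<theta> i)\<^sup>2) + T"
      using tail[of L] unfolding K_def sum_wave_index_below coeff_index_sum_split[OF L J] by (simp add: \<theta>_def wave_def)
  qed
  moreover have "(\<Sum>i\<in>K. (c i - \<theta> i)\<^sup>2) = (\<Sum>k<C. (y0 k - inner01 f (\<Phi> k))\<^sup>2)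
      + (\<Sum>i\<in>coeff_index j0 J. ((if x i = 1 then y (fst i) (snd i) else 0) - inner01 f (\<Psi> (fst i) (snd i)))\<^sup>2)"
    unfolding K_def sum_wave_index_below by (simp add: c_def \<theta>_def wave_def)
  ultimately show ?thesis unfolding eq by (intro ennreal_leI) linarith
qed

lemma fin_diff_cut01:
  assumes "x \<in> {0..1 - real m * h}" "0 \<le> h"
  shows "fin_diff m h (cut01 f) x = fin_diff m h f x"
  unfolding fin_diff_def
proof (intro sum.cong refl)
  fix i assume "i \<in> {..m}"
  then have "real i * h \<le> real m * h" using assms by (intro mult_right_mono) auto
  then have "x + real i * h \<in> {0..1}" using assms by auto
  then show "(-1) ^ (m - i) * real (m choose i) * cut01 f (x + real i * h) = (-1) ^ (m - i) * real (m choose i) * f (x + real i * h)"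
    by (simp add: cut01_def)
qed

lemma inner01_half_open:
  assumes "f \<in> L2_01" "g \<in> L2_01"
  shows "(\<integral>y. indicator {0..<1} y * (cut01 f y * cut01 g y) \<partial>lborel) = inner01 f g"
proof -
  have m: "(\<lambda>y. cut01 f y * cut01 g y) \<in> borel_measurable borel"
    using assms[unfolded L2_01_iff sq_int_def] by (intro borel_measurable_times) simp_all
  have e: "cut01 (\<lambda>y. f y * g y) = (\<lambda>y. cut01 f y * cut01 g y)" by (auto simp: cut01_def indicator_def)
  have "(\<integral>y. indicator {0..<1} y * (cut01 f y * cut01 g y) \<partial>lborel) = (\<integral>y. indicator {0..<1} y * (f y * g y) \<partial>lborel)"
    by (intro Bochner_Integration.integral_cong) (auto simp: cut01_def indicator_def)
  also have "\<dots> = inner01 f g" unfolding inner01_def by (rule integral_half_open_eq) (simp only: e m)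
  finally show ?thesis .
qed

text \<open>The sup norm \<open>B * sqrt (2 ^ j)\<close> and the support length \<open>1 / 2 ^ j\<close> of a wavelet contribute the factor \<open>2 powr (- j / 2)\<close> to each
coefficient. The start level \<open>j1\<close> guarantees that a block of \<open>m\<close> nodes fits into the grid.\<close>

lemma besov_level_bound:
  assumes basis: "boundary_wavelet_basis r \<phi> \<psi> j0 C \<Phi> \<Psi>"
    and p: "0 < p" and q: "0 < q" and ps: "1 / p < ennreal s" and sr: "s < real r" and M: "0 < M"
  shows "\<exists>p' C1 j1. 0 < p' \<and> 1 / p' < s \<and> 0 \<le> C1 \<and> j0 \<le> j1 \<and> (\<forall>f\<in>besov_ball s p q M \<inter> L2_01. \<forall>j\<ge>j1.
     (\<Sum>k<2 ^ j. \<bar>inner01 f (\<Psi> j k)\<bar> powr p') \<le> C1 * 2 powr (- (real j * (p' * (s + 1 / 2 - 1 / p')))))"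
proof -
  define m where "m = nat \<lfloor>s\<rfloor> + 1"
  have "0 < ennreal s" using ps by (rule le_less_trans[OF zero_le])
  then have s: "0 < s" by (simp add: ennreal_less_zero_iff)
  have "\<lfloor>s\<rfloor> < int r" using sr by (simp add: floor_less_iff)
  moreover have "0 \<le> \<lfloor>s\<rfloor>" using s by simp
  ultimately have mr: "m \<le> r" unfolding m_def by linarith
  have m0: "0 < m" by (simp add: m_def)
  have r: "0 < r" using mr m0 by simp
  obtain p' M' where p': "0 < p'" "1 / p' < s" and M': "0 \<le> M'" and diff: "\<forall>f\<in>besov_ball s p q M. \<forall>h. 0 < h \<longrightarrow> h \<le> 1 / 2 \<longrightarrow>
     (\<integral>\<^sup>+x. indicator {0..1 - real m * h} x * ennreal (\<bar>fin_diff m h f x\<bar> powr p') \<partial>lborel) \<le> ennreal (M' * h powr (s * p'))"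
    using besov_difference_bound[OF p q ps M, folded m_def] by (elim exE conjE)
  obtain \<rho> :: nat and B c where B: "0 < B" and loc: "\<forall>j\<ge>j0. \<forall>k<2 ^ j. \<forall>x\<in>{0..1}. \<bar>\<Psi> j k x\<bar> \<le> B * sqrt (2 ^ j) \<and>
      (\<Psi> j k x \<noteq> 0 \<longrightarrow> \<bar>x - c j k\<bar> \<le> real \<rho> / 2 ^ j)"
    and ov: "\<forall>a::nat. \<exists>K. \<forall>j\<ge>j0. \<forall>x. card {k. k < 2 ^ j \<and> \<bar>x - c j k\<bar> \<le> real a / 2 ^ j} \<le> K"
    using wavelet_localization[OF basis r] by (elim exE conjE)
  obtain Kov where Kov: "\<forall>j\<ge>j0. \<forall>x. card {k. k < 2 ^ j \<and> \<bar>x - c j k\<bar> \<le> real (\<rho> + 2 * m) / 2 ^ j} \<le> Kov"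
    using ov[THEN spec, of "\<rho> + 2 * m"] by (elim exE)
  define j1 where "j1 = max j0 m"
  define G where "G = (B * refine_const m \<rho> * (2 * real \<rho>)) powr p'"
  define C1 where "C1 = 2 * 2 powr p' * G * (1 / (1 - 2 powr (- ((s - 1 / p') / 2)))) powr p'
       * (real Kov * M' / (1 - 2 powr (- ((s * p' - 1) / 2))))"
  have sp: "1 < s * p'" using p' by (simp add: field_simps)
  then have "2 powr (- ((s * p' - 1) / 2)) < 1" by (simp add: powr_less_one)
  then have C1: "0 \<le> C1" unfolding C1_def G_def using M' by (intro mult_nonneg_nonneg divide_nonneg_nonneg) auto
  have main: "(\<Sum>k<2 ^ j. \<bar>inner01 f (\<Psi> j k)\<bar> powr p') \<le> C1 * 2 powr (- (real j * (p' * (s + 1 / 2 - 1 / p'))))"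
    if f: "f \<in> besov_ball s p q M" "f \<in> L2_01" and j: "j1 \<le> j" for f j
  proof -
    have jj: "j0 \<le> j" "m \<le> j" "1 \<le> j" using j m0 by (auto simp: j1_def)
    have "m < 2 ^ m" by simp
    also have "(2::nat) ^ m \<le> 2 ^ j" using jj by (intro power_increasing) auto
    finally have m2: "m \<le> 2 ^ j" by simp
    define psi where "psi k = cut01 (\<Psi> j k)" for k
    have cont: "continuous_on {0..1} (\<Psi> j k)" if "k < 2 ^ j" for k by (rule basis_continuous(2)[OF basis r jj(1) that])
    have fs: "sq_int (cut01 f)" using f(2) by (simp add: L2_01_iff)
    have fm: "cut01 f \<in> borel_measurable borel" using sq_intD[OF fs] by simp
    have f1: "integrable lborel (\<lambda>y. indicator {0..<1} y * cut01 f y)"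
    proof -
      have "integrable lborel (\<lambda>y. indicator {0<..1} y * cut01 f y)" by (rule sq_int_mult[OF sq_int_indicator fs])
      moreover have "AE y in lborel. indicator {0<..1} y * cut01 f y = indicator {0..<1} y * cut01 f y"
        using AE_lborel_singleton[of "1::real"] AE_lborel_singleton[of "0::real"] by eventually_elim (auto simp: indicator_def)
      ultimately show ?thesis using fm by (subst integrable_cong_AE[symmetric]) auto
    qed
    have Bj: "0 < B * sqrt (2 ^ j)" using B by simp
    have bound: "(\<Sum>k<2 ^ j. \<bar>\<integral>y. indicator {0..<1} y * (cut01 f y * psi k y) \<partial>lborel\<bar> powr p')
      \<le> 2 * 2 powr p' * (B * sqrt (2 ^ j) * refine_const m \<rho> * (2 * real \<rho> / 2 ^ j)) powr p' * (1 / (1 - 2 powr (- ((s - 1 / p') / 2)))) powr p'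
       * (real Kov * M' * 2 powr (real j * (1 - s * p')) / (1 - 2 powr (- ((s * p' - 1) / 2))))"
    proof (rule level_power_sum_bound[where c = "c j" and \<rho> = \<rho>, OF m0 m2 p' fm _ f1 Bj])
      show "psi k \<in> borel_measurable borel" if "k < 2 ^ j" for k
        unfolding psi_def by (rule continuous_imp_L2_01(2)[OF cont[OF that]])
      show "\<bar>psi k y\<bar> \<le> B * sqrt (2 ^ j)" if "k < 2 ^ j" "0 \<le> y" "y < 1" for k y
        using loc[THEN spec, THEN mp, OF jj(1)] that by (auto simp: psi_def cut01_def)
      show "\<bar>y - c j k\<bar> \<le> real \<rho> / 2 ^ j" if "k < 2 ^ j" "0 \<le> y" "y < 1" "psi k y \<noteq> 0" for k y
        using loc[THEN spec, THEN mp, OF jj(1)] that by (auto simp: psi_def cut01_def)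
      show "(\<integral>y. indicator {0..<1} y * (poly P y * psi k y) \<partial>lborel) = 0" if "k < 2 ^ j" "degree P < m" for k P
      proof -
        have "(\<integral>y. indicator {0..<1} y * (poly P y * psi k y) \<partial>lborel) = (\<integral>y. indicator {0..<1} y * (poly P y * \<Psi> j k y) \<partial>lborel)"
          by (intro Bochner_Integration.integral_cong) (auto simp: psi_def cut01_def indicator_def)
        also have "\<dots> = 0" using that mr by (intro wavelet_vanishing_moments[OF basis jj(1)]) auto
        finally show ?thesis .
      qed
      show "\<exists>g. g \<in> borel_measurable borel \<and> continuous_on {0..1} g \<and>
        (\<integral>\<^sup>+y. ennreal (indicator {0..<1} y * \<bar>cut01 f y - g y\<bar>) \<partial>lborel) \<le> ennreal \<delta>" if "0 < \<delta>" for \<delta>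
        by (rule wavelet_sums_dense[OF basis r f(2) that])
      show "card {k. k < 2 ^ j \<and> \<bar>x - c j k\<bar> \<le> real (\<rho> + 2 * m) / 2 ^ j} \<le> Kov" for x
        using Kov jj(1) by blast
      show "0 \<le> M'" by (rule M')
      show "(\<integral>\<^sup>+x. indicator {0..1 - real m / 2 ^ l} x * ennreal (\<bar>fin_diff m (1 / 2 ^ l) (cut01 f) x\<bar> powr p') \<partial>lborel)
        \<le> ennreal (M' * 2 powr (- real l * s * p'))" if l: "j \<le> l" for l
      proof -
        define h :: real where "h = 1 / 2 ^ l"
        have "(2::real) ^ 1 \<le> 2 ^ l" using l jj by (intro power_increasing) auto
        then have h: "0 < h" "h \<le> 1 / 2" by (auto simp: h_def field_simps)
        have hp: "h powr (s * p') = 2 powr (- real l * s * p')"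
        proof -
          have "h = 2 powr (- real l)" by (simp add: h_def powr_minus_divide powr_realpow)
          then show ?thesis by (simp add: powr_powr mult.assoc)
        qed
        have mh: "real m / 2 ^ l = real m * h" by (simp add: h_def)
        have "(\<integral>\<^sup>+x. indicator {0..1 - real m * h} x * ennreal (\<bar>fin_diff m h (cut01 f) x\<bar> powr p') \<partial>lborel)
          = (\<integral>\<^sup>+x. indicator {0..1 - real m * h} x * ennreal (\<bar>fin_diff m h f x\<bar> powr p') \<partial>lborel)"
        proof (intro nn_integral_cong)
          fix x :: real
          show "indicator {0..1 - real m * h} x * ennreal (\<bar>fin_diff m h (cut01 f) x\<bar> powr p')
            = indicator {0..1 - real m * h} x * ennreal (\<bar>fin_diff m h f x\<bar> powr p')"
            using fin_diff_cut01[of x m h f] h(1) by (cases "x \<in> {0..1 - real m * h}") auto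
        qed
        also have "\<dots> \<le> ennreal (M' * h powr (s * p'))" using diff f(1) h by blast
        finally show ?thesis unfolding hp mh unfolding h_def .
      qed
    qed
    also have "(B * sqrt (2 ^ j) * refine_const m \<rho> * (2 * real \<rho> / 2 ^ j)) powr p' = G * 2 powr (- (real j * (p' / 2)))"
    proof -
      have "sqrt (2 ^ j) / 2 ^ j = 2 powr (- (real j / 2))"
        by (simp add: powr_realpow[symmetric] powr_half_sqrt[symmetric] powr_powr powr_diff[symmetric])
      moreover have "B * sqrt (2 ^ j) * refine_const m \<rho> * (2 * real \<rho> / 2 ^ j) = (B * refine_const m \<rho> * (2 * real \<rho>)) * (sqrt (2 ^ j) / 2 ^ j)"
        by simp
      ultimately show ?thesis by (simp add: G_def powr_mult powr_powr)
    qed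
    also have "2 * 2 powr p' * (G * 2 powr (- (real j * (p' / 2)))) * (1 / (1 - 2 powr (- ((s - 1 / p') / 2)))) powr p'
       * (real Kov * M' * 2 powr (real j * (1 - s * p')) / (1 - 2 powr (- ((s * p' - 1) / 2))))
      = C1 * (2 powr (- (real j * (p' / 2))) * 2 powr (real j * (1 - s * p')))"
      by (simp add: C1_def)
    also have "2 powr (- (real j * (p' / 2))) * 2 powr (real j * (1 - s * p')) = 2 powr (- (real j * (p' * (s + 1 / 2 - 1 / p'))))"
    proof -
      have "p' * (s + 1 / 2 - 1 / p') = p' / 2 - (1 - s * p')" using p' by (simp add: algebra_simps)
      then show ?thesis by (simp add: powr_add[symmetric] algebra_simps)
    qed
    also have "(\<Sum>k<2 ^ j. \<bar>\<integral>y. indicator {0..<1} y * (cut01 f y * psi k y) \<partial>lborel\<bar> powr p') = (\<Sum>k<2 ^ j. \<bar>inner01 f (\<Psi> j k)\<bar> powr p')"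
      unfolding psi_def using f(2) by (intro sum.cong refl) (simp add: inner01_half_open continuous_imp_L2_01(1)[OF cont])
    finally show ?thesis .
  qed
  have "j0 \<le> j1" by (simp add: j1_def)
  show ?thesis
  proof (intro exI conjI)
    show "\<forall>f\<in>besov_ball s p q M \<inter> L2_01. \<forall>j\<ge>j1.
     (\<Sum>k<2 ^ j. \<bar>inner01 f (\<Psi> j k)\<bar> powr p') \<le> C1 * 2 powr (- (real j * (p' * (s + 1 / 2 - 1 / p'))))"
      using main by blast
  qed (fact p' C1 \<open>j0 \<le> j1\<close>)+
qed

text \<open>There are only \<open>2 ^ j\<close> coefficients at level \<open>j\<close>, so those of size at most \<open>T = 2 powr (- j * (s + 1/2))\<close> have energy at most
\<open>2 powr (- 2 * j * s)\<close>; for the larger ones \<open>t\<^sup>2 \<le> t powr p * T powr (2 - p)\<close>.\<close>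

lemma power_sum_large_exponent:
  fixes \<theta> :: "nat \<Rightarrow> real"
  assumes p: "2 < p" and C1: "0 \<le> C1"
    and bd: "(\<Sum>k<2 ^ j. \<bar>\<theta> k\<bar> powr p) \<le> C1 * 2 powr (- (real j * (p * (s + 1 / 2 - 1 / p))))"
  shows "(\<Sum>k<2 ^ j. \<bar>\<theta> k\<bar> powr 2) \<le> (1 + C1) * 2 powr (- (real j * (2 * s)))"
proof -
  define T where "T = 2 powr (- (real j * (s + 1 / 2)))"
  have T: "0 < T" by (simp add: T_def)
  have each: "t powr 2 \<le> T powr 2 + t powr p * T powr (2 - p)" if t: "0 \<le> t" for t
  proof (cases "t \<le> T")
    case True
    then have "t powr 2 \<le> T powr 2" using t by (intro powr_mono2) auto
    then show ?thesis by (simp add: add_increasing2)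
  next
    case False
    then have "t powr (2 - p) \<le> T powr (2 - p)" using p T by (intro powr_mono2') auto
    then have "t powr p * t powr (2 - p) \<le> t powr p * T powr (2 - p)" by (intro mult_left_mono) auto
    then have "t powr 2 \<le> t powr p * T powr (2 - p)" by (simp add: powr_add[symmetric])
    also have "\<dots> \<le> T powr 2 + t powr p * T powr (2 - p)" by simp
    finally show ?thesis .
  qed
  have "(\<Sum>k<2 ^ j. \<bar>\<theta> k\<bar> powr 2) \<le> (\<Sum>k<(2::nat) ^ j. T powr 2 + \<bar>\<theta> k\<bar> powr p * T powr (2 - p))"
    by (intro sum_mono each) auto
  also have "\<dots> = 2 ^ j * T powr 2 + (\<Sum>k<2 ^ j. \<bar>\<theta> k\<bar> powr p) * T powr (2 - p)"
    by (simp add: sum.distrib sum_distrib_right)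
  also have "\<dots> \<le> 2 ^ j * T powr 2 + C1 * 2 powr (- (real j * (p * (s + 1 / 2 - 1 / p)))) * T powr (2 - p)"
    by (intro add_left_mono mult_right_mono bd) auto
  also have "2 ^ j * T powr 2 = 2 powr (- (real j * (2 * s)))"
    by (simp add: T_def powr_realpow[symmetric] powr_powr powr_add[symmetric] algebra_simps)
  also have "C1 * 2 powr (- (real j * (p * (s + 1 / 2 - 1 / p)))) * T powr (2 - p) = C1 * 2 powr (- (real j * (2 * s)))"
  proof -
    have "- (real j * (p * (s + 1 / 2 - 1 / p))) + - (real j * (s + 1 / 2)) * (2 - p) = - (real j * (2 * s))"
      using p by (simp add: field_simps)
    then have "2 powr (- (real j * (p * (s + 1 / 2 - 1 / p)))) * T powr (2 - p) = 2 powr (- (real j * (2 * s)))"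
      unfolding T_def powr_powr powr_add[symmetric] by (rule arg_cong)
    then show ?thesis by (simp add: mult.assoc)
  qed
  finally show ?thesis by (simp add: distrib_right)
qed

text \<open>Exponents above 2 are reduced to 2, where the smoothness index \<open>\<alpha>\<close> becomes \<open>s\<close>. For smaller exponents \<open>1 / \<rho> < s\<close> gives
\<open>\<alpha> > 1 / 2\<close>, so that \<open>2 * \<alpha>\<close> exceeds the exponent of the rate in either case.\<close>

lemma besov_coefficient_bound:
  assumes basis: "boundary_wavelet_basis r \<phi> \<psi> j0 C \<Phi> \<Psi>"
    and p: "0 < p" and q: "0 < q" and ps: "1 / p < ennreal s" and sr: "s < real r" and M: "0 < M"
  shows "\<exists>\<rho> \<alpha> C1 j1. 0 < \<rho> \<and> \<rho> \<le> 2 \<and> \<alpha> = s + 1 / 2 - 1 / \<rho> \<and> 0 < \<alpha> \<and> 2 * s / (2 * s + 1) \<le> 2 * \<alpha> \<and> 0 \<le> C1 \<and> j0 \<le> j1 \<and>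
    (\<forall>f\<in>besov_ball s p q M \<inter> L2_01. \<forall>j\<ge>j1.
     (\<Sum>k<2 ^ j. \<bar>inner01 f (\<Psi> j k)\<bar> powr \<rho>) \<le> C1 * 2 powr (- (real j * (\<rho> * \<alpha>))))"
proof -
  have "0 < ennreal s" using ps by (rule le_less_trans[OF zero_le])
  then have s: "0 < s" by (simp add: ennreal_less_zero_iff)
  have frac: "2 * s / (2 * s + 1) \<le> 1" "2 * s / (2 * s + 1) \<le> 2 * s" using s by (auto simp: divide_le_eq)
  obtain p' C1 j1 where p': "0 < p'" "1 / p' < s" and C1: "0 \<le> C1" "j0 \<le> j1" and bd: "\<forall>f\<in>besov_ball s p q M \<inter> L2_01. \<forall>j\<ge>j1.
     (\<Sum>k<2 ^ j. \<bar>inner01 f (\<Psi> j k)\<bar> powr p') \<le> C1 * 2 powr (- (real j * (p' * (s + 1 / 2 - 1 / p'))))"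
    using besov_level_bound[OF assms] by (elim exE conjE)
  show ?thesis
  proof (cases "p' \<le> 2")
    case True
    then have "0 < s + 1 / 2 - 1 / p'" "2 * s / (2 * s + 1) \<le> 2 * (s + 1 / 2 - 1 / p')" using p'(2) frac by auto
    then show ?thesis using p' True C1 bd by (intro exI[of _ p'] exI[of _ "s + 1 / 2 - 1 / p'"] exI[of _ C1] exI[of _ j1]) blast
  next
    case False
    have "(\<Sum>k<2 ^ j. \<bar>inner01 f (\<Psi> j k)\<bar> powr 2) \<le> (1 + C1) * 2 powr (- (real j * (2 * s)))"
      if "f \<in> besov_ball s p q M \<inter> L2_01" "j1 \<le> j" for f j
      using bd that False C1 by (intro power_sum_large_exponent[where p = p']) auto
    then show ?thesis using s frac C1
      by (intro exI[of _ "2::real"] exI[of _ s] exI[of _ "1 + C1"] exI[of _ j1]) auto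
  qed
qed

section \<open>The maximum a posteriori rule as penalized maximization\<close>
text \<open>The negative logarithm of the prior probability of one configuration with \<open>k\<close> non-zero coefficients.\<close>

definition prior_penalty :: "nat \<Rightarrow> nat \<Rightarrow> nat pmf \<Rightarrow> nat \<Rightarrow> real" where
  "prior_penalty j0 J \<pi> k = ln (real ((2 ^ J - 2 ^ j0) choose k)) - ln (pmf \<pi> k)"

text \<open>The logarithm of the inverse Bayes factor of a coefficient.\<close>

definition gain :: "real \<Rightarrow> nat \<Rightarrow> real \<Rightarrow> real \<Rightarrow> real" where
  "gain \<sigma> n g y = shrinkage g / 2 * (sqrt n / \<sigma> * y)\<^sup>2 - ln (1 + g) / 2"

lemma card_coeff_index:
  assumes "j0 \<le> J" shows "card (coeff_index j0 J) = 2 ^ J - 2 ^ j0"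
proof -
  have "card (coeff_index j0 J) = (\<Sum>j=j0..<J. 2 ^ j)" by (simp add: coeff_index_def)
  also have "(\<Sum>j=j0..<J. 2 ^ j) + 2 ^ j0 = (2::nat) ^ J" using assms
    by (induction J rule: dec_induct) auto
  then have "(\<Sum>j=j0..<J. (2::nat) ^ j) = 2 ^ J - 2 ^ j0" by simp
  finally show ?thesis .
qed

lemma inverse_bayes_factor:
  assumes "0 < g" "0 < \<sigma>" shows "inverse (bayes_factor \<sigma> n g y) = exp (gain \<sigma> n g y)"
proof -
  have e: "real n * y\<^sup>2 / (2 * \<sigma>\<^sup>2 * (1 + 1 / g)) = shrinkage g / 2 * (sqrt n / \<sigma> * y)\<^sup>2"
    using assms by (simp add: shrinkage_def power_mult_distrib power_divide field_simps)
  have s: "sqrt (1 + g) = exp (ln (1 + g) / 2)" using assms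
    by (simp add: powr_half_sqrt[symmetric] powr_def)
  show ?thesis unfolding bayes_factor_def gain_def e s
    by (simp add: exp_minus[symmetric] exp_add[symmetric] exp_diff field_simps)
qed

lemma posterior_weight_eq_exp:
  assumes x: "x \<in> indicator_vectors j0 J" and J: "j0 \<le> J" and \<sigma>: "0 < \<sigma>"
    and \<gamma>: "\<forall>j\<in>{j0..<J}. 0 < \<gamma> j" and supp: "set_pmf \<pi> = {0..2 ^ J - 2 ^ j0}"
    and S: "S = {i \<in> coeff_index j0 J. x i = 1}"
  shows "posterior_weight \<sigma> j0 J \<gamma> \<pi> y x
    = exp ((\<Sum>i\<in>S. gain \<sigma> (2 ^ J) (\<gamma> (fst i)) (y (fst i) (snd i))) - prior_penalty j0 J \<pi> (card S))"
proof -
  define U where "U = coeff_index j0 J"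
  have U: "finite U" by (simp add: U_def coeff_index_def)
  have SU: "S \<subseteq> U" by (auto simp: S U_def)
  have fS: "finite S" using SU U by (rule finite_subset)
  have x01: "x i = 0 \<or> x i = 1" if "i \<in> U" for i using PiE_mem[OF x[unfolded indicator_vectors_def U_def[symmetric]] that] by simp
  have k: "(\<Sum>i\<in>U. x i) = card S"
  proof -
    have "(\<Sum>i\<in>U. x i) = (\<Sum>i\<in>U. if x i = 1 then 1 else 0)" using x01 by (intro sum.cong) auto
    also have "\<dots> = card S" using U by (simp add: sum.If_cases S U_def Int_def)
    finally show ?thesis .
  qed
  have le: "card S \<le> 2 ^ J - 2 ^ j0" using card_mono[OF U SU] card_coeff_index[OF J] by (simp add: U_def)
  then have pos: "0 < real ((2 ^ J - 2 ^ j0) choose card S)" "0 < pmf \<pi> (card S)"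
    using supp by (auto simp: pmf_positive_iff)
  have pen: "inverse (real ((2 ^ J - 2 ^ j0) choose card S)) * pmf \<pi> (card S) = exp (- prior_penalty j0 J \<pi> (card S))"
    using pos by (simp add: prior_penalty_def exp_diff field_simps)
  have "(\<Prod>(j, k)\<in>U. inverse (bayes_factor \<sigma> (2 ^ J) (\<gamma> j) (y j k)) ^ x (j, k))
    = (\<Prod>i\<in>U. if x i = 1 then exp (gain \<sigma> (2 ^ J) (\<gamma> (fst i)) (y (fst i) (snd i))) else 1)"
  proof (intro prod.cong refl)
    fix i assume i: "i \<in> U"
    then have "0 < \<gamma> (fst i)" using \<gamma> by (auto simp: U_def coeff_index_def)
    then show "(case i of (j, k) \<Rightarrow> inverse (bayes_factor \<sigma> (2 ^ J) (\<gamma> j) (y j k)) ^ x (j, k))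
      = (if x i = 1 then exp (gain \<sigma> (2 ^ J) (\<gamma> (fst i)) (y (fst i) (snd i))) else 1)"
      using x01[OF i] inverse_bayes_factor[OF _ \<sigma>, of "\<gamma> (fst i)"] by (cases i) auto
  qed
  also have "\<dots> = (\<Prod>i\<in>S. exp (gain \<sigma> (2 ^ J) (\<gamma> (fst i)) (y (fst i) (snd i))))"
    using U by (simp add: prod.If_cases S U_def Int_def)
  also have "\<dots> = exp (\<Sum>i\<in>S. gain \<sigma> (2 ^ J) (\<gamma> (fst i)) (y (fst i) (snd i)))" using fS by (simp add: exp_sum)
  finally have pr: "(\<Prod>(j, k)\<in>U. inverse (bayes_factor \<sigma> (2 ^ J) (\<gamma> j) (y j k)) ^ x (j, k))
    = exp (\<Sum>i\<in>S. gain \<sigma> (2 ^ J) (\<gamma> (fst i)) (y (fst i) (snd i)))" .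
  have "posterior_weight \<sigma> j0 J \<gamma> \<pi> y x = (inverse (real ((2 ^ J - 2 ^ j0) choose card S)) * pmf \<pi> (card S))
      * (\<Prod>(j, k)\<in>U. inverse (bayes_factor \<sigma> (2 ^ J) (\<gamma> j) (y j k)) ^ x (j, k))"
    unfolding posterior_weight_def Let_def U_def[symmetric] k ..
  also have "\<dots> = exp ((\<Sum>i\<in>S. gain \<sigma> (2 ^ J) (\<gamma> (fst i)) (y (fst i) (snd i))) - prior_penalty j0 J \<pi> (card S))"
    unfolding pen pr exp_add[symmetric] by simp
  finally show ?thesis .
qed

lemma MAP_maximizes_penalized_gain:
  assumes map: "is_MAP \<sigma> j0 J \<gamma> \<pi> y x" and J: "j0 \<le> J" and \<sigma>: "0 < \<sigma>"
    and \<gamma>: "\<forall>j\<in>{j0..<J}. 0 < \<gamma> j" and supp: "set_pmf \<pi> = {0..2 ^ J - 2 ^ j0}"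
    and A: "A \<subseteq> coeff_index j0 J" and S: "S = {i \<in> coeff_index j0 J. x i = 1}"
  shows "(\<Sum>i\<in>A. gain \<sigma> (2 ^ J) (\<gamma> (fst i)) (y (fst i) (snd i))) - prior_penalty j0 J \<pi> (card A)
    \<le> (\<Sum>i\<in>S. gain \<sigma> (2 ^ J) (\<gamma> (fst i)) (y (fst i) (snd i))) - prior_penalty j0 J \<pi> (card S)"
proof -
  (* the competitor A as an admissible indicator vector *)
  define xA where "xA = restrict (\<lambda>i. if i \<in> A then 1 else (0::nat)) (coeff_index j0 J)"
  have xA: "xA \<in> indicator_vectors j0 J" by (auto simp: xA_def indicator_vectors_def)
  have SA: "A = {i \<in> coeff_index j0 J. xA i = 1}" using A by (auto simp: xA_def)
  have x: "x \<in> indicator_vectors j0 J" using map by (simp add: is_MAP_def)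
  have w: "0 < posterior_weight \<sigma> j0 J \<gamma> \<pi> y x'" if "x' \<in> indicator_vectors j0 J" for x'
    unfolding posterior_weight_eq_exp[OF that J \<sigma> \<gamma> supp refl] by simp
  define D where "D = (\<Sum>x'\<in>indicator_vectors j0 J. posterior_weight \<sigma> j0 J \<gamma> \<pi> y x')"
  have "finite (indicator_vectors j0 J)" unfolding indicator_vectors_def by (intro finite_PiE) (auto simp: coeff_index_def)
  then have D: "0 < D" unfolding D_def using w x by (intro sum_pos) auto
  have "posterior_prob \<sigma> j0 J \<gamma> \<pi> y xA \<le> posterior_prob \<sigma> j0 J \<gamma> \<pi> y x" using map xA by (simp add: is_MAP_def)
  then have "posterior_weight \<sigma> j0 J \<gamma> \<pi> y xA \<le> posterior_weight \<sigma> j0 J \<gamma> \<pi> y x"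
    unfolding posterior_prob_def D_def[symmetric] using D by (simp add: divide_le_cancel)
  then show ?thesis
    unfolding posterior_weight_eq_exp[OF xA J \<sigma> \<gamma> supp SA] posterior_weight_eq_exp[OF x J \<sigma> \<gamma> supp S] by simp
qed

lemma prior_penalty_lower:
  assumes "k \<le> 2 ^ J - 2 ^ j0" "set_pmf \<pi> = {0..2 ^ J - 2 ^ j0}"
  shows "ln (real ((2 ^ J - 2 ^ j0) choose k)) \<le> prior_penalty j0 J \<pi> k" "0 \<le> prior_penalty j0 J \<pi> k"
proof -
  have "0 < pmf \<pi> k" using assms by (auto simp: pmf_positive_iff)
  then have "ln (pmf \<pi> k) \<le> 0" using pmf_le_1[of \<pi> k] by simp
  then show 1: "ln (real ((2 ^ J - 2 ^ j0) choose k)) \<le> prior_penalty j0 J \<pi> k" by (simp add: prior_penalty_def)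
  have "1 \<le> (2 ^ J - 2 ^ j0) choose k" using assms(1) by (simp add: Suc_le_eq)
  then have "0 \<le> ln (real ((2 ^ J - 2 ^ j0) choose k))" by simp
  then show "0 \<le> prior_penalty j0 J \<pi> k" using 1 by linarith
qed

text \<open>Both the combinatorial term and the lower bound on the prior cost at most a multiple of \<open>ln n\<close> per selected coefficient.\<close>

lemma prior_penalty_upper:
  assumes k: "1 \<le> k" "k \<le> 2 ^ J - 2 ^ j0" and c: "0 \<le> c" and low: "(real k / 2 ^ J) powr (c * real k) \<le> pmf \<pi> k"
  shows "prior_penalty j0 J \<pi> k \<le> (1 + c) * (real k * ln (2 ^ J))"
proof -
  define N where "N = (2::nat) ^ J - 2 ^ j0"
  have "N choose k \<le> N ^ k" by (rule binomial_le_pow) (use k in \<open>simp add: N_def\<close>)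
  also have "N ^ k \<le> (2 ^ J) ^ k" by (intro power_mono) (auto simp: N_def)
  finally have le: "N choose k \<le> (2 ^ J) ^ k" .
  have "real (N choose k) \<le> real ((2 ^ J) ^ k)" using le by (rule of_nat_mono)
  then have le': "real (N choose k) \<le> ((2::real) ^ J) ^ k" by simp
  have "0 < N choose k" using k by (simp add: N_def)
  then have "ln (real (N choose k)) \<le> ln (((2::real) ^ J) ^ k)" using le' by (intro ln_mono) auto
  also have "\<dots> = real k * ln (2 ^ J)" by (rule ln_realpow)
  finally have 1: "ln (real (N choose k)) \<le> real k * ln (2 ^ J)" .
  have pos: "0 < real k / 2 ^ J" using k by simp
  have pp: "0 < (real k / 2 ^ J) powr (c * real k)" using k by simp
  have "ln ((real k / 2 ^ J) powr (c * real k)) \<le> ln (pmf \<pi> k)" using low pp by (intro ln_mono) auto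
  moreover have "ln ((real k / 2 ^ J) powr (c * real k)) = c * real k * ln (real k / 2 ^ J)" using k by (simp add: ln_powr)
  moreover have "ln (real k / 2 ^ J) = ln (real k) - ln (2 ^ J)" using k by (simp add: ln_div)
  moreover have "c * real k * (- ln (2 ^ J)) \<le> c * real k * (ln (real k) - ln (2 ^ J))"
    using k c by (intro mult_left_mono) auto
  ultimately have "- ln (pmf \<pi> k) \<le> c * real k * ln (2 ^ J)" by simp
  then show ?thesis using 1 by (simp add: prior_penalty_def N_def algebra_simps)
qed

text \<open>In the risk bound \<open>Z k\<close> is the error of a scaling coefficient, which is kept unthresholded, and \<open>X\<close> the majorant for the wavelets.\<close>

lemma nn_integral_affine_le:
  assumes P: "prob_space P" and K: "finite K" and Z[measurable]: "\<And>k. k \<in> K \<Longrightarrow> Z k \<in> borel_measurable P"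
    and X[measurable]: "X \<in> borel_measurable P" and nn: "0 \<le> a" "0 \<le> T" "\<And>w. 0 \<le> X w" "0 \<le> b" "0 \<le> x"
    and Zb: "\<And>k. k \<in> K \<Longrightarrow> (\<integral>\<^sup>+w. ennreal ((Z k w)\<^sup>2) \<partial>P) \<le> ennreal b" and Xb: "(\<integral>\<^sup>+w. ennreal (X w) \<partial>P) \<le> ennreal x"
  shows "(\<integral>\<^sup>+w. ennreal (a * ((\<Sum>k\<in>K. (Z k w)\<^sup>2) + X w) + T) \<partial>P) \<le> ennreal (a * (real (card K) * b + x) + T)"
proof -
  interpret prob_space P by (rule P)
  have "ennreal (a * ((\<Sum>k\<in>K. (Z k w)\<^sup>2) + X w) + T) = ennreal a * ((\<Sum>k\<in>K. ennreal ((Z k w)\<^sup>2)) + ennreal (X w)) + ennreal T" for w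
    using nn by (simp add: ennreal_plus ennreal_mult sum_nonneg)
  then have "(\<integral>\<^sup>+w. ennreal (a * ((\<Sum>k\<in>K. (Z k w)\<^sup>2) + X w) + T) \<partial>P)
    = (\<integral>\<^sup>+w. ennreal a * ((\<Sum>k\<in>K. ennreal ((Z k w)\<^sup>2)) + ennreal (X w)) + ennreal T \<partial>P)" by simp
  also have "\<dots> = ennreal a * ((\<Sum>k\<in>K. \<integral>\<^sup>+w. ennreal ((Z k w)\<^sup>2) \<partial>P) + (\<integral>\<^sup>+w. ennreal (X w) \<partial>P)) + ennreal T"
    by (simp add: nn_integral_add nn_integral_cmult nn_integral_sum emeasure_space_1 del: sum_ennreal)
  also have "\<dots> \<le> ennreal a * ((\<Sum>k\<in>K. ennreal b) + ennreal x) + ennreal T"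
    by (intro add_mono mult_left_mono sum_mono Zb Xb) auto
  also have "(\<Sum>k\<in>K. ennreal b) = ennreal (real (card K) * b)"
    using nn by (simp add: ennreal_mult ennreal_of_nat_eq_real_of_nat)
  also have "ennreal a * (ennreal (real (card K) * b) + ennreal x) + ennreal T = ennreal (a * (real (card K) * b + x) + T)"
    using nn by (simp add: ennreal_plus ennreal_mult)
  finally show ?thesis .
qed

lemma thresholded_square_loss:
  fixes x :: "'i \<Rightarrow> nat" and a :: real and y \<theta> :: "'i \<Rightarrow> real"
  assumes U: "finite U" and a: "0 < a" and S: "S = {i \<in> U. x i = 1}"
  shows "(\<Sum>i\<in>U. ((if x i = 1 then y i else 0) - \<theta> i)\<^sup>2)
    = (1 / a\<^sup>2) * ((\<Sum>i\<in>S. (a * (y i - \<theta> i))\<^sup>2) + (\<Sum>i\<in>U - S. (a * \<theta> i)\<^sup>2))"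
proof -
  have "(\<Sum>i\<in>U. ((if x i = 1 then y i else 0) - \<theta> i)\<^sup>2)
    = (\<Sum>i\<in>U - S. ((if x i = 1 then y i else 0) - \<theta> i)\<^sup>2) + (\<Sum>i\<in>S. ((if x i = 1 then y i else 0) - \<theta> i)\<^sup>2)"
    using U by (intro sum.subset_diff) (auto simp: S)
  also have "(\<Sum>i\<in>U - S. ((if x i = 1 then y i else 0) - \<theta> i)\<^sup>2) = (\<Sum>i\<in>U - S. (1 / a\<^sup>2) * (a * \<theta> i)\<^sup>2)"
    using a by (intro sum.cong refl) (auto simp: S power_mult_distrib)
  also have "(\<Sum>i\<in>S. ((if x i = 1 then y i else 0) - \<theta> i)\<^sup>2) = (\<Sum>i\<in>S. (1 / a\<^sup>2) * (a * (y i - \<theta> i))\<^sup>2)"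
    using a by (intro sum.cong refl) (auto simp: S power_mult_distrib)
  finally show ?thesis by (simp only: sum_distrib_left[symmetric] distrib_left add.commute)
qed

section \<open>The rate of convergence over Besov balls\<close>
theorem theorem1:
  fixes P :: "'w measure"
    and W :: "real \<Rightarrow> 'w \<Rightarrow> real"
    and \<phi> \<psi> :: "real \<Rightarrow> real"
    and \<Phi> :: "nat \<Rightarrow> real \<Rightarrow> real"
    and \<Psi> :: "nat \<Rightarrow> nat \<Rightarrow> real \<Rightarrow> real"
    and r j0 C :: "nat"
    and p q :: ennreal
    and s M \<sigma> c\<^sub>2 \<gamma>\<^sub>m \<gamma>\<^sub>p :: real
    and \<tau> :: "nat \<Rightarrow> nat \<Rightarrow> real"
    and \<gamma> :: "nat \<Rightarrow> nat \<Rightarrow> real"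
    and \<pi> :: "nat \<Rightarrow> nat pmf"
    and Y0 :: "nat \<Rightarrow> (real \<Rightarrow> real) \<Rightarrow> nat \<Rightarrow> 'w \<Rightarrow> real"
    and Y :: "nat \<Rightarrow> (real \<Rightarrow> real) \<Rightarrow> nat \<Rightarrow> nat \<Rightarrow> 'w \<Rightarrow> real"
    and xhat :: "nat \<Rightarrow> (nat \<Rightarrow> nat \<Rightarrow> real) \<Rightarrow> (nat \<times> nat \<Rightarrow> nat)"
    and fhat :: "nat \<Rightarrow> (real \<Rightarrow> real) \<Rightarrow> 'w \<Rightarrow> real \<Rightarrow> real"
  assumes wiener: "wiener_process P W"
    and sigma: "\<sigma> > 0"
    and basis: "boundary_wavelet_basis r \<phi> \<psi> j0 C \<Phi> \<Psi>"
    and besov_params: "0 < p" "0 < q" "1 / p < ennreal s" "s < real r" "0 < M"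
    and obs_scaling: "\<And>J f k. \<lbrakk>j0 < J; f \<in> L2_01; k < C\<rbrakk> \<Longrightarrow>
          stoch_integral P (white_noise_obs \<sigma> (2 ^ J) f W) (\<Phi> k) (Y0 (2 ^ J) f k)"
    and obs_wavelet: "\<And>J f j k. \<lbrakk>j0 < J; f \<in> L2_01; (j, k) \<in> coeff_index j0 J\<rbrakk> \<Longrightarrow>
          stoch_integral P (white_noise_obs \<sigma> (2 ^ J) f W) (\<Psi> j k) (Y (2 ^ J) f j k)"
    and gamma_def: "\<And>n j. \<gamma> n j = (\<tau> n j)\<^sup>2 / \<sigma>\<^sup>2"
    and gamma_bounds: "0 < \<gamma>\<^sub>m" "0 < \<gamma>\<^sub>p"
          "\<And>J j. \<lbrakk>j0 \<le> j; j < J\<rbrakk> \<Longrightarrow> \<gamma>\<^sub>m \<le> \<gamma> (2 ^ J) j \<and> \<gamma> (2 ^ J) j \<le> \<gamma>\<^sub>p"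
    and prior_support: "\<And>J. j0 < J \<Longrightarrow> set_pmf (\<pi> (2 ^ J)) = {0..2 ^ J - 2 ^ j0}"
    and c2: "0 < c\<^sub>2"
    and prior_lower:
          "(\<forall>J>j0. \<forall>\<kappa>\<ge>1. real \<kappa> \<le> exp (- 9 / 2) * 2 ^ J \<longrightarrow>
               pmf (\<pi> (2 ^ J)) \<kappa> \<ge> (real \<kappa> / 2 ^ J) powr (c\<^sub>2 * real \<kappa>)) \<or>
           (\<forall>J>j0. \<forall>\<kappa>\<ge>1. real \<kappa> \<le> exp (- (8 * (\<gamma>\<^sub>m + 3 / 4)\<^sup>2)) * 2 ^ J \<longrightarrow>
               pmf (\<pi> (2 ^ J)) \<kappa> \<ge> (real \<kappa> / 2 ^ J) powr (c\<^sub>2 * real \<kappa>))"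
    and map_rule: "\<And>J y. j0 < J \<Longrightarrow> is_MAP \<sigma> j0 J (\<gamma> (2 ^ J)) (\<pi> (2 ^ J)) y (xhat (2 ^ J) y)"
    and estimator: "\<And>J f w. j0 < J \<Longrightarrow>
          fhat (2 ^ J) f w =
            wavelet_estimate j0 C J \<Phi> \<Psi> (\<lambda>k. Y0 (2 ^ J) f k w) (\<lambda>j k. Y (2 ^ J) f j k w)
              (xhat (2 ^ J) (\<lambda>j k. Y (2 ^ J) f j k w))"
  shows "\<exists>K. \<forall>\<^sub>F J in sequentially.
           (SUP f \<in> besov_ball s p q M \<inter> L2_01. \<integral>\<^sup>+w. L2_loss (fhat (2 ^ J) f w) f \<partial>P)
             \<le> ennreal (K * (ln (2 ^ J) / 2 ^ J) powr (2 * s / (2 * s + 1)))"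
proof -
  have s: "0 < s"
  proof -
    have "0 < ennreal s" using besov_params(3) by (rule le_less_trans[OF zero_le])
    then show ?thesis by (simp add: ennreal_less_zero_iff)
  qed
  have r: "0 < r" using s besov_params(4) by (cases r) auto
  have gmp: "\<gamma>\<^sub>m \<le> \<gamma>\<^sub>p" using gamma_bounds(3)[of j0 "Suc j0"] by simp
  obtain C' where C': "0 < C'" and risk: "\<forall>(P :: 'w measure) (U :: (nat \<times> nat) set) z \<mu> g A pA S pS.
     prob_space P \<longrightarrow> finite U \<longrightarrow> U \<noteq> {} \<longrightarrow> std_subgaussian P U z \<longrightarrow> (\<forall>i\<in>U. \<gamma>\<^sub>m \<le> g i \<and> g i \<le> \<gamma>\<^sub>p) \<longrightarrow>
     A \<subseteq> U \<longrightarrow> 0 \<le> pA \<longrightarrow>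
     (\<forall>w. S w \<subseteq> U \<and> ln (real (card U choose card (S w))) \<le> pS w \<and>
        (\<Sum>i\<in>A. shrinkage (g i) / 2 * (\<mu> i + z i w)\<^sup>2 - ln (1 + g i) / 2) - pA
          \<le> (\<Sum>i\<in>S w. shrinkage (g i) / 2 * (\<mu> i + z i w)\<^sup>2 - ln (1 + g i) / 2) - pS w) \<longrightarrow>
     (\<exists>X \<in> borel_measurable P. (\<forall>w. 0 \<le> X w \<and> (\<Sum>i\<in>S w. (z i w)\<^sup>2) + (\<Sum>i\<in>U - S w. (\<mu> i)\<^sup>2) \<le> X w) \<and>
       (\<integral>\<^sup>+w. ennreal (X w) \<partial>P)
         \<le> ennreal (C' * ((\<Sum>i\<in>U - A. (\<mu> i)\<^sup>2) + real (card A) + pA + ln (real (card U) + 1) + 1)))"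
    using penalized_selection_risk[where 'w = 'w and 'i = "nat \<times> nat", OF gamma_bounds(1) gmp] by (elim exE conjE)
  (* either range of the prior condition contains all sizes up to a fixed fraction of n *)
  obtain c0 where c0: "0 < c0" "c0 < 1" and low: "\<forall>J>j0. \<forall>\<kappa>\<ge>1. real \<kappa> \<le> c0 * 2 ^ J \<longrightarrow>
      (real \<kappa> / 2 ^ J) powr (c\<^sub>2 * real \<kappa>) \<le> pmf (\<pi> (2 ^ J)) \<kappa>"
    using prior_lower
  proof
    assume "\<forall>J>j0. \<forall>\<kappa>\<ge>1. real \<kappa> \<le> exp (- 9 / 2) * 2 ^ J \<longrightarrow>
               pmf (\<pi> (2 ^ J)) \<kappa> \<ge> (real \<kappa> / 2 ^ J) powr (c\<^sub>2 * real \<kappa>)"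
    then show ?thesis by (intro that[of "exp (- 9 / 2)"]) auto
  next
    assume "\<forall>J>j0. \<forall>\<kappa>\<ge>1. real \<kappa> \<le> exp (- (8 * (\<gamma>\<^sub>m + 3 / 4)\<^sup>2)) * 2 ^ J \<longrightarrow>
               pmf (\<pi> (2 ^ J)) \<kappa> \<ge> (real \<kappa> / 2 ^ J) powr (c\<^sub>2 * real \<kappa>)"
    then show ?thesis using gamma_bounds(1) by (intro that[of "exp (- (8 * (\<gamma>\<^sub>m + 3 / 4)\<^sup>2))"]) auto
  qed
  obtain \<rho> \<alpha> C1 j1 where \<rho>: "0 < \<rho>" "\<rho> \<le> 2" and \<alpha>: "\<alpha> = s + 1 / 2 - 1 / \<rho>" "0 < \<alpha>" "2 * s / (2 * s + 1) \<le> 2 * \<alpha>"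
    and C1: "0 \<le> C1" and decay: "\<forall>f\<in>besov_ball s p q M \<inter> L2_01. \<forall>j\<ge>j1.
     (\<Sum>k<2 ^ j. \<bar>inner01 f (\<Psi> j k)\<bar> powr \<rho>) \<le> C1 * 2 powr (- (real j * (\<rho> * \<alpha>)))"
    using besov_coefficient_bound[OF basis besov_params] by (elim exE conjE)
  obtain C2 where C2: "0 \<le> C2" and ev_set: "\<forall>\<^sub>F J in sequentially. \<forall>\<theta> :: nat \<Rightarrow> nat \<Rightarrow> real.
    (\<forall>j\<ge>j1. (\<Sum>k<2 ^ j. \<bar>\<theta> j k\<bar> powr \<rho>) \<le> C1 * 2 powr (- (real j * (\<rho> * \<alpha>)))) \<longrightarrow>
    (\<exists>A\<subseteq>coeff_index j0 J. 1 \<le> card A \<and> real (card A) \<le> c0 * 2 ^ J \<and>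
       real (card A) * (ln (2 ^ J) / 2 ^ J) \<le> C2 * rate s J \<and>
       (\<Sum>i\<in>coeff_index j0 J - A. (\<theta> (fst i) (snd i))\<^sup>2) \<le> C2 * rate s J)"
    using competitor_set_exists[OF s \<rho> \<alpha>(1,2) C1 c0(1), of j1 j0] by (elim exE conjE)
  obtain C3 where C3: "0 \<le> C3" and ev_tail: "\<forall>\<^sub>F J in sequentially. \<forall>\<theta> :: nat \<Rightarrow> nat \<Rightarrow> real.
    (\<forall>j\<ge>j1. (\<Sum>k<2 ^ j. \<bar>\<theta> j k\<bar> powr \<rho>) \<le> C1 * 2 powr (- (real j * (\<rho> * \<alpha>)))) \<longrightarrow>
    (\<forall>L. (\<Sum>j=J..<L. \<Sum>k<2 ^ j. (\<theta> j k)\<^sup>2) \<le> C3 * rate s J)"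
    using tail_rate[OF s \<rho> \<alpha>(2,3) C1, of j1] by (elim exE conjE)
  have ev_ln: "eventually (\<lambda>J. 1 \<le> ln ((2::real) ^ J)) sequentially"
  proof -
    have "filterlim (\<lambda>J::nat. real J * ln 2) at_top sequentially" by real_asymp
    then show ?thesis by (simp add: ln_realpow filterlim_at_top)
  qed
  (* collects what is charged to each selected coefficient: noise of the scaling coefficients, penalty and lower-order terms *)
  define D where "D = 6 * real C + C' * (4 + c\<^sub>2)"
  have D: "0 \<le> D" unfolding D_def using C' c2 by simp
  define K where "K = \<sigma>\<^sup>2 * D * C2 + C' * C2 + C3"
  have "\<forall>\<^sub>F J in sequentially.
           (SUP f \<in> besov_ball s p q M \<inter> L2_01. \<integral>\<^sup>+w. L2_loss (fhat (2 ^ J) f w) f \<partial>P) \<le> ennreal (K * rate s J)"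
    using ev_set ev_tail ev_ln eventually_gt_at_top[of j0]
  proof eventually_elim
    case (elim J)
    note setJ = elim(1) and tailJ = elim(2) and lnJ = elim(3) and J = elim(4)
    show ?case
    proof (rule SUP_least)
      fix f assume f: "f \<in> besov_ball s p q M \<inter> L2_01"
      then have fL: "f \<in> L2_01" by simp
      define \<theta> where "\<theta> j k = inner01 f (\<Psi> j k)" for j k
      have dec: "\<forall>j\<ge>j1. (\<Sum>k<2 ^ j. \<bar>\<theta> j k\<bar> powr \<rho>) \<le> C1 * 2 powr (- (real j * (\<rho> * \<alpha>)))"
        using decay f unfolding \<theta>_def by blast
      define T where "T = C3 * rate s J"
      have T: "0 \<le> T" using C3 by (simp add: T_def rate_def)
      have tail: "(\<Sum>j=J..<L. \<Sum>k<2 ^ j. (\<theta> j k)\<^sup>2) \<le> T" for L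
        unfolding T_def using tailJ[THEN spec, of \<theta>] dec by blast
      define U where "U = coeff_index j0 J"
      define N where "N = (2::nat) ^ J"
      have N: "0 < N" "real N = 2 ^ J" by (auto simp: N_def)
      obtain A where A: "A \<subseteq> U" "1 \<le> card A" "real (card A) \<le> c0 * 2 ^ J" "real (card A) * (ln (2 ^ J) / 2 ^ J) \<le> C2 * rate s J"
        "(\<Sum>i\<in>U - A. (\<theta> (fst i) (snd i))\<^sup>2) \<le> C2 * rate s J"
        using setJ[THEN spec, of \<theta>] dec unfolding U_def by blast
      have U: "finite U" "card U = 2 ^ J - 2 ^ j0" using card_coeff_index[of j0 J] J by (auto simp: U_def coeff_index_def)
      have Une: "U \<noteq> {}" using A by auto
      have lev: "j0 \<le> fst i" "fst i < J" "snd i < 2 ^ fst i" if "i \<in> U" for i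
        using that by (auto simp: U_def coeff_index_def)
      define a where "a = sqrt (real N) / \<sigma>"
      have a: "0 < a" using N sigma by (simp add: a_def)
      have a2: "1 / a\<^sup>2 = \<sigma>\<^sup>2 / 2 ^ J" using N(2) by (simp add: a_def power_divide)
      (* signal and noise in units of the noise level *)
      define z where "z i w = a * (Y N f (fst i) (snd i) w - \<theta> (fst i) (snd i))" for i :: "nat \<times> nat" and w
      define \<mu> where "\<mu> i = a * \<theta> (fst i) (snd i)" for i :: "nat \<times> nat"
      define z0 where "z0 k w = a * (Y0 N f k w - inner01 f (\<Phi> k))" for k w
      have P: "prob_space P" using wiener by (simp add: wiener_process_def)
      have sub: "std_subgaussian P U z"
        unfolding z_def a_def \<theta>_def
      proof (rule white_noise_coefficients_subgaussian[OF wiener sigma N(1) fL U(1), of "\<lambda>i. \<Psi> (fst i) (snd i)" "\<lambda>i. Y N f (fst i) (snd i)"])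
        show "\<Psi> (fst i) (snd i) \<in> L2_01" if "i \<in> U" for i
          using lev[OF that] by (intro continuous_imp_L2_01(1) basis_continuous(2)[OF basis r])
        show "inner01 (\<Psi> (fst i) (snd i)) (\<Psi> (fst j) (snd j)) = (if i = j then 1 else 0)" if "i \<in> U" "j \<in> U" for i j
        proof -
          have "inner01 (\<Psi> (fst i) (snd i)) (\<Psi> (fst j) (snd j)) = (if (fst i, snd i) = (fst j, snd j) then 1 else 0)"
            using basis_orth_wavelet[OF basis] lev[OF that(1)] lev[OF that(2)] by blast
          then show ?thesis by simp
        qed
        show "stoch_integral P (white_noise_obs \<sigma> N f W) (\<Psi> (fst i) (snd i)) (Y N f (fst i) (snd i))" if "i \<in> U" for i
          unfolding N_def using that by (intro obs_wavelet J fL) (simp add: U_def)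
      qed
      have sub0: "std_subgaussian P {..<C} z0"
        unfolding z0_def a_def
      proof (rule white_noise_coefficients_subgaussian[OF wiener sigma N(1) fL finite_lessThan])
        show "\<Phi> k \<in> L2_01" if "k \<in> {..<C}" for k
          using that by (intro continuous_imp_L2_01(1) basis_continuous(1)[OF basis r]) simp
        show "inner01 (\<Phi> k) (\<Phi> k') = (if k = k' then 1 else 0)" if "k \<in> {..<C}" "k' \<in> {..<C}" for k k'
          using basis_orth_scaling[OF basis] that by blast
        show "stoch_integral P (white_noise_obs \<sigma> N f W) (\<Phi> k) (Y0 N f k)" if "k \<in> {..<C}" for k
          unfolding N_def using that by (intro obs_scaling J fL) simp
      qed
      define xh where "xh w = xhat N (\<lambda>j k. Y N f j k w)" for w
      define S where "S w = {i \<in> U. xh w i = 1}" for w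
      define pen where "pen k = prior_penalty j0 J (\<pi> N) k" for k
      have supp: "set_pmf (\<pi> N) = {0..2 ^ J - 2 ^ j0}" unfolding N_def by (rule prior_support[OF J])
      have cardS: "card (S w) \<le> 2 ^ J - 2 ^ j0" for w using card_mono[OF U(1), of "S w"] by (auto simp: S_def U(2))
      have cardA: "card A \<le> 2 ^ J - 2 ^ j0" using card_mono[OF U(1) A(1)] by (simp add: U(2))
      have penA: "pen (card A) \<le> (1 + c\<^sub>2) * (real (card A) * ln (2 ^ J))"
        unfolding pen_def
      proof (rule prior_penalty_upper[OF A(2) cardA])
        show "0 \<le> c\<^sub>2" using c2 by simp
        show "(real (card A) / 2 ^ J) powr (c\<^sub>2 * real (card A)) \<le> pmf (\<pi> N) (card A)"
          unfolding N_def using low J A(2,3) by blast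
      qed
      have v: "sqrt N / \<sigma> * Y N f (fst i) (snd i) w = \<mu> i + z i w" for i w
        by (simp add: \<mu>_def z_def a_def algebra_simps)
      have opt: "(\<Sum>i\<in>A. shrinkage (\<gamma> N (fst i)) / 2 * (\<mu> i + z i w)\<^sup>2 - ln (1 + \<gamma> N (fst i)) / 2) - pen (card A)
          \<le> (\<Sum>i\<in>S w. shrinkage (\<gamma> N (fst i)) / 2 * (\<mu> i + z i w)\<^sup>2 - ln (1 + \<gamma> N (fst i)) / 2) - pen (card (S w))" for w
      proof -
        have "is_MAP \<sigma> j0 J (\<gamma> N) (\<pi> N) (\<lambda>j k. Y N f j k w) (xh w)" unfolding xh_def N_def by (rule map_rule[OF J])
        moreover have "\<forall>j\<in>{j0..<J}. 0 < \<gamma> N j" unfolding N_def using gamma_bounds(1,3) by force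
        ultimately show ?thesis
          using MAP_maximizes_penalized_gain[of \<sigma> j0 J "\<gamma> N" "\<pi> N" "\<lambda>j k. Y N f j k w" "xh w" A "S w"] J sigma supp A(1)
          unfolding gain_def N_def[symmetric] v pen_def S_def U_def by simp
      qed
      have "\<exists>X \<in> borel_measurable P. (\<forall>w. 0 \<le> X w \<and> (\<Sum>i\<in>S w. (z i w)\<^sup>2) + (\<Sum>i\<in>U - S w. (\<mu> i)\<^sup>2) \<le> X w) \<and>
       (\<integral>\<^sup>+w. ennreal (X w) \<partial>P)
         \<le> ennreal (C' * ((\<Sum>i\<in>U - A. (\<mu> i)\<^sup>2) + real (card A) + pen (card A) + ln (real (card U) + 1) + 1))"
      proof (rule risk[THEN spec[where x = P], THEN spec[where x = U], THEN spec[where x = z], THEN spec[where x = \<mu>],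
        THEN spec[where x = "\<lambda>i. \<gamma> N (fst i)"], THEN spec[where x = A], THEN spec[where x = "pen (card A)"], THEN spec[where x = S], THEN spec[where x = "\<lambda>w. pen (card (S w))"],
        THEN mp[OF _ P], THEN mp[OF _ U(1)], THEN mp[OF _ Une], THEN mp[OF _ sub], THEN mp, THEN mp, THEN mp, THEN mp])
        show "\<forall>i\<in>U. \<gamma>\<^sub>m \<le> \<gamma> N (fst i) \<and> \<gamma> N (fst i) \<le> \<gamma>\<^sub>p" unfolding N_def using gamma_bounds(3) lev by blast
        show "A \<subseteq> U" by (rule A(1))
        show "0 \<le> pen (card A)" unfolding pen_def by (rule prior_penalty_lower(2)[OF cardA supp])
        have "ln (real (card U choose card (S w))) \<le> pen (card (S w))" for w
          unfolding pen_def U(2) by (rule prior_penalty_lower(1)[OF cardS supp])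
        then show "\<forall>w. S w \<subseteq> U \<and> ln (real (card U choose card (S w))) \<le> pen (card (S w)) \<and>
          (\<Sum>i\<in>A. shrinkage (\<gamma> N (fst i)) / 2 * (\<mu> i + z i w)\<^sup>2 - ln (1 + \<gamma> N (fst i)) / 2) - pen (card A)
          \<le> (\<Sum>i\<in>S w. shrinkage (\<gamma> N (fst i)) / 2 * (\<mu> i + z i w)\<^sup>2 - ln (1 + \<gamma> N (fst i)) / 2) - pen (card (S w))"
          using opt by (auto simp: S_def)
      qed
      then obtain X where X: "X \<in> borel_measurable P" "\<And>w. 0 \<le> X w" "\<And>w. (\<Sum>i\<in>S w. (z i w)\<^sup>2) + (\<Sum>i\<in>U - S w. (\<mu> i)\<^sup>2) \<le> X w"
        and EX: "(\<integral>\<^sup>+w. ennreal (X w) \<partial>P)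
         \<le> ennreal (C' * ((\<Sum>i\<in>U - A. (\<mu> i)\<^sup>2) + real (card A) + pen (card A) + ln (real (card U) + 1) + 1))"
        by (elim bexE conjE) blast
      define \<kappa> where "\<kappa> = real (card A) * ln (2 ^ J)"
      define R where "R = (\<Sum>i\<in>U - A. (\<theta> (fst i) (snd i))\<^sup>2)"
      have l1: "real (card A) \<le> \<kappa>" "ln (2 ^ J) \<le> \<kappa>" "1 \<le> \<kappa>"
      proof -
        show *: "real (card A) \<le> \<kappa>" unfolding \<kappa>_def using mult_left_mono[OF lnJ, of "real (card A)"] by simp
        show "ln (2 ^ J) \<le> \<kappa>" unfolding \<kappa>_def using mult_right_mono[of 1 "real (card A)" "ln (2 ^ J)"] A(2) lnJ by linarith
        show "1 \<le> \<kappa>" using * A(2) by linarith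
      qed
      have lnU: "ln (real (card U) + 1) \<le> ln (2 ^ J)"
      proof (rule ln_mono)
        have "card U + 1 \<le> 2 ^ J" unfolding U(2) using one_le_power[of "2::nat" j0] zero_less_power[of "2::nat" J] by linarith
        then have "real (card U + 1) \<le> real (2 ^ J)" by (rule of_nat_mono)
        then show "real (card U) + 1 \<le> 2 ^ J" by simp
      qed simp
      (* since |A| * ln n is at least 1, ln n and |A|, it absorbs the lower-order terms *)
      have bracket: "C' * ((\<Sum>i\<in>U - A. (\<mu> i)\<^sup>2) + real (card A) + pen (card A) + ln (real (card U) + 1) + 1)
          \<le> C' * (a\<^sup>2 * R + (4 + c\<^sub>2) * \<kappa>)"
      proof (rule mult_left_mono)
        have "(\<Sum>i\<in>U - A. (\<mu> i)\<^sup>2) = a\<^sup>2 * R" by (simp add: \<mu>_def R_def power_mult_distrib sum_distrib_left)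
        then show "(\<Sum>i\<in>U - A. (\<mu> i)\<^sup>2) + real (card A) + pen (card A) + ln (real (card U) + 1) + 1 \<le> a\<^sup>2 * R + (4 + c\<^sub>2) * \<kappa>"
          using l1 lnU penA[folded \<kappa>_def, unfolded distrib_right] unfolding distrib_right by linarith
      qed (use C' in simp)
      have loss: "L2_loss (fhat N f w) f \<le> ennreal (1 / a\<^sup>2 * ((\<Sum>k<C. (z0 k w)\<^sup>2) + X w) + T)" for w
      proof -
        have "L2_loss (fhat N f w) f \<le> ennreal ((\<Sum>k<C. (Y0 N f k w - inner01 f (\<Phi> k))\<^sup>2)
          + (\<Sum>i\<in>coeff_index j0 J. ((if xh w i = 1 then Y N f (fst i) (snd i) w else 0) - inner01 f (\<Psi> (fst i) (snd i)))\<^sup>2) + T)"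
          unfolding estimator[OF J, folded N_def] xh_def[symmetric]
          using J by (intro wavelet_loss_le[OF basis r fL _ tail[unfolded \<theta>_def]]) simp
        also have "(\<Sum>k<C. (Y0 N f k w - inner01 f (\<Phi> k))\<^sup>2) = 1 / a\<^sup>2 * (\<Sum>k<C. (z0 k w)\<^sup>2)"
          using a by (simp add: z0_def power_mult_distrib sum_distrib_left)
        also have "(\<Sum>i\<in>coeff_index j0 J. ((if xh w i = 1 then Y N f (fst i) (snd i) w else 0) - inner01 f (\<Psi> (fst i) (snd i)))\<^sup>2)
          = 1 / a\<^sup>2 * ((\<Sum>i\<in>S w. (z i w)\<^sup>2) + (\<Sum>i\<in>U - S w. (\<mu> i)\<^sup>2))"
          unfolding z_def \<mu>_def \<theta>_def U_def[symmetric] by (rule thresholded_square_loss[OF U(1) a S_def])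
        also have "ennreal (1 / a\<^sup>2 * (\<Sum>k<C. (z0 k w)\<^sup>2) + 1 / a\<^sup>2 * ((\<Sum>i\<in>S w. (z i w)\<^sup>2) + (\<Sum>i\<in>U - S w. (\<mu> i)\<^sup>2)) + T)
          \<le> ennreal (1 / a\<^sup>2 * ((\<Sum>k<C. (z0 k w)\<^sup>2) + X w) + T)"
          unfolding distrib_left[of "1 / a\<^sup>2" "\<Sum>k<C. (z0 k w)\<^sup>2"]
          by (intro ennreal_leI add_mono order_refl mult_left_mono X(3)) simp
        finally show ?thesis .
      qed
      have R0: "0 \<le> R" unfolding R_def by (intro sum_nonneg) simp
      have "(\<integral>\<^sup>+w. L2_loss (fhat N f w) f \<partial>P) \<le> (\<integral>\<^sup>+w. ennreal (1 / a\<^sup>2 * ((\<Sum>k<C. (z0 k w)\<^sup>2) + X w) + T) \<partial>P)"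
        by (intro nn_integral_mono loss)
      also have "\<dots> \<le> ennreal (1 / a\<^sup>2 * (real (card {..<C}) * 6 + C' * (a\<^sup>2 * R + (4 + c\<^sub>2) * \<kappa>)) + T)"
      proof (rule nn_integral_affine_le[OF P finite_lessThan _ X(1) _ T X(2)])
        show "z0 k \<in> borel_measurable P" if "k \<in> {..<C}" for k using sub0 that by (simp add: std_subgaussian_def)
        show "(\<integral>\<^sup>+w. ennreal ((z0 k w)\<^sup>2) \<partial>P) \<le> ennreal 6" if "k \<in> {..<C}" for k
          using subgaussian_second_moment[OF P finite_lessThan sub0 that] by simp
        show "(\<integral>\<^sup>+w. ennreal (X w) \<partial>P) \<le> ennreal (C' * (a\<^sup>2 * R + (4 + c\<^sub>2) * \<kappa>))"
          by (rule order_trans[OF EX ennreal_leI[OF bracket]])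
        show "0 \<le> C' * (a\<^sup>2 * R + (4 + c\<^sub>2) * \<kappa>)" using C' R0 c2 l1 by simp
      qed simp_all
      also have "\<dots> \<le> ennreal (K * rate s J)"
      proof (rule ennreal_leI)
        have "1 / a\<^sup>2 * (real (card {..<C}) * 6 + C' * (a\<^sup>2 * R + (4 + c\<^sub>2) * \<kappa>))
          \<le> 1 / a\<^sup>2 * (real C * 6 * \<kappa> + C' * (a\<^sup>2 * R + (4 + c\<^sub>2) * \<kappa>))"
          using mult_left_mono[OF l1(3), of "real C * 6"] by (intro mult_left_mono add_right_mono) simp_all
        also have "\<dots> = 1 / a\<^sup>2 * (D * \<kappa>) + C' * R"
          using a by (simp add: D_def field_simps)
        also have "1 / a\<^sup>2 * (D * \<kappa>) = \<sigma>\<^sup>2 * D * (real (card A) * (ln (2 ^ J) / 2 ^ J))"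
          unfolding a2 by (simp add: \<kappa>_def)
        also have "\<sigma>\<^sup>2 * D * (real (card A) * (ln (2 ^ J) / 2 ^ J)) + C' * R \<le> \<sigma>\<^sup>2 * D * (C2 * rate s J) + C' * (C2 * rate s J)"
          using A(4,5) C' D by (intro add_mono mult_left_mono) (auto simp: R_def)
        finally show "1 / a\<^sup>2 * (real (card {..<C}) * 6 + C' * (a\<^sup>2 * R + (4 + c\<^sub>2) * \<kappa>)) + T \<le> K * rate s J"
          by (simp add: K_def T_def algebra_simps)
      qed
      finally show "(\<integral>\<^sup>+w. L2_loss (fhat (2 ^ J) f w) f \<partial>P) \<le> ennreal (K * rate s J)" unfolding N_def .
    qed
  qed
  then show ?thesis unfolding rate_def by blast
qed

end
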